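(* Let $M$ be Cohen's first model (as described in the context). Then $\mathrm{Spec}_\aleph(M)=\{\langle\lambda^+,\lambda^+\rangle\mid\lambda \text{ a cardinal}\}\cup\{\langle\lambda,\lambda^+\rangle\mid\lambda\text{ a cardinal},\ \mathrm{cf}(\lambda)=\aleph_0\}$.
   Context: Cohen's first model: let $V\vDash\mathsf{ZFC}$; in $V$ let $\mathbb{P}=\mathrm{Add}(\omega,\omega)$ be the set of finite partial functions $p\colon\omega\times\omega\to 2$ ordered by $q\leq p$ iff $q\supseteq p$. Let $\mathscr{G}$ be the group of finitary permutations $\pi$ of $\omega$ (those moving only finitely many points), acting on $\mathbb{P}$ by $(\pi p)(\pi n,m)=p(n,m)$, and extended recursively to $\mathbb{P}$-names by $\pi\dot x=\{\langle\pi p,\pi\dot y\rangle\mid\langle p,\dot y\rangle\in\dot x\}$. For finite $E\subseteq\omega$ let $\mathrm{fix}(E)=\{\pi\in\mathscr{G}\mid\pi\restriction E=\mathrm{id}\}$, and let $\mathscr{F}$ be the filter of subgroups of $\mathscr{G}$ generated by the $\mathrm{fix}(E)$, $E\in[\omega]^{<\omega}$. A name $\dot x$ is hereditarily symmetric if $\{\pi\in\mathscr{G}\mid\pi\dot x=\dot x\}\in\mathscr{F}$ and the same holds for all names hereditarily appearing in $\dot x$. For a $V$-generic $G\subseteq\mathbb{P}$, $M$ is the class of interpretations by $G$ of hereditarily symmetric names; it is a transitive model of $\mathsf{ZF}$ with $V\subseteq M\subseteq V[G]$. For a set $X$, $\aleph(X)$ is the least ordinal $\alpha$ with no injection $\alpha\to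 X$, and $\aleph^*(X)$ is the least ordinal $\alpha>0$ with no surjection $X\to\alpha$. $\mathrm{Spec}_\aleph(M)=\{\langle\lambda,\kappa\rangle\mid M\vDash\exists X\,(\aleph(X)=\lambda\wedge\aleph^*(X)=\kappa)\}$. *)

theory Defs
  imports "HOL-Algebra.Group" "HOL-Library.Countable_Set_Type"
begin

section \<open>The ambient universe of sets\<close>

text \<open>
  Transitive models and their extensions live in a type of well-founded extensional sets.
  The axioms are satisfied, for example, by the hereditarily countable sets (see the instance
  below), which contain every countable transitive model; neither power set nor infinity is
  assumed of the ambient universe.
\<close>

class set_universe =
  fixes elts :: "'a \<Rightarrow> 'a set"
  assumes elts_inject: "elts x = elts y \<Longrightarrow> x = y"
    and wf_elts: "wf {(x, y). x \<in> elts y}"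
    and adjunction: "\<exists>z. elts z = insert a (elts x)"
    and replacement: "A \<subseteq> f ` elts x \<Longrightarrow> \<exists>z. elts z = A"

definition mk :: "'u::set_universe set \<Rightarrow> 'u"
  where "mk A = (THE x. elts x = A)"

lemma elts_mk:
  assumes "\<exists>z::'u::set_universe. elts z = A"
  shows "elts (mk A :: 'u) = A"
proof -
  have "\<exists>!z::'u. elts z = A"
    using assms elts_inject by metis
  then show ?thesis
    unfolding mk_def by (rule theI')
qed

lemma finite_is_set:
  fixes A :: "'u::set_universe set"
  assumes "finite A"
  shows "\<exists>z::'u. elts z = A"
  using assms
proof (induction A)
  case empty
  show ?case using replacement[of "{}" id] by auto
next
  case (insert a A)
  then obtain z where "elts z = A" by blast
  then show ?case using adjunction[of a z] by simp
qed

definition opair :: "'u \<Rightarrow> 'u \<Rightarrow> 'u::set_universe"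
  where "opair x y = mk {mk {x}, mk {x, y}}"

definition mem_rel :: "('u::set_universe \<times> 'u) set"
  where "mem_rel = {(x, y). x \<in> elts y}"

lemma wf_mem_rel_trancl: "wf (mem_rel\<^sup>+)"
  unfolding mem_rel_def by (rule wf_trancl[OF wf_elts])

lemma opair_snd_mem_rel:
  fixes x :: "'u::set_universe"
  assumes "opair p y \<in> elts x"
  shows "(y, x) \<in> mem_rel\<^sup>+"
proof -
  have "y \<in> elts (mk {p, y})" "mk {p, y} \<in> elts (opair p y)"
    by (simp_all add: opair_def elts_mk finite_is_set)
  with assms have "(y, mk {p, y}) \<in> mem_rel" "(mk {p, y}, opair p y) \<in> mem_rel"
    "(opair p y, x) \<in> mem_rel"
    by (simp_all add: mem_rel_def)
  then show ?thesis by (meson trancl.simps)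
qed

datatype hc = HC (hc_elts: "hc cset")

instantiation hc :: set_universe
begin

definition elts_hc :: "hc \<Rightarrow> hc set"
  where "elts_hc x = rcset (hc_elts x)"

instance
proof
  fix x y a :: hc and A :: "hc set" and f :: "hc \<Rightarrow> hc"
  show "elts x = elts y \<Longrightarrow> x = y"
    by (simp add: elts_hc_def rcset_inject hc.expand)
  show "wf {(x, y :: hc). x \<in> elts y}"
  proof (rule wfUNIVI)
    fix P :: "hc \<Rightarrow> bool" and x
    assume "\<forall>x. (\<forall>y. (y, x) \<in> {(x, y). x \<in> elts y} \<longrightarrow> P y) \<longrightarrow> P x"
    then show "P x"
      by (induction x) (auto simp: elts_hc_def cin.rep_eq)
  qed
  have ex: "\<exists>z. elts z = B" if "countable B" for B :: "hc set"
    using that by (intro exI[of _ "HC (acset B)"]) (simp add: elts_hc_def)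
  have count: "countable (elts x)"
    by (simp add: elts_hc_def)
  show "\<exists>z. elts z = insert a (elts x)"
    using count by (intro ex) simp
  show "A \<subseteq> f ` elts x \<Longrightarrow> \<exists>z. elts z = A"
    using count by (intro ex) (meson countable_image countable_subset)
qed

end

section \<open>Transitive models of ZFC\<close>

datatype fm = Mem nat nat | Equ nat nat | Neg fm | Conj fm fm | All nat fm

primrec sat :: "'u::set_universe set \<Rightarrow> fm \<Rightarrow> (nat \<Rightarrow> 'u) \<Rightarrow> bool" where
  "sat M (Mem i j) s = (s i \<in> elts (s j))"
| "sat M (Equ i j) s = (s i = s j)"
| "sat M (Neg \<phi>) s = (\<not> sat M \<phi> s)"
| "sat M (Conj \<phi> \<psi>) s = (sat M \<phi> s \<and> sat M \<psi> s)"
| "sat M (All i \<phi>) s = (\<forall>x\<in>M. sat M \<phi> (s(i := x)))"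

definition transitive_class :: "'u::set_universe set \<Rightarrow> bool"
  where "transitive_class M \<longleftrightarrow> (\<forall>x\<in>M. elts x \<subseteq> M)"

text \<open>
  The single axioms are written in relativised form; the two schemata range over formulas with
  parameters, supplied by the assignment \<open>s\<close>.
\<close>

definition models_ZFC :: "'u::set_universe set \<Rightarrow> bool" where
  "models_ZFC M \<longleftrightarrow>
    \<comment> \<open>extensionality\<close>
    (\<forall>x\<in>M. \<forall>y\<in>M. (\<forall>z\<in>M. z \<in> elts x \<longleftrightarrow> z \<in> elts y) \<longrightarrow> x = y) \<and>
    \<comment> \<open>foundation\<close>
    (\<forall>x\<in>M. (\<exists>y\<in>M. y \<in> elts x) \<longrightarrow>
      (\<exists>y\<in>M. y \<in> elts x \<and> \<not> (\<exists>z\<in>M. z \<in> elts x \<and> z \<in> elts y))) \<and>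
    \<comment> \<open>pairing\<close>
    (\<forall>x\<in>M. \<forall>y\<in>M. \<exists>z\<in>M. \<forall>w\<in>M. w \<in> elts z \<longleftrightarrow> w = x \<or> w = y) \<and>
    \<comment> \<open>union\<close>
    (\<forall>x\<in>M. \<exists>u\<in>M. \<forall>z\<in>M. z \<in> elts u \<longleftrightarrow> (\<exists>y\<in>M. y \<in> elts x \<and> z \<in> elts y)) \<and>
    \<comment> \<open>power set\<close>
    (\<forall>x\<in>M. \<exists>u\<in>M. \<forall>y\<in>M. y \<in> elts u \<longleftrightarrow> (\<forall>z\<in>M. z \<in> elts y \<longrightarrow> z \<in> elts x)) \<and>
    \<comment> \<open>infinity\<close>
    (\<exists>x\<in>M. (\<exists>e\<in>M. e \<in> elts x \<and> \<not> (\<exists>z\<in>M. z \<in> elts e)) \<and>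
      (\<forall>y\<in>M. y \<in> elts x \<longrightarrow>
        (\<exists>z\<in>M. z \<in> elts x \<and> (\<forall>w\<in>M. w \<in> elts z \<longleftrightarrow> w \<in> elts y \<or> w = y)))) \<and>
    \<comment> \<open>separation\<close>
    (\<forall>\<phi> s. range s \<subseteq> M \<longrightarrow>
      (\<forall>a\<in>M. \<exists>b\<in>M. \<forall>x\<in>M. x \<in> elts b \<longleftrightarrow> x \<in> elts a \<and> sat M \<phi> (s(0 := x)))) \<and>
    \<comment> \<open>replacement\<close>
    (\<forall>\<phi> s. range s \<subseteq> M \<longrightarrow>
      (\<forall>a\<in>M. (\<forall>x\<in>M. x \<in> elts a \<longrightarrow> (\<exists>!y. y \<in> M \<and> sat M \<phi> (s(0 := x, 1 := y)))) \<longrightarrow>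
        (\<exists>b\<in>M. \<forall>y\<in>M. y \<in> elts b \<longleftrightarrow>
          (\<exists>x\<in>M. x \<in> elts a \<and> sat M \<phi> (s(0 := x, 1 := y)))))) \<and>
    \<comment> \<open>choice\<close>
    (\<forall>a\<in>M. (\<forall>x\<in>M. x \<in> elts a \<longrightarrow> (\<exists>z\<in>M. z \<in> elts x)) \<and>
        (\<forall>x\<in>M. \<forall>y\<in>M. x \<in> elts a \<and> y \<in> elts a \<and> x \<noteq> y \<longrightarrow>
          \<not> (\<exists>z\<in>M. z \<in> elts x \<and> z \<in> elts y)) \<longrightarrow>
      (\<exists>c\<in>M. \<forall>x\<in>M. x \<in> elts a \<longrightarrow> (\<exists>!z. z \<in> M \<and> z \<in> elts x \<and> z \<in> elts c)))"

section \<open>Ordinals, cardinals, Hartogs and Lindenbaum numbers in a transitive class\<close>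

text \<open>
  Being an ordinal, or a (one-to-one, onto) function between two given sets, is expressed by
  bounded formulas and hence absolute for transitive classes.  Only the existential quantifier
  over functions has to be relativised to \<open>M\<close>.
\<close>

primrec num :: "nat \<Rightarrow> 'u::set_universe" where
  "num 0 = mk {}"
| "num (Suc n) = mk (insert (num n) (elts (num n)))"

text \<open>\<open>range num\<close> is a set of the universe as soon as some transitive class satisfies
  infinity.\<close>

definition omega :: "'u::set_universe"
  where "omega = mk (range num)"

definition is_ord :: "'u::set_universe \<Rightarrow> bool" where
  "is_ord \<alpha> \<longleftrightarrow> (\<forall>\<beta>\<in>elts \<alpha>. elts \<beta> \<subseteq> elts \<alpha>) \<and>
    (\<forall>\<beta>\<in>elts \<alpha>. \<forall>\<gamma>\<in>elts \<beta>. elts \<gamma> \<subseteq> elts \<beta>)"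

definition is_fun :: "'u::set_universe \<Rightarrow> 'u \<Rightarrow> 'u \<Rightarrow> bool" where
  "is_fun f a b \<longleftrightarrow> (\<forall>z\<in>elts f. \<exists>x\<in>elts a. \<exists>y\<in>elts b. z = opair x y) \<and>
    (\<forall>x\<in>elts a. \<exists>!y. opair x y \<in> elts f)"

definition is_inj :: "'u::set_universe \<Rightarrow> 'u \<Rightarrow> 'u \<Rightarrow> bool" where
  "is_inj f a b \<longleftrightarrow> is_fun f a b \<and>
    (\<forall>x\<in>elts a. \<forall>x'\<in>elts a. \<forall>y. opair x y \<in> elts f \<and> opair x' y \<in> elts f \<longrightarrow> x = x')"

definition is_surj :: "'u::set_universe \<Rightarrow> 'u \<Rightarrow> 'u \<Rightarrow> bool" where
  "is_surj f a b \<longleftrightarrow> is_fun f a b \<and> (\<forall>y\<in>elts b. \<exists>x\<in>elts a. opair x y \<in> elts f)"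

definition is_cofinal_map :: "'u::set_universe \<Rightarrow> 'u \<Rightarrow> 'u \<Rightarrow> bool" where
  "is_cofinal_map f \<alpha> \<kappa> \<longleftrightarrow> is_fun f \<alpha> \<kappa> \<and>
    (\<forall>\<gamma>\<in>elts \<kappa>. \<exists>\<xi>\<in>elts \<alpha>. \<exists>\<delta>\<in>elts \<kappa>. opair \<xi> \<delta> \<in> elts f \<and> (\<gamma> = \<delta> \<or> \<gamma> \<in> elts \<delta>))"

definition hartogs_in :: "'u::set_universe set \<Rightarrow> 'u \<Rightarrow> 'u \<Rightarrow> bool" where
  "hartogs_in M X \<alpha> \<longleftrightarrow> \<alpha> \<in> M \<and> is_ord \<alpha> \<and> \<not> (\<exists>f\<in>M. is_inj f \<alpha> X) \<and>
    (\<forall>\<beta>\<in>elts \<alpha>. \<exists>f\<in>M. is_inj f \<beta> X)"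

definition lindenbaum_in :: "'u::set_universe set \<Rightarrow> 'u \<Rightarrow> 'u \<Rightarrow> bool" where
  "lindenbaum_in M X \<alpha> \<longleftrightarrow> \<alpha> \<in> M \<and> is_ord \<alpha> \<and> elts \<alpha> \<noteq> {} \<and> \<not> (\<exists>f\<in>M. is_surj f X \<alpha>) \<and>
    (\<forall>\<beta>\<in>elts \<alpha>. elts \<beta> \<noteq> {} \<longrightarrow> (\<exists>f\<in>M. is_surj f X \<beta>))"

definition Spec_aleph :: "'u::set_universe set \<Rightarrow> ('u \<times> 'u) set" where
  "Spec_aleph M = {(\<kappa>, \<mu>). \<exists>X\<in>M. hartogs_in M X \<kappa> \<and> lindenbaum_in M X \<mu>}"

text \<open>Cardinals are initial ordinals; finite ones are included.\<close>

definition cardinal_in :: "'u::set_universe set \<Rightarrow> 'u \<Rightarrow> bool" where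
  "cardinal_in M \<kappa> \<longleftrightarrow> \<kappa> \<in> M \<and> is_ord \<kappa> \<and>
    (\<forall>\<beta>\<in>elts \<kappa>. \<not> (\<exists>f\<in>M. is_inj f \<beta> \<kappa> \<and> is_surj f \<beta> \<kappa>))"

definition succ_cardinal_in :: "'u::set_universe set \<Rightarrow> 'u \<Rightarrow> 'u \<Rightarrow> bool" where
  "succ_cardinal_in M \<kappa> \<mu> \<longleftrightarrow> cardinal_in M \<mu> \<and> \<kappa> \<in> elts \<mu> \<and>
    (\<forall>\<nu>\<in>elts \<mu>. \<kappa> \<in> elts \<nu> \<longrightarrow> \<not> cardinal_in M \<nu>)"

definition cofinality_in :: "'u::set_universe set \<Rightarrow> 'u \<Rightarrow> 'u \<Rightarrow> bool" where
  "cofinality_in M \<kappa> \<alpha> \<longleftrightarrow> \<alpha> \<in> M \<and> is_ord \<alpha> \<and> (\<exists>f\<in>M. is_cofinal_map f \<alpha> \<kappa>) \<and>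
    (\<forall>\<beta>\<in>elts \<alpha>. \<not> (\<exists>f\<in>M. is_cofinal_map f \<beta> \<kappa>))"

section \<open>Cohen forcing\<close>

text \<open>Finiteness and the natural numbers are absolute for transitive models of ZFC, so those of
  HOL can be used.\<close>

definition Add :: "'u::set_universe set \<Rightarrow> 'u set" where
  "Add V = {p \<in> V. finite (elts p) \<and>
    (\<forall>z\<in>elts p. \<exists>n m. \<exists>i\<in>{0, 1}. z = opair (opair (num n) (num m)) (num i)) \<and>
    (\<forall>x i j. opair x i \<in> elts p \<and> opair x j \<in> elts p \<longrightarrow> i = j)}"

definition stronger :: "'u::set_universe \<Rightarrow> 'u \<Rightarrow> bool"
  where "stronger q p \<longleftrightarrow> elts p \<subseteq> elts q"

definition dense_in_Add :: "'u::set_universe set \<Rightarrow> 'u set \<Rightarrow> bool" where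
  "dense_in_Add V D \<longleftrightarrow> D \<subseteq> Add V \<and> (\<forall>p\<in>Add V. \<exists>q\<in>D. stronger q p)"

definition generic :: "'u::set_universe set \<Rightarrow> 'u set \<Rightarrow> bool" where
  "generic V G \<longleftrightarrow> G \<subseteq> Add V \<and> G \<noteq> {} \<and>
    (\<forall>q\<in>G. \<forall>p\<in>Add V. stronger q p \<longrightarrow> p \<in> G) \<and>
    (\<forall>p\<in>G. \<forall>q\<in>G. \<exists>r\<in>G. stronger r p \<and> stronger r q) \<and>
    (\<forall>D\<in>V. dense_in_Add V (elts D) \<longrightarrow> G \<inter> elts D \<noteq> {})"

inductive is_name :: "'u::set_universe set \<Rightarrow> 'u \<Rightarrow> bool" for V where
  "x \<in> V \<Longrightarrow> (\<forall>z\<in>elts x. \<exists>p y. p \<in> Add V \<and> is_name V y \<and> z = opair p y) \<Longrightarrow> is_name V x"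

function interp :: "'u::set_universe set \<Rightarrow> 'u \<Rightarrow> 'u" where
  "interp G x = mk ((\<lambda>(p, y). interp G y) ` {(p, y). p \<in> G \<and> opair p y \<in> elts x})"
  by auto
termination
  by (relation "inv_image (mem_rel\<^sup>+) snd") (auto simp: wf_mem_rel_trancl opair_snd_mem_rel)

declare interp.simps [simp del]

section \<open>The symmetric system and Cohen's first model\<close>

text \<open>Finitary permutations of \<open>\<omega>\<close> are hereditarily finite and thus all belong to \<open>V\<close>; they are
  represented by functions on \<^typ>\<open>nat\<close>.\<close>

definition finitary_group :: "(nat \<Rightarrow> nat) monoid" where
  "finitary_group = \<lparr>carrier = {\<pi>. bij \<pi> \<and> finite {n. \<pi> n \<noteq> n}}, mult = (\<circ>), one = id\<rparr>"

definition act_cond :: "(nat \<Rightarrow> nat) \<Rightarrow> 'u \<Rightarrow> 'u::set_universe" where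
  "act_cond \<pi> p = mk {opair (opair (num (\<pi> n)) (num m)) i | n m i.
     opair (opair (num n) (num m)) i \<in> elts p}"

function act_name :: "(nat \<Rightarrow> nat) \<Rightarrow> 'u \<Rightarrow> 'u::set_universe" where
  "act_name \<pi> x = mk ((\<lambda>(p, y). opair (act_cond \<pi> p) (act_name \<pi> y)) `
     {(p, y). opair p y \<in> elts x})"
  by auto
termination
  by (relation "inv_image (mem_rel\<^sup>+) snd") (auto simp: wf_mem_rel_trancl opair_snd_mem_rel)

declare act_name.simps [simp del]

definition fixer :: "nat set \<Rightarrow> (nat \<Rightarrow> nat) set"
  where "fixer E = {\<pi> \<in> carrier finitary_group. \<forall>n\<in>E. \<pi> n = n}"

inductive_set sym_filter :: "(nat \<Rightarrow> nat) set set" where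
  base: "finite E \<Longrightarrow> fixer E \<in> sym_filter"
| inter: "H \<in> sym_filter \<Longrightarrow> K \<in> sym_filter \<Longrightarrow> H \<inter> K \<in> sym_filter"
| upward: "H \<in> sym_filter \<Longrightarrow> H \<subseteq> K \<Longrightarrow> subgroup K finitary_group \<Longrightarrow> K \<in> sym_filter"

definition sym_group :: "'u::set_universe \<Rightarrow> (nat \<Rightarrow> nat) set"
  where "sym_group x = {\<pi> \<in> carrier finitary_group. act_name \<pi> x = x}"

inductive hereditarily_symmetric :: "'u::set_universe set \<Rightarrow> 'u \<Rightarrow> bool" for V where
  "is_name V x \<Longrightarrow> sym_group x \<in> sym_filter \<Longrightarrow>
    (\<forall>p y. opair p y \<in> elts x \<longrightarrow> hereditarily_symmetric V y) \<Longrightarrow> hereditarily_symmetric V x"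

definition Cohen_first_model :: "'u::set_universe set \<Rightarrow> 'u set \<Rightarrow> 'u set"
  where "Cohen_first_model V G = {interp G x | x. hereditarily_symmetric V x}"

end

theory Submission imports Defs begin

text \<open>
  Every set \<open>X\<close> of Cohen's first model \<open>M\<close> is the image in \<open>M\<close> of a subset of \<open>D \<times> B\<close> with \<open>D \<in> V\<close>,
  where \<open>B\<close> is the set of finite sequences of distinct Cohen reals. Mapping \<open>x \<in> X\<close> to the
  first index under which it occurs and collapsing the range gives a cardinal \<open>\<kappa>\<close> with a
  surjection \<open>X \<rightarrow> \<kappa>\<close> and a partial surjection \<open>\<kappa> \<times> B \<rightarrow> X\<close>. As \<open>B\<close> has only countably many names,
  every well-ordered image of \<open>X\<close> in \<open>M\<close> is an image of \<open>\<kappa>\<close> in \<open>V\<close>, so \<open>\<aleph>\<^sup>*(X) = \<kappa>\<^sup>+\<close>. In \<open>V\<close>, for each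
  \<open>\<delta> < \<kappa>\<close>, one of the countably many pairs of a condition and a name for an element of \<open>B\<close>
  decides an element of \<open>X\<close> over at least \<open>\<delta>\<close> indices, and over \<open>\<kappa>\<close> of them unless \<open>\<kappa>\<close> has
  cofinality \<open>\<omega>\<close>; this gives \<open>\<aleph>(X) \<ge> \<kappa>\<close>, and \<open>\<aleph>(X) = \<kappa>\<^sup>+\<close> if \<open>cf(\<kappa>) > \<omega>\<close>. If there are only finitely
  many indices, \<open>X\<close> still maps onto \<open>\<omega>\<close>, because an element with a fixed index is determined by
  the closure of the set of sequences that name it.

  Conversely \<open>\<kappa>\<close> itself realises \<open>(\<kappa>\<^sup>+, \<kappa>\<^sup>+)\<close>. If \<open>c\<close> is cofinal from \<open>\<omega>\<close> to \<open>\<kappa>\<close>, the pairs \<open>(\<beta>, a)\<close> of a Cohen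
  real \<open>a\<close> and some \<open>\<beta> \<in> c(min a)\<close> realise \<open>(\<kappa>, \<kappa>\<^sup>+)\<close>, because a well-ordered sequence of Cohen
  reals in \<open>M\<close> takes finitely many values.
\<close>

section \<open>Sets, pairs and ordinals of the universe\<close>

text \<open>For \<open>M\<close> only pairing, separation and products are established, and these
  also hold in \<open>V\<close>, so that one theory of injections, surjections and collapses serves
  both. Without replacement and choice on the side of \<open>M\<close>, sizes are compared by
  partial surjections (\<open>psurj\<close>), which compose and invert injections freely, and a
  function of \<open>M\<close> is found by cutting its graph out of a product whose codomain is
  known beforehand. Genericity applies only to dense sets that belong to \<open>V\<close>, so every
  notion entering one has to be definable over \<open>V\<close>. Predicates and terms of HOL are
  therefore certified definable along their shape, and the recursion theorem turns a HOL recursion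
  (action on names, hereditary symmetry, forcing) into a definable function. The delicate case is an
  infinite set with finitely many indices: it may contain no copy of \<omega>, yet it has to map
  onto \<omega>. Closures help because a set whose points are separated by countably many predicates
  maps onto \<omega> in a definable way, through limit points or through isolating neighbourhoods.
  That closures separate the elements is the one place where single forcing conditions have to be
  moved by hand.\<close>

abbreviation perms :: "(nat => nat) set" where
  "perms \<equiv> carrier finitary_group"

abbreviation entry :: "nat => nat => 'u => 'u::set_universe" where
  "entry n m \<equiv> opair (opair (num n) (num m))"

lemma elts_mk_finite: "finite A ==> elts (mk A) = A"
  by (simp add: elts_mk finite_is_set)

lemma elts_mk_subset_image:
  fixes x :: "'u::set_universe" and f :: "'u => 'u"
  shows "A \<subseteq> f ` elts x ==> elts (mk A) = A"
  by (intro elts_mk replacement[of A f x])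

lemma elts_mk_image [simp]:
  fixes x :: "'u::set_universe" and f :: "'u => 'u"
  shows "elts (mk (f ` elts x)) = f ` elts x"
  using elts_mk_subset_image[of "f ` elts x" f x] by simp

lemma elts_mk_subset: "A \<subseteq> elts x ==> elts (mk A) = A"
  by (rule elts_mk_subset_image[where f = id]) simp

lemma elts_mk_Collect [simp]: "elts (mk {x \<in> elts a. P x}) = {x \<in> elts a. P x}"
  by (rule elts_mk_subset) auto

lemma elts_mk_empty [simp]: "elts (mk {}) = {}"
  and elts_mk_singleton [simp]: "elts (mk {x}) = {x}"
  and elts_mk_doubleton [simp]: "elts (mk {x, y}) = {x, y}"
  by (simp_all add: elts_mk_finite)

lemma mk_elts [simp]: "mk (elts x) = x"
  by (rule elts_inject) (simp add: elts_mk_subset[of _ x])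

lemma elts_eq_iff: "x = y \<longleftrightarrow> elts x = elts y"
  using elts_inject by auto

lemma mk_singleton_eq_iff [simp]: "mk {x} = mk {y} \<longleftrightarrow> x = y"
  by (simp add: elts_eq_iff[of "mk {x}"])

lemma opair_inject [simp]: "opair a b = opair c d \<longleftrightarrow> a = c \<and> b = d"
  by (auto simp: opair_def elts_eq_iff[of "mk {_, _}"] elts_eq_iff[of "mk {_}"] doubleton_eq_iff)

text \<open>The value \<open>mk {}\<close> outside pairs belongs to every transitive class
  considered, so the projections are total there and may occur in definable terms.\<close>

definition ufst :: "'u::set_universe => 'u" where
  "ufst w = (if \<exists>x y. w = opair x y then THE x. \<exists>y. w = opair x y else mk {})"

definition usnd :: "'u::set_universe => 'u" where
  "usnd w = (if \<exists>x y. w = opair x y then THE y. \<exists>x. w = opair x y else mk {})"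

lemma ufst_opair [simp]: "ufst (opair x y) = x"
  and usnd_opair [simp]: "usnd (opair x y) = y"
  by (auto simp: ufst_def usnd_def)

text \<open>\<open>mk\<close> is meaningful only on sets. The image is indexed by HOL pairs; reading
  \<open>p\<close> and \<open>y\<close> off the members of \<open>x\<close> by the projections
  exhibits it as a subset of an image of \<open>elts x\<close>, hence a set by replacement.\<close>

lemma elts_mk_opair_image:
  fixes x :: "'u::set_universe"
  shows "elts (mk ((\<lambda>(p, y). f p y :: 'u) ` {(p, y). opair p y \<in> elts x \<and> Q p y})) =
    {f p y | p y. opair p y \<in> elts x \<and> Q p y}"
proof -
  have "(\<lambda>(p, y). f p y) ` {(p, y). opair p y \<in> elts x \<and> Q p y} \<subseteq> (\<lambda>w. f (ufst w) (usnd w)) ` elts x"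
    by (auto simp: image_iff) (metis ufst_opair usnd_opair)
  from elts_mk_subset_image[OF this] show ?thesis by auto
qed

lemma elts_interp: "elts (interp G x) = {interp G y | p y. p \<in> G \<and> opair p y \<in> elts x}"
proof -
  have eq: "{(p, y). p \<in> G \<and> opair p y \<in> elts x} = {(p, y). opair p y \<in> elts x \<and> p \<in> G}"
    by auto
  show ?thesis
    unfolding interp.simps[of G x] eq
    by (subst elts_mk_opair_image[where Q = "\<lambda>p y. p \<in> G"]) blast
qed

lemma elts_act_name:
  "elts (act_name \<pi> x) = {opair (act_cond \<pi> p) (act_name \<pi> y) | p y. opair p y \<in> elts x}"
  using elts_mk_opair_image[of "\<lambda>p y. opair (act_cond \<pi> p) (act_name \<pi> y)" x "\<lambda>p y. True"]
  by (simp add: act_name.simps[of \<pi> x])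

lemma mem_induct [case_names step]: "(\<And>x. (\<And>y. y \<in> elts x ==> P y) ==> P x) ==> P x"
  using wf_induct_rule[OF wf_elts, of P x] by auto

lemma name_induct [case_names step]:
  "(\<And>x. (\<And>p y. opair p y \<in> elts x ==> P y) ==> P x) ==> P x"
  using wf_induct_rule[OF wf_mem_rel_trancl, of P x] opair_snd_mem_rel by blast

lemma mem_irrefl [simp]: "x \<notin> elts x"
  by (induction x rule: mem_induct) blast

lemma mem_asym: "x \<in> elts y ==> y \<notin> elts x"
  by (induction x arbitrary: y rule: mem_induct) blast

section \<open>Ordinals and natural numbers\<close>

definition suc :: "'u::set_universe => 'u" where "suc x = mk (insert x (elts x))"

lemma elts_suc [simp]: "elts (suc x) = insert x (elts x)"
  unfolding suc_def by (rule elts_mk) (rule adjunction)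

lemma ord_trans: "is_ord \<alpha> ==> \<beta> \<in> elts \<alpha> ==> \<gamma> \<in> elts \<beta> ==> \<gamma> \<in> elts \<alpha>"
  by (auto simp: is_ord_def)

lemma ord_mem: "is_ord \<alpha> ==> \<beta> \<in> elts \<alpha> ==> is_ord \<beta>"
  unfolding is_ord_def by blast

lemma ordI: "(\<And>\<beta>. \<beta> \<in> elts \<alpha> ==> is_ord \<beta>) ==> (\<And>\<beta> \<gamma>. \<beta> \<in> elts \<alpha> ==> \<gamma> \<in> elts \<beta> ==> \<gamma> \<in> elts \<alpha>) ==> is_ord \<alpha>"
  by (auto simp: is_ord_def)

lemma ord_linear: "is_ord \<alpha> ==> is_ord \<beta> ==> \<alpha> \<in> elts \<beta> \<or> \<alpha> = \<beta> \<or> \<beta> \<in> elts \<alpha>"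
proof (induction \<alpha> arbitrary: \<beta> rule: mem_induct)
  case (step \<alpha>)
  note IH\<alpha> = step.IH and \<alpha> = step.prems(1)
  show ?case using step.prems(2)
  proof (induction \<beta> rule: mem_induct)
    case (step \<beta>)
    show ?case
    proof (rule ccontr)
      assume c: "\<not> (\<alpha> \<in> elts \<beta> \<or> \<alpha> = \<beta> \<or> \<beta> \<in> elts \<alpha>)"
      have "\<gamma> \<in> elts \<beta>" if "\<gamma> \<in> elts \<alpha>" for \<gamma>
        using IH\<alpha>[OF that ord_mem[OF \<alpha> that] step.prems] c that ord_trans[OF \<alpha> that] by auto
      moreover have "\<gamma> \<in> elts \<alpha>" if "\<gamma> \<in> elts \<beta>" for \<gamma>
        using step.IH[OF that ord_mem[OF step.prems that]] c that ord_trans[OF step.prems that] by auto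
      ultimately have "elts \<alpha> = elts \<beta>" by auto
      with c show False using elts_inject[of \<alpha> \<beta>] by simp
    qed
  qed
qed

lemma ord_subset_iff:
  assumes "is_ord \<alpha>" "is_ord \<beta>"
  shows "elts \<alpha> \<subseteq> elts \<beta> \<longleftrightarrow> \<alpha> = \<beta> \<or> \<alpha> \<in> elts \<beta>"
proof
  show "elts \<alpha> \<subseteq> elts \<beta> ==> \<alpha> = \<beta> \<or> \<alpha> \<in> elts \<beta>"
    using ord_linear[OF assms] mem_irrefl[of \<beta>] by blast
  show "\<alpha> = \<beta> \<or> \<alpha> \<in> elts \<beta> ==> elts \<alpha> \<subseteq> elts \<beta>"
    using ord_trans[OF assms(2)] by blast
qed

lemma ord_suc: "is_ord \<alpha> ==> is_ord (suc \<alpha>)"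
  by (auto simp: is_ord_def)

lemma ord_least:
  assumes "A \<noteq> {}" "\<And>\<alpha>. \<alpha> \<in> A ==> is_ord \<alpha>"
  obtains \<alpha> where "\<alpha> \<in> A" "\<And>\<beta>. \<beta> \<in> A ==> \<alpha> = \<beta> \<or> \<alpha> \<in> elts \<beta>"
proof -
  obtain \<alpha> where "\<alpha> \<in> A" "\<And>\<beta>. \<beta> \<in> elts \<alpha> ==> \<beta> \<notin> A"
    using wfE_min'[OF wf_elts assms(1)] by auto
  then show ?thesis using that[of \<alpha>] ord_linear[OF assms(2) assms(2)] by blast
qed

lemma num_Suc: "num (Suc n) = suc (num n)"
  by (simp add: suc_def)

declare num.simps(2) [simp del]

lemma elts_num: "elts (num n) = num ` {..<n}"
  by (induction n) (auto simp: num_Suc lessThan_Suc)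

lemma ord_num [simp]: "is_ord (num n)"
  by (induction n) (auto simp: num_Suc ord_suc is_ord_def)

lemma num_eq_iff [simp]: "num m = num n \<longleftrightarrow> m = n"
proof -
  have "(num m :: 'a) \<noteq> num n" if "m < n" for m n
  proof
    assume eq: "(num m :: 'a) = num n"
    have "(num m :: 'a) \<in> elts (num n)" using that by (auto simp: elts_num)
    then show False using mem_irrefl[of "num n :: 'a"] by (simp only: eq not_True_eq_False)
  qed
  then show ?thesis by (metis nat_neq_iff)
qed

lemma num_mem_iff [simp]: "num m \<in> elts (num n) \<longleftrightarrow> m < n"
  by (auto simp: elts_num)

lemma finite_num [simp]: "finite (elts (num n))"
  by (simp add: elts_num)

lemma card_num [simp]: "card (elts (num n)) = n"
  by (simp add: elts_num card_image inj_on_def)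

text \<open>A finite ordinal omits some numeral and, by linearity, lies at or below it.\<close>

lemma finite_ord: "is_ord \<alpha> ==> finite (elts \<alpha>) ==> \<exists>n. \<alpha> = num n"
proof (induction \<alpha> rule: mem_induct)
  case (step \<alpha>)
  have sub: "\<exists>n. \<beta> = num n" if "\<beta> \<in> elts \<alpha>" for \<beta>
    using step.IH[OF that ord_mem[OF step.prems(1) that]]
      finite_subset[OF _ step.prems(2), of "elts \<beta>"] ord_trans[OF step.prems(1) that] by blast
  have "\<not> elts \<alpha> \<supseteq> range num"
    using step.prems(2) finite_subset finite_imageD[of num UNIV] by (auto simp: inj_on_def)
  then obtain n where n: "num n \<notin> elts \<alpha>" by auto
  then have "elts \<alpha> \<subseteq> elts (num n)"
    using ord_linear[OF step.prems(1) ord_num[of n]] ord_subset_iff[OF step.prems(1) ord_num[of n]] by blast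
  then show ?case
    using ord_subset_iff[OF step.prems(1) ord_num[of n]] by (auto simp: elts_num)
qed

lemma infinite_ord: "is_ord \<alpha> ==> infinite (elts \<alpha>) ==> num n \<in> elts \<alpha>"
  using ord_linear[of "num n" \<alpha>] finite_subset[OF _ finite_num, of "elts \<alpha>" n]
    ord_trans[OF ord_num, of \<alpha> n] by auto

section \<open>Functions of the universe as graphs of HOL functions\<close>

definition Gr :: "'u::set_universe => ('u => 'u) => 'u" where
  "Gr a F = mk ((\<lambda>x. opair x (F x)) ` elts a)"

text \<open>Where \<open>f\<close> is not single-valued the value is \<open>mk {}\<close>, which
  keeps application total and definable in every class considered.\<close>

definition ap :: "'u::set_universe => 'u => 'u" where
  "ap f x = (if \<exists>!y. opair x y \<in> elts f then THE y. opair x y \<in> elts f else mk {})"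

lemma elts_Gr: "elts (Gr a F) = (\<lambda>x. opair x (F x)) ` elts a"
  by (simp add: Gr_def)

lemma opair_Gr: "opair x y \<in> elts (Gr a F) \<longleftrightarrow> x \<in> elts a \<and> y = F x"
  by (auto simp: elts_Gr)

lemma ap_Gr [simp]: "x \<in> elts a ==> ap (Gr a F) x = F x"
  by (auto simp: ap_def elts_Gr image_iff)

lemma Gr_cong: "a = b ==> (\<And>x. x \<in> elts b ==> F x = E x) ==> Gr a F = Gr b E"
  by (auto simp: Gr_def intro!: arg_cong[of _ _ mk] image_cong)

lemma is_fun_Gr [simp]: "is_fun (Gr a F) a b \<longleftrightarrow> F ` elts a \<subseteq> elts b"
  by (auto simp: is_fun_def elts_Gr image_iff)

lemma is_inj_Gr [simp]: "is_inj (Gr a F) a b \<longleftrightarrow> F ` elts a \<subseteq> elts b \<and> inj_on F (elts a)"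
  by (auto simp: is_inj_def elts_Gr image_iff inj_on_def)

lemma is_surj_Gr [simp]: "is_surj (Gr a F) a b \<longleftrightarrow> F ` elts a = elts b"
  by (auto simp: is_surj_def elts_Gr image_iff)

text \<open>Internal functions are thereby graphs of HOL functions, so that statements about
  functions of a class can all take the form \<open>Gr a F \<in> N\<close>.\<close>

lemma is_fun_eq_Gr:
  assumes "is_fun f a b"
  shows "f = Gr a (ap f)"
proof (rule elts_inject)
  have ap: "opair x y \<in> elts f \<longleftrightarrow> y = ap f x" if "x \<in> elts a" for x y
  proof -
    have ex: "\<exists>!y. opair x y \<in> elts f" using assms that by (simp add: is_fun_def)
    from theI'[OF ex] ex show ?thesis by (auto simp: ap_def)
  qed
  show "elts f = elts (Gr a (ap f))"
  proof (intro equalityI subsetI)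
    fix z assume z: "z \<in> elts f"
    then obtain x y where "x \<in> elts a" "z = opair x y" using assms by (auto simp: is_fun_def)
    with z ap show "z \<in> elts (Gr a (ap f))" by (auto simp: elts_Gr)
  next
    fix z assume "z \<in> elts (Gr a (ap f))"
    with ap show "z \<in> elts f" by (auto simp: elts_Gr)
  qed
qed

lemma is_inj_iff: "is_inj f a b \<longleftrightarrow> f = Gr a (ap f) \<and> ap f ` elts a \<subseteq> elts b \<and> inj_on (ap f) (elts a)"
proof -
  have "f = Gr a (ap f)" if "is_inj f a b" using that is_fun_eq_Gr unfolding is_inj_def by blast
  moreover have "is_inj f a b \<longleftrightarrow> is_inj (Gr a (ap f)) a b" if "f = Gr a (ap f)"
    by (simp only: that[symmetric])
  ultimately show ?thesis unfolding is_inj_Gr by blast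
qed

lemma is_surj_iff: "is_surj f a b \<longleftrightarrow> f = Gr a (ap f) \<and> ap f ` elts a = elts b"
proof -
  have "f = Gr a (ap f)" if "is_surj f a b" using that is_fun_eq_Gr unfolding is_surj_def by blast
  moreover have "is_surj f a b \<longleftrightarrow> is_surj (Gr a (ap f)) a b" if "f = Gr a (ap f)"
    by (simp only: that[symmetric])
  ultimately show ?thesis unfolding is_surj_Gr by blast
qed

section \<open>Definable relations and functions of a transitive class\<close>

text \<open>Variables and parameters both have an infinite supply, and either can be moved by an
  injective renaming that leaves the other in place.\<close>

definition interleave :: "(nat => 'a) => (nat => 'a) => nat => 'a" where
  "interleave s c n = (if even n then s (n div 2) else c (n div 2))"

primrec rename :: "(nat => nat) => fm => fm" where
  "rename f (Mem i j) = Mem (f i) (f j)"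
| "rename f (Equ i j) = Equ (f i) (f j)"
| "rename f (Neg \<phi>) = Neg (rename f \<phi>)"
| "rename f (Conj \<phi> \<psi>) = Conj (rename f \<phi>) (rename f \<psi>)"
| "rename f (All i \<phi>) = All (f i) (rename f \<phi>)"

lemma sat_rename: "inj f ==> sat N (rename f \<phi>) s \<longleftrightarrow> sat N \<phi> (\<lambda>n. s (f n))"
proof (induction \<phi> arbitrary: s)
  case (All i \<phi>)
  have "(\<lambda>n. (s(f i := x)) (f n)) = (\<lambda>n. s (f n))(i := x)" for x
    using All.prems by (auto simp: inj_eq)
  with All show ?case by simp
qed auto

definition env :: "'u set => (nat => 'u) => bool" where "env N s \<longleftrightarrow> (\<forall>n. s n \<in> N)"

text \<open>
  The assignment \<open>s\<close> supplies the variables and \<open>c\<close> the parameters.  Quantifiers over \<^term>\<open>N\<close> are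
  handled by shifting the environment, which lets definability be derived by resolution from the
  shape of a predicate.
\<close>

definition definable :: "'u::set_universe set => ((nat => 'u) => bool) => bool" where
  "definable N P \<longleftrightarrow> (\<exists>\<phi> c. env N c \<and> (\<forall>s. env N s --> (P s \<longleftrightarrow> sat N \<phi> (interleave s c))))"

text \<open>Terms are tracked alongside predicates so that compound expressions such as
  \<open>ap f (opair x y)\<close> can be substituted into a definable predicate instead of being
  unfolded. In the graph the value occupies variable 0 and the arguments are shifted by one.\<close>

definition dterm :: "'u::set_universe set => ((nat => 'u) => 'u) => bool" where
  "dterm N t \<longleftrightarrow> (\<forall>s. env N s --> t s \<in> N) \<and> definable N (\<lambda>s. s 0 = t (\<lambda>n. s (Suc n)))"

named_theorems dintro

locale trans_class =
  fixes N :: "'u::set_universe set"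
  assumes trans: "x \<in> N ==> elts x \<subseteq> N"
    and empty_mem [simp]: "mk {} \<in> N"
begin

lemma mem_trans: "y \<in> elts x ==> x \<in> N ==> y \<in> N"
  using trans by blast

lemma definable_cong: "(\<And>s. env N s ==> P s \<longleftrightarrow> Q s) ==> definable N P \<longleftrightarrow> definable N Q"
  by (simp add: definable_def cong: conj_cong imp_cong)

lemma env_empty: "env N (\<lambda>_. mk {})"
  by (simp add: env_def)

lemma definable_rename:
  assumes "definable N P" "inj f"
  shows "definable N (\<lambda>s. P (\<lambda>n. s (f n)))"
proof -
  obtain \<phi> c where *: "env N c" "\<And>s. env N s ==> P s \<longleftrightarrow> sat N \<phi> (interleave s c)"
    using assms by (auto simp: definable_def)
  \<comment> \<open>Only even positions, the variables, are renamed; odd ones carry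
    parameters.\<close>
  define g where "g n = (if even n then 2 * f (n div 2) else n)" for n
  have "inj g"
  proof (rule injI)
    fix x y assume g: "g x = g y"
    then have e: "even x = even y" by (metis g_def dvd_triv_left)
    show "x = y"
    proof (cases "even x")
      case True
      with e g have "x div 2 = y div 2" using assms(2) by (simp add: g_def inj_eq)
      with True e show ?thesis by (metis dvd_mult_div_cancel)
    qed (use e g in \<open>simp add: g_def\<close>)
  qed
  moreover have "(\<lambda>n. interleave s c (g n)) = interleave (\<lambda>n. s (f n)) c" for s
    by (auto simp: interleave_def g_def fun_eq_iff)
  ultimately have "P (\<lambda>n. s (f n)) \<longleftrightarrow> sat N (rename g \<phi>) (interleave s c)" if "env N s" for s
    using *(2)[of "\<lambda>n. s (f n)"] that by (simp add: sat_rename env_def)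
  with *(1) show ?thesis
    unfolding definable_def by (intro exI[of _ "rename g \<phi>"] exI[of _ c]) simp
qed

lemma definable_not [dintro]:
  assumes "definable N P" shows "definable N (\<lambda>s. \<not> P s)"
proof -
  obtain \<phi> c where "env N c" "\<And>s. env N s ==> P s \<longleftrightarrow> sat N \<phi> (interleave s c)"
    using assms by (auto simp: definable_def)
  then show ?thesis
    unfolding definable_def by (intro exI[of _ "Neg \<phi>"] exI[of _ c]) simp
qed

lemma definable_conj [dintro]:
  assumes "definable N P" "definable N Q"
  shows "definable N (\<lambda>s. P s \<and> Q s)"
proof -
  obtain \<phi> c where 1: "env N c" "\<And>s. env N s ==> P s \<longleftrightarrow> sat N \<phi> (interleave s c)"
    using assms(1) by (auto simp: definable_def)
  obtain \<psi> d where 2: "env N d" "\<And>s. env N s ==> Q s \<longleftrightarrow> sat N \<psi> (interleave s d)"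
    using assms(2) by (auto simp: definable_def)
  \<comment> \<open>\<open>interleave c d\<close> merges the parameters. A parameter of the first
    formula at the odd position 2i+1 moves to 4i+1, one of the second formula to 4i+3.\<close>
  define f where "f n = (if even n then n else 2 * n - 1)" for n :: nat
  define g where "g n = (if even n then n else 2 * n + 1)" for n :: nat
  have "inj f" "inj g"
    unfolding inj_def f_def g_def by presburger+
  moreover have "(\<lambda>n. interleave s (interleave c d) (f n)) = interleave s c"
    "(\<lambda>n. interleave s (interleave c d) (g n)) = interleave s d" for s
    by (auto simp: interleave_def f_def g_def fun_eq_iff double_not_eq_Suc_double elim!: oddE)
  ultimately have "\<forall>s. env N s --> (P s \<and> Q s \<longleftrightarrow>
      sat N (Conj (rename f \<phi>) (rename g \<psi>)) (interleave s (interleave c d)))"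
    using 1(2) 2(2) by (simp add: sat_rename)
  moreover have "env N (interleave c d)"
    using 1(1) 2(1) by (simp add: env_def interleave_def)
  ultimately show ?thesis
    unfolding definable_def by (intro exI conjI)
qed

lemma definable_all [dintro]:
  assumes "definable N (\<lambda>s. Q (s 0) (\<lambda>n. s (Suc n)))"
  shows "definable N (\<lambda>s. \<forall>x\<in>N. Q x s)"
proof -
  obtain \<phi> c where *: "env N c" "\<And>s. env N s ==> Q (s 0) (\<lambda>n. s (Suc n)) \<longleftrightarrow> sat N \<phi> (interleave s c)"
    using assms by (auto simp: definable_def)
  \<comment> \<open>The quantified variable, at position 0, moves to position 1, where a dummy
    parameter \<open>mk {}\<close> has been inserted for it to overwrite. The other variables drop
    by one place and the parameters rise by one, that is by two positions each.\<close>
  define f where "f n = (if n = 0 then 1 else if even n then n - 2 else n + 2)" for n :: nat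
  have "inj f" unfolding inj_def f_def by presburger
  have env': "env N (case_nat (mk {}) c)" using *(1) by (auto simp: env_def split: nat.split)
  have "Q x s \<longleftrightarrow> sat N (rename f \<phi>) ((interleave s (case_nat (mk {}) c))(1 := x))"
    if "env N s" "x \<in> N" for s x
  proof -
    have "(\<lambda>n. ((interleave s (case_nat (mk {}) c))(1 := x)) (f n)) = interleave (case_nat x s) c"
      by (auto simp: interleave_def f_def fun_eq_iff split: nat.split elim!: oddE evenE)
    moreover have "env N (case_nat x s)" using that by (auto simp: env_def split: nat.split)
    ultimately show ?thesis using *(2)[of "case_nat x s"] \<open>inj f\<close> by (simp add: sat_rename)
  qed
  then have "\<forall>s. env N s --> ((\<forall>x\<in>N. Q x s) \<longleftrightarrow>
      sat N (All 1 (rename f \<phi>)) (interleave s (case_nat (mk {}) c)))"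
    by simp
  with env' show ?thesis unfolding definable_def by (intro exI conjI)
qed

lemma definable_ex [dintro]:
  assumes "definable N (\<lambda>s. Q (s 0) (\<lambda>n. s (Suc n)))"
  shows "definable N (\<lambda>s. \<exists>x\<in>N. Q x s)"
proof -
  have "definable N (\<lambda>s. \<not> (\<forall>x\<in>N. \<not> Q x s))"
    by (intro definable_not definable_all assms)
  then show ?thesis by simp
qed

lemma definable_disj [dintro]:
  assumes "definable N P" "definable N Q" shows "definable N (\<lambda>s. P s \<or> Q s)"
proof -
  have "definable N (\<lambda>s. \<not> (\<not> P s \<and> \<not> Q s))"
    by (intro definable_not definable_conj assms)
  then show ?thesis by simp
qed

lemma definable_imp [dintro]:
  assumes "definable N P" "definable N Q" shows "definable N (\<lambda>s. P s --> Q s)"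
  unfolding imp_conv_disj by (intro definable_not definable_disj assms)

lemma definable_iff [dintro]:
  assumes "definable N P" "definable N Q" shows "definable N (\<lambda>s. P s \<longleftrightarrow> Q s)"
  unfolding iff_conv_conj_imp by (intro definable_conj definable_imp assms)

lemma definable_var_mem: "definable N (\<lambda>s. s i \<in> elts (s j))"
  unfolding definable_def
  by (rule exI[of _ "Mem (2 * i) (2 * j)"], rule exI[of _ "\<lambda>_. mk {}"])
    (simp add: interleave_def env_empty)

lemma definable_var_eq: "definable N (\<lambda>s. s i = s j)"
  unfolding definable_def
  by (rule exI[of _ "Equ (2 * i) (2 * j)"], rule exI[of _ "\<lambda>_. mk {}"])
    (simp add: interleave_def env_empty)

lemma definable_const [dintro]: "definable N (\<lambda>s. b)"
  using definable_var_eq[of 0 0] definable_not[OF definable_var_eq[of 0 0]] by (cases b) simp_all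

lemma dterm_var [dintro]: "dterm N (\<lambda>s. s i)"
  using definable_var_eq by (simp add: dterm_def env_def)

lemma dterm_const [dintro]:
  assumes "c \<in> N" shows "dterm N (\<lambda>s. c)"
proof -
  have "definable N (\<lambda>s. s 0 = c)"
    unfolding definable_def
    by (rule exI[of _ "Equ 0 1"], rule exI[of _ "\<lambda>_. c"]) (simp add: interleave_def env_def assms)
  with assms show ?thesis by (simp add: dterm_def)
qed

lemma dterm_mem: "dterm N t ==> env N s ==> t s \<in> N"
  by (simp add: dterm_def)

lemma dterm_shift: "dterm N t ==> dterm N (\<lambda>s. t (\<lambda>n. s (Suc n)))"
  unfolding dterm_def
  using definable_rename[of "\<lambda>s. s 0 = t (\<lambda>n. s (Suc n))" "\<lambda>n. if n = 0 then 0 else Suc n"]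
  by (auto simp: env_def inj_def)

text \<open>The term is replaced by a quantified variable with the same value; in this way atomic
  statements about terms reduce to statements about variables.\<close>

lemma definable_let:
  assumes t: "dterm N t" and Q: "definable N (\<lambda>s. Q (s 0) (\<lambda>n. s (Suc n)))"
  shows "definable N (\<lambda>s. Q (t s) s)"
proof -
  have "definable N (\<lambda>s. \<exists>x\<in>N. x = t s \<and> Q x s)"
    using t Q by (intro dintro) (auto simp: dterm_def)
  then show ?thesis
    by (rule definable_cong[THEN iffD1, rotated]) (use dterm_mem[OF t] in auto)
qed

lemma definable_eq [dintro]:
  assumes "dterm N t" "dterm N u"
  shows "definable N (\<lambda>s. t s = u s)"
  using assms(2) by (intro definable_let[OF assms(1), of "\<lambda>x s. x = u s"]) (simp add: dterm_def)

lemma definable_mem [dintro]: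
  assumes "dterm N t" "dterm N u"
  shows "definable N (\<lambda>s. t s \<in> elts (u s))"
proof (rule definable_let[OF assms(1), of "\<lambda>x s. x \<in> elts (u s)"],
    rule definable_let[OF dterm_shift[OF assms(2)], of "\<lambda>y s. s 0 \<in> elts y"])
  show "definable N (\<lambda>s. s (Suc 0) \<in> elts (s 0))" by (rule definable_var_mem)
qed

lemma definable_ball [dintro]:
  assumes "dterm N t" "definable N (\<lambda>s. Q (s 0) (\<lambda>n. s (Suc n)))"
  shows "definable N (\<lambda>s. \<forall>x\<in>elts (t s). Q x s)"
proof -
  have "definable N (\<lambda>s. \<forall>x\<in>N. x \<in> elts (t s) --> Q x s)"
    using assms by (intro dintro dterm_shift)
  then show ?thesis
    by (rule definable_cong[THEN iffD1, rotated]) (use mem_trans[OF _ dterm_mem[OF assms(1)]] in auto)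
qed

lemma definable_bex [dintro]:
  assumes "dterm N t" "definable N (\<lambda>s. Q (s 0) (\<lambda>n. s (Suc n)))"
  shows "definable N (\<lambda>s. \<exists>x\<in>elts (t s). Q x s)"
proof -
  have "definable N (\<lambda>s. \<not> (\<forall>x\<in>elts (t s). \<not> Q x s))"
    by (intro definable_not definable_ball assms)
  then show ?thesis by simp
qed

lemma definable_subset [dintro]:
  "dterm N t ==> dterm N u ==> definable N (\<lambda>s. elts (t s) \<subseteq> elts (u s))"
  unfolding subset_eq by (intro dintro dterm_shift)

lemma dterm_if_const:
  "(b ==> dterm N t) ==> (\<not> b ==> dterm N u) ==> dterm N (\<lambda>s. if b then t s else u s)"
  by (cases b) simp_all

text \<open>The substitution is simultaneous for all variables. Below a quantifier the bound
  variable becomes variable 0 of the shifted environment and all other terms are shifted along, so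
  nothing is captured.\<close>

lemma sat_subst: "(\<And>n. dterm N (t n)) ==> definable N (\<lambda>s. sat N \<phi> (\<lambda>n. t n s))"
proof (induction \<phi> arbitrary: t)
  case (All i \<phi>)
  have "definable N (\<lambda>s. sat N \<phi> (\<lambda>n. if n = i then s 0 else t n (\<lambda>n. s (Suc n))))"
    by (rule All.IH) (intro dterm_if_const dterm_var dterm_shift All.prems)
  then have "definable N (\<lambda>s. \<forall>x\<in>N. sat N \<phi> ((\<lambda>n. t n s)(i := x)))"
    by (intro dintro) (simp add: fun_upd_def)
  then show ?case by simp
qed (simp_all add: definable_not definable_conj definable_mem definable_eq)

lemma definable_subst:
  assumes "definable N P" "\<And>n. dterm N (t n)"
  shows "definable N (\<lambda>s. P (\<lambda>n. t n s))"
proof -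
  obtain \<phi> c where *: "env N c" "\<And>s. env N s ==> P s \<longleftrightarrow> sat N \<phi> (interleave s c)"
    using assms(1) by (auto simp: definable_def)
  have "definable N (\<lambda>s. sat N \<phi> (\<lambda>n. (if even n then t (n div 2) s else c (n div 2))))"
    by (rule sat_subst) (use *(1) in \<open>intro dterm_if_const dterm_const assms(2), simp add: env_def\<close>)
  then show ?thesis
    by (rule definable_cong[THEN iffD1, rotated])
      (use *(2) dterm_mem[OF assms(2)] in \<open>simp add: env_def interleave_def[abs_def]\<close>)
qed

lemma definable_comp1:
  assumes "definable N (\<lambda>s. R (s 0))" "dterm N t"
  shows "definable N (\<lambda>s. R (t s))"
  by (rule definable_subst[OF assms(1)]) (rule assms(2))

lemma definable_comp2:
  assumes "definable N (\<lambda>s. R (s 0) (s 1))" "dterm N t" "dterm N u"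
  shows "definable N (\<lambda>s. R (t s) (u s))"
proof -
  have "dterm N (\<lambda>s. if n = (0::nat) then t s else u s)" for n
    by (intro dterm_if_const assms)
  from definable_subst[OF assms(1), of "\<lambda>n s. if n = 0 then t s else u s", OF this]
  show ?thesis by simp
qed

lemma definable_comp3:
  assumes "definable N (\<lambda>s. R (s 0) (s 1) (s 2))" "dterm N t" "dterm N u" "dterm N v"
  shows "definable N (\<lambda>s. R (t s) (u s) (v s))"
proof -
  have "dterm N (\<lambda>s. if n = (0::nat) then t s else if n = 1 then u s else v s)" for n
    by (intro dterm_if_const assms)
  from definable_subst[OF assms(1),
      of "\<lambda>n s. if n = 0 then t s else if n = 1 then u s else v s", OF this]
  show ?thesis by simp
qed

lemma dterm_subst:
  assumes "dterm N t" "\<And>n. dterm N (u n)"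
  shows "dterm N (\<lambda>s. t (\<lambda>n. u n s))"
proof -
  have 0: "definable N (\<lambda>s. s 0 = t (\<lambda>n. s (Suc n)))" using assms(1) by (simp add: dterm_def)
  have "definable N (\<lambda>s. (\<lambda>s. s 0 = t (\<lambda>n. s (Suc n)))
      (\<lambda>n. if n = 0 then s 0 else u (n - 1) (\<lambda>n. s (Suc n))))"
    by (rule definable_subst[OF 0]) (intro dterm_if_const dterm_var dterm_shift assms(2))
  then have "definable N (\<lambda>s. s 0 = t (\<lambda>n. u n (\<lambda>n. s (Suc n))))" by simp
  moreover have "t (\<lambda>n. u n s) \<in> N" if "env N s" for s
    using that dterm_mem[OF assms(2) that] by (intro dterm_mem[OF assms(1)]) (simp add: env_def)
  ultimately show ?thesis by (simp add: dterm_def)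
qed

lemma dterm_comp1: "dterm N (\<lambda>s. F (s 0)) ==> dterm N t ==> dterm N (\<lambda>s. F (t s))"
  by (rule dterm_subst[of "\<lambda>s. F (s 0)" "\<lambda>n. t"])

lemma dterm_comp2:
  assumes "dterm N (\<lambda>s. F (s 0) (s 1))" "dterm N t" "dterm N u"
  shows "dterm N (\<lambda>s. F (t s) (u s))"
proof -
  have "dterm N (\<lambda>s. if n = (0::nat) then t s else u s)" for n
    by (intro dterm_if_const assms)
  from dterm_subst[OF assms(1), of "\<lambda>n s. if n = 0 then t s else u s", OF this]
  show ?thesis by simp
qed

lemma dtermI:
  assumes "\<And>s. env N s ==> t s \<in> N" "definable N (\<lambda>s. Q (s 0) (\<lambda>n. s (Suc n)))"
    and "\<And>x s. x \<in> N ==> env N s ==> x = t s \<longleftrightarrow> Q x s"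
  shows "dterm N t"
proof -
  have "definable N (\<lambda>s. s 0 = t (\<lambda>n. s (Suc n))) \<longleftrightarrow> definable N (\<lambda>s. Q (s 0) (\<lambda>n. s (Suc n)))"
    by (rule definable_cong) (use assms(3) in \<open>simp add: env_def\<close>)
  with assms(1,2) show ?thesis by (simp add: dterm_def)
qed

lemma dterm_If [dintro]:
  assumes "definable N P" "dterm N t" "dterm N u"
  shows "dterm N (\<lambda>s. if P s then t s else u s)"
proof (rule dtermI[where Q = "\<lambda>x s. (P s --> x = t s) \<and> (\<not> P s --> x = u s)"])
  have "definable N (\<lambda>s. P (\<lambda>n. s (Suc n)))" by (rule definable_rename[OF assms(1)]) simp
  then show "definable N (\<lambda>s. (P (\<lambda>n. s (Suc n)) --> s 0 = t (\<lambda>n. s (Suc n))) \<and>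
      (\<not> P (\<lambda>n. s (Suc n)) --> s 0 = u (\<lambda>n. s (Suc n))))"
    using assms by (intro dintro dterm_shift)
qed (use dterm_mem[OF assms(2)] dterm_mem[OF assms(3)] in auto)

end

section \<open>Internal functions of a transitive class\<close>

definition cprod :: "'u::set_universe => 'u => 'u" where
  "cprod a b = mk {opair x y | x y. x \<in> elts a \<and> y \<in> elts b}"

definition injects :: "'u::set_universe set => 'u => 'u => bool" where
  "injects N a b \<longleftrightarrow> (\<exists>F. Gr a F \<in> N \<and> inj_on F (elts a) \<and> F ` elts a \<subseteq> elts b)"

text \<open>A partial domain makes the relation meaningful for empty \<open>b\<close> and lets it
  follow from an injection in the other direction without choosing a point. It is the comparison of
  size used throughout.\<close>

definition psurj :: "'u::set_universe set => 'u => 'u => bool" where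
  "psurj N a b \<longleftrightarrow> (\<exists>d\<in>N. \<exists>F. elts d \<subseteq> elts a \<and> Gr d F \<in> N \<and> F ` elts d = elts b)"

text \<open>For a set \<open>R\<close> of ordinals this is the Mostowski collapse. It is defined at
  every \<xi>, also outside \<open>R\<close>, through the predecessors that belong to
  \<open>R\<close>.\<close>

function coll :: "'u::set_universe => 'u => 'u" where
  "coll R \<xi> = mk (coll R ` {\<zeta> \<in> elts \<xi>. \<zeta> \<in> elts R})"
  by auto
termination
  by (relation "inv_image {(x, y). x \<in> elts y} snd") (auto simp: wf_elts)

declare coll.simps [simp del]

lemma elts_coll: "elts (coll R \<xi>) = coll R ` {\<zeta> \<in> elts \<xi>. \<zeta> \<in> elts R}"
  unfolding coll.simps[of R \<xi>] by (rule elts_mk_subset_image[of _ "coll R" \<xi>]) auto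

text \<open>The values never exceed the arguments, because the collapse of \<xi> consists of
  collapses of smaller ordinals. This bound later takes the place of replacement.\<close>

lemma
  assumes "\<And>\<zeta>. \<zeta> \<in> elts R ==> is_ord \<zeta>"
  shows ord_coll: "is_ord \<xi> ==> is_ord (coll R \<xi>)"
    and coll_le: "is_ord \<xi> ==> coll R \<xi> = \<xi> \<or> coll R \<xi> \<in> elts \<xi>"
proof -
  show ord: "is_ord (coll R \<xi>)" if "is_ord \<xi>" for \<xi>
    using that
  proof (induction \<xi> rule: mem_induct)
    case (step \<xi>)
    show ?case
    proof (rule ordI)
      fix \<beta> \<gamma> assume "\<beta> \<in> elts (coll R \<xi>)" "\<gamma> \<in> elts \<beta>"
      then show "\<gamma> \<in> elts (coll R \<xi>)"
        using ord_trans[OF step.prems] by (force simp: elts_coll)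
    qed (use step ord_mem in \<open>auto simp: elts_coll\<close>)
  qed
  show "coll R \<xi> = \<xi> \<or> coll R \<xi> \<in> elts \<xi>" if "is_ord \<xi>"
    using that
  proof (induction \<xi> rule: mem_induct)
    case (step \<xi>)
    have "elts (coll R \<xi>) \<subseteq> elts \<xi>"
    proof
      fix z assume "z \<in> elts (coll R \<xi>)"
      then obtain \<zeta> where z: "\<zeta> \<in> elts \<xi>" "z = coll R \<zeta>" by (auto simp: elts_coll)
      then show "z \<in> elts \<xi>" using step.IH[OF z(1) ord_mem[OF step.prems z(1)]] ord_trans[OF step.prems z(1)] by auto
    qed
    then show ?case using ord_subset_iff[OF ord[OF step.prems] step.prems] by blast
  qed
qed

lemma coll_mono: "\<zeta> \<in> elts R ==> \<zeta> \<in> elts \<xi> ==> coll R \<zeta> \<in> elts (coll R \<xi>)"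
  by (auto simp: elts_coll)

lemma inj_on_coll:
  assumes "\<And>\<zeta>. \<zeta> \<in> elts R ==> is_ord \<zeta>"
  shows "inj_on (coll R) (elts R)"
proof (rule inj_onI, rule ccontr)
  fix x y assume xy: "x \<in> elts R" "y \<in> elts R" "coll R x = coll R y" "x \<noteq> y"
  then have "x \<in> elts y \<or> y \<in> elts x" using ord_linear[OF assms assms] by blast
  with coll_mono[of x R y] coll_mono[of y R x] xy show False by auto
qed

text \<open>Together with products, added in \<open>weak_class\<close>, these properties hold for
  \<open>V\<close> by its axioms and for \<open>M\<close> by forcing, so one theory of functions
  serves both. Finiteness is that of HOL.\<close>

locale pair_class = trans_class +
  assumes finite_mem: "finite A ==> A \<subseteq> N ==> mk A \<in> N"
    and separation: "a \<in> N ==> definable N (\<lambda>s. P (s 0)) ==> mk {x \<in> elts a. P x} \<in> N"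
begin

lemma opair_mem [simp]: "opair x y \<in> N \<longleftrightarrow> x \<in> N \<and> y \<in> N"
proof
  show "opair x y \<in> N ==> x \<in> N \<and> y \<in> N"
    using mem_trans[of "mk {x, y}" "opair x y"] mem_trans[of x "mk {x, y}"] mem_trans[of y "mk {x, y}"]
    by (auto simp: opair_def)
qed (simp add: opair_def finite_mem)

lemma num_mem [simp]: "num n \<in> N"
proof (induction n)
  case (Suc n)
  then show ?case
    using finite_mem[of "insert (num n) (elts (num n))"] trans[OF Suc] by (simp add: num_Suc suc_def)
qed simp

lemma dterm_upair [dintro]:
  assumes "dterm N t" "dterm N u"
  shows "dterm N (\<lambda>s. mk {t s, u s})"
proof (rule dtermI[where Q = "\<lambda>z s. t s \<in> elts z \<and> u s \<in> elts z \<and> (\<forall>w\<in>elts z. w = t s \<or> w = u s)"])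
  show "definable N (\<lambda>s. t (\<lambda>n. s (Suc n)) \<in> elts (s 0) \<and> u (\<lambda>n. s (Suc n)) \<in> elts (s 0) \<and>
      (\<forall>w\<in>elts (s 0). w = t (\<lambda>n. s (Suc n)) \<or> w = u (\<lambda>n. s (Suc n))))"
    by (intro dintro dterm_shift assms dterm_shift[OF dterm_shift[OF assms(1)]] dterm_shift[OF dterm_shift[OF assms(2)]])
qed (use dterm_mem[OF assms(1)] dterm_mem[OF assms(2)] in \<open>auto simp: finite_mem elts_eq_iff\<close>)

lemma dterm_opair [dintro]:
  assumes "dterm N t" "dterm N u"
  shows "dterm N (\<lambda>s. opair (t s) (u s))"
proof -
  have "dterm N (\<lambda>s. mk {mk {t s, t s}, mk {t s, u s}})"
    by (intro dterm_upair assms)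
  then show ?thesis by (simp add: opair_def)
qed

lemma dterm_ufst [dintro]:
  assumes "dterm N t"
  shows "dterm N (\<lambda>s. ufst (t s))"
proof -
  have "dterm N (\<lambda>s. ufst (s 0))"
  proof (rule dtermI[where Q = "\<lambda>z s. (\<exists>y\<in>N. s 0 = opair z y) \<or>
      (\<not> (\<exists>x\<in>N. \<exists>y\<in>N. s 0 = opair x y) \<and> z = mk {})"])
    fix x s assume "x \<in> N" "env N s"
    then have "s 0 \<in> N" by (simp add: env_def)
    then show "x = ufst (s 0) \<longleftrightarrow> ((\<exists>y\<in>N. s 0 = opair x y) \<or> (\<not> (\<exists>x\<in>N. \<exists>y\<in>N. s 0 = opair x y) \<and> x = mk {}))"
      by (cases "\<exists>x y. s 0 = opair x y") (auto simp: ufst_def)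
  next
    fix s assume "env N s"
    then have "s 0 \<in> N" by (simp add: env_def)
    then show "ufst (s 0) \<in> N"
      by (cases "\<exists>x y. s 0 = opair x y") (auto simp: ufst_def)
  qed (intro dintro empty_mem)
  then show ?thesis by (rule dterm_comp1) fact
qed

lemma dterm_usnd [dintro]:
  assumes "dterm N t"
  shows "dterm N (\<lambda>s. usnd (t s))"
proof -
  have "dterm N (\<lambda>s. usnd (s 0))"
  proof (rule dtermI[where Q = "\<lambda>z s. (\<exists>y\<in>N. s 0 = opair y z) \<or>
      (\<not> (\<exists>x\<in>N. \<exists>y\<in>N. s 0 = opair x y) \<and> z = mk {})"])
    fix x s assume "x \<in> N" "env N s"
    then have "s 0 \<in> N" by (simp add: env_def)
    then show "x = usnd (s 0) \<longleftrightarrow> ((\<exists>y\<in>N. s 0 = opair y x) \<or> (\<not> (\<exists>x\<in>N. \<exists>y\<in>N. s 0 = opair x y) \<and> x = mk {}))"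
      by (cases "\<exists>x y. s 0 = opair x y") (auto simp: usnd_def)
  next
    fix s assume "env N s"
    then have "s 0 \<in> N" by (simp add: env_def)
    then show "usnd (s 0) \<in> N"
      by (cases "\<exists>x y. s 0 = opair x y") (auto simp: usnd_def)
  qed (intro dintro empty_mem)
  then show ?thesis by (rule dterm_comp1) fact
qed

lemma opair_mem_elts: "opair x y \<in> elts f ==> f \<in> N ==> x \<in> N \<and> y \<in> N"
  using mem_trans[of "opair x y" f] by simp

lemma ap_cases: "(\<exists>!y. opair x y \<in> elts f) \<and> opair x (ap f x) \<in> elts f \<or>
    \<not> (\<exists>!y. opair x y \<in> elts f) \<and> ap f x = mk {}"
proof (cases "\<exists>!y. opair x y \<in> elts f")
  case True
  from theI'[OF True] True show ?thesis by (simp add: ap_def)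
next
  case False
  then show ?thesis unfolding ap_def by simp
qed

lemma ap_mem: "f \<in> N ==> ap f x \<in> N"
  using ap_cases[of x f] opair_mem_elts[of x "ap f x" f] by auto

lemma dterm_ap [dintro]:
  assumes "dterm N t" "dterm N u"
  shows "dterm N (\<lambda>s. ap (t s) (u s))"
proof -
  have "dterm N (\<lambda>s. ap (s 0) (s 1))"
  proof (rule dtermI[where Q = "\<lambda>z s. (opair (s 1) z \<in> elts (s 0) \<and> (\<forall>y\<in>N. opair (s 1) y \<in> elts (s 0) --> y = z)) \<or>
      (\<not> (\<exists>y\<in>N. opair (s 1) y \<in> elts (s 0) \<and> (\<forall>y'\<in>N. opair (s 1) y' \<in> elts (s 0) --> y' = y)) \<and> z = mk {})"])
    fix x s assume "x \<in> N" "env N s"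
    then have s: "s 0 \<in> N" by (simp add: env_def)
    then have *: "y \<in> N" if "opair (s 1) y \<in> elts (s 0)" for y using that opair_mem_elts by blast
    have ex: "(\<exists>y\<in>N. opair (s 1) y \<in> elts (s 0) \<and> (\<forall>y'\<in>N. opair (s 1) y' \<in> elts (s 0) --> y' = y)) \<longleftrightarrow>
        (\<exists>!y. opair (s 1) y \<in> elts (s 0))"
      using * by blast
    show "x = ap (s 0) (s 1) \<longleftrightarrow> (opair (s 1) x \<in> elts (s 0) \<and> (\<forall>y\<in>N. opair (s 1) y \<in> elts (s 0) --> y = x)) \<or>
      (\<not> (\<exists>y\<in>N. opair (s 1) y \<in> elts (s 0) \<and> (\<forall>y'\<in>N. opair (s 1) y' \<in> elts (s 0) --> y' = y)) \<and> x = mk {})"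
    proof (cases "\<exists>!y. opair (s 1) y \<in> elts (s 0)")
      case True
      then have "opair (s 1) y \<in> elts (s 0) \<longleftrightarrow> y = ap (s 0) (s 1)" for y
        using ap_cases[of "s 1" "s 0"] by blast
      with True * show ?thesis unfolding ex by auto
    next
      case False
      then have "\<not> (opair (s 1) x \<in> elts (s 0) \<and> (\<forall>y\<in>N. opair (s 1) y \<in> elts (s 0) --> y = x))"
        using * by blast
      with False show ?thesis unfolding ex using ap_cases[of "s 1" "s 0"] by (simp, blast)
    qed
  next
    fix s assume "env N s"
    then show "ap (s 0) (s 1) \<in> N" by (simp add: env_def ap_mem)
  qed (intro dintro empty_mem)
  then show ?thesis by (rule dterm_comp2) fact+
qed

lemma dterm_Collect [dintro]:
  assumes t: "dterm N t" and P: "definable N (\<lambda>s. P (s 0) (\<lambda>n. s (Suc n)))"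
  shows "dterm N (\<lambda>s. mk {x \<in> elts (t s). P x s})"
proof (rule dtermI[where Q = "\<lambda>z s. \<forall>x\<in>N. x \<in> elts z \<longleftrightarrow> x \<in> elts (t s) \<and> P x s"])
  fix s assume s: "env N s"
  \<comment> \<open>The environment is frozen into parameters, except for the variable that ranges
    over the set to be separated.\<close>
  have "definable N (\<lambda>e. (\<lambda>s. P (s 0) (\<lambda>n. s (Suc n))) (\<lambda>n. if n = 0 then e 0 else s (n - 1)))"
    by (rule definable_subst[OF P]) (use s in \<open>intro dterm_if_const dintro, simp add: env_def\<close>)
  then have "definable N (\<lambda>e. P (e 0) s)" by simp
  then show "mk {x \<in> elts (t s). P x s} \<in> N"
    by (rule separation[OF dterm_mem[OF t s]])
next
  fix z s assume "z \<in> N" "env N s"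
  then show "z = mk {x \<in> elts (t s). P x s} \<longleftrightarrow> (\<forall>x\<in>N. x \<in> elts z \<longleftrightarrow> x \<in> elts (t s) \<and> P x s)"
    using mem_trans dterm_mem[OF t] by (auto simp: elts_eq_iff[of z])
next
  have "definable N (\<lambda>s. (\<lambda>s. P (s 0) (\<lambda>n. s (Suc n))) (\<lambda>n. if n = 0 then s 0 else s (Suc n)))"
    by (rule definable_subst[OF P]) (intro dterm_if_const dintro)
  then have "definable N (\<lambda>s. P (s 0) (\<lambda>n. s (Suc (Suc n))))" by simp
  then show "definable N (\<lambda>s. \<forall>x\<in>N. x \<in> elts (s 0) \<longleftrightarrow> x \<in> elts (t (\<lambda>n. s (Suc n))) \<and> P x (\<lambda>n. s (Suc n)))"
    using dterm_shift[OF dterm_shift[OF t]] by (intro dintro)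
qed

end

locale weak_class = pair_class +
  assumes product: "a \<in> N ==> b \<in> N ==> \<exists>c\<in>N. elts c = {opair x y | x y. x \<in> elts a \<and> y \<in> elts b}"
begin

lemma
  assumes "a \<in> N" "b \<in> N"
  shows cprod_mem: "cprod a b \<in> N"
    and elts_cprod: "elts (cprod a b) = {opair x y | x y. x \<in> elts a \<and> y \<in> elts b}"
proof -
  obtain c where c: "c \<in> N" "elts c = {opair x y | x y. x \<in> elts a \<and> y \<in> elts b}"
    using product[OF assms] by blast
  then have "cprod a b = c" unfolding cprod_def c(2)[symmetric] by simp
  with c show "cprod a b \<in> N" "elts (cprod a b) = {opair x y | x y. x \<in> elts a \<and> y \<in> elts b}"
    by simp_all
qed

lemma opair_cprod [simp]: "a \<in> N ==> b \<in> N ==> opair x y \<in> elts (cprod a b) \<longleftrightarrow> x \<in> elts a \<and> y \<in> elts b"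
  by (auto simp: elts_cprod)

lemma dterm_cprod [dintro]:
  assumes "dterm N t" "dterm N u"
  shows "dterm N (\<lambda>s. cprod (t s) (u s))"
proof -
  have "dterm N (\<lambda>s. cprod (s 0) (s 1))"
  proof (rule dtermI[where Q = "\<lambda>z s. \<forall>w\<in>N. w \<in> elts z \<longleftrightarrow> (\<exists>x\<in>elts (s 0). \<exists>y\<in>elts (s 1). w = opair x y)"])
    fix z s assume *: "z \<in> N" "env N s"
    then have "s 0 \<in> N" "s 1 \<in> N" by (auto simp: env_def)
    moreover from this have "w \<in> N" if "w \<in> elts (cprod (s 0) (s 1))" for w
      using mem_trans[OF that cprod_mem] by simp
    moreover have "z = cprod (s 0) (s 1) \<longleftrightarrow> (\<forall>w\<in>N. w \<in> elts z \<longleftrightarrow> w \<in> elts (cprod (s 0) (s 1)))"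
      using mem_trans[OF _ *(1)] calculation(3) unfolding elts_eq_iff[of z] by blast
    ultimately show "z = cprod (s 0) (s 1) \<longleftrightarrow> (\<forall>w\<in>N. w \<in> elts z \<longleftrightarrow> (\<exists>x\<in>elts (s 0). \<exists>y\<in>elts (s 1). w = opair x y))"
      by (auto simp: elts_cprod)
  next
    fix s assume "env N s"
    then show "cprod (s 0) (s 1) \<in> N" by (simp add: env_def cprod_mem)
  qed (intro dintro)
  then show ?thesis by (rule dterm_comp2) fact+
qed

lemma definable_ord [dintro]: "dterm N t ==> definable N (\<lambda>s. is_ord (t s))"
  unfolding is_ord_def by (intro dintro dterm_shift)

text \<open>Separation can only cut a graph out of a product, so the codomain has to be given
  beforehand together with a definable relation that singles out the value.\<close>

lemma Gr_mem_rel: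
  assumes "a \<in> N" "b \<in> N" "F ` elts a \<subseteq> elts b" "definable N (\<lambda>s. R (s 0) (s 1))"
    and "\<And>x y. x \<in> elts a ==> y \<in> elts b ==> R x y \<longleftrightarrow> y = F x"
  shows "Gr a F \<in> N"
proof -
  have "definable N (\<lambda>s. R (ufst (s 0)) (usnd (s 0)))"
    by (rule definable_comp2[OF assms(4)]) (intro dintro)+
  from separation[OF cprod_mem[OF assms(1,2)] this]
  have "mk {w \<in> elts (cprod a b). R (ufst w) (usnd w)} \<in> N" .
  also have "mk {w \<in> elts (cprod a b). R (ufst w) (usnd w)} = Gr a F"
    unfolding Gr_def using assms(1,2,3,5) by (intro arg_cong[of _ _ mk]) (auto simp: elts_cprod)
  finally show ?thesis .
qed

lemma Gr_mem_dterm: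
  assumes "a \<in> N" "b \<in> N" "F ` elts a \<subseteq> elts b" "dterm N (\<lambda>s. F (s 0))"
  shows "Gr a F \<in> N"
proof (rule Gr_mem_rel[OF assms(1-3), of "\<lambda>x y. y = F x"])
  show "definable N (\<lambda>s. s 1 = F (s 0))" by (intro dintro assms)
qed auto

lemma Gr_comp:
  assumes "a \<in> N" "c \<in> N" "Gr a F \<in> N" "Gr b E \<in> N" "F ` elts a \<subseteq> elts b" "E ` elts b \<subseteq> elts c"
  shows "Gr a (\<lambda>x. E (F x)) \<in> N"
proof -
  have eq: "E (F x) = ap (Gr b E) (ap (Gr a F) x)" if "x \<in> elts a" for x
    using assms(5) that by (simp add: image_subset_iff)
  have "Gr a (\<lambda>x. ap (Gr b E) (ap (Gr a F) x)) \<in> N"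
  proof (rule Gr_mem_dterm[OF assms(1,2)])
    show "(\<lambda>x. ap (Gr b E) (ap (Gr a F) x)) ` elts a \<subseteq> elts c"
      using assms(5,6) by (simp add: image_subset_iff eq[symmetric])
    show "dterm N (\<lambda>s. ap (Gr b E) (ap (Gr a F) (s 0)))" by (intro dintro assms)
  qed
  also have "Gr a (\<lambda>x. ap (Gr b E) (ap (Gr a F) x)) = Gr a (\<lambda>x. E (F x))"
    by (rule Gr_cong) (simp_all add: eq)
  finally show ?thesis .
qed

lemma Gr_restrict:
  assumes "a \<in> N" "d \<in> N" "Gr a F \<in> N" "elts d \<subseteq> elts a"
  shows "Gr d F \<in> N"
proof -
  have "mk {w \<in> elts (Gr a F). ufst w \<in> elts d} \<in> N"
    by (rule separation[OF assms(3)]) (intro dintro assms)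
  also have "mk {w \<in> elts (Gr a F). ufst w \<in> elts d} = Gr d F"
    unfolding Gr_def[of d] using assms(4) by (intro arg_cong[of _ _ mk]) (auto simp: elts_Gr)
  finally show ?thesis .
qed

lemma Gr_inverse:
  assumes "a \<in> N" "b \<in> N" "Gr a F \<in> N" "inj_on F (elts a)" "F ` elts a = elts b"
  shows "Gr b (inv_into (elts a) F) \<in> N"
proof (rule Gr_mem_rel[where b = a and R = "\<lambda>x y. opair y x \<in> elts (Gr a F)"])
  show "definable N (\<lambda>s. opair (s 1) (s 0) \<in> elts (Gr a F))" by (intro dintro assms)
  show "opair y x \<in> elts (Gr a F) \<longleftrightarrow> y = inv_into (elts a) F x" if "x \<in> elts b" "y \<in> elts a" for x y
    using that assms(4,5) by (auto simp: elts_Gr image_iff f_inv_into_f)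
qed (use assms inv_into_into[of _ F "elts a"] in auto)

lemma finite_Gr: "finite (elts a) ==> a \<in> N ==> F ` elts a \<subseteq> N ==> Gr a F \<in> N"
  unfolding Gr_def by (rule finite_mem) (use mem_trans in auto)

lemma injects_iff: "injects N a b \<longleftrightarrow> (\<exists>f\<in>N. is_inj f a b)"
proof
  show "injects N a b ==> \<exists>f\<in>N. is_inj f a b" unfolding injects_def by (metis is_inj_Gr)
  show "\<exists>f\<in>N. is_inj f a b ==> injects N a b" unfolding injects_def is_inj_iff by metis
qed

lemma psurjE:
  assumes "psurj N a b"
  obtains d F where "d \<in> N" "elts d \<subseteq> elts a" "Gr d F \<in> N" "\<forall>x\<in>elts d. F x \<in> elts b"
    "\<forall>y\<in>elts b. \<exists>x\<in>elts d. F x = y"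
proof -
  obtain d F where *: "d \<in> N" "elts d \<subseteq> elts a" "Gr d F \<in> N" "F ` elts d = elts b"
    using assms unfolding psurj_def by blast
  have "\<forall>y\<in>elts b. \<exists>x\<in>elts d. F x = y" "\<forall>x\<in>elts d. F x \<in> elts b"
    unfolding *(4)[symmetric] by auto
  with * show ?thesis by (intro that[of d F])
qed

lemma injectsE:
  assumes "injects N a b"
  obtains F where "Gr a F \<in> N" "inj_on F (elts a)" "\<forall>x\<in>elts a. F x \<in> elts b"
  using assms unfolding injects_def by blast

lemma psurjI:
  assumes "d \<in> N" "elts d \<subseteq> elts a" "Gr d F \<in> N" "\<And>x. x \<in> elts d ==> F x \<in> elts b"
    "\<And>y. y \<in> elts b ==> \<exists>x\<in>elts d. F x = y"
  shows "psurj N a b"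
  using assms unfolding psurj_def by (intro bexI[of _ d] exI[of _ F]) blast+

lemma injects_trans:
  assumes "injects N a b" "injects N b c" "a \<in> N" "c \<in> N"
  shows "injects N a c"
proof -
  obtain F where 0: "Gr a F \<in> N" "inj_on F (elts a)"
    "\<forall>x\<in>elts a. F x \<in> elts b"
    by (rule injectsE[OF assms(1)])
  note F = 0(1,2) 0(3)[rule_format]
  obtain E where 0: "Gr b E \<in> N" "inj_on E (elts b)"
    "\<forall>x\<in>elts b. E x \<in> elts c"
    by (rule injectsE[OF assms(2)])
  note E = 0(1,2) 0(3)[rule_format]
  have "Gr a (\<lambda>x. E (F x)) \<in> N" by (rule Gr_comp[OF assms(3,4) F(1) E(1)]) (use F(3) E(3) in auto)
  moreover have "inj_on (\<lambda>x. E (F x)) (elts a)"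
    using F E by (auto simp: inj_on_def)
  ultimately show ?thesis using F E unfolding injects_def by blast
qed

lemma psurj_subset:
  assumes "a \<in> N" "b \<in> N" "elts b \<subseteq> elts a" shows "psurj N a b"
proof (rule psurjI[of b _ "\<lambda>x. x"])
  show "Gr b (\<lambda>x. x) \<in> N"
    by (rule Gr_mem_dterm[OF assms(2,2)]) (simp, intro dintro)
qed (use assms in auto)

lemma psurj_trans:
  assumes "psurj N a b" "psurj N b c" "a \<in> N" "b \<in> N" "c \<in> N"
  shows "psurj N a c"
proof -
  obtain d F where 0: "d \<in> N" "elts d \<subseteq> elts a" "Gr d F \<in> N" "\<forall>x\<in>elts d. F x \<in> elts b"
    "\<forall>y\<in>elts b. \<exists>x\<in>elts d. F x = y"
    by (rule psurjE[OF assms(1)])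
  note F = 0(1-3) 0(4,5)[rule_format]
  obtain e E where 1: "e \<in> N" "elts e \<subseteq> elts b" "Gr e E \<in> N" "\<forall>x\<in>elts e. E x \<in> elts c"
    "\<forall>y\<in>elts c. \<exists>x\<in>elts e. E x = y"
    by (rule psurjE[OF assms(2)])
  note E = 1(1-3) 1(4,5)[rule_format]
  define d' where "d' = mk {x \<in> elts d. ap (Gr d F) x \<in> elts e}"
  have "d' \<in> N" unfolding d'_def by (rule separation[OF F(1)]) (intro dintro F E)
  have d': "elts d' = {x \<in> elts d. F x \<in> elts e}" by (auto simp: d'_def)
  have "Gr d' F \<in> N" by (rule Gr_restrict[of d]) (use F \<open>d' \<in> N\<close> d' in auto)
  then have "Gr d' (\<lambda>x. E (F x)) \<in> N"
    using E(4) by (intro Gr_comp[of d' c _ e E] E \<open>d' \<in> N\<close> assms) (auto simp: d')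
  then show ?thesis
  proof (rule psurjI[OF \<open>d' \<in> N\<close>, rotated])
    show "\<exists>x\<in>elts d'. E (F x) = z" if z: "z \<in> elts c" for z
    proof -
      obtain y where y: "y \<in> elts e" "E y = z" using E(5)[OF z] by blast
      then obtain x where "x \<in> elts d" "F x = y" using F(5) E(2) by blast
      then show ?thesis using y d' by auto
    qed
  qed (use F E d' in auto)
qed

lemma injects_psurj:
  assumes "injects N a b" "a \<in> N" "b \<in> N"
  shows "psurj N b a"
proof -
  obtain F where 0: "Gr a F \<in> N" "inj_on F (elts a)"
    "\<forall>x\<in>elts a. F x \<in> elts b"
    by (rule injectsE[OF assms(1)])
  note * = 0(1,2) 0(3)[rule_format]
  define d where "d = mk {y \<in> elts b. \<exists>x\<in>elts a. opair x y \<in> elts (Gr a F)}"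
  have "d \<in> N" unfolding d_def by (rule separation[OF assms(3)]) (intro dintro assms *)
  have d: "F ` elts a = elts d" using *(3) by (auto simp: d_def elts_Gr)
  show ?thesis
  proof (rule psurjI[OF \<open>d \<in> N\<close>])
    show "Gr d (inv_into (elts a) F) \<in> N"
      by (rule Gr_inverse[OF assms(2) \<open>d \<in> N\<close> *(1,2) d])
    show "inv_into (elts a) F x \<in> elts a" if "x \<in> elts d" for x
      using that inv_into_into[of x F "elts a"] d by simp
    show "\<exists>x\<in>elts d. inv_into (elts a) F x = y" if "y \<in> elts a" for y
      using that inv_into_f_f[OF *(2) that] d by blast
    show "elts d \<subseteq> elts b" unfolding d[symmetric] using *(3) by blast
  qed
qed

text \<open>The members of \<open>a\<close> are ordinals, so each value has a least preimage and a
  section is definable without choice.\<close>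

lemma psurj_injects:
  assumes "psurj N a b" "a \<in> N" "b \<in> N" "\<And>\<zeta>. \<zeta> \<in> elts a ==> is_ord \<zeta>"
  shows "injects N b a"
proof -
  obtain d F where 0: "d \<in> N" "elts d \<subseteq> elts a" "Gr d F \<in> N" "\<forall>x\<in>elts d. F x \<in> elts b"
    "\<forall>y\<in>elts b. \<exists>x\<in>elts d. F x = y"
    by (rule psurjE[OF assms(1)])
  note * = 0(1-3) 0(4,5)[rule_format]
  define L where "L y = (THE x. x \<in> elts d \<and> F x = y \<and> (\<forall>z\<in>elts d. F z = y --> z \<notin> elts x))" for y
  have ex1: "\<exists>!x. x \<in> elts d \<and> F x = y \<and> (\<forall>z\<in>elts d. F z = y --> z \<notin> elts x)" if "y \<in> elts b" for y
  proof -
    have ne: "{x \<in> elts d. F x = y} \<noteq> {}" using *(5)[OF that] by blast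
    have ords: "is_ord x" if "x \<in> {x \<in> elts d. F x = y}" for x
      using that *(2) assms(4) by blast
    obtain x where x: "x \<in> {x \<in> elts d. F x = y}" "\<And>\<beta>. \<beta> \<in> {x \<in> elts d. F x = y} ==> x = \<beta> \<or> x \<in> elts \<beta>"
      using ord_least[OF ne ords] by blast
    then show ?thesis by (intro ex1I[of _ x]) (auto dest: mem_asym)
  qed
  have L: "L y \<in> elts d \<and> F (L y) = y \<and> (\<forall>z\<in>elts d. F z = y --> z \<notin> elts (L y))" if "y \<in> elts b" for y
    using theI'[OF ex1[OF that]] by (simp add: L_def)
  have "Gr b L \<in> N"
  proof (rule Gr_mem_rel[where b = d and R = "\<lambda>y x. opair x y \<in> elts (Gr d F) \<and>
      (\<forall>z\<in>elts d. opair z y \<in> elts (Gr d F) --> z \<notin> elts x)"])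
    show "definable N (\<lambda>s. opair (s 1) (s 0) \<in> elts (Gr d F) \<and>
      (\<forall>z\<in>elts d. opair z (s 0) \<in> elts (Gr d F) --> z \<notin> elts (s 1)))"
      by (intro dintro dterm_shift *)
    show "(opair x y \<in> elts (Gr d F) \<and> (\<forall>z\<in>elts d. opair z y \<in> elts (Gr d F) --> z \<notin> elts x)) \<longleftrightarrow> x = L y"
      if "y \<in> elts b" "x \<in> elts d" for y x
    proof -
      have "x = L y \<longleftrightarrow> x \<in> elts d \<and> F x = y \<and> (\<forall>z\<in>elts d. F z = y --> z \<notin> elts x)"
        using L[OF that(1)] the1_equality[OF ex1[OF that(1)], of x] unfolding L_def[symmetric] by metis
      then show ?thesis unfolding opair_Gr using that(2) by auto
    qed
  qed (use assms * L in auto)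
  moreover have "inj_on L (elts b)" by (rule inj_on_inverseI[of _ F]) (use L in blast)
  ultimately show ?thesis unfolding injects_def using L *(2) by blast
qed

lemma is_surj_psurj: "a \<in> N ==> f \<in> N ==> is_surj f a b ==> psurj N a b"
  unfolding is_surj_iff psurj_def by (intro bexI[of _ a] exI[of _ "ap f"]) simp_all

text \<open>Arguments outside the partial domain are sent to one fixed member of \<open>b\<close>,
  which is why \<open>b\<close> has to be nonempty.\<close>

lemma psurj_is_surj:
  assumes "psurj N a b" "a \<in> N" "b \<in> N" "elts b \<noteq> {}"
  shows "\<exists>f\<in>N. is_surj f a b"
proof -
  obtain d F where 0: "d \<in> N" "elts d \<subseteq> elts a" "Gr d F \<in> N" "\<forall>x\<in>elts d. F x \<in> elts b"
    "\<forall>y\<in>elts b. \<exists>x\<in>elts d. F x = y"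
    by (rule psurjE[OF assms(1)])
  note * = 0(1-3) 0(4,5)[rule_format]
  obtain y0 where y0: "y0 \<in> elts b" using assms(4) by blast
  define E where "E x = (if x \<in> elts d then ap (Gr d F) x else y0)" for x
  have "dterm N (\<lambda>s. E (s 0))"
    unfolding E_def by (intro dintro * mem_trans[OF y0 assms(3)])
  moreover have "E ` elts a \<subseteq> elts b" using *(4) y0 by (auto simp: E_def)
  ultimately have "Gr a E \<in> N" by (intro Gr_mem_dterm[OF assms(2,3)])
  moreover have "elts b \<subseteq> E ` elts a"
  proof
    fix y assume "y \<in> elts b"
    then obtain x where "x \<in> elts d" "F x = y" using *(5) by blast
    then show "y \<in> E ` elts a" using *(2) by (intro image_eqI[of _ _ x]) (auto simp: E_def)
  qed
  ultimately have "is_surj (Gr a E) a b"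
    unfolding is_surj_Gr using \<open>E ` elts a \<subseteq> elts b\<close> by blast
  with \<open>Gr a E \<in> N\<close> show ?thesis by blast
qed

lemma psurj_cprod:
  assumes "psurj N a a'" "psurj N b b'" "a \<in> N" "a' \<in> N" "b \<in> N" "b' \<in> N"
  shows "psurj N (cprod a b) (cprod a' b')"
proof -
  obtain d F where 0: "d \<in> N" "elts d \<subseteq> elts a" "Gr d F \<in> N" "\<forall>x\<in>elts d. F x \<in> elts a'"
    "\<forall>y\<in>elts a'. \<exists>x\<in>elts d. F x = y"
    by (rule psurjE[OF assms(1)])
  note F = 0(1-3) 0(4,5)[rule_format]
  obtain e E where 1: "e \<in> N" "elts e \<subseteq> elts b" "Gr e E \<in> N" "\<forall>x\<in>elts e. E x \<in> elts b'"
    "\<forall>y\<in>elts b'. \<exists>x\<in>elts e. E x = y"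
    by (rule psurjE[OF assms(2)])
  note E = 1(1-3) 1(4,5)[rule_format]
  define H where "H w = opair (ap (Gr d F) (ufst w)) (ap (Gr e E) (usnd w))" for w
  have H: "H (opair x y) = opair (F x) (E y)" if "x \<in> elts d" "y \<in> elts e" for x y
    using that by (simp add: H_def)
  have "dterm N (\<lambda>s. H (s 0))" unfolding H_def by (intro dintro F E)
  then have "Gr (cprod d e) H \<in> N"
    by (rule Gr_mem_dterm[of _ "cprod a' b'", rotated 3])
      (use F(1,4) E(1,4) H assms in \<open>auto simp: elts_cprod cprod_mem\<close>)
  then show ?thesis
  proof (rule psurjI[OF cprod_mem[OF F(1) E(1)], rotated])
    fix z assume "z \<in> elts (cprod a' b')"
    then obtain x' y' where z: "z = opair x' y'" "x' \<in> elts a'" "y' \<in> elts b'"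
      using assms by (auto simp: elts_cprod)
    then obtain x y where "x \<in> elts d" "F x = x'" "y \<in> elts e" "E y = y'" using F(5) E(5) by blast
    then show "\<exists>x\<in>elts (cprod d e). H x = z"
      using z H[of x y] F(1) E(1) by (intro bexI[of _ "opair x y"]) auto
  qed (use F(1,2,4) E(1,2,4) H assms in \<open>auto simp: elts_cprod\<close>)
qed

lemma psurj_finite: "psurj N a b ==> finite (elts a) ==> finite (elts b) \<and> card (elts b) \<le> card (elts a)"
proof (elim psurjE)
  fix d F assume *: "finite (elts a)" "elts d \<subseteq> elts a" "\<forall>y\<in>elts b. \<exists>x\<in>elts d. F x = y"
  have "elts b \<subseteq> F ` elts a"
  proof
    fix y assume "y \<in> elts b"
    then obtain x where "x \<in> elts d" "F x = y" using *(3) by blast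
    then show "y \<in> F ` elts a" using *(2) by blast
  qed
  then show "finite (elts b) \<and> card (elts b) \<le> card (elts a)"
    using *(1) by (meson card_image_le card_mono finite_imageI finite_subset le_trans)
qed

lemma finite_injects:
  assumes "finite (elts a)" "finite (elts b) --> card (elts a) \<le> card (elts b)" "a \<in> N" "b \<in> N"
  shows "injects N a b"
proof -
  obtain B where B: "B \<subseteq> elts b" "finite B" "card (elts a) \<le> card B"
    using assms(1,2) infinite_arbitrarily_large[of "elts b"] by (metis order_refl)
  then obtain F where F: "inj_on F (elts a)" "F ` elts a \<subseteq> B"
    using card_le_inj[OF assms(1) B(2,3)] by blast
  then show ?thesis
    unfolding injects_def using finite_Gr[OF assms(1,3), of F] B(1) trans[OF assms(4)] by blast
qed

text \<open>With separation alone the collapse has to be found inside a given set. Since it never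
  raises an ordinal, all its approximations fit into \<open>cprod R \<eta>\<close>, and its graph
  consists of the pairs that occur in some approximation.\<close>

lemma collapse:
  assumes R: "R \<in> N" and \<eta>: "\<eta> \<in> N" "is_ord \<eta>" and sub: "elts R \<subseteq> elts \<eta>"
  shows "\<exists>\<theta>\<in>N. is_ord \<theta> \<and> elts \<theta> \<subseteq> elts \<eta> \<and> Gr R (coll R) \<in> N \<and> bij_betw (coll R) (elts R) (elts \<theta>)"
proof -
  have ordR: "\<And>\<zeta>. \<zeta> \<in> elts R ==> is_ord \<zeta>" using sub ord_mem[OF \<eta>(2)] by blast
  have coll: "coll R \<zeta> \<in> elts \<eta>" if "\<zeta> \<in> elts R" for \<zeta>
    using coll_le[of R \<zeta>] ordR that sub ord_trans[OF \<eta>(2), of \<zeta>] by auto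
  \<comment> \<open>\<open>g\<close> is closed under predecessors in \<open>R\<close>, and each of
    its values is exactly the set of its values at those predecessors; hence \<open>g\<close> agrees
    with the collapse on its domain.\<close>
  define appr where "appr g \<longleftrightarrow> (\<forall>w\<in>elts g. \<exists>z\<in>elts R. \<exists>v\<in>N. w = opair z v \<and>
      (\<forall>y\<in>elts R. y \<in> elts z --> (\<exists>u\<in>elts v. opair y u \<in> elts g)) \<and>
      (\<forall>u\<in>elts v. \<exists>y\<in>elts R. y \<in> elts z \<and> opair y u \<in> elts g))" for g
  have appr_dfn: "definable N (\<lambda>s. appr (s i))" for i
    unfolding appr_def by (intro dintro dterm_shift R)
  have appr_val: "v = coll R z" if "appr g" "opair z v \<in> elts g" for g z v
    using that(2)
  proof (induction z arbitrary: v rule: mem_induct)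
    case (step z)
    have *: "\<forall>y\<in>elts R. y \<in> elts z --> (\<exists>u\<in>elts v. opair y u \<in> elts g)"
      "\<forall>u\<in>elts v. \<exists>y\<in>elts R. y \<in> elts z \<and> opair y u \<in> elts g"
      using that(1) step.prems by (auto simp: appr_def)
    have "elts v = elts (coll R z)"
    proof (intro equalityI subsetI)
      fix u assume "u \<in> elts v"
      with *(2) obtain y where "y \<in> elts R" "y \<in> elts z" "opair y u \<in> elts g" by blast
      then show "u \<in> elts (coll R z)" using step.IH[of y u] by (auto simp: elts_coll)
    next
      fix u assume "u \<in> elts (coll R z)"
      then obtain y where y: "y \<in> elts R" "y \<in> elts z" "u = coll R y" by (auto simp: elts_coll)
      with *(1) obtain u' where "u' \<in> elts v" "opair y u' \<in> elts g" by blast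
      then show "u \<in> elts v" using step.IH[of y u'] y by simp
    qed
    then show ?case by (rule elts_inject)
  qed
  have ex: "\<exists>g\<in>N. appr g \<and> opair z (coll R z) \<in> elts g" if "z \<in> elts R" for z
    using that
  proof (induction z rule: mem_induct)
    case (step z)
    \<comment> \<open>The approximations at predecessors of \<open>z\<close> are pooled and the pair
      at \<open>z\<close> is added.\<close>
    define g where "g = mk {w \<in> elts (cprod R \<eta>). w = opair z (coll R z) \<or>
        (\<exists>y\<in>elts R. y \<in> elts z \<and> (\<exists>v\<in>N. w = opair y v) \<and> (\<exists>h\<in>N. appr h \<and> w \<in> elts h))}"
    have cz: "coll R z \<in> N" "z \<in> N"
      using mem_trans[OF coll[OF step.prems] \<eta>(1)] mem_trans[OF step.prems R] by auto
    have "definable N (\<lambda>s. s 0 = opair z (coll R z) \<or>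
        (\<exists>y\<in>elts R. y \<in> elts z \<and> (\<exists>v\<in>N. s 0 = opair y v) \<and> (\<exists>h\<in>N. appr h \<and> s 0 \<in> elts h)))"
      by (intro dintro dterm_shift appr_dfn R cz)
    from separation[OF cprod_mem[OF R \<eta>(1)] this] have "g \<in> N" by (simp add: g_def)
    have mem: "opair y v \<in> elts g \<longleftrightarrow> y \<in> elts R \<and> (y = z \<or> y \<in> elts z) \<and> v = coll R y" for y v
    proof
      assume "opair y v \<in> elts g"
      then show "y \<in> elts R \<and> (y = z \<or> y \<in> elts z) \<and> v = coll R y"
        using R \<eta> appr_val by (auto simp: g_def)
    next
      assume *: "y \<in> elts R \<and> (y = z \<or> y \<in> elts z) \<and> v = coll R y"
      then have "v \<in> elts \<eta>" "v \<in> N" using coll mem_trans \<eta>(1) by auto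
      then show "opair y v \<in> elts g"
        using * step.IH[of y] R \<eta> by (auto simp: g_def)
    qed
    have "appr g"
      unfolding appr_def
    proof
      fix w assume w: "w \<in> elts g"
      then have "w \<in> elts (cprod R \<eta>)" by (simp add: g_def)
      then obtain y v where yv: "w = opair y v" using R \<eta> by (auto simp: elts_cprod)
      with w mem have y: "y \<in> elts R" "y = z \<or> y \<in> elts z" "v = coll R y" by auto
      have "x = z \<or> x \<in> elts z" if "x \<in> elts y" for x
        using y(2) that ord_trans[OF ordR[OF step.prems]] by auto
      then show "\<exists>z\<in>elts R. \<exists>v\<in>N. w = opair z v \<and>
          (\<forall>y\<in>elts R. y \<in> elts z --> (\<exists>u\<in>elts v. opair y u \<in> elts g)) \<and>
          (\<forall>u\<in>elts v. \<exists>y\<in>elts R. y \<in> elts z \<and> opair y u \<in> elts g)"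
        using y yv mem_trans[OF coll[OF y(1)] \<eta>(1)]
        by (intro bexI[of _ y] bexI[of _ v]) (auto simp: mem elts_coll)
    qed
    with \<open>g \<in> N\<close> mem step.prems show ?case by blast
  qed
  have "Gr R (coll R) \<in> N"
  proof (rule Gr_mem_rel[OF R \<eta>(1), where R = "\<lambda>z v. \<exists>g\<in>N. appr g \<and> opair z v \<in> elts g"])
    show "definable N (\<lambda>s. \<exists>g\<in>N. appr g \<and> opair (s 0) (s 1) \<in> elts g)"
      by (intro dintro appr_dfn)
  qed (use coll ex appr_val in auto)
  moreover define \<theta> where "\<theta> = mk (coll R ` elts R)"
  have \<theta>: "elts \<theta> = coll R ` elts R" by (simp add: \<theta>_def)
  have "is_ord \<theta>"
  proof (rule ordI)
    fix \<beta> assume "\<beta> \<in> elts \<theta>" then show "is_ord \<beta>" using ord_coll[of R] ordR by (auto simp: \<theta>)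
  next
    fix \<beta> \<gamma> assume "\<beta> \<in> elts \<theta>" "\<gamma> \<in> elts \<beta>" then show "\<gamma> \<in> elts \<theta>" by (auto simp: \<theta> elts_coll)
  qed
  moreover have "elts \<theta> \<subseteq> elts \<eta>" using coll by (auto simp: \<theta>)
  moreover from calculation have "\<theta> \<in> N" using ord_subset_iff[of \<theta> \<eta>] \<eta> mem_trans by auto
  ultimately show ?thesis
    using inj_on_coll[of R] ordR by (intro bexI[of _ \<theta>] conjI) (auto simp: bij_betw_def \<theta>)
qed

end

section \<open>Transitive models of ZFC\<close>

definition bun :: "'u::set_universe => 'u" where "bun x = mk (\<Union> (elts ` elts x))"

locale zfc_model =
  fixes V :: "'u::set_universe set"
  assumes transitive: "transitive_class V" and ZFC: "models_ZFC V"
begin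

lemma V_trans: "y \<in> elts x ==> x \<in> V ==> y \<in> V"
  using transitive by (auto simp: transitive_class_def)

lemma pairing_ax: "x \<in> V ==> y \<in> V ==> \<exists>z\<in>V. \<forall>w\<in>V. w \<in> elts z \<longleftrightarrow> w = x \<or> w = y"
  and union_ax: "x \<in> V ==> \<exists>u\<in>V. \<forall>z\<in>V. z \<in> elts u \<longleftrightarrow> (\<exists>y\<in>V. y \<in> elts x \<and> z \<in> elts y)"
  and power_ax: "x \<in> V ==> \<exists>u\<in>V. \<forall>y\<in>V. y \<in> elts u \<longleftrightarrow> (\<forall>z\<in>V. z \<in> elts y --> z \<in> elts x)"
  and infinity_ax: "\<exists>x\<in>V. (\<exists>e\<in>V. e \<in> elts x \<and> \<not> (\<exists>z\<in>V. z \<in> elts e)) \<and>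
      (\<forall>y\<in>V. y \<in> elts x -->
        (\<exists>z\<in>V. z \<in> elts x \<and> (\<forall>w\<in>V. w \<in> elts z \<longleftrightarrow> w \<in> elts y \<or> w = y)))"
  and separation_ax: "range s \<subseteq> V ==> a \<in> V ==>
      \<exists>b\<in>V. \<forall>x\<in>V. x \<in> elts b \<longleftrightarrow> x \<in> elts a \<and> sat V \<phi> (s(0 := x))"
  and replacement_ax: "range s \<subseteq> V ==> a \<in> V ==>
      (\<forall>x\<in>V. x \<in> elts a --> (\<exists>!y. y \<in> V \<and> sat V \<phi> (s(0 := x, 1 := y)))) ==>
      \<exists>b\<in>V. \<forall>y\<in>V. y \<in> elts b \<longleftrightarrow> (\<exists>x\<in>V. x \<in> elts a \<and> sat V \<phi> (s(0 := x, 1 := y)))"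
  and choice_ax: "a \<in> V ==> (\<forall>x\<in>V. x \<in> elts a --> (\<exists>z\<in>V. z \<in> elts x)) \<and>
        (\<forall>x\<in>V. \<forall>y\<in>V. x \<in> elts a \<and> y \<in> elts a \<and> x \<noteq> y -->
          \<not> (\<exists>z\<in>V. z \<in> elts x \<and> z \<in> elts y)) ==>
      \<exists>c\<in>V. \<forall>x\<in>V. x \<in> elts a --> (\<exists>!z. z \<in> V \<and> z \<in> elts x \<and> z \<in> elts c)"
  by (rule ZFC[unfolded models_ZFC_def, THEN conjunct2, THEN conjunct2, THEN conjunct1, THEN bspec, THEN bspec],
      assumption+,
      rule ZFC[unfolded models_ZFC_def, THEN conjunct2, THEN conjunct2, THEN conjunct2, THEN conjunct1, THEN bspec],
      assumption+,
      rule ZFC[unfolded models_ZFC_def, THEN conjunct2, THEN conjunct2, THEN conjunct2, THEN conjunct2, THEN conjunct1, THEN bspec],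
      assumption+,
      rule ZFC[unfolded models_ZFC_def, THEN conjunct2, THEN conjunct2, THEN conjunct2, THEN conjunct2, THEN conjunct2, THEN conjunct1],
      rule ZFC[unfolded models_ZFC_def, THEN conjunct2, THEN conjunct2, THEN conjunct2, THEN conjunct2, THEN conjunct2, THEN conjunct2, THEN conjunct1, THEN spec, THEN spec, THEN mp, THEN bspec],
      assumption+,
      rule ZFC[unfolded models_ZFC_def, THEN conjunct2, THEN conjunct2, THEN conjunct2, THEN conjunct2, THEN conjunct2, THEN conjunct2, THEN conjunct2, THEN conjunct1, THEN spec, THEN spec, THEN mp, THEN bspec, THEN mp],
      assumption+,
      rule ZFC[unfolded models_ZFC_def, THEN conjunct2, THEN conjunct2, THEN conjunct2, THEN conjunct2, THEN conjunct2, THEN conjunct2, THEN conjunct2, THEN conjunct2, THEN bspec, THEN mp],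
      assumption+)

lemma V_memI: "\<exists>z\<in>V. \<forall>w\<in>V. w \<in> elts z \<longleftrightarrow> w \<in> A ==> A \<subseteq> V ==> mk A \<in> V \<and> elts (mk A) = A"
proof -
  assume "\<exists>z\<in>V. \<forall>w\<in>V. w \<in> elts z \<longleftrightarrow> w \<in> A" "A \<subseteq> V"
  then obtain z where z: "z \<in> V" "\<forall>w\<in>V. w \<in> elts z \<longleftrightarrow> w \<in> A" by blast
  then have "elts z = A" using V_trans[OF _ z(1)] \<open>A \<subseteq> V\<close> by blast
  with z(1) show ?thesis using mk_elts[of z] by simp
qed

lemma V_pair: "x \<in> V ==> y \<in> V ==> mk {x, y} \<in> V"
  using V_memI[of "{x, y}"] pairing_ax[of x y] by simp

lemma Un_mem: "x \<in> V ==> bun x \<in> V" and elts_Un: "x \<in> V ==> elts (bun x) = \<Union> (elts ` elts x)"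
proof -
  assume x: "x \<in> V"
  have sub: "\<Union> (elts ` elts x) \<subseteq> V" using V_trans[OF _ V_trans[OF _ x]] by blast
  have "\<exists>z\<in>V. \<forall>w\<in>V. w \<in> elts z \<longleftrightarrow> w \<in> \<Union> (elts ` elts x)"
  proof -
    obtain u where u: "u \<in> V" "\<forall>z\<in>V. z \<in> elts u \<longleftrightarrow> (\<exists>y\<in>V. y \<in> elts x \<and> z \<in> elts y)"
      using union_ax[OF x] by blast
    then show ?thesis using V_trans[OF _ x] by (intro bexI[of _ u]) blast+
  qed
  from V_memI[OF this sub] show "bun x \<in> V" "elts (bun x) = \<Union> (elts ` elts x)"
    by (simp_all add: bun_def)
qed

lemma V_empty: "mk {} \<in> V"
proof -
  obtain e where "e \<in> V" "\<not> (\<exists>z\<in>V. z \<in> elts e)" using infinity_ax by blast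
  then have "e = mk {}" using V_trans[of _ e] by (auto simp: elts_eq_iff)
  with \<open>e \<in> V\<close> show ?thesis by simp
qed

sublocale trans_class V
  by unfold_locales (use V_trans V_empty in auto)

sublocale pair_class V
proof
  fix A :: "'u set" assume "finite A" "A \<subseteq> V"
  then show "mk A \<in> V"
  proof (induction A)
    case (insert x A)
    then have *: "mk {mk A, mk {x}} \<in> V" using V_pair V_pair[of x x] by simp
    have "elts (bun (mk {mk A, mk {x}})) = insert x A"
      unfolding elts_Un[OF *] using insert.hyps by (auto simp: elts_mk_finite)
    then show ?case using Un_mem[OF *] mk_elts[of "bun (mk {mk A, mk {x}})"] by simp
  qed (simp add: V_empty)
next
  fix a P assume a: "a \<in> V" and "definable V (\<lambda>s. P (s 0))"
  then obtain \<phi> c where *: "env V c" "\<And>s. env V s ==> P (s 0) \<longleftrightarrow> sat V \<phi> (interleave s c)"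
    unfolding definable_def by blast
  define s where "s = interleave (\<lambda>_. mk {}) c"
  have "range s \<subseteq> V" using *(1) by (auto simp: s_def interleave_def env_def)
  from separation_ax[OF this a, of \<phi>]
  obtain b where b: "b \<in> V" "\<forall>x\<in>V. x \<in> elts b \<longleftrightarrow> x \<in> elts a \<and> sat V \<phi> (s(0 := x))" by blast
  have "s(0 := x) = interleave ((\<lambda>_. mk {})(0 := x)) c" for x
    by (auto simp: s_def interleave_def fun_eq_iff elim!: evenE)
  then have "x \<in> elts b \<longleftrightarrow> x \<in> elts a \<and> P x" if "x \<in> V" for x
    using b(2) that *(2)[of "(\<lambda>_. mk {})(0 := x)"] by (simp add: env_def)
  then have "elts b = {x \<in> elts a. P x}" using V_trans[OF _ a] V_trans[OF _ b(1)] by blast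
  then show "mk {x \<in> elts a. P x} \<in> V" using b(1) mk_elts[of b] by simp
qed

definition pw :: "'u => 'u" where "pw x = mk {y \<in> V. elts y \<subseteq> elts x}"

lemma pw_mem: "x \<in> V ==> pw x \<in> V" and elts_pw: "x \<in> V ==> elts (pw x) = {y \<in> V. elts y \<subseteq> elts x}"
proof -
  assume x: "x \<in> V"
  have "\<exists>z\<in>V. \<forall>w\<in>V. w \<in> elts z \<longleftrightarrow> w \<in> {y \<in> V. elts y \<subseteq> elts x}"
    using power_ax[OF x] V_trans by (simp add: subset_iff) blast
  from V_memI[OF this] show "pw x \<in> V" "elts (pw x) = {y \<in> V. elts y \<subseteq> elts x}"
    by (auto simp: pw_def)
qed

lemma Un_pair_mem: "a \<in> V ==> b \<in> V ==> bun (mk {a, b}) \<in> V"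
  and elts_Un_pair: "a \<in> V ==> b \<in> V ==> elts (bun (mk {a, b})) = elts a \<union> elts b"
  using Un_mem[OF V_pair[of a b]] elts_Un[OF V_pair[of a b]] by auto

text \<open>An ordered pair from \<open>a\<close> and \<open>b\<close> lies in the double power set
  of their union, from which separation extracts the product.\<close>

sublocale weak_class V
proof
  fix a b assume ab: "a \<in> V" "b \<in> V"
  define u where "u = pw (pw (bun (mk {a, b})))"
  have u: "u \<in> V" using ab by (simp add: u_def pw_mem Un_pair_mem)
  have "opair x y \<in> elts u" if "x \<in> elts a" "y \<in> elts b" for x y
  proof -
    have "x \<in> V" "y \<in> V" using that ab V_trans by auto
    then show ?thesis
      using that ab by (auto simp: u_def elts_pw pw_mem Un_pair_mem elts_Un_pair V_pair V_pair[of x x, simplified] opair_def)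
  qed
  then have eq: "{w \<in> elts u. \<exists>x\<in>elts a. \<exists>y\<in>elts b. w = opair x y} = {opair x y | x y. x \<in> elts a \<and> y \<in> elts b}"
    by blast
  have "definable V (\<lambda>s. \<exists>x\<in>elts a. \<exists>y\<in>elts b. s 0 = opair x y)" by (intro dintro ab)
  from separation[OF u this] show "\<exists>c\<in>V. elts c = {opair x y | x y. x \<in> elts a \<and> y \<in> elts b}"
    unfolding eq[symmetric] by (rule bexI[rotated]) simp
qed

lemma dterm_pw [dintro]:
  assumes "dterm V t" shows "dterm V (\<lambda>s. pw (t s))"
proof -
  have "dterm V (\<lambda>s. pw (s 0))"
  proof (rule dtermI[where Q = "\<lambda>z s. \<forall>y\<in>V. y \<in> elts z \<longleftrightarrow> elts y \<subseteq> elts (s 0)"])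
    fix z s assume z: "z \<in> V" and "env V s"
    then have "s 0 \<in> V" by (simp add: env_def)
    then show "z = pw (s 0) \<longleftrightarrow> (\<forall>y\<in>V. y \<in> elts z \<longleftrightarrow> elts y \<subseteq> elts (s 0))"
      using V_trans[OF _ z] by (auto simp: elts_eq_iff[of z] elts_pw)
  qed (auto simp: env_def pw_mem intro!: dintro)
  then show ?thesis by (rule dterm_comp1) fact
qed

lemma dterm_Un [dintro]:
  assumes "dterm V t" shows "dterm V (\<lambda>s. bun (t s))"
proof -
  have "dterm V (\<lambda>s. bun (s 0))"
  proof (rule dtermI[where Q = "\<lambda>z s. \<forall>y\<in>V. y \<in> elts z \<longleftrightarrow> (\<exists>w\<in>elts (s 0). y \<in> elts w)"])
    fix z s assume z: "z \<in> V" and "env V s"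
    then have s: "s 0 \<in> V" by (simp add: env_def)
    then show "z = bun (s 0) \<longleftrightarrow> (\<forall>y\<in>V. y \<in> elts z \<longleftrightarrow> (\<exists>w\<in>elts (s 0). y \<in> elts w))"
      using V_trans[OF _ z] V_trans[OF _ V_trans[OF _ s]] by (auto simp: elts_eq_iff[of z] elts_Un)
  qed (auto simp: env_def Un_mem intro!: dintro)
  then show ?thesis by (rule dterm_comp1) fact
qed

lemma replacement:
  assumes a: "a \<in> V" and F: "dterm V (\<lambda>s. F (s 0))"
  shows "mk (F ` elts a) \<in> V"
proof -
  have "definable V (\<lambda>s. s 0 = F (s 1))" using F by (simp add: dterm_def)
  then obtain \<phi> c where *: "env V c" "\<And>s. env V s ==> s 0 = F (s 1) \<longleftrightarrow> sat V \<phi> (interleave s c)"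
    unfolding definable_def by blast
  \<comment> \<open>The axiom reads the argument from variable 0 and the value from variable 1,
    whereas the formula at hand has the value at position 0 and the argument at position 2. All
    parameters are moved up by two positions, which the assignment \<open>s\<close> below
    undoes.\<close>
  define f where "f n = (if n = 0 then 1 else if n = 2 then 0 else n + 2)" for n :: nat
  have "inj f" by (auto simp: f_def inj_def)
  define s where "s n = (if odd n \<and> n \<ge> 3 then c ((n - 2) div 2) else mk {})" for n
  have "range s \<subseteq> V" using *(1) by (auto simp: s_def env_def)
  have val: "y = F x \<longleftrightarrow> sat V (rename f \<phi>) (s(0 := x, 1 := y))" if "x \<in> V" "y \<in> V" for x y
  proof -
    have "(\<lambda>n. (s(0 := x, 1 := y)) (f n)) = interleave ((\<lambda>_. mk {})(0 := y, 1 := x)) c"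
      by (auto simp: s_def f_def interleave_def fun_eq_iff elim!: evenE oddE)
    then have "sat V (rename f \<phi>) (s(0 := x, 1 := y)) \<longleftrightarrow>
        sat V \<phi> (interleave ((\<lambda>_. mk {})(0 := y, 1 := x)) c)"
      by (simp only: sat_rename[OF \<open>inj f\<close>])
    moreover have "env V ((\<lambda>_. mk {})(0 := y, 1 := x))" using that by (simp add: env_def)
    ultimately show ?thesis using *(2)[of "(\<lambda>_. mk {})(0 := y, 1 := x)"] by simp
  qed
  have FV: "F x \<in> V" if "x \<in> V" for x
    using dterm_mem[OF F, of "\<lambda>_. x"] that by (simp add: env_def)
  have "\<forall>x\<in>V. x \<in> elts a --> (\<exists>!y. y \<in> V \<and> sat V (rename f \<phi>) (s(0 := x, 1 := y)))"
    using val FV by (metis (no_types, lifting))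
  from replacement_ax[OF \<open>range s \<subseteq> V\<close> a this] obtain b where b: "b \<in> V"
    "\<forall>y\<in>V. y \<in> elts b \<longleftrightarrow> (\<exists>x\<in>V. x \<in> elts a \<and> sat V (rename f \<phi>) (s(0 := x, 1 := y)))" by blast
  have "elts b = F ` elts a"
    using b(2) val FV V_trans[OF _ a] V_trans[OF _ b(1)] by blast
  then show ?thesis using b(1) mk_elts[of b] by simp
qed

lemma dterm_image [dintro]:
  assumes t: "dterm V t" and F: "dterm V (\<lambda>s. F (s 0) (\<lambda>n. s (Suc n)))"
  shows "dterm V (\<lambda>s. mk ((\<lambda>x. F x s) ` elts (t s)))"
proof (rule dtermI[where Q = "\<lambda>z s. \<forall>y\<in>V. y \<in> elts z \<longleftrightarrow> (\<exists>x\<in>elts (t s). y = F x s)"])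
  fix s assume s: "env V s"
  have "dterm V (\<lambda>e. (\<lambda>s. F (s 0) (\<lambda>n. s (Suc n))) (\<lambda>n. if n = 0 then e 0 else s (n - 1)))"
    by (rule dterm_subst[OF F]) (use s in \<open>intro dterm_if_const dintro, simp add: env_def\<close>)
  then have Fs: "dterm V (\<lambda>e. F (e 0) s)" by simp
  then show *: "mk ((\<lambda>x. F x s) ` elts (t s)) \<in> V"
    by (rule replacement[OF dterm_mem[OF t s]])
  show "z = mk ((\<lambda>x. F x s) ` elts (t s)) \<longleftrightarrow> (\<forall>y\<in>V. y \<in> elts z \<longleftrightarrow> (\<exists>x\<in>elts (t s). y = F x s))"
    if "z \<in> V" for z
    using V_trans[OF _ that] V_trans[OF _ *] unfolding elts_eq_iff[of z] elts_mk_image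
    by blast
next
  have "dterm V (\<lambda>s. (\<lambda>s. F (s 0) (\<lambda>n. s (Suc n))) (\<lambda>n. if n = 0 then s 0 else s (Suc (Suc n))))"
    by (rule dterm_subst[OF F]) (intro dterm_if_const dintro)
  then have "dterm V (\<lambda>s. F (s 0) (\<lambda>n. s (Suc (Suc (Suc n)))))" by simp
  then show "definable V (\<lambda>s. \<forall>y\<in>V. y \<in> elts (s 0) \<longleftrightarrow> (\<exists>x\<in>elts (t (\<lambda>n. s (Suc n))). y = F x (\<lambda>n. s (Suc n))))"
    using dterm_shift[OF dterm_shift[OF t]] by (intro dintro)
qed

lemma dterm_Gr [dintro]:
  assumes "dterm V t" "dterm V (\<lambda>s. F (s 0) (\<lambda>n. s (Suc n)))"
  shows "dterm V (\<lambda>s. Gr (t s) (\<lambda>x. F x s))"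
  unfolding Gr_def by (intro dintro assms)

lemma dterm_union2 [dintro]:
  "dterm V t ==> dterm V u ==> dterm V (\<lambda>s. bun (mk {t s, u s}))"
  by (intro dintro)

lemma suc_eq_Un: "x \<in> V ==> suc x = bun (mk {x, mk {x, x}})"
  using elts_Un_pair[of x "mk {x}"] V_pair[of x x] unfolding elts_eq_iff[of "suc x"] by simp

lemma suc_mem [simp]: "x \<in> V ==> suc x \<in> V"
  using Un_pair_mem[of x "mk {x}"] V_pair[of x x] suc_eq_Un[of x] by simp

lemma dterm_suc [dintro]:
  assumes "dterm V t" shows "dterm V (\<lambda>s. suc (t s))"
proof (rule dtermI[where Q = "\<lambda>z s. z = bun (mk {t s, mk {t s, t s}})"])
  show "definable V (\<lambda>s. s 0 = bun (mk {t (\<lambda>n. s (Suc n)), mk {t (\<lambda>n. s (Suc n)), t (\<lambda>n. s (Suc n))}}))"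
    by (intro dintro dterm_shift assms)
  show "suc (t s) \<in> V" if "env V s" for s using dterm_mem[OF assms that] by (rule suc_mem)
  show "x = suc (t s) \<longleftrightarrow> x = bun (mk {t s, mk {t s, t s}})" if "env V s" for x s
    unfolding suc_eq_Un[OF dterm_mem[OF assms that]] by (rule refl)
qed

text \<open>Being a natural number becomes a bounded formula, by which \<omega> is separated from
  the inductive set of the infinity axiom. For the converse, a nonzero ordinal of this kind is the
  successor of a smaller one with the same property.\<close>

lemma num_char: "(\<exists>n. \<alpha> = num n) \<longleftrightarrow> is_ord \<alpha> \<and> (\<forall>m\<in>elts (suc \<alpha>). m = mk {} \<or> (\<exists>k\<in>elts m. m = suc k))"
proof
  assume "\<exists>n. \<alpha> = num n"
  then obtain n where n: "\<alpha> = num n" by blast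
  show "is_ord \<alpha> \<and> (\<forall>m\<in>elts (suc \<alpha>). m = mk {} \<or> (\<exists>k\<in>elts m. m = suc k))"
  proof (intro conjI ballI)
    fix m assume "m \<in> elts (suc \<alpha>)"
    then obtain i where "m = num i" unfolding n num_Suc[symmetric] by (auto simp: elts_num)
    then show "m = mk {} \<or> (\<exists>k\<in>elts m. m = suc k)" by (cases i) (auto simp: num_Suc)
  qed (simp add: n)
next
  show "is_ord \<alpha> \<and> (\<forall>m\<in>elts (suc \<alpha>). m = mk {} \<or> (\<exists>k\<in>elts m. m = suc k)) ==> \<exists>n. \<alpha> = num n"
  proof (induction \<alpha> rule: mem_induct)
    case (step \<alpha>)
    then consider "\<alpha> = mk {}" | k where "k \<in> elts \<alpha>" "\<alpha> = suc k" by auto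
    then show ?case
    proof cases
      case 1
      then show ?thesis using num.simps(1) by metis
    next
      case 2
      have "\<exists>n. k = num n"
        by (rule step.IH[OF 2(1)]) (use step.prems 2(2) ord_mem[OF _ 2(1)] in simp)
      then show ?thesis using 2(2) num_Suc by metis
    qed
  qed
qed

lemma omega_mem [simp]: "omega \<in> V" and elts_omega: "elts (omega :: 'u) = range num"
proof -
  obtain x where x: "x \<in> V" "\<exists>e\<in>V. e \<in> elts x \<and> \<not> (\<exists>z\<in>V. z \<in> elts e)"
    "\<forall>y\<in>V. y \<in> elts x --> (\<exists>z\<in>V. z \<in> elts x \<and> (\<forall>w\<in>V. w \<in> elts z \<longleftrightarrow> w \<in> elts y \<or> w = y))"
    using infinity_ax by blast
  have num: "num n \<in> elts x" for n
  proof (induction n)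
    case 0
    obtain e where "e \<in> V" "e \<in> elts x" "\<not> (\<exists>z\<in>V. z \<in> elts e)" using x(2) by blast
    moreover from this have "e = mk {}" using V_trans[of _ e] by (auto simp: elts_eq_iff)
    ultimately show ?case by simp
  next
    case (Suc n)
    then obtain z where z: "z \<in> V" "z \<in> elts x" "\<forall>w\<in>V. w \<in> elts z \<longleftrightarrow> w \<in> elts (num n) \<or> w = num n"
      using x(3) by (meson num_mem)
    have "elts z = elts (suc (num n))"
      using z(3) V_trans[OF _ z(1)] V_trans[OF _ num_mem[of n]] num_mem[of n] by auto
    then show ?case using z(2) elts_inject[of z "suc (num n)"] by (simp add: num_Suc)
  qed
  define w where "w = mk {n \<in> elts x. is_ord n \<and> (\<forall>m\<in>elts (suc n). m = mk {} \<or> (\<exists>k\<in>elts m. m = suc k))}"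
  have w: "elts w = range num"
    unfolding w_def num_char[symmetric] elts_mk_Collect using num by blast
  then have "omega = w" unfolding omega_def w[symmetric] by simp
  moreover have "w \<in> V"
    unfolding w_def by (rule separation[OF x(1)]) (intro dintro empty_mem)
  ultimately show "omega \<in> V" "elts (omega :: 'u) = range num" using w by simp_all
qed

lemma num_omega [simp]: "(num n :: 'u) \<in> elts omega"
  by (simp add: elts_omega)

lemma ord_omega [simp]: "is_ord (omega :: 'u)"
  by (rule ordI) (auto simp: elts_omega elts_num)

lemma infinite_omega: "infinite (elts (omega :: 'u))"
  unfolding elts_omega by (rule range_inj_infinite) (simp add: inj_def)

text \<open>\<open>C x\<close> is the set of predecessors and \<open>F\<close> the recursion step. A
  HOL function satisfying the recursion equation is definable because its values can be read off
  set-sized approximations closed under \<open>C\<close>. This makes the recursive notions of HOL,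
  such as the action on names or forcing of equality, available in formulas over
  \<open>V\<close>.\<close>

theorem recursion:
  assumes C: "dterm V (\<lambda>s. C (s 0))" and F: "dterm V (\<lambda>s. F (s 0) (s 1))"
    and wf: "wf {(y, x). x \<in> V \<and> y \<in> elts (C x)}"
    and H: "\<And>x. x \<in> V ==> H x = F x (Gr (C x) H)"
  shows "dterm V (\<lambda>s. H (s 0))"
proof -
  have CV: "C x \<in> V" if "x \<in> V" for x
    using dterm_mem[OF C, of "\<lambda>_. x"] that by (simp add: env_def)
  have FV: "F x y \<in> V" if "x \<in> V" "y \<in> V" for x y
    using dterm_mem[OF F, of "\<lambda>n. if n = 0 then x else y"] that by (simp add: env_def)
  define part where "part f z = mk {q \<in> elts f. \<exists>y\<in>elts (C z). \<exists>u\<in>V. q = opair y u}" for f z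
  \<comment> \<open>\<open>appr\<close> is the formula, which does not mention \<open>H\<close>;
    \<open>good\<close> is its meaning in terms of \<open>H\<close>. They are shown to agree on
    members of \<open>V\<close> by induction along \<open>C\<close>.\<close>
  define appr where "appr f \<longleftrightarrow> (\<forall>w\<in>elts f. \<exists>z\<in>V. \<exists>v\<in>V. w = opair z v \<and>
      (\<forall>y\<in>elts (C z). \<exists>u\<in>V. opair y u \<in> elts f) \<and> v = F z (part f z))" for f
  define good where "good f \<longleftrightarrow> (\<forall>w\<in>elts f. \<exists>z\<in>V. w = opair z (H z) \<and>
      (\<forall>y\<in>elts (C z). opair y (H y) \<in> elts f))" for f
  have appr_dfn: "definable V (\<lambda>s. appr (s i))" for i
  proof -
    have part: "dterm V (\<lambda>s. part (s 0) (s 1))"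
      unfolding part_def by (intro dintro dterm_comp1[OF C])
    show ?thesis
      unfolding appr_def by (intro dintro dterm_comp1[OF C] dterm_comp2[OF F] dterm_comp2[OF part])
  qed
  have part_good: "part f z = Gr (C z) H"
    if "f \<in> V" "\<forall>y\<in>elts (C z). opair y (H y) \<in> elts f" "\<forall>y\<in>elts (C z). \<forall>u. opair y u \<in> elts f --> u = H y" for f z
  proof (rule elts_inject)
    show "elts (part f z) = elts (Gr (C z) H)"
      unfolding part_def elts_mk_Collect elts_Gr
      using that opair_mem_elts[OF _ that(1)] by blast
  qed
  have appr_good: "appr f \<longleftrightarrow> good f" if f: "f \<in> V" for f
  proof
    assume ap: "appr f"
    have val: "v = H z" if "opair z v \<in> elts f" for z v
      using that
    proof (induction z arbitrary: v rule: wf_induct_rule[OF wf])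
      case (1 z)
      have zV: "z \<in> V" using opair_mem_elts[OF 1(2) f] by simp
      have *: "\<forall>y\<in>elts (C z). \<exists>u\<in>V. opair y u \<in> elts f" "v = F z (part f z)"
        using ap 1(2) by (auto simp: appr_def)
      have IH: "u = H y" if "y \<in> elts (C z)" "opair y u \<in> elts f" for y u
        using 1(1)[of y u] that zV by simp
      have "part f z = Gr (C z) H"
        by (rule part_good[OF f]) (use *(1) IH in blast)+
      then show "v = H z" using *(2) H[OF zV] by simp
    qed
    show "good f"
      unfolding good_def
    proof
      fix w assume "w \<in> elts f"
      then obtain z v where zv: "z \<in> V" "w = opair z v" "\<forall>y\<in>elts (C z). \<exists>u\<in>V. opair y u \<in> elts f"
        using ap by (auto simp: appr_def)
      then show "\<exists>z\<in>V. w = opair z (H z) \<and> (\<forall>y\<in>elts (C z). opair y (H y) \<in> elts f)"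
        using val \<open>w \<in> elts f\<close> by (intro bexI[of _ z]) auto
    qed
  next
    assume g: "good f"
    show "appr f"
      unfolding appr_def
    proof
      fix w assume "w \<in> elts f"
      then obtain z where z: "z \<in> V" "w = opair z (H z)" "\<forall>y\<in>elts (C z). opair y (H y) \<in> elts f"
        using g by (auto simp: good_def)
      have "part f z = Gr (C z) H"
        by (rule part_good[OF f]) (use z(3) g in \<open>auto simp: good_def\<close>)
      then have "H z = F z (part f z)" using H[OF z(1)] by simp
      moreover have "H z \<in> V" using opair_mem_elts[OF _ f] \<open>w \<in> elts f\<close> z(2) by blast
      moreover have "\<forall>y\<in>elts (C z). \<exists>u\<in>V. opair y u \<in> elts f"
        using z(3) opair_mem_elts[OF _ f] by blast
      ultimately show "\<exists>z\<in>V. \<exists>v\<in>V. w = opair z v \<and> (\<forall>y\<in>elts (C z). \<exists>u\<in>V. opair y u \<in> elts f) \<and> v = F z (part f z)"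
        using z(1,2) by blast
    qed
  qed
  \<comment> \<open>To unite approximations at all predecessors by replacement, one of them has to
    be selected definably; the smallest under inclusion is unique.\<close>
  define least where "least x f \<longleftrightarrow> appr f \<and> (\<exists>v\<in>V. opair x v \<in> elts f) \<and>
      (\<forall>f'\<in>V. appr f' \<and> (\<exists>v\<in>V. opair x v \<in> elts f') --> elts f \<subseteq> elts f')" for x f
  have least_unique: "f = f'" if "least x f" "least x f'" "f \<in> V" "f' \<in> V" for x f f'
    using that unfolding least_def elts_eq_iff[of f] by blast
  define L where "L x = (if \<exists>f\<in>V. least x f then THE f. f \<in> V \<and> least x f else mk {})" for x
  have L: "L x = f" if "least x f" "f \<in> V" for x f
  proof -
    have "(THE g. g \<in> V \<and> least x g) = f"
      by (rule the_equality) (use that least_unique[of x _ f] in blast)+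
    moreover have "\<exists>f\<in>V. least x f" using that by blast
    ultimately show ?thesis by (simp add: L_def)
  qed
  have least_dfn: "definable V (\<lambda>s. least (s i) (s j))" for i j
    unfolding least_def by (intro dintro appr_dfn dterm_shift)
  have L_dterm: "dterm V (\<lambda>s. L (s 0))"
  proof (rule dtermI[where Q = "\<lambda>z s. least (s 0) z \<or> ((\<forall>f\<in>V. \<not> least (s 0) f) \<and> z = mk {})"])
    show "definable V (\<lambda>s. least (s (Suc 0)) (s 0) \<or> ((\<forall>f\<in>V. \<not> least (s (Suc 0)) f) \<and> s 0 = mk {}))"
      by (intro dintro least_dfn empty_mem)
    fix z s assume "z \<in> V"
    show "z = L (s 0) \<longleftrightarrow> least (s 0) z \<or> ((\<forall>f\<in>V. \<not> least (s 0) f) \<and> z = mk {})"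
    proof (cases "\<exists>f\<in>V. least (s 0) f")
      case True
      then show ?thesis using L least_unique \<open>z \<in> V\<close> by blast
    next
      case False
      then show ?thesis using \<open>z \<in> V\<close> by (auto simp: L_def)
    qed
  next
    fix s show "L (s 0) \<in> V"
    proof (cases "\<exists>f\<in>V. least (s 0) f")
      case True
      then show ?thesis using L by blast
    qed (simp add: L_def)
  qed
  have ex: "\<exists>f\<in>V. least x f" if "x \<in> V" for x
    using that
  proof (induction x rule: wf_induct_rule[OF wf])
    case (1 x)
    note x = 1(2)
    have IH: "least y (L y) \<and> L y \<in> V" if "y \<in> elts (C x)" for y
    proof -
      have "y \<in> V" using V_trans[OF that CV[OF x]] .
      with 1(1)[of y] that x obtain f where "f \<in> V" "least y f" by blast
      then show ?thesis using L by blast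
    qed
    define U where "U = bun (mk (L ` elts (C x)))"
    have LV: "mk (L ` elts (C x)) \<in> V" by (rule replacement[OF CV[OF x] L_dterm])
    have U: "U \<in> V" "elts U = \<Union> (elts ` L ` elts (C x))"
      using Un_mem[OF LV] elts_Un[OF LV] by (simp_all add: U_def)
    have goodL: "good (L y)" if "y \<in> elts (C x)" for y
      using IH[OF that] appr_good by (auto simp: least_def)
    have memU: "opair y (H y) \<in> elts U" if y: "y \<in> elts (C x)" for y
    proof -
      obtain v where "opair y v \<in> elts (L y)" using IH[OF y] by (auto simp: least_def)
      moreover from this have "v = H y" using goodL[OF y] by (auto simp: good_def)
      ultimately show ?thesis using U(2) y by auto
    qed
    have "good U"
      unfolding good_def
    proof
      fix w assume "w \<in> elts U"
      then obtain y where y: "y \<in> elts (C x)" "w \<in> elts (L y)" using U(2) by auto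
      then obtain z where "z \<in> V" "w = opair z (H z)" "\<forall>y'\<in>elts (C z). opair y' (H y') \<in> elts (L y)"
        using goodL[OF y(1)] by (auto simp: good_def)
      then show "\<exists>z\<in>V. w = opair z (H z) \<and> (\<forall>y\<in>elts (C z). opair y (H y) \<in> elts U)"
        using U(2) y(1) by blast
    qed
    have "part U x = Gr (C x) H"
      by (rule part_good[OF U(1)]) (use memU \<open>good U\<close> in \<open>auto simp: good_def\<close>)
    moreover have "part U x \<in> V"
      unfolding part_def by (rule separation[OF U(1)]) (intro dintro CV x)
    ultimately have HV: "H x \<in> V" using H[OF x] FV[OF x] by simp
    \<comment> \<open>The union of the least approximations at the predecessors, with the pair at
      \<open>x\<close> added, is the least approximation at \<open>x\<close>.\<close>
    define f where "f = bun (mk {U, mk {opair x (H x)}})"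
    have sing: "mk {opair x (H x)} \<in> V" using finite_mem[of "{opair x (H x)}"] x HV by simp
    have f: "f \<in> V" "elts f = insert (opair x (H x)) (elts U)"
      using Un_pair_mem[OF U(1) sing] elts_Un_pair[OF U(1) sing] by (auto simp: f_def)
    have "good f"
      using \<open>good U\<close> memU x unfolding good_def f(2) by blast
    moreover have "elts f \<subseteq> elts f'" if f': "f' \<in> V" "appr f'" "opair x v \<in> elts f'" for f' v
    proof -
      have g': "good f'" using f' appr_good by blast
      then have "v = H x" "\<forall>y\<in>elts (C x). opair y (H y) \<in> elts f'"
        using f'(3) by (auto simp: good_def)
      then have "elts (L y) \<subseteq> elts f'" if y: "y \<in> elts (C x)" for y
        using IH[OF y] f' y opair_mem_elts[OF _ f'(1)] unfolding least_def by blast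
      then show ?thesis using f'(3) \<open>v = H x\<close> unfolding f(2) U(2) by blast
    qed
    ultimately have "least x f"
      using appr_good[OF f(1)] HV f(2) unfolding least_def by blast
    then show ?case using f(1) by blast
  qed
  have mem: "\<exists>f\<in>V. appr f \<and> opair x (H x) \<in> elts f" if x: "x \<in> V" for x
  proof -
    obtain f v where f: "f \<in> V" "appr f" "opair x v \<in> elts f" using ex[OF x] unfolding least_def by blast
    then have "v = H x" using appr_good[OF f(1)] by (auto simp: good_def)
    with f show ?thesis by blast
  qed
  show ?thesis
  proof (rule dtermI[where Q = "\<lambda>z s. \<exists>f\<in>V. appr f \<and> opair (s 0) z \<in> elts f"])
    show "definable V (\<lambda>s. \<exists>f\<in>V. appr f \<and> opair (s (Suc 0)) (s 0) \<in> elts f)"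
      by (intro dintro appr_dfn)
  next
    fix s assume "env V s"
    then show "H (s 0) \<in> V" using mem[of "s 0"] opair_mem_elts by (auto simp: env_def)
  next
    fix z s assume "env V s"
    then show "z = H (s 0) \<longleftrightarrow> (\<exists>f\<in>V. appr f \<and> opair (s 0) z \<in> elts f)"
      using mem[of "s 0"] appr_good by (auto simp: env_def good_def)
  qed
qed

end

section \<open>Cardinal arithmetic inside a model\<close>

context weak_class
begin

text \<open>Least preimages form a set of ordinals below \<open>a\<close>, and this set collapses to
  an ordinal \<theta> that is not larger than \<open>a\<close>.\<close>

lemma psurj_ord_bij:
  assumes "psurj N a b" "a \<in> N" "b \<in> N" "is_ord a"
  shows "\<exists>\<theta>\<in>N. is_ord \<theta> \<and> elts \<theta> \<subseteq> elts a \<and> (\<exists>F. Gr \<theta> F \<in> N \<and> bij_betw F (elts \<theta>) (elts b))"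
proof -
  have "injects N b a" using psurj_injects[OF assms(1-3)] ord_mem[OF assms(4)] by blast
  then obtain F where F: "Gr b F \<in> N" "inj_on F (elts b)" "\<forall>x\<in>elts b. F x \<in> elts a"
    by (rule injectsE)
  define R where "R = mk {y \<in> elts a. \<exists>x\<in>elts b. opair x y \<in> elts (Gr b F)}"
  have R: "R \<in> N" unfolding R_def by (rule separation[OF assms(2)]) (intro dintro assms F)
  have eR: "elts R = F ` elts b" unfolding R_def elts_mk_Collect opair_Gr using F(3) by blast
  have "elts R \<subseteq> elts a" unfolding R_def by auto
  from collapse[OF R assms(2,4) this] obtain \<theta> where \<theta>: "\<theta> \<in> N" "is_ord \<theta>" "elts \<theta> \<subseteq> elts a"
    "Gr R (coll R) \<in> N" "bij_betw (coll R) (elts R) (elts \<theta>)" by blast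
  have comp: "Gr b (\<lambda>x. coll R (F x)) \<in> N"
    by (rule Gr_comp[OF assms(3) \<theta>(1) F(1) \<theta>(4)]) (use eR \<theta>(5) in \<open>auto simp: bij_betw_def\<close>)
  have bij: "bij_betw (\<lambda>x. coll R (F x)) (elts b) (elts \<theta>)"
    using bij_betw_trans[of F "elts b" "elts R" "coll R" "elts \<theta>"] F(2) eR \<theta>(5)
    by (simp add: bij_betw_def comp_def)
  have "Gr \<theta> (inv_into (elts b) (\<lambda>x. coll R (F x))) \<in> N"
    by (rule Gr_inverse[OF assms(3) \<theta>(1) comp]) (use bij in \<open>auto simp: bij_betw_def\<close>)
  then show ?thesis using \<theta>(1-3) bij_betw_inv_into[OF bij] by blast
qed

text \<open>The definition of a cardinal excludes only bijections from smaller ordinals. A partial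
  surjection from \<beta> yields a bijection from an ordinal no larger than \<beta>, which is
  excluded as well.\<close>

lemma cardinal_no_psurj:
  assumes "cardinal_in N \<kappa>" "\<beta> \<in> elts \<kappa>"
  shows "\<not> psurj N \<beta> \<kappa>"
proof
  assume *: "psurj N \<beta> \<kappa>"
  have \<kappa>: "\<kappa> \<in> N" "is_ord \<kappa>" using assms(1) by (auto simp: cardinal_in_def)
  have \<beta>: "\<beta> \<in> N" "is_ord \<beta>" using \<kappa> assms(2) mem_trans ord_mem by auto
  obtain \<theta> F where \<theta>: "\<theta> \<in> N" "is_ord \<theta>" "elts \<theta> \<subseteq> elts \<beta>" "Gr \<theta> F \<in> N" "bij_betw F (elts \<theta>) (elts \<kappa>)"
    using psurj_ord_bij[OF * \<beta>(1) \<kappa>(1) \<beta>(2)] by blast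
  have "\<theta> \<in> elts \<kappa>"
    using ord_subset_iff[OF \<theta>(2) \<beta>(2)] \<theta>(3) assms(2) ord_trans[OF \<kappa>(2) assms(2)] by auto
  moreover have "is_inj (Gr \<theta> F) \<theta> \<kappa>" "is_surj (Gr \<theta> F) \<theta> \<kappa>"
    using \<theta>(5) by (auto simp: bij_betw_def)
  ultimately show False using assms(1) \<theta>(4) unfolding cardinal_in_def by blast
qed

lemma cardinalI:
  assumes "\<kappa> \<in> N" "is_ord \<kappa>" "\<And>\<beta>. \<beta> \<in> elts \<kappa> ==> \<not> psurj N \<beta> \<kappa>"
  shows "cardinal_in N \<kappa>"
  unfolding cardinal_in_def
  using assms is_surj_psurj[OF mem_trans[OF _ assms(1)]] by blast

end

context zfc_model
begin

text \<open>In HOL the function comes from \<open>wfrec\<close>, whose cut-off at predecessors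
  matches the restriction \<open>Gr (C x)\<close>.\<close>

lemma recursion_exists:
  assumes "dterm V (\<lambda>s. C (s 0))" "dterm V (\<lambda>s. F (s 0) (s 1))"
    and wf: "wf {(y, x). x \<in> V \<and> y \<in> elts (C x)}"
  obtains H where "dterm V (\<lambda>s. H (s 0))" "\<And>x. x \<in> V ==> H x = F x (Gr (C x) H)"
proof -
  define R where "R = {(y, x). x \<in> V \<and> y \<in> elts (C x)}"
  define H where "H = wfrec R (\<lambda>h x. F x (Gr (C x) h))"
  have "H x = F x (Gr (C x) H)" if "x \<in> V" for x
  proof -
    have "H x = F x (Gr (C x) (cut H R x))"
      unfolding H_def using wfrec[OF wf[folded R_def], of "\<lambda>h x. F x (Gr (C x) h)" x] by simp
    also have "Gr (C x) (cut H R x) = Gr (C x) H"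
      by (rule Gr_cong) (use that in \<open>auto simp: cut_def R_def\<close>)
    finally show ?thesis .
  qed
  with recursion[OF assms, of H] that show ?thesis by blast
qed

lemma wellorder:
  assumes a: "a \<in> V"
  shows "\<exists>\<alpha>\<in>V. is_ord \<alpha> \<and> psurj V \<alpha> a"
proof -
  \<comment> \<open>The choice axiom is stated for disjoint families, so each nonempty subset
    \<open>b\<close> is replaced by the product of \<open>{b}\<close> with \<open>b\<close>. A
    selector of this family yields a choice function.\<close>
  define fam where "fam = mk ((\<lambda>b. cprod (mk {b, b}) b) ` elts (mk {b \<in> elts (pw a). \<exists>x\<in>elts b. True}))"
  have "dterm V (\<lambda>s. mk ((\<lambda>b. cprod (mk {b, b}) b) ` elts (mk {b \<in> elts (pw a). \<exists>x\<in>elts b. True})))"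
    by (intro dintro a)
  from dterm_mem[OF this env_empty] have fam: "fam \<in> V" by (simp only: fam_def)
  have sing: "mk {b, b} \<in> V" if "b \<in> V" for b using V_pair[OF that that] .
  have pwV: "b \<in> V" if "b \<in> elts (pw a)" for b using that a by (simp add: elts_pw)
  have elts_fam: "elts fam = (\<lambda>b. cprod (mk {b, b}) b) ` {b \<in> elts (pw a). elts b \<noteq> {}}"
    unfolding fam_def by (subst elts_mk_image) auto
  have box: "elts (cprod (mk {b, b}) b) = opair b ` elts b" if "b \<in> V" for b
    unfolding elts_cprod[OF sing[OF that] that] by auto
  have "\<exists>c\<in>V. \<forall>x\<in>V. x \<in> elts fam --> (\<exists>!z. z \<in> V \<and> z \<in> elts x \<and> z \<in> elts c)"
  proof (rule choice_ax[OF fam], intro conjI ballI impI)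
    fix x assume "x \<in> elts fam" "x \<in> V"
    then obtain b where "b \<in> V" "elts b \<noteq> {}" "x = cprod (mk {b, b}) b"
      using pwV unfolding elts_fam by blast
    moreover from this obtain y where "y \<in> elts b" by blast
    ultimately have "opair b y \<in> elts x" using box[of b] by blast
    then show "\<exists>z\<in>V. z \<in> elts x" using V_trans[OF _ \<open>x \<in> V\<close>] by blast
  next
    fix x y assume "x \<in> V" "y \<in> V" and xy: "x \<in> elts fam \<and> y \<in> elts fam \<and> x \<noteq> y"
    then obtain b b' where "b \<in> V" "x = cprod (mk {b, b}) b" "b' \<in> V" "y = cprod (mk {b', b'}) b'"
      using pwV unfolding elts_fam by blast
    then show "\<not> (\<exists>z\<in>V. z \<in> elts x \<and> z \<in> elts y)" using xy box by auto
  qed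
  then obtain c where c: "c \<in> V" "\<forall>x\<in>V. x \<in> elts fam --> (\<exists>!z. z \<in> V \<and> z \<in> elts x \<and> z \<in> elts c)" by blast
  define c' where "c' = mk {w \<in> elts c. \<exists>b\<in>elts (pw a). \<exists>x\<in>elts b. w = opair b x}"
  have c': "c' \<in> V" unfolding c'_def by (rule separation[OF c(1)]) (intro dintro pw_mem a)
  have ch: "ap c' b \<in> elts b" if b: "b \<in> V" "elts b \<subseteq> elts a" "elts b \<noteq> {}" for b
  proof -
    have bp: "b \<in> elts (pw a)" using b a by (simp add: elts_pw)
    have "cprod (mk {b, b}) b \<in> elts fam" unfolding elts_fam using bp b by blast
    then have "\<exists>!z. z \<in> V \<and> z \<in> elts (cprod (mk {b, b}) b) \<and> z \<in> elts c"
      using c(2) cprod_mem[OF sing[OF b(1)] b(1)] by blast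
    then obtain z where z: "z \<in> opair b ` elts b" "z \<in> elts c"
      "\<And>z'. z' \<in> V ==> z' \<in> opair b ` elts b ==> z' \<in> elts c ==> z' = z"
      unfolding box[OF b(1)] by blast
    then obtain x where x: "x \<in> elts b" "z = opair b x" by blast
    have "opair b y \<in> elts c' \<longleftrightarrow> y = x" for y
    proof
      assume "opair b y \<in> elts c'"
      then have "opair b y \<in> elts c" "y \<in> elts b" unfolding c'_def elts_mk_Collect by auto
      moreover from this have "opair b y \<in> V" using V_trans[OF _ c(1)] by blast
      ultimately have "opair b y = z" using z(3) by blast
      then show "y = x" using x(2) by simp
    qed (use z x bp in \<open>auto simp: c'_def\<close>)
    then have "ap c' b = x" by (simp add: ap_def)
    with x show ?thesis by simp
  qed
  define rest where "rest x g = mk {z \<in> elts a. \<forall>y\<in>elts x. ap g y \<noteq> z}" for x g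
  have rest: "dterm V (\<lambda>s. rest (s 0) (s 1))" unfolding rest_def by (intro dintro a)
  \<comment> \<open>Since \<open>a\<close> is not a member of itself, the value \<open>a\<close> can
    mark that nothing is left to choose.\<close>
  define F where "F x g = (if rest x g = mk {} then a else ap c' (rest x g))" for x g
  have F: "dterm V (\<lambda>s. F (s 0) (s 1))"
    unfolding F_def by (intro dintro dterm_comp2[OF rest] a c' empty_mem)
  have wf: "wf {(y, x). x \<in> V \<and> y \<in> elts x}" by (rule wf_subset[OF wf_elts]) auto
  obtain H where H: "dterm V (\<lambda>s. H (s 0))" "\<And>x. x \<in> V ==> H x = F x (Gr x H)"
    using recursion_exists[of "\<lambda>x. x" F, OF dterm_var F wf] by blast
  have HV: "H x \<in> V" if "x \<in> V" for x using dterm_mem[OF H(1), of "\<lambda>_. x"] that by (simp add: env_def)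
  have elts_rest: "elts (rest x (Gr x H)) = elts a - H ` elts x" for x
    unfolding rest_def elts_mk_Collect by auto
  have Hx: "H x = a \<and> elts a \<subseteq> H ` elts x \<or> H x \<in> elts a - H ` elts x" if x: "x \<in> V" for x
  proof (cases "rest x (Gr x H) = mk {}")
    case True
    then have "elts (rest x (Gr x H)) = {}" by simp
    then show ?thesis using H(2)[OF x] True unfolding elts_rest F_def by auto
  next
    case False
    have "dterm V (\<lambda>s. Gr (s 0) (\<lambda>x. H x))" by (intro dintro dterm_comp1[OF H(1)])
    from dterm_mem[OF this, of "\<lambda>_. x"] x have "Gr x H \<in> V" by (simp add: env_def)
    then have "rest x (Gr x H) \<in> V"
      using dterm_mem[OF rest, of "\<lambda>n. if n = 0 then x else Gr x H"] x by (simp add: env_def)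
    moreover have "elts (rest x (Gr x H)) \<noteq> {}" using False by (simp add: elts_eq_iff)
    moreover have "elts (rest x (Gr x H)) \<subseteq> elts a" unfolding elts_rest by blast
    ultimately have "ap c' (rest x (Gr x H)) \<in> elts (rest x (Gr x H))"
      using ch by blast
    then show ?thesis using H(2)[OF x] False unfolding F_def elts_rest by simp
  qed
  have "\<exists>\<alpha>\<in>V. is_ord \<alpha> \<and> H \<alpha> = a"
  proof (rule ccontr)
    assume "\<not> (\<exists>\<alpha>\<in>V. is_ord \<alpha> \<and> H \<alpha> = a)"
    then have mem: "H \<alpha> \<in> elts a - H ` elts \<alpha>" if "\<alpha> \<in> V" "is_ord \<alpha>" for \<alpha> using Hx that by blast
    have inj: "\<alpha> = \<beta>" if "\<alpha> \<in> V" "is_ord \<alpha>" "\<beta> \<in> V" "is_ord \<beta>" "H \<alpha> = H \<beta>" for \<alpha> \<beta>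
    proof (rule ccontr)
      assume "\<alpha> \<noteq> \<beta>"
      then have "H \<alpha> \<in> H ` elts \<beta> \<or> H \<beta> \<in> H ` elts \<alpha>" using ord_linear[OF that(2,4)] by blast
      then show False using mem[OF that(1,2)] mem[OF that(3,4)] that(5) by simp
    qed
    \<comment> \<open>If the enumeration never stopped, its inverse would be definable on a subset
      of \<open>a\<close> and have all ordinals as values, so that the ordinals would form a set by
      replacement.\<close>
    define K where "K z = (if \<exists>\<alpha>\<in>V. is_ord \<alpha> \<and> H \<alpha> = z then THE \<alpha>. \<alpha> \<in> V \<and> is_ord \<alpha> \<and> H \<alpha> = z else mk {})" for z
    have K: "K (H \<alpha>) = \<alpha>" if "\<alpha> \<in> V" "is_ord \<alpha>" for \<alpha>
    proof -
      have "(THE \<beta>. \<beta> \<in> V \<and> is_ord \<beta> \<and> H \<beta> = H \<alpha>) = \<alpha>"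
        by (rule the_equality) (use that inj in blast)+
      then show ?thesis unfolding K_def using that by auto
    qed
    have "dterm V (\<lambda>s. K (s 0))"
    proof (rule dtermI[where Q = "\<lambda>z s. (is_ord z \<and> H z = s 0) \<or> ((\<forall>\<alpha>\<in>V. \<not> (is_ord \<alpha> \<and> H \<alpha> = s 0)) \<and> z = mk {})"])
      show "definable V (\<lambda>s. (is_ord (s 0) \<and> H (s 0) = s (Suc 0)) \<or>
          ((\<forall>\<alpha>\<in>V. \<not> (is_ord \<alpha> \<and> H \<alpha> = s (Suc 0))) \<and> s 0 = mk {}))"
        by (intro dintro dterm_comp1[OF H(1)] empty_mem)
      fix s :: "nat => 'u" 
      show "K (s 0) \<in> V"
      proof (cases "\<exists>\<alpha>\<in>V. is_ord \<alpha> \<and> H \<alpha> = s 0")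
        case True
        then obtain \<alpha> where "\<alpha> \<in> V" "is_ord \<alpha>" "H \<alpha> = s 0" by blast
        then show ?thesis using K[of \<alpha>] by simp
      next
        case False
        then show ?thesis unfolding K_def by (simp del: ball_simps bex_simps)
      qed
      show "x = K (s 0) \<longleftrightarrow> (is_ord x \<and> H x = s 0) \<or> ((\<forall>\<alpha>\<in>V. \<not> (is_ord \<alpha> \<and> H \<alpha> = s 0)) \<and> x = mk {})"
        if "x \<in> V" for x
      proof (cases "\<exists>\<alpha>\<in>V. is_ord \<alpha> \<and> H \<alpha> = s 0")
        case True
        then obtain \<alpha> where \<alpha>: "\<alpha> \<in> V" "is_ord \<alpha>" "H \<alpha> = s 0" by blast
        then have "K (s 0) = \<alpha>" using K[of \<alpha>] by simp
        then show ?thesis using \<alpha> inj[of x \<alpha>] that by auto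
      next
        case False
        then show ?thesis using that by (auto simp: K_def)
      qed
    qed
    moreover define S where "S = mk {z \<in> elts a. \<exists>\<alpha>\<in>V. is_ord \<alpha> \<and> H \<alpha> = z}"
    have "S \<in> V" unfolding S_def by (rule separation[OF a]) (intro dintro dterm_comp1[OF H(1)])
    ultimately have "mk (K ` elts S) \<in> V" using replacement by blast
    moreover have "elts (mk (K ` elts S)) = {\<alpha> \<in> V. is_ord \<alpha>}"
    proof (intro equalityI subsetI)
      fix x assume "x \<in> elts (mk (K ` elts S))"
      then obtain \<alpha> where "\<alpha> \<in> V" "is_ord \<alpha>" "x = K (H \<alpha>)" unfolding S_def elts_mk_image by auto
      then show "x \<in> {\<alpha> \<in> V. is_ord \<alpha>}" using K by simp
    next
      fix \<alpha> assume \<alpha>: "\<alpha> \<in> {\<alpha> \<in> V. is_ord \<alpha>}"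
      then have "H \<alpha> \<in> elts S" using mem unfolding S_def by auto
      then show "\<alpha> \<in> elts (mk (K ` elts S))" using K[of \<alpha>] \<alpha> by (auto intro!: image_eqI[of _ _ "H \<alpha>"])
    qed
    moreover have "is_ord O'" if "elts O' = {\<alpha> \<in> V. is_ord \<alpha>}" for O'
    proof (rule ordI)
      fix \<beta> \<gamma> assume "\<beta> \<in> elts O'" "\<gamma> \<in> elts \<beta>"
      then show "\<gamma> \<in> elts O'" unfolding that using ord_mem[of \<beta> \<gamma>] V_trans[of \<gamma> \<beta>] by blast
    qed (use that in blast)
    ultimately show False using mem_irrefl[of "mk (K ` elts S)"] by blast
  qed
  then obtain \<alpha> where \<alpha>: "\<alpha> \<in> V" "is_ord \<alpha>" "H \<alpha> = a" by blast
  then have sub: "elts a \<subseteq> H ` elts \<alpha>" using Hx[OF \<alpha>(1)] mem_irrefl[of a] by auto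
  define d where "d = mk {x \<in> elts \<alpha>. H x \<in> elts a}"
  have d: "d \<in> V" unfolding d_def by (rule separation[OF \<alpha>(1)]) (intro dintro dterm_comp1[OF H(1)] a)
  have "psurj V \<alpha> a"
  proof (rule psurjI[OF d, of \<alpha> H])
    show "Gr d H \<in> V" by (rule Gr_mem_dterm[OF d a _ H(1)]) (auto simp: d_def)
    show "\<exists>x\<in>elts d. H x = y" if "y \<in> elts a" for y using sub that unfolding d_def by auto
  qed (auto simp: d_def)
  then show ?thesis using \<alpha> by blast
qed

text \<open>The cardinal is the least ordinal mapping partially onto \<theta>; by minimality it
  equals the domain of the bijection that such a map induces.\<close>

lemma cardinal_bij:
  assumes \<theta>: "\<theta> \<in> V" "is_ord \<theta>"
  shows "\<exists>\<kappa>\<in>V. cardinal_in V \<kappa> \<and> elts \<kappa> \<subseteq> elts \<theta> \<and> (\<exists>F. Gr \<kappa> F \<in> V \<and> bij_betw F (elts \<kappa>) (elts \<theta>))"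
proof -
  define A where "A = {\<alpha> \<in> V. is_ord \<alpha> \<and> psurj V \<alpha> \<theta>}"
  have "\<theta> \<in> A" using \<theta> psurj_subset[OF \<theta>(1,1)] by (simp add: A_def)
  then have ne: "A \<noteq> {}" by blast
  have ords: "\<And>\<alpha>. \<alpha> \<in> A ==> is_ord \<alpha>" by (simp add: A_def)
  obtain \<kappa> where \<kappa>: "\<kappa> \<in> A" "\<And>\<beta>. \<beta> \<in> A ==> \<kappa> = \<beta> \<or> \<kappa> \<in> elts \<beta>"
    using ord_least[OF ne ords] by blast
  then have \<kappa>': "\<kappa> \<in> V" "is_ord \<kappa>" "psurj V \<kappa> \<theta>" by (auto simp: A_def)
  obtain \<alpha> F where \<alpha>: "\<alpha> \<in> V" "is_ord \<alpha>" "elts \<alpha> \<subseteq> elts \<kappa>" "Gr \<alpha> F \<in> V" "bij_betw F (elts \<alpha>) (elts \<theta>)"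
    using psurj_ord_bij[OF \<kappa>'(3,1) \<theta>(1) \<kappa>'(2)] by blast
  have "psurj V \<alpha> \<theta>"
    unfolding psurj_def using \<alpha> by (intro bexI[of _ \<alpha>] exI[of _ F]) (auto simp: bij_betw_def)
  then have "\<kappa> = \<alpha>" using \<kappa>(2)[of \<alpha>] \<alpha> \<kappa>'(2) ord_subset_iff[OF \<alpha>(2) \<kappa>'(2)] mem_asym[of \<kappa> \<alpha>] mem_irrefl
    by (auto simp: A_def)
  moreover have "cardinal_in V \<kappa>"
  proof (rule cardinalI[OF \<kappa>'(1,2)])
    fix \<beta> assume \<beta>: "\<beta> \<in> elts \<kappa>"
    show "\<not> psurj V \<beta> \<kappa>"
    proof
      assume "psurj V \<beta> \<kappa>"
      then have "psurj V \<beta> \<theta>" using psurj_trans[OF _ \<kappa>'(3)] V_trans[OF \<beta> \<kappa>'(1)] \<kappa>'(1) \<theta>(1) by blast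
      then have "\<beta> \<in> A" using V_trans[OF \<beta> \<kappa>'(1)] ord_mem[OF \<kappa>'(2) \<beta>] by (simp add: A_def)
      then show False using \<kappa>(2)[of \<beta>] \<beta> mem_asym mem_irrefl by blast
    qed
  qed
  moreover have "elts \<kappa> \<subseteq> elts \<theta>" using \<kappa>(2)[OF \<open>\<theta> \<in> A\<close>] ord_subset_iff[OF \<kappa>'(2) \<theta>(2)] by blast
  ultimately show ?thesis using \<alpha> \<kappa>'(1) by blast
qed

text \<open>The Mostowski collapse of a definable well-order, obtained by recursion along it. Unlike
  \<open>coll\<close> it accepts arbitrary elements, at the price of working in \<open>V\<close>
  only.\<close>

lemma order_collapse:
  assumes A: "A \<in> V" and L: "definable V (\<lambda>s. L (s 0) (s 1))" and wf: "wf {(x, y). L x y}"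
    and trans: "\<And>x y z. L x y ==> L y z ==> L x z"
    and total: "\<And>x y. x \<in> elts A ==> y \<in> elts A ==> x = y \<or> L x y \<or> L y x"
  obtains H where "dterm V (\<lambda>s. H (s 0))" "inj_on H (elts A)"
    "\<forall>x\<in>elts A. is_ord (H x)" "\<forall>x\<in>V. elts (H x) = H ` {y \<in> elts A. L y x}"
proof -
  define C where "C x = mk {y \<in> elts A. L y x}" for x
  have C: "dterm V (\<lambda>s. C (s 0))" unfolding C_def by (intro dintro A definable_comp2[OF L])
  have F: "dterm V (\<lambda>s. (\<lambda>x g. mk ((\<lambda>y. ap g y) ` elts (C x))) (s 0) (s 1))"
    by (intro dintro dterm_comp1[OF C])
  have wf': "wf {(y, x). x \<in> V \<and> y \<in> elts (C x)}"
    by (rule wf_subset[OF wf]) (auto simp: C_def)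
  obtain H where H: "dterm V (\<lambda>s. H (s 0))" "\<And>x. x \<in> V ==> H x = mk ((\<lambda>y. ap (Gr (C x) H) y) ` elts (C x))"
    using recursion_exists[OF C F wf'] by blast
  have elts_H: "elts (H x) = H ` {y \<in> elts A. L y x}" if "x \<in> V" for x
  proof -
    have "(\<lambda>y. ap (Gr (C x) H) y) ` elts (C x) = H ` elts (C x)" by (rule image_cong) simp_all
    then show ?thesis unfolding H(2)[OF that] elts_mk_image by (simp add: C_def)
  qed
  have AV: "x \<in> V" if "x \<in> elts A" for x using V_trans[OF that A] .
  have ord: "is_ord (H x)" if "x \<in> elts A" for x
    using that
  proof (induction x rule: wf_induct_rule[OF wf])
    case (1 x)
    show ?case
    proof (rule ordI)
      fix \<beta> assume "\<beta> \<in> elts (H x)" then show "is_ord \<beta>" using 1 elts_H[OF AV[OF 1(2)]] by auto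
    next
      fix \<beta> \<gamma> assume "\<beta> \<in> elts (H x)" "\<gamma> \<in> elts \<beta>"
      then obtain y z where "y \<in> elts A" "L y x" "z \<in> elts A" "L z y" "\<gamma> = H z"
        using elts_H[OF AV[OF 1(2)]] elts_H[OF AV] by auto
      then show "\<gamma> \<in> elts (H x)" using elts_H[OF AV[OF 1(2)]] trans by auto
    qed
  qed
  have "inj_on H (elts A)"
  proof (rule inj_onI, rule ccontr)
    fix x y assume xy: "x \<in> elts A" "y \<in> elts A" "H x = H y" "x \<noteq> y"
    have mem: "H u \<in> elts (H v)" if "u \<in> elts A" "v \<in> elts A" "L u v" for u v
      unfolding elts_H[OF AV[OF that(2)]] using that by blast
    have "H x \<in> elts (H y) \<or> H y \<in> elts (H x)" using total[OF xy(1,2)] xy mem by blast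
    then show False by (simp add: xy(3))
  qed
  then show ?thesis using that H(1) ord elts_H by blast
qed

text \<open>\<open>Q\<close> is ordered by \<nu> first and by an auxiliary well-order second. Only
  finitely many finite fibres precede a point, so initial segments are finite and the order
  collapses into \<omega>.\<close>

lemma countable_if_finite_to_one:
  assumes Q: "Q \<in> V" and \<nu>: "dterm V (\<lambda>s. \<nu> (s 0))" "\<And>x. x \<in> elts Q ==> \<nu> x \<in> elts omega"
    and fin: "\<And>n. finite {x \<in> elts Q. \<nu> x = num n}"
  shows "psurj V omega Q"
proof -
  obtain \<alpha> where \<alpha>: "\<alpha> \<in> V" "is_ord \<alpha>" "psurj V \<alpha> Q" using wellorder[OF Q] by blast
  have "injects V Q \<alpha>" using psurj_injects[OF \<alpha>(3,1) Q] ord_mem[OF \<alpha>(2)] by blast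
  then obtain \<rho> where \<rho>: "Gr Q \<rho> \<in> V" "inj_on \<rho> (elts Q)" "\<forall>x\<in>elts Q. \<rho> x \<in> elts \<alpha>" by (rule injectsE)
  define L where "L x y \<longleftrightarrow> x \<in> elts Q \<and> y \<in> elts Q \<and>
      (\<nu> x \<in> elts (\<nu> y) \<or> \<nu> x = \<nu> y \<and> ap (Gr Q \<rho>) x \<in> elts (ap (Gr Q \<rho>) y))" for x y
  have ord\<rho>: "is_ord (ap (Gr Q \<rho>) x)" if "x \<in> elts Q" for x using that \<rho>(3) ord_mem[OF \<alpha>(2)] by simp
  have ord\<nu>: "is_ord (\<nu> x)" if "x \<in> elts Q" for x using \<nu>(2)[OF that] ord_mem[OF ord_omega] by blast
  have "definable V (\<lambda>s. L (s 0) (s 1))"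
    unfolding L_def by (intro dintro dterm_comp1[OF \<nu>(1)] Q \<rho>)
  moreover have "wf {(x, y). L x y}"
    by (rule wf_subset[OF wf_inv_image[OF wf_lex_prod[OF wf_elts wf_elts]], of _ "\<lambda>x. (\<nu> x, ap (Gr Q \<rho>) x)"])
      (auto simp: L_def in_inv_image)
  moreover have "L x z" if "L x y" "L y z" for x y z
    using that ord_trans[OF ord\<nu>, of z] ord_trans[OF ord\<rho>, of z] unfolding L_def by metis
  moreover have "x = y \<or> L x y \<or> L y x" if "x \<in> elts Q" "y \<in> elts Q" for x y
    using ord_linear[OF ord\<nu> ord\<nu>, OF that] ord_linear[OF ord\<rho> ord\<rho>, OF that] \<rho>(2) that
    unfolding L_def by (auto dest: inj_onD)
  ultimately obtain H where H0: "dterm V (\<lambda>s. H (s 0))" "inj_on H (elts Q)"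
    "\<forall>x\<in>elts Q. is_ord (H x)" "\<forall>x\<in>V. elts (H x) = H ` {y \<in> elts Q. L y x}"
    by (rule order_collapse[OF Q])
  note H = H0(1,2) H0(3,4)[rule_format]
  have "H x \<in> elts omega" if x: "x \<in> elts Q" for x
  proof -
    obtain n where n: "\<nu> x = num n" using \<nu>(2)[OF x] by (auto simp: elts_omega)
    have "{y \<in> elts Q. L y x} \<subseteq> (\<Union>m\<in>{..n}. {y \<in> elts Q. \<nu> y = num m})"
      using n unfolding L_def by (auto simp: elts_num)
    then have "finite {y \<in> elts Q. L y x}" by (rule finite_subset) (use fin in auto)
    then have "finite (elts (H x))" using H(4)[OF V_trans[OF x Q]] by simp
    then obtain k where "H x = num k" using finite_ord[OF H(3)[OF x]] by blast
    then show ?thesis by simp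
  qed
  then have "injects V Q omega"
    unfolding injects_def using H(2) Gr_mem_dterm[OF Q omega_mem _ H(1)] by blast
  then show ?thesis by (rule injects_psurj) (use Q in auto)
qed

lemma bun_num: "bun (mk {num i, num j}) = (num (max i j) :: 'u)"
proof (rule elts_inject)
  show "elts (bun (mk {num i, num j})) = elts (num (max i j) :: 'u)"
    unfolding elts_Un_pair[OF num_mem num_mem] elts_num by (auto simp: less_max_iff_disj)
qed

text \<open>The maximum of the two components, which is their union, is finite-to-one.\<close>

lemma psurj_omega_square: "psurj V omega (cprod omega omega)"
proof (rule countable_if_finite_to_one[where \<nu> = "\<lambda>w. bun (mk {ufst w, usnd w})"])
  show "finite {x \<in> elts (cprod omega omega :: 'u). bun (mk {ufst x, usnd x}) = num n}" for n
  proof (rule finite_subset)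
    show "{x \<in> elts (cprod omega omega :: 'u). bun (mk {ufst x, usnd x}) = num n} \<subseteq>
        (\<lambda>(i, j). opair (num i) (num j)) ` ({..n} \<times> {..n})"
      by (auto simp: elts_cprod elts_omega bun_num)
  qed simp
  show "dterm V (\<lambda>s. bun (mk {ufst (s 0), usnd (s 0)}))" by (intro dintro)
qed (auto simp: elts_cprod elts_omega bun_num cprod_mem)

text \<open>Hilbert's hotel: zero is sent to \<zeta>, a positive natural number to its predecessor,
  which is its union, and everything else to itself.\<close>

lemma psurj_suc:
  assumes "\<zeta> \<in> V" "is_ord \<zeta>" "infinite (elts \<zeta>)"
  shows "psurj V \<zeta> (suc \<zeta>)"
proof -
  define F where "F x = (if x = mk {} then \<zeta> else if x \<in> elts omega then bun x else x)" for x
  have F: "dterm V (\<lambda>s. F (s 0))" unfolding F_def by (intro dintro empty_mem assms omega_mem)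
  have [simp]: "F (mk {}) = \<zeta>" by (simp add: F_def)
  have Fs: "F (num (Suc n)) = num n" for n
  proof -
    have "elts (bun (num (Suc n))) = elts (num n :: 'u)"
      unfolding elts_Un[OF num_mem] by (auto simp: elts_num)
    then have "bun (num (Suc n)) = (num n :: 'u)" by (rule elts_inject)
    moreover have "num (Suc n) \<noteq> (mk {} :: 'u)"
      using num_eq_iff[of "Suc n" 0, where ?'a = 'u] by (simp del: num_eq_iff)
    ultimately show ?thesis by (simp add: F_def)
  qed
  have Fo: "F x = x" if "x \<notin> elts omega" for x using that num_omega[of 0] by (auto simp: F_def)
  have mem: "num n \<in> elts \<zeta>" for n using infinite_ord[OF assms(2,3)] .
  have range: "F x \<in> elts (suc \<zeta>)" if "x \<in> elts \<zeta>" for x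
  proof (cases "x \<in> elts omega")
    case True
    then obtain n where "x = num n" by (auto simp: elts_omega)
    then show ?thesis using mem Fs by (cases n) auto
  qed (use that Fo in simp)
  show ?thesis
  proof (rule psurjI[OF assms(1) order_refl])
    show "Gr \<zeta> F \<in> V" by (rule Gr_mem_dterm[OF assms(1) suc_mem[OF assms(1)] _ F]) (use range in auto)
    show "\<exists>x\<in>elts \<zeta>. F x = y" if y: "y \<in> elts (suc \<zeta>)" for y
    proof (cases "y \<in> elts omega")
      case True
      then obtain n where "y = num n" by (auto simp: elts_omega)
      then show ?thesis using Fs mem by (intro bexI[of _ "num (Suc n)"]) auto
    next
      case False
      then show ?thesis using y mem[of 0] Fo[OF False] by (cases "y = \<zeta>") (auto intro: bexI[of _ "num 0"])
    qed
  qed (use range in auto)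
qed

text \<open>Induction on \<kappa>. If a smaller ordinal maps onto \<kappa>, the claim is inherited
  from it. Otherwise \<kappa> \<times> \<omega> is ordered lexicographically: the predecessors of a
  point lie in a product of \<open>suc \<zeta>\<close> with \<omega> for some \<zeta> < \<kappa>,
  which is too small to map onto \<kappa>, so the order collapses into \<kappa>. The case \<kappa> =
  \<omega> is the square of \<omega>.\<close>

lemma psurj_times_omega:
  assumes "\<kappa> \<in> V" "is_ord \<kappa>" "infinite (elts \<kappa>)"
  shows "psurj V \<kappa> (cprod \<kappa> omega)"
  using assms
proof (induction \<kappa> rule: mem_induct)
  case (step \<kappa>)
  note \<kappa> = step.prems
  show ?case
  proof (cases "\<exists>\<beta>\<in>elts \<kappa>. psurj V \<beta> \<kappa>")
    case True
    then obtain \<beta> where \<beta>: "\<beta> \<in> elts \<kappa>" "psurj V \<beta> \<kappa>" by blast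
    have bV: "\<beta> \<in> V" using V_trans[OF \<beta>(1) \<kappa>(1)] .
    have "infinite (elts \<beta>)" using psurj_finite[OF \<beta>(2)] \<kappa>(3) by blast
    then have IH: "psurj V \<beta> (cprod \<beta> omega)" using step.IH[OF \<beta>(1) bV] ord_mem[OF \<kappa>(2) \<beta>(1)] by blast
    have "psurj V \<kappa> \<beta>" using \<kappa> bV ord_trans[OF \<kappa>(2) \<beta>(1)] by (intro psurj_subset) auto
    moreover have "psurj V (cprod \<beta> omega) (cprod \<kappa> omega)"
      by (rule psurj_cprod[OF \<beta>(2) psurj_subset]) (use bV \<kappa> in auto)
    ultimately show ?thesis
      using IH psurj_trans bV \<kappa>(1) cprod_mem omega_mem by meson
  next
    case False
    show ?thesis
    proof (cases "\<kappa> = omega")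
      case True
      then show ?thesis using psurj_omega_square by simp
    next
      case False': False
      then have om: "omega \<in> elts \<kappa>"
        using ord_linear[OF ord_omega \<kappa>(2)] \<kappa>(3) by (auto simp: elts_omega)
      define A where "A = cprod \<kappa> omega"
      have A: "A \<in> V" "elts A = {opair x y | x y. x \<in> elts \<kappa> \<and> y \<in> elts omega}"
        using cprod_mem[OF \<kappa>(1) omega_mem] elts_cprod[OF \<kappa>(1) omega_mem] by (simp_all add: A_def)
      define L where "L v w \<longleftrightarrow> v \<in> elts A \<and> w \<in> elts A \<and> (ufst v \<in> elts (ufst w) \<or> ufst v = ufst w \<and> usnd v \<in> elts (usnd w))" for v w
      have "definable V (\<lambda>s. L (s 0) (s 1))" unfolding L_def by (intro dintro A)
      moreover have "wf {(x, y). L x y}"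
        by (rule wf_subset[OF wf_inv_image[OF wf_lex_prod[OF wf_elts wf_elts]], of _ "\<lambda>x. (ufst x, usnd x)"])
          (auto simp: L_def in_inv_image)
      moreover have "L x z" if "L x y" "L y z" for x y z
        using that ord_trans[OF ord_mem[OF \<kappa>(2)], of "ufst z"] ord_trans[OF ord_mem[OF ord_omega], of "usnd z"]
        unfolding L_def A(2) by auto
      moreover have "x = y \<or> L x y \<or> L y x" if "x \<in> elts A" "y \<in> elts A" for x y
        using that ord_linear[OF ord_mem[OF \<kappa>(2)] ord_mem[OF \<kappa>(2)], of "ufst x" "ufst y"]
          ord_linear[OF ord_mem[OF ord_omega] ord_mem[OF ord_omega], of "usnd x" "usnd y"]
        unfolding L_def A(2) by auto
      ultimately obtain H where H0: "dterm V (\<lambda>s. H (s 0))" "inj_on H (elts A)"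
        "\<forall>x\<in>elts A. is_ord (H x)" "\<forall>x\<in>V. elts (H x) = H ` {y \<in> elts A. L y x}"
        by (rule order_collapse[OF A(1)])
      note H = H0(1,2) H0(3,4)[rule_format]
      have "H w \<in> elts \<kappa>" if w: "w \<in> elts A" for w
      proof (rule ccontr)
        assume nin: "H w \<notin> elts \<kappa>"
        have HwV: "H w \<in> V" using dterm_mem[OF H(1), of "\<lambda>_. w"] V_trans[OF w A(1)] by (simp add: env_def)
        have sub: "elts \<kappa> \<subseteq> elts (H w)"
          using nin ord_linear[OF \<kappa>(2) H(3)[OF w]] ord_subset_iff[OF \<kappa>(2) H(3)[OF w]] by blast
        obtain \<zeta> n where \<zeta>: "w = opair \<zeta> n" "\<zeta> \<in> elts \<kappa>" using w A(2) by blast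
        have \<zeta>V: "\<zeta> \<in> V" "suc \<zeta> \<in> V" using V_trans[OF \<zeta>(2) \<kappa>(1)] by auto
        define c where "c = mk {v \<in> elts A. L v w}"
        have c: "c \<in> V" unfolding c_def
          by (rule separation[OF A(1)]) (use V_trans[OF w A(1)] A(1) in \<open>unfold L_def, intro dintro\<close>)
        have cs: "elts c \<subseteq> elts (cprod (suc \<zeta>) omega)"
          using \<zeta>V unfolding c_def elts_mk_Collect L_def \<zeta>(1) by (auto simp: A(2) elts_cprod)
        have "psurj V c (H w)"
        proof (rule psurjI[OF c order_refl, of H])
          show "Gr c H \<in> V" by (rule Gr_mem_dterm[OF c HwV _ H(1)]) (use H(4)[OF V_trans[OF w A(1)]] in \<open>auto simp: c_def\<close>)
        qed (use H(4)[OF V_trans[OF w A(1)]] in \<open>auto simp: c_def\<close>)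
        then have big: "psurj V (cprod (suc \<zeta>) omega) \<kappa>"
          using psurj_trans[OF psurj_trans[OF psurj_subset[OF _ c cs]] psurj_subset[OF HwV \<kappa>(1) sub]]
            cprod_mem[OF \<zeta>V(2) omega_mem] c HwV \<kappa>(1) by blast
        have ord\<zeta>: "is_ord \<zeta>" "is_ord (suc \<zeta>)" using ord_mem[OF \<kappa>(2) \<zeta>(2)] ord_suc by auto
        have "suc \<zeta> \<in> elts \<kappa>"
        proof -
          have "elts (suc \<zeta>) \<subseteq> elts \<kappa>" using \<zeta>(2) ord_trans[OF \<kappa>(2) \<zeta>(2)] by auto
          moreover have "suc \<zeta> \<noteq> \<kappa>"
          proof
            assume eq: "suc \<zeta> = \<kappa>"
            then have "infinite (elts \<zeta>)" using \<kappa>(3) by (metis elts_suc finite_insert)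
            then show False using psurj_suc[OF \<zeta>V(1) ord\<zeta>(1)] eq False \<zeta>(2) by auto
          qed
          ultimately show ?thesis using ord_subset_iff[OF ord\<zeta>(2) \<kappa>(2)] by blast
        qed
        have cV: "cprod (suc \<zeta>) omega \<in> V" using cprod_mem[OF \<zeta>V(2) omega_mem] .
        show False
        proof (cases "finite (elts (suc \<zeta>))")
          case True
          then obtain k where "suc \<zeta> = num k" using finite_ord[OF ord\<zeta>(2)] by blast
          then have "elts (suc \<zeta>) \<subseteq> elts omega" by (simp add: elts_num elts_omega image_mono del: elts_suc)
          then have "psurj V (cprod omega omega) (cprod (suc \<zeta>) omega)"
            using \<zeta>V(2) by (intro psurj_cprod psurj_subset) auto
          then have "psurj V omega \<kappa>"
            using psurj_trans[OF psurj_trans[OF psurj_omega_square] big] cV \<kappa>(1) cprod_mem omega_mem by blast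
          then show False using False om by blast
        next
          case infinite: False
          have "psurj V (suc \<zeta>) (cprod (suc \<zeta>) omega)"
            using step.IH[OF \<open>suc \<zeta> \<in> elts \<kappa>\<close> \<zeta>V(2) ord\<zeta>(2) infinite] .
          then have "psurj V (suc \<zeta>) \<kappa>" using psurj_trans[OF _ big \<zeta>V(2) cV \<kappa>(1)] by blast
          then show False using False \<open>suc \<zeta> \<in> elts \<kappa>\<close> by blast
        qed
      qed
      then have "injects V A \<kappa>"
        unfolding injects_def using H(2) Gr_mem_dterm[OF A(1) \<kappa>(1) _ H(1)] by blast
      then show ?thesis using injects_psurj A(1) \<kappa>(1) unfolding A_def by blast
    qed
  qed
qed

lemma psurj_times_countable:
  assumes "\<kappa> \<in> V" "is_ord \<kappa>" "infinite (elts \<kappa>)" "Q \<in> V" "psurj V omega Q" "D \<in> V" "psurj V \<kappa> D"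
  shows "psurj V \<kappa> (cprod D Q)"
  using psurj_trans[OF psurj_times_omega[OF assms(1-3)] psurj_cprod[OF assms(7,5)]] assms cprod_mem omega_mem
  by blast

lemma dterm_coll: "dterm V (\<lambda>s. coll (s 0) (s 1))"
proof -
  \<comment> \<open>The recursion runs on pairs; it keeps the first component fixed and descends in
    the second.\<close>
  define C where "C w = mk ((\<lambda>\<zeta>. opair (ufst w) \<zeta>) ` elts (usnd w))" for w :: 'u
  have C: "dterm V (\<lambda>s. C (s 0))" unfolding C_def by (intro dintro)
  define F where "F w g = mk ((\<lambda>\<zeta>. ap g (opair (ufst w) \<zeta>)) ` elts (mk {\<zeta> \<in> elts (usnd w). \<zeta> \<in> elts (ufst w)}))" for w g :: 'u
  have F: "dterm V (\<lambda>s. F (s 0) (s 1))" unfolding F_def by (intro dintro)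
  have wf: "wf {(y, x). x \<in> V \<and> y \<in> elts (C x)}"
    by (rule wf_subset[OF wf_inv_image[OF wf_elts], of _ usnd]) (auto simp: C_def in_inv_image)
  have "dterm V (\<lambda>s. (\<lambda>w. coll (ufst w) (usnd w)) (s 0))"
  proof (rule recursion[OF C F wf])
    fix w
    have "(\<lambda>\<zeta>. ap (Gr (C w) (\<lambda>w. coll (ufst w) (usnd w))) (opair (ufst w) \<zeta>)) ` {\<zeta> \<in> elts (usnd w). \<zeta> \<in> elts (ufst w)} =
        coll (ufst w) ` {\<zeta> \<in> elts (usnd w). \<zeta> \<in> elts (ufst w)}"
      by (rule image_cong) (auto simp: C_def)
    then show "coll (ufst w) (usnd w) = F w (Gr (C w) (\<lambda>w. coll (ufst w) (usnd w)))"
      unfolding F_def elts_mk_Collect by (simp add: coll.simps[of "ufst w" "usnd w"])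
  qed
  then have "dterm V (\<lambda>s. (\<lambda>w. coll (ufst w) (usnd w)) (opair (s 0) (s 1)))"
    by (rule dterm_comp1) (intro dintro)
  then show ?thesis by simp
qed

text \<open>The order types of the countably many sections cannot all lie below one \<delta> <
  \<kappa>, since \<kappa> would then be an image of \<delta> \<times> \<open>Q\<close>, hence of a
  smaller ordinal. So they are unbounded: either one of them is all of \<kappa>, or they form a
  countable cofinal sequence.\<close>

lemma countable_union:
  assumes \<kappa>: "\<kappa> \<in> V" "is_ord \<kappa>" "omega \<in> elts \<kappa>" "\<And>\<beta>. \<beta> \<in> elts \<kappa> ==> \<not> psurj V \<beta> \<kappa>"
    and Q: "Q \<in> V" "psurj V omega Q" and S: "S \<in> V"
    and cover: "\<And>i. i \<in> elts \<kappa> ==> \<exists>q\<in>elts Q. opair q i \<in> elts S"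
  defines "sec q \<equiv> mk {i \<in> elts \<kappa>. opair q i \<in> elts S}"
  shows "\<delta> \<in> elts \<kappa> ==> \<exists>q\<in>elts Q. injects V \<delta> (sec q)"
    and "(\<exists>q\<in>elts Q. injects V \<kappa> (sec q)) \<or> (\<exists>f\<in>V. is_cofinal_map f omega \<kappa>)"
proof -
  have sec: "dterm V (\<lambda>s. sec (s 0))" unfolding sec_def by (intro dintro \<kappa> S)
  have secV: "sec q \<in> V" if "q \<in> elts Q" for q
    using dterm_mem[OF sec, of "\<lambda>_. q"] V_trans[OF that Q(1)] by (simp add: env_def)
  have sub: "elts (sec q) \<subseteq> elts \<kappa>" for q by (auto simp: sec_def)
  define \<theta> where "\<theta> q = mk (coll (sec q) ` elts (sec q))" for q
  have \<theta>: "dterm V (\<lambda>s. \<theta> (s 0))"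
    unfolding \<theta>_def by (intro dintro dterm_comp2[OF dterm_coll] dterm_comp1[OF sec])
  have col: "\<theta> q \<in> V \<and> is_ord (\<theta> q) \<and> elts (\<theta> q) \<subseteq> elts \<kappa> \<and> Gr (sec q) (coll (sec q)) \<in> V \<and>
      bij_betw (coll (sec q)) (elts (sec q)) (elts (\<theta> q))" if q: "q \<in> elts Q" for q
  proof -
    obtain \<alpha> where \<alpha>: "\<alpha> \<in> V" "is_ord \<alpha>" "elts \<alpha> \<subseteq> elts \<kappa>" "Gr (sec q) (coll (sec q)) \<in> V"
      "bij_betw (coll (sec q)) (elts (sec q)) (elts \<alpha>)"
      using collapse[OF secV[OF q] \<kappa>(1,2) sub] by blast
    then have "\<theta> q = \<alpha>" by (simp add: \<theta>_def bij_betw_def)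
    with \<alpha> show ?thesis by simp
  qed
  have inj: "injects V \<delta> (sec q)" if "q \<in> elts Q" "\<delta> \<in> V" "elts \<delta> \<subseteq> elts (\<theta> q)" for q \<delta>
  proof -
    have "Gr (\<theta> q) (inv_into (elts (sec q)) (coll (sec q))) \<in> V"
      using col[OF that(1)] by (intro Gr_inverse secV that) (auto simp: bij_betw_def)
    then have "Gr \<delta> (inv_into (elts (sec q)) (coll (sec q))) \<in> V"
      using col[OF that(1)] by (intro Gr_restrict[OF _ that(2) _ that(3)]) auto
    moreover have "bij_betw (inv_into (elts (sec q)) (coll (sec q))) (elts (\<theta> q)) (elts (sec q))"
      using col[OF that(1)] bij_betw_inv_into by blast
    ultimately show ?thesis
      unfolding injects_def bij_betw_def using that(3)
      by (intro exI[of _ "inv_into (elts (sec q)) (coll (sec q))"]) (auto intro: inj_on_subset)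
  qed
  have core: "\<exists>q\<in>elts Q. \<theta> q \<notin> elts \<delta>" if \<delta>: "\<delta> \<in> elts \<kappa>" for \<delta>
  proof (rule ccontr)
    assume "\<not> (\<exists>q\<in>elts Q. \<theta> q \<notin> elts \<delta>)"
    then have small: "\<theta> q \<in> elts \<delta>" if "q \<in> elts Q" for q using that by blast
    have \<delta>V: "\<delta> \<in> V" "is_ord \<delta>" using V_trans[OF \<delta> \<kappa>(1)] ord_mem[OF \<kappa>(2) \<delta>] by auto
    \<comment> \<open>The factor \<open>Q\<close> is absorbed only by infinite ordinals, so \<delta>
      is raised to \<omega> if it is smaller.\<close>
    obtain \<delta>' where \<delta>': "\<delta>' \<in> elts \<kappa>" "infinite (elts \<delta>')" "elts \<delta> \<subseteq> elts \<delta>'"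
    proof (cases "omega \<in> elts \<delta>")
      case True
      then have "elts omega \<subseteq> elts \<delta>" using ord_trans[OF \<delta>V(2)] by blast
      then have "infinite (elts \<delta>)" using infinite_omega finite_subset by blast
      then show ?thesis using that[of \<delta>] \<delta> by simp
    next
      case False
      then have "elts \<delta> \<subseteq> elts omega"
        using ord_linear[OF \<delta>V(2) ord_omega] ord_subset_iff[OF \<delta>V(2) ord_omega] by blast
      then show ?thesis using that[of omega] \<kappa>(3) infinite_omega by blast
    qed
    have \<delta>'V: "\<delta>' \<in> V" "is_ord \<delta>'" using V_trans[OF \<delta>'(1) \<kappa>(1)] ord_mem[OF \<kappa>(2) \<delta>'(1)] by auto
    \<comment> \<open>A pair of a position below \<delta> and a section names the member of the
      section at that position.\<close>
    define R where "R w \<zeta> \<longleftrightarrow> \<zeta> \<in> elts (sec (usnd w)) \<and> coll (sec (usnd w)) \<zeta> = ufst w" for w \<zeta>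
    have R: "definable V (\<lambda>s. R (s 0) (s 1))"
      unfolding R_def by (intro dintro dterm_comp2[OF dterm_coll] dterm_comp1[OF sec])
    define d where "d = mk {w \<in> elts (cprod \<delta> Q). \<exists>\<zeta>\<in>elts \<kappa>. R w \<zeta>}"
    have d: "d \<in> V" unfolding d_def
      by (rule separation[OF cprod_mem[OF \<delta>V(1) Q(1)]]) (intro dintro definable_comp2[OF R] \<kappa>)
    have uniq: "\<zeta> = \<zeta>'" if "w \<in> elts d" "R w \<zeta>" "R w \<zeta>'" for w \<zeta> \<zeta>'
    proof -
      have "w \<in> elts (cprod \<delta> Q)" using that(1) by (simp add: d_def)
      then have "usnd w \<in> elts Q" using \<delta>V(1) Q(1) by (auto simp: elts_cprod)
      then show ?thesis using col that(2,3) unfolding R_def bij_betw_def inj_on_def by metis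
    qed
    define F where "F w = (THE \<zeta>. R w \<zeta>)" for w
    have F: "R w \<zeta> \<longleftrightarrow> \<zeta> = F w" if "w \<in> elts d" for w \<zeta>
    proof -
      obtain \<xi> where \<xi>: "R w \<xi>" using \<open>w \<in> elts d\<close> by (auto simp: d_def)
      have "F w = \<xi>" unfolding F_def by (rule the_equality) (use \<xi> uniq that in blast)+
      then show ?thesis using \<xi> uniq that by blast
    qed
    have range: "F w \<in> elts \<kappa>" if "w \<in> elts d" for w
      using that F[OF that] by (auto simp: d_def)
    have "psurj V (cprod \<delta> Q) \<kappa>"
    proof (rule psurjI[OF d _ _ range])
      show "Gr d F \<in> V" by (rule Gr_mem_rel[OF d \<kappa>(1) _ R]) (use F range in auto)
      show "\<exists>w\<in>elts d. F w = i" if i: "i \<in> elts \<kappa>" for i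
      proof -
        obtain q where q: "q \<in> elts Q" "opair q i \<in> elts S" using cover[OF i] by blast
        then have isec: "i \<in> elts (sec q)" using i by (simp add: sec_def)
        then have "coll (sec q) i \<in> elts (\<theta> q)" by (simp add: \<theta>_def)
        then have "coll (sec q) i \<in> elts \<delta>" using small[OF q(1)] ord_trans[OF \<delta>V(2)] by blast
        then have w: "opair (coll (sec q) i) q \<in> elts d" "R (opair (coll (sec q) i) q) i"
          using q(1) isec i \<delta>V(1) Q(1) by (auto simp: d_def R_def)
        then have "F (opair (coll (sec q) i) q) = i" using F by simp
        with w(1) show ?thesis by blast
      qed
    qed (auto simp: d_def)
    moreover have "psurj V \<delta>' (cprod \<delta> Q)"
      by (rule psurj_times_countable[OF \<delta>'V \<delta>'(2) Q \<delta>V(1) psurj_subset[OF \<delta>'V(1) \<delta>V(1) \<delta>'(3)]])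
    ultimately have "psurj V \<delta>' \<kappa>" using psurj_trans cprod_mem \<delta>'V(1) \<delta>V(1) Q(1) \<kappa>(1) by blast
    then show False using \<kappa>(4)[OF \<delta>'(1)] by blast
  qed
  show "\<exists>q\<in>elts Q. injects V \<delta> (sec q)" if \<delta>: "\<delta> \<in> elts \<kappa>"
  proof -
    obtain q where q: "q \<in> elts Q" "\<theta> q \<notin> elts \<delta>" using core[OF \<delta>] by blast
    have o: "is_ord \<delta>" "is_ord (\<theta> q)" using ord_mem[OF \<kappa>(2) \<delta>] col[OF q(1)] by auto
    then have "elts \<delta> \<subseteq> elts (\<theta> q)" using ord_linear[OF o] q(2) ord_subset_iff[OF o] by blast
    then show ?thesis using inj[OF q(1) V_trans[OF \<delta> \<kappa>(1)]] q(1) by blast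
  qed
  show "(\<exists>q\<in>elts Q. injects V \<kappa> (sec q)) \<or> (\<exists>f\<in>V. is_cofinal_map f omega \<kappa>)"
  proof (cases "\<exists>q\<in>elts Q. elts \<kappa> \<subseteq> elts (\<theta> q)")
    case True
    then show ?thesis using inj \<kappa>(1) by blast
  next
    case False
    then have small: "\<theta> q \<in> elts \<kappa>" if "q \<in> elts Q" for q
      using that col[OF that] ord_subset_iff[of "\<theta> q" \<kappa>] \<kappa>(2) by blast
    obtain d E where E: "d \<in> V" "elts d \<subseteq> elts omega" "Gr d E \<in> V" "\<forall>x\<in>elts d. E x \<in> elts Q"
      "\<forall>y\<in>elts Q. \<exists>x\<in>elts d. E x = y" by (rule psurjE[OF Q(2)])
    \<comment> \<open>Numbers outside the partial enumeration of \<open>Q\<close> receive the value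
      0, which does not affect cofinality.\<close>
    define f where "f n = (if n \<in> elts d then \<theta> (ap (Gr d E) n) else mk {})" for n
    have f: "dterm V (\<lambda>s. f (s 0))" unfolding f_def by (intro dintro dterm_comp1[OF \<theta>] E empty_mem)
    have "num 0 \<in> elts \<kappa>" using ord_trans[OF \<kappa>(2,3)] num_omega by blast
    then have fr: "f n \<in> elts \<kappa>" for n using small E(4) by (auto simp: f_def)
    have "Gr omega f \<in> V" by (rule Gr_mem_dterm[OF omega_mem \<kappa>(1) _ f]) (use fr in auto)
    moreover have "is_cofinal_map (Gr omega f) omega \<kappa>"
      unfolding is_cofinal_map_def
    proof (intro conjI ballI)
      fix \<gamma> assume \<gamma>: "\<gamma> \<in> elts \<kappa>"
      obtain q where q: "q \<in> elts Q" "\<theta> q \<notin> elts \<gamma>" using core[OF \<gamma>] by blast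
      obtain n where n: "n \<in> elts d" "E n = q" using E(5) q(1) by blast
      have "f n = \<theta> q" using n by (simp add: f_def)
      moreover have "\<gamma> = \<theta> q \<or> \<gamma> \<in> elts (\<theta> q)"
        using ord_linear[OF ord_mem[OF \<kappa>(2) \<gamma>], of "\<theta> q"] col[OF q(1)] q(2) by blast
      ultimately show "\<exists>\<xi>\<in>elts omega. \<exists>\<delta>\<in>elts \<kappa>. opair \<xi> \<delta> \<in> elts (Gr omega f) \<and> (\<gamma> = \<delta> \<or> \<gamma> \<in> elts \<delta>)"
        using n E(2) small[OF q(1)] by (intro bexI[of _ n] bexI[of _ "\<theta> q"]) (auto simp: opair_Gr)
    qed (use fr in auto)
    ultimately show ?thesis by blast
  qed
qed

end

section \<open>Conditions, permutations and names\<close>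

lemma stronger_refl [simp]: "stronger p p"
  and stronger_trans: "stronger r q ==> stronger q p ==> stronger r p"
  by (auto simp: stronger_def)

lemma elts_act_cond: "elts (act_cond \<pi> p) =
    {entry (\<pi> n) m i | n m i. entry n m i \<in> elts p}"
proof -
  define f :: "'a => 'a" where
    "f z = opair (opair (num (\<pi> (THE n. ufst (ufst z) = num n))) (usnd (ufst z))) (usnd z)" for z
  have "f (entry n m i) = entry (\<pi> n) m i" for n m i
    by (simp add: f_def)
  then have "{entry (\<pi> n) m i | n m i. entry n m i \<in> elts p} \<subseteq> f ` elts p"
    by (smt (verit) image_eqI mem_Collect_eq subsetI)
  then show ?thesis unfolding act_cond_def by (rule elts_mk_subset_image)
qed

lemma opair_act_cond:
  assumes "inj \<pi>"
  shows "entry (\<pi> n) m i \<in> elts (act_cond \<pi> p) \<longleftrightarrow> entry n m i \<in> elts p"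
  unfolding elts_act_cond using assms by (auto dest: injD)

lemma act_cond_empty [simp]: "act_cond \<pi> (mk {}) = mk {}"
  by (simp add: elts_eq_iff elts_act_cond)

lemma act_cond_comp: "act_cond \<pi> (act_cond \<sigma> p) = act_cond (\<pi> \<circ> \<sigma>) p"
  unfolding elts_eq_iff[of "act_cond \<pi> _"] elts_act_cond by auto

lemma elts_act_name_image:
  "elts (act_name \<pi> x) = (\<lambda>(p, y). opair (act_cond \<pi> p) (act_name \<pi> y)) ` {(p, y). opair p y \<in> elts x}"
  unfolding elts_act_name by auto

lemma act_name_comp: "act_name \<pi> (act_name \<sigma> x) = act_name (\<pi> \<circ> \<sigma>) x"
proof (induction x rule: name_induct)
  case (step x)
  have "{(p, y). opair p y \<in> elts (act_name \<sigma> x)} =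
      (\<lambda>(p, y). (act_cond \<sigma> p, act_name \<sigma> y)) ` {(p, y). opair p y \<in> elts x}"
    unfolding elts_act_name by auto
  then have "elts (act_name \<pi> (act_name \<sigma> x)) =
      (\<lambda>(p, y). opair (act_cond \<pi> (act_cond \<sigma> p)) (act_name \<pi> (act_name \<sigma> y))) ` {(p, y). opair p y \<in> elts x}"
    unfolding elts_act_name_image[of \<pi>] by (simp add: image_image case_prod_beta)
  also have "\<dots> = elts (act_name (\<pi> \<circ> \<sigma>) x)"
    unfolding elts_act_name_image[of "\<pi> \<circ> \<sigma>"]
  proof (rule image_cong[OF refl])
    fix w assume "w \<in> {(p, y). opair p y \<in> elts x}"
    then obtain p y where "w = (p, y)" "opair p y \<in> elts x" by blast
    then show "(case w of (p, y) => opair (act_cond \<pi> (act_cond \<sigma> p)) (act_name \<pi> (act_name \<sigma> y))) =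
        (case w of (p, y) => opair (act_cond (\<pi> \<circ> \<sigma>) p) (act_name (\<pi> \<circ> \<sigma>) y))"
      using step.IH by (simp only: act_cond_comp case_prod_conv)
  qed
  finally show ?case by (rule elts_inject)
qed

abbreviation pinv :: "(nat => nat) => nat => nat" where "pinv \<equiv> inv_into UNIV"

lemma carrier_finitary: "\<pi> \<in> perms \<longleftrightarrow> bij \<pi> \<and> finite {n. \<pi> n \<noteq> n}"
  by (simp add: finitary_group_def)

lemma finitary_comp: "\<pi> \<in> perms ==> \<sigma> \<in> perms ==> \<pi> \<circ> \<sigma> \<in> perms"
  unfolding carrier_finitary
  by (auto intro: bij_comp finite_subset[of _ "{n. \<pi> n \<noteq> n} \<union> {n. \<sigma> n \<noteq> n}"])

lemma finitary_inv:
  assumes "\<pi> \<in> perms" shows "pinv \<pi> \<in> perms"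
proof -
  have "bij \<pi>" using assms by (simp add: carrier_finitary)
  then have "{n. pinv \<pi> n \<noteq> n} = {n. \<pi> n \<noteq> n}" by (metis bij_inv_eq_iff)
  then show ?thesis using assms by (simp add: carrier_finitary bij_imp_bij_inv)
qed

lemma finitary_id [simp]: "id \<in> perms"
  by (simp add: carrier_finitary)

lemma finitary_bij: "\<pi> \<in> perms ==> bij \<pi>"
  by (simp add: carrier_finitary)

lemma finitary_inv_comp:
  assumes "\<pi> \<in> perms"
  shows "pinv \<pi> \<circ> \<pi> = id" "\<pi> \<circ> pinv \<pi> = id"
  using finitary_bij[OF assms] by (auto simp: fun_eq_iff bij_is_inj surj_f_inv_f bij_is_surj)

lemma group_finitary: "group finitary_group"
proof (rule groupI)
  fix \<pi> assume "\<pi> \<in> perms"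
  then show "\<exists>\<sigma>\<in>perms. \<sigma> \<otimes>\<^bsub>finitary_group\<^esub> \<pi> = \<one>\<^bsub>finitary_group\<^esub>"
    using finitary_inv finitary_inv_comp by (intro bexI[of _ "pinv \<pi>"]) (auto simp: finitary_group_def)
next
  fix \<pi> \<sigma> assume "\<pi> \<in> perms" "\<sigma> \<in> perms"
  then show "\<pi> \<otimes>\<^bsub>finitary_group\<^esub> \<sigma> \<in> perms"
    using finitary_comp by (auto simp: finitary_group_def)
qed (auto simp: finitary_group_def)

lemma inv_finitary:
  assumes "\<pi> \<in> perms"
  shows "inv\<^bsub>finitary_group\<^esub> \<pi> = pinv \<pi>"
  using group.inv_equality[OF group_finitary _ assms finitary_inv[OF assms]] finitary_inv_comp(1)[OF assms]
  by (simp add: finitary_group_def)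

lemma fixer_carrier: "\<pi> \<in> fixer E ==> \<pi> \<in> perms"
  by (simp add: fixer_def)

lemma fixer_mono: "E \<subseteq> F ==> fixer F \<subseteq> fixer E"
  by (auto simp: fixer_def)

lemma fixer_comp: "\<pi> \<in> fixer E ==> \<sigma> \<in> fixer E ==> \<pi> \<circ> \<sigma> \<in> fixer E"
  unfolding fixer_def using finitary_comp by auto

lemma fixer_inv: "\<pi> \<in> fixer E ==> pinv \<pi> \<in> fixer E"
  unfolding fixer_def using finitary_inv bij_inv_eq_iff[OF finitary_bij, symmetric] by fastforce

text \<open>The groups fixing initial segments are cofinal in the filter, so a support can be
  measured by a single natural number.\<close>

lemma sym_filter_fixer: "H \<in> sym_filter ==> \<exists>k. fixer {..<k} \<subseteq> H"
proof (induction rule: sym_filter.induct)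
  case (base E)
  then obtain k where "E \<subseteq> {..<k}" using finite_nat_iff_bounded by blast
  then show ?case using fixer_mono by blast
next
  case (inter H K)
  then obtain j k where "fixer {..<j} \<subseteq> H" "fixer {..<k} \<subseteq> K" by blast
  then have "fixer {..<max j k} \<subseteq> H \<inter> K"
    using fixer_mono[of "{..<j}" "{..<max j k}"] fixer_mono[of "{..<k}" "{..<max j k}"] by auto
  then show ?case by blast
qed blast

text \<open>The permutation as a set of the universe, through which formulas over \<open>V\<close>
  can speak of it.\<close>

definition code :: "(nat => nat) => 'u::set_universe" where
  "code \<pi> = mk (range (\<lambda>n. opair (num n) (num (\<pi> n))))"

function check :: "'u::set_universe => 'u" where
  "check x = mk ((\<lambda>y. opair (mk {}) (check y)) ` elts x)"
  by auto
termination
  by (relation "{(x, y). x \<in> elts y}") (auto simp: wf_elts)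

declare check.simps [simp del]

lemma elts_check: "elts (check x) = (\<lambda>y. opair (mk {}) (check y)) ` elts x"
  unfolding check.simps[of x] by (rule elts_mk_image)

lemma act_name_check [simp]: "act_name \<pi> (check x) = check x"
proof (induction x rule: mem_induct)
  case (step x)
  have "elts (act_name \<pi> (check x)) = elts (check x)"
    unfolding elts_act_name elts_check using step by (auto simp: image_iff) metis
  then show ?case by (rule elts_inject)
qed

lemma interp_check: "mk {} \<in> G ==> interp G (check x) = x"
proof (induction x rule: mem_induct)
  case (step x)
  have "elts (interp G (check x)) = elts x"
    unfolding elts_interp elts_check using step by (auto simp: image_iff) metis
  then show ?case by (rule elts_inject)
qed

text \<open>Canonical names of unordered and, below, of ordered pairs. All conditions are trivial,
  so a permutation acts on the components only.\<close>

definition upn :: "'u::set_universe => 'u => 'u" where "upn x y = mk {opair (mk {}) x, opair (mk {}) y}"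

definition opn :: "'u::set_universe => 'u => 'u" where "opn x y = upn (upn x x) (upn x y)"

lemma interp_opn: "mk {} \<in> G ==> interp G (opn x y) = opair (interp G x) (interp G y)"
proof -
  assume G: "mk {} \<in> G"
  have upn: "interp G (upn x y) = mk {interp G x, interp G y}" for x y
    unfolding elts_eq_iff[of "interp G _"] elts_interp using G by (auto simp: upn_def)
  show ?thesis by (simp add: opn_def upn opair_def)
qed

lemma act_name_opn: "act_name \<pi> (opn x y) = opn (act_name \<pi> x) (act_name \<pi> y)"
proof -
  have upn: "act_name \<pi> (upn x y) = upn (act_name \<pi> x) (act_name \<pi> y)" for x y
    unfolding elts_eq_iff[of "act_name \<pi> _"] elts_act_name
    by (auto simp: upn_def) (metis act_cond_empty)+
  show ?thesis by (simp add: opn_def upn)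
qed

section \<open>Conditions, permutations and names as definable objects of the ground model\<close>

context zfc_model
begin

abbreviation P :: "'u set" where "P \<equiv> Add V"

definition PP :: 'u where "PP = mk P"

lemma PP: "PP \<in> V \<and> elts PP = P"
proof -
  \<comment> \<open>In place of finiteness the formula asks for one bound \<open>n\<close> on all
    coordinates, from which finiteness follows.\<close>
  define c where "c p \<longleftrightarrow> (\<exists>n\<in>elts omega. \<forall>z\<in>elts p. \<exists>a\<in>elts n. \<exists>b\<in>elts n. \<exists>i\<in>elts (num 2). z = opair (opair a b) i) \<and>
      (\<forall>z\<in>elts p. \<forall>z'\<in>elts p. ufst z = ufst z' --> z = z')" for p :: 'u
  define B where "B = pw (cprod (cprod omega omega) (num 2))"
  have cV: "cprod omega omega \<in> V" by (simp add: cprod_mem)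
  then have BV: "B \<in> V" unfolding B_def by (intro pw_mem cprod_mem) simp_all
  have "definable V (\<lambda>s. c (s 0))" unfolding c_def by (intro dintro omega_mem num_mem)
  from separation[OF BV this] have V: "mk {p \<in> elts B. c p} \<in> V" .
  have num2: "elts (num 2 :: 'u) = {num 0, num 1}"
    by (simp add: elts_num numeral_2_eq_2 lessThan_Suc insert_commute)
  have "p \<in> P \<longleftrightarrow> p \<in> elts B \<and> c p" for p
  proof
    assume p: "p \<in> P"
    then have pV: "p \<in> V" "finite (elts p)"
      and sh: "\<And>z. z \<in> elts p ==> \<exists>n m. \<exists>i\<in>{0, 1}. z = entry n m (num i)"
      and fn: "\<And>x i j. opair x i \<in> elts p ==> opair x j \<in> elts p ==> i = j"
      unfolding Add_def by blast+
    have "elts p \<subseteq> elts (cprod (cprod omega omega) (num 2))"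
    proof
      fix z assume "z \<in> elts p"
      from sh[OF this] show "z \<in> elts (cprod (cprod omega omega) (num 2))" using cV num2 by auto
    qed
    then have pB: "p \<in> elts B" unfolding B_def using pV(1) cV by (simp add: elts_pw cprod_mem)
    define h where "h z = (THE N. \<exists>n m. \<exists>i\<in>{0::nat, 1}. z = entry n m (num i) \<and> N = Suc (max n m))" for z :: 'u
    have h: "h (entry n m (num i)) = Suc (max n m)" if "i \<in> {0, 1}" for n m i
      unfolding h_def using that by (intro the_equality) auto
    obtain K where K: "h ` elts p \<subseteq> {..<K}" using pV(2) finite_nat_iff_bounded[of "h ` elts p"] by auto
    have "\<exists>a\<in>elts (num K). \<exists>b\<in>elts (num K). \<exists>i\<in>elts (num 2). z = opair (opair a b) i" if z: "z \<in> elts p" for z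
    proof -
      obtain n m i where *: "i \<in> {0, 1}" "z = entry n m (num i)" using sh[OF z] by blast
      then have "n < K" "m < K" using K z h[OF *(1), of n m] by auto
      then show ?thesis using * num2 by (intro bexI[of _ "num n"] bexI[of _ "num m"] bexI[of _ "num i"]) auto
    qed
    moreover have "z = z'" if "z \<in> elts p" "z' \<in> elts p" "ufst z = ufst z'" for z z'
      using sh[OF that(1)] sh[OF that(2)] fn that by auto
    ultimately have "c p" unfolding c_def using num_omega[of K] by blast
    with pB show "p \<in> elts B \<and> c p" by blast
  next
    assume *: "p \<in> elts B \<and> c p"
    then have pV: "p \<in> V" unfolding B_def using cV by (simp add: elts_pw cprod_mem)
    obtain n where "n \<in> elts omega" and n: "\<forall>z\<in>elts p. \<exists>a\<in>elts n. \<exists>b\<in>elts n. \<exists>i\<in>elts (num 2). z = opair (opair a b) i"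
      using * unfolding c_def by blast
    then obtain N where N: "n = num N" by (auto simp: elts_omega)
    have sh: "\<exists>a<N. \<exists>b<N. \<exists>i\<in>{0, 1}. z = entry a b (num i)" if "z \<in> elts p" for z
      using n that unfolding N num2 by (simp add: elts_num) (metis lessThan_iff)
    then have "elts p \<subseteq> (\<lambda>(a, b, i). entry a b (num i)) ` ({..<N} \<times> {..<N} \<times> {0, 1})"
      by (force simp: image_iff)
    then have "finite (elts p)" by (rule finite_subset) simp
    moreover have "\<forall>x i j. opair x i \<in> elts p \<and> opair x j \<in> elts p --> i = j"
      using * unfolding c_def by (metis opair_inject ufst_opair)
    ultimately show "p \<in> P" unfolding Add_def using pV sh by blast
  qed
  then have "P = elts (mk {p \<in> elts B. c p})" by auto
  then have "PP = mk {p \<in> elts B. c p}" unfolding PP_def by simp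
  with V \<open>P = _\<close> show ?thesis by simp
qed

lemmas PP_mem [simp] = PP[THEN conjunct1] and elts_PP = PP[THEN conjunct2]

lemma P_V: "p \<in> P ==> p \<in> V" by (simp add: Add_def)

lemma empty_P [simp]: "mk {} \<in> P" by (simp add: Add_def)

lemma finite_P: "p \<in> P ==> finite (elts p)" by (simp add: Add_def)

lemma P_shape: "p \<in> P ==> z \<in> elts p ==> \<exists>n m. \<exists>i\<in>{0, 1}. z = entry n m (num i)"
  by (simp add: Add_def)

lemma definable_stronger [dintro]:
  "dterm V t ==> dterm V u ==> definable V (\<lambda>s. stronger (t s) (u s))"
  unfolding stronger_def by (intro dintro)

lemma finitary_code:
  shows elts_code: "elts (code \<pi> :: 'u) = range (\<lambda>n. opair (num n) (num (\<pi> n)))"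
    and code_mem: "\<pi> \<in> perms ==> (code \<pi> :: 'u) \<in> V"
proof -
  have "range (\<lambda>n. opair (num n) (num (\<pi> n))) \<subseteq> (\<lambda>x. opair x (num (\<pi> (THE n. x = num n)))) ` elts (omega :: 'u)"
    by (auto simp: elts_omega image_iff)
  then show el: "elts (code \<pi> :: 'u) = range (\<lambda>n. opair (num n) (num (\<pi> n)))"
    unfolding code_def by (rule elts_mk_subset_image)
  assume "\<pi> \<in> perms"
  then have fin: "finite {n. \<pi> n \<noteq> n}" by (simp add: carrier_finitary)
  \<comment> \<open>A finitary permutation is the identity except on the finite set
    \<open>S\<close>, where its graph is the finite set \<open>F\<close>; both belong to
    \<open>V\<close>.\<close>
  define S :: 'u where "S = mk (num ` {n. \<pi> n \<noteq> n})"
  define F :: 'u where "F = mk ((\<lambda>n. opair (num n) (num (\<pi> n))) ` {n. \<pi> n \<noteq> n})"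
  have S: "S \<in> V" "elts S = num ` {n. \<pi> n \<noteq> n}"
    unfolding S_def using fin by (auto intro!: finite_mem simp: elts_mk_finite)
  have F: "F \<in> V" "elts F = (\<lambda>n. opair (num n) (num (\<pi> n))) ` {n. \<pi> n \<noteq> n}"
    unfolding F_def using fin by (auto intro!: finite_mem simp: elts_mk_finite)
  have "mk {w \<in> elts (cprod omega omega). w \<in> elts F \<or> (\<exists>x\<in>elts omega. w = opair x x \<and> x \<notin> elts S)} \<in> V"
    by (rule separation[OF cprod_mem[OF omega_mem omega_mem]]) (intro dintro S F omega_mem)
  also have "mk {w \<in> elts (cprod omega omega). w \<in> elts F \<or> (\<exists>x\<in>elts omega. w = opair x x \<and> x \<notin> elts S)} = code \<pi>"
    unfolding code_def S(2) F(2) elts_cprod[OF omega_mem omega_mem] elts_omega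
    by (intro arg_cong[of _ _ mk]) (auto simp: image_iff, metis+)
  finally show "(code \<pi> :: 'u) \<in> V" .
qed

lemma ap_code [simp]: "ap (code \<pi> :: 'u) (num n) = num (\<pi> n)"
proof -
  have "opair (num n) y \<in> elts (code \<pi> :: 'u) \<longleftrightarrow> y = num (\<pi> n)" for y
    unfolding elts_code by auto
  then show ?thesis by (simp add: ap_def)
qed

lemma code_inject: "(code \<pi> :: 'u) = code \<sigma> \<longleftrightarrow> \<pi> = \<sigma>"
  using ap_code num_eq_iff by (metis ext)

definition GG :: 'u where "GG = mk (code ` perms)"

lemma GG: "GG \<in> V \<and> elts GG = code ` perms"
proof -
  \<comment> \<open>The last clause expresses that the permutation is finitary: it is the identity
    from some \<open>k\<close> on.\<close>
  define c where "c u \<longleftrightarrow>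
      (\<forall>x\<in>elts omega. \<exists>y\<in>elts omega. opair x y \<in> elts u \<and> (\<forall>y'\<in>elts omega. opair x y' \<in> elts u --> y' = y)) \<and>
      (\<forall>y\<in>elts omega. \<exists>x\<in>elts omega. opair x y \<in> elts u \<and> (\<forall>x'\<in>elts omega. opair x' y \<in> elts u --> x' = x)) \<and>
      (\<exists>k\<in>elts omega. \<forall>x\<in>elts omega. x \<notin> elts k --> opair x x \<in> elts u)" for u :: 'u
  have wV: "cprod omega omega \<in> V" by (simp add: cprod_mem)
  have "definable V (\<lambda>s. c (s 0))" unfolding c_def by (intro dintro omega_mem)
  from separation[OF pw_mem[OF wV] this] have V: "mk {u \<in> elts (pw (cprod omega omega)). c u} \<in> V" .
  have "u \<in> code ` perms \<longleftrightarrow> u \<in> elts (pw (cprod omega omega)) \<and> c u" for u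
  proof
    assume "u \<in> code ` perms"
    then obtain \<pi> where \<pi>: "u = code \<pi>" "\<pi> \<in> perms" by blast
    then have b: "bij \<pi>" "finite {n. \<pi> n \<noteq> n}" by (auto simp: carrier_finitary)
    have "elts u \<subseteq> elts (cprod omega omega)" unfolding \<pi>(1) elts_code by (auto simp: elts_omega)
    then have 1: "u \<in> elts (pw (cprod omega omega))" using wV code_mem[OF \<pi>(2)] by (simp add: elts_pw \<pi>)
    have mem: "opair (num n) (num m) \<in> elts u \<longleftrightarrow> m = \<pi> n" for n m unfolding \<pi>(1) elts_code by auto
    obtain k where k: "{n. \<pi> n \<noteq> n} \<subseteq> {..<k}" using b(2) finite_nat_iff_bounded by blast
    have "\<exists>x. y = \<pi> x \<and> (\<forall>x'. y = \<pi> x' --> x' = x)" for y using b(1) by (metis bij_pointE)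
    moreover have "\<forall>x. \<not> x < k --> x = \<pi> x" using k by (metis (mono_tags) lessThan_iff mem_Collect_eq subsetD)
    ultimately have "c u" unfolding c_def elts_omega ball_simps bex_simps mem num_eq_iff num_mem_iff by blast
    with 1 show "u \<in> elts (pw (cprod omega omega)) \<and> c u" by blast
  next
    assume *: "u \<in> elts (pw (cprod omega omega)) \<and> c u"
    then have sub: "elts u \<subseteq> elts (cprod omega omega)" using wV by (simp add: elts_pw)
    have cu: "\<forall>x. \<exists>y. opair (num x) (num y) \<in> elts u \<and> (\<forall>y'. opair (num x) (num y') \<in> elts u --> y' = y)"
      "\<forall>y. \<exists>x. opair (num x) (num y) \<in> elts u \<and> (\<forall>x'. opair (num x') (num y) \<in> elts u --> x' = x)"
      "\<exists>k. \<forall>x. \<not> x < k --> opair (num x) (num x) \<in> elts u"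
      using * unfolding c_def elts_omega ball_simps bex_simps num_eq_iff num_mem_iff by blast+
    define \<pi> where "\<pi> x = (THE y. opair (num x) (num y) \<in> elts u)" for x
    have \<pi>: "opair (num x) (num y) \<in> elts u \<longleftrightarrow> y = \<pi> x" for x y
    proof -
      obtain y0 where y0: "opair (num x) (num y0) \<in> elts u" "\<forall>y'. opair (num x) (num y') \<in> elts u --> y' = y0"
        using cu(1) by blast
      then have "\<pi> x = y0" unfolding \<pi>_def by (intro the_equality) blast+
      then show ?thesis using y0 by blast
    qed
    have "bij \<pi>"
      unfolding bij_iff using cu(2) unfolding \<pi> by metis
    moreover obtain k where "\<forall>x. \<not> x < k --> x = \<pi> x" using cu(3) unfolding \<pi> by blast
    then have "{n. \<pi> n \<noteq> n} \<subseteq> {..<k}" by force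
    then have "finite {n. \<pi> n \<noteq> n}" by (rule finite_subset) simp
    ultimately have "\<pi> \<in> perms" by (simp add: carrier_finitary)
    moreover have "u = code \<pi>"
    proof (rule elts_inject)
      show "elts u = elts (code \<pi>)"
        unfolding elts_code using sub \<pi> by (auto simp: elts_cprod elts_omega)
    qed
    ultimately show "u \<in> code ` perms" by blast
  qed
  then have eq: "code ` perms = elts (mk {u \<in> elts (pw (cprod omega omega)). c u})" by auto
  then have "GG = mk {u \<in> elts (pw (cprod omega omega)). c u}" unfolding GG_def by simp
  with V eq show ?thesis by simp
qed

lemmas GG_mem [simp] = GG[THEN conjunct1] and elts_GG = GG[THEN conjunct2]

text \<open>\<open>act_cond\<close> with the permutation supplied as a code, hence a definable term
  of both arguments.\<close>

definition actc :: "'u => 'u => 'u" where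
  "actc u p = mk ((\<lambda>z. opair (opair (ap u (ufst (ufst z))) (usnd (ufst z))) (usnd z)) `
     elts (mk {z \<in> elts p. \<exists>a\<in>elts omega. \<exists>b\<in>elts omega. \<exists>i\<in>V. z = opair (opair a b) i}))"

lemma dterm_actc: "dterm V (\<lambda>s. actc (s 0) (s 1))"
  unfolding actc_def by (intro dintro omega_mem)

lemma actc_code: "p \<in> V ==> actc (code \<pi>) p = act_cond \<pi> p"
proof (rule elts_inject)
  assume p: "p \<in> V"
  then have iV: "i \<in> V" if "opair (opair a b) i \<in> elts p" for a b i
    using opair_mem_elts[OF that p] by blast
  show "elts (actc (code \<pi>) p) = elts (act_cond \<pi> p)"
    unfolding actc_def elts_act_cond elts_mk_image
  proof (intro equalityI subsetI)
    fix w assume "w \<in> (\<lambda>z. opair (opair (ap (code \<pi>) (ufst (ufst z))) (usnd (ufst z))) (usnd z)) `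
      elts (mk {z \<in> elts p. \<exists>a\<in>elts omega. \<exists>b\<in>elts omega. \<exists>i\<in>V. z = opair (opair a b) i})"
    then show "w \<in> {entry (\<pi> n) m i |n m i. entry n m i \<in> elts p}"
      by (auto simp: elts_omega)
  next
    fix w assume "w \<in> {entry (\<pi> n) m i |n m i. entry n m i \<in> elts p}"
    then obtain n m i where "w = entry (\<pi> n) m i" "entry n m i \<in> elts p" by blast
    then show "w \<in> (\<lambda>z. opair (opair (ap (code \<pi>) (ufst (ufst z))) (usnd (ufst z))) (usnd z)) `
      elts (mk {z \<in> elts p. \<exists>a\<in>elts omega. \<exists>b\<in>elts omega. \<exists>i\<in>V. z = opair (opair a b) i})"
      using iV by (intro image_eqI[of _ _ "entry n m i"]) auto
  qed
qed

definition dec :: "'u => nat => nat" where "dec u = (THE \<pi>. u = code \<pi>)"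

lemma dec_code [simp]: "dec (code \<pi>) = \<pi>"
  by (auto simp: dec_def code_inject)

text \<open>Outside the codes the value is \<open>mk {}\<close>; this makes the action total, as the
  recursion theorem requires.\<close>

definition actn :: "'u => 'u => 'u" where
  "actn u x = (if u \<in> elts GG then act_name (dec u) x else mk {})"

lemma actn_code: "\<pi> \<in> perms ==> actn (code \<pi>) x = act_name \<pi> x"
  by (simp add: actn_def elts_GG)

text \<open>Ordered pairs are Kuratowski pairs, so the names inside \<open>x\<close> lie two unions
  down. This possibly larger set of children is a definable term and serves the recursions on
  names.\<close>

lemma name_child: "x \<in> V ==> opair p y \<in> elts x ==> y \<in> elts (bun (bun x))"
proof -
  assume "x \<in> V" "opair p y \<in> elts x"
  moreover have "mk {p, y} \<in> elts (opair p y)" by (simp add: opair_def)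
  ultimately have "x \<in> V" "mk {p, y} \<in> elts (bun x)" by (auto simp: elts_Un)
  moreover have "y \<in> elts (mk {p, y})" by simp
  ultimately show ?thesis using Un_mem[of x] elts_Un[of "bun x"] by blast
qed

lemma child_mem_rel: "x \<in> V ==> y \<in> elts (bun (bun x)) ==> (y, x) \<in> mem_rel\<^sup>+"
proof -
  assume "x \<in> V" "y \<in> elts (bun (bun x))"
  then obtain a b where "(y, a) \<in> mem_rel" "(a, b) \<in> mem_rel" "(b, x) \<in> mem_rel"
    using Un_mem[of x] elts_Un[of x] elts_Un[of "bun x"] by (auto simp: mem_rel_def)
  then show ?thesis by (meson trancl.simps)
qed

lemma wf_children: "wf {(y, x). x \<in> V \<and> y \<in> elts (bun (bun x))}"
  by (rule wf_subset[OF wf_mem_rel_trancl]) (auto intro: child_mem_rel)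

lemma dterm_actn: "dterm V (\<lambda>s. actn (s 0) (s 1))"
proof -
  \<comment> \<open>The recursion runs on the pair of code and name, with the code held
    fixed.\<close>
  define C where "C w = mk ((\<lambda>y. opair (ufst w) y) ` elts (bun (bun (usnd w))))" for w :: 'u
  define F where "F w g = (if ufst w \<in> elts GG then
      mk ((\<lambda>z. opair (actc (ufst w) (ufst z)) (ap g (opair (ufst w) (usnd z)))) `
        elts (mk {z \<in> elts (usnd w). \<exists>p\<in>V. \<exists>y\<in>V. z = opair p y})) else mk {})" for w g
  have C: "dterm V (\<lambda>s. C (s 0))" unfolding C_def by (intro dintro)
  have F: "dterm V (\<lambda>s. F (s 0) (s 1))"
    unfolding F_def by (intro dintro dterm_comp2[OF dterm_actc] GG_mem empty_mem)
  have usndV: "usnd w \<in> V" if "w \<in> V" for w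
    using dterm_mem[OF dterm_usnd[OF dterm_var], of "\<lambda>_. w"] that by (simp add: env_def)
  have wf: "wf {(y, x). x \<in> V \<and> y \<in> elts (C x)}"
    by (rule wf_subset[OF wf_inv_image[OF wf_mem_rel_trancl], of _ usnd])
      (auto simp: C_def in_inv_image intro: child_mem_rel[OF usndV])
  have "dterm V (\<lambda>s. (\<lambda>w. actn (ufst w) (usnd w)) (s 0))"
  proof (rule recursion[OF C F wf])
    fix w :: 'u assume w: "w \<in> V"
    show "actn (ufst w) (usnd w) = F w (Gr (C w) (\<lambda>w. actn (ufst w) (usnd w)))"
    proof (cases "ufst w \<in> elts GG")
      case True
      then obtain \<pi> where \<pi>: "ufst w = code \<pi>" "\<pi> \<in> perms" by (auto simp: elts_GG)
      define x where "x = usnd w"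
      have xV: "x \<in> V" using usndV[OF w] by (simp add: x_def)
      have *: "opair (actc (code \<pi>) (ufst z)) (ap (Gr (C w) (\<lambda>w. actn (ufst w) (usnd w))) (opair (code \<pi>) (usnd z))) =
          opair (act_cond \<pi> p) (act_name \<pi> y)" if "z \<in> elts x" "z = opair p y" for z p y
      proof -
        have "p \<in> V" using opair_mem_elts xV that by blast
        moreover have "opair (code \<pi>) y \<in> elts (C w)"
          unfolding C_def elts_mk_image \<pi>(1) x_def[symmetric] using name_child[OF xV, of p y] that by auto
        ultimately show ?thesis using that by (simp add: actc_code actn_code[OF \<pi>(2)])
      qed
      have "elts (act_name \<pi> x) = elts (F w (Gr (C w) (\<lambda>w. actn (ufst w) (usnd w))))"
      proof -
        have "elts (F w (Gr (C w) (\<lambda>w. actn (ufst w) (usnd w)))) =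
            (\<lambda>z. opair (actc (code \<pi>) (ufst z)) (ap (Gr (C w) (\<lambda>w. actn (ufst w) (usnd w))) (opair (code \<pi>) (usnd z)))) `
              {z \<in> elts x. \<exists>p\<in>V. \<exists>y\<in>V. z = opair p y}"
          unfolding F_def if_P[OF True] unfolding elts_mk_image unfolding elts_mk_Collect \<pi>(1) x_def by (rule refl)
        also have "\<dots> = elts (act_name \<pi> x)"
        proof (intro equalityI subsetI)
          fix v assume "v \<in> elts (act_name \<pi> x)"
          then obtain p y where py: "v = opair (act_cond \<pi> p) (act_name \<pi> y)" "opair p y \<in> elts x"
            by (auto simp: elts_act_name)
          then have "p \<in> V" "y \<in> V" using opair_mem_elts xV by blast+
          then show "v \<in> (\<lambda>z. opair (actc (code \<pi>) (ufst z)) (ap (Gr (C w) (\<lambda>w. actn (ufst w) (usnd w))) (opair (code \<pi>) (usnd z)))) `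
              {z \<in> elts x. \<exists>p\<in>V. \<exists>y\<in>V. z = opair p y}"
            using py *[OF py(2) refl] by (intro image_eqI[of _ _ "opair p y"]) auto
        next
          fix v assume "v \<in> (\<lambda>z. opair (actc (code \<pi>) (ufst z)) (ap (Gr (C w) (\<lambda>w. actn (ufst w) (usnd w))) (opair (code \<pi>) (usnd z)))) `
              {z \<in> elts x. \<exists>p\<in>V. \<exists>y\<in>V. z = opair p y}"
          then obtain p y where py: "opair p y \<in> elts x" "v = opair (act_cond \<pi> p) (act_name \<pi> y)"
            using * by blast
          then show "v \<in> elts (act_name \<pi> x)" unfolding elts_act_name by blast
        qed
        finally show ?thesis by simp
      qed
      then have "act_name \<pi> x = F w (Gr (C w) (\<lambda>w. actn (ufst w) (usnd w)))" by (rule elts_inject)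
      then show ?thesis using \<pi> by (simp add: actn_code x_def)
    qed (simp add: F_def actn_def)
  qed
  then have "dterm V (\<lambda>s. (\<lambda>w. actn (ufst w) (usnd w)) (opair (s 0) (s 1)))"
    by (rule dterm_comp1) (intro dintro)
  then show ?thesis by simp
qed

lemma act_name_V:
  assumes "\<pi> \<in> perms" "x \<in> V" shows "act_name \<pi> x \<in> V"
  using dterm_mem[OF dterm_actn, of "\<lambda>n. if n = 0 then code \<pi> else x"] code_mem[OF assms(1)] assms
  by (simp add: env_def actn_code)

lemma act_cond_P:
  assumes \<pi>: "\<pi> \<in> perms" and p: "p \<in> P" shows "act_cond \<pi> p \<in> P"
proof -
  have inj: "inj \<pi>" using finitary_bij[OF \<pi>] bij_is_inj by blast
  have "act_cond \<pi> p \<in> V"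
    using dterm_mem[OF dterm_actc, of "\<lambda>n. if n = 0 then code \<pi> else p"] code_mem[OF \<pi>] P_V[OF p]
    by (simp add: env_def actc_code)
  moreover have "finite (elts (act_cond \<pi> p))"
  proof -
    have "elts (act_cond \<pi> p) = (\<lambda>z. opair (opair (ap (code \<pi>) (ufst (ufst z))) (usnd (ufst z))) (usnd z)) ` elts p"
    proof (intro equalityI subsetI)
      fix w assume "w \<in> elts (act_cond \<pi> p)"
      then show "w \<in> (\<lambda>z. opair (opair (ap (code \<pi>) (ufst (ufst z))) (usnd (ufst z))) (usnd z)) ` elts p"
        unfolding elts_act_cond by (auto intro!: image_eqI[rotated])
    qed (use P_shape[OF p] in \<open>force simp: elts_act_cond\<close>)
    then show ?thesis using finite_P[OF p] by simp
  qed
  moreover have "\<forall>z\<in>elts (act_cond \<pi> p). \<exists>n m. \<exists>i\<in>{0, 1}. z = entry n m (num i)"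
    unfolding elts_act_cond using P_shape[OF p] by fastforce
  moreover have "i = j" if xi: "opair x i \<in> elts (act_cond \<pi> p)" and xj: "opair x j \<in> elts (act_cond \<pi> p)" for x i j
  proof -
    obtain n m where nm: "x = opair (num (\<pi> n)) (num m)" "entry n m i \<in> elts p"
      using xi unfolding elts_act_cond by auto
    moreover from this xj have "entry n m j \<in> elts p"
      by (simp add: opair_act_cond[OF inj])
    ultimately show ?thesis using p unfolding Add_def by blast
  qed
  ultimately show ?thesis unfolding Add_def by blast
qed

lemma act_cond_id: "p \<in> P ==> act_cond id p = p"
  by (rule elts_inject) (use P_shape[of p] in \<open>fastforce simp: elts_act_cond\<close>)

lemma stronger_act: "stronger q p ==> stronger (act_cond \<pi> q) (act_cond \<pi> p)"
  unfolding stronger_def elts_act_cond by blast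

lemma act_cond_inv:
  assumes "\<pi> \<in> perms" "p \<in> P"
  shows "act_cond (pinv \<pi>) (act_cond \<pi> p) = p" "act_cond \<pi> (act_cond (pinv \<pi>) p) = p"
  by (simp_all add: act_cond_comp finitary_inv_comp[OF assms(1)] act_cond_id[OF assms(2)])

lemma act_name_id: "is_name V x ==> act_name id x = x"
proof (induction rule: is_name.induct)
  case (1 x)
  have "elts (act_name id x) = elts x"
    unfolding elts_act_name
  proof (intro equalityI subsetI)
    fix z assume "z \<in> {opair (act_cond id p) (act_name id y) |p y. opair p y \<in> elts x}"
    then obtain p y where "z = opair (act_cond id p) (act_name id y)" "opair p y \<in> elts x" by blast
    moreover from this(2) 1(2) obtain p' y' where "p' \<in> P" "act_name id y' = y'" "opair p y = opair p' y'" by blast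
    then have "p \<in> P" "act_name id y = y" by auto
    ultimately show "z \<in> elts x" using act_cond_id by simp
  next
    fix z assume z: "z \<in> elts x"
    then obtain p y where "p \<in> P" "act_name id y = y" "z = opair p y" using 1(2) by blast
    then show "z \<in> {opair (act_cond id p) (act_name id y) |p y. opair p y \<in> elts x}"
      using z act_cond_id[of p] by (intro CollectI exI[of _ p] exI[of _ y]) simp
  qed
  then show ?case by (rule elts_inject)
qed

lemma name_act: "\<pi> \<in> perms ==> is_name V x ==> is_name V (act_name \<pi> x)"
proof (rotate_tac 1, induction rule: is_name.induct)
  case (1 x)
  show ?case
  proof (rule is_name.intros)
    show "act_name \<pi> x \<in> V" using act_name_V 1 by blast
    show "\<forall>z\<in>elts (act_name \<pi> x). \<exists>p y. p \<in> P \<and> is_name V y \<and> z = opair p y"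
    proof
      fix z assume "z \<in> elts (act_name \<pi> x)"
      then obtain p y where z: "z = opair (act_cond \<pi> p) (act_name \<pi> y)" "opair p y \<in> elts x"
        by (auto simp: elts_act_name)
      with 1(2) have "p \<in> P" "is_name V (act_name \<pi> y)" using 1(3) by fastforce+
      then show "\<exists>p y. p \<in> P \<and> is_name V y \<and> z = opair p y" using z(1) act_cond_P[OF 1(3)] by blast
    qed
  qed
qed

lemma act_name_inv:
  assumes "\<pi> \<in> perms" "is_name V x"
  shows "act_name (pinv \<pi>) (act_name \<pi> x) = x" "act_name \<pi> (act_name (pinv \<pi>) x) = x"
  by (simp_all add: act_name_comp finitary_inv_comp[OF assms(1)] act_name_id[OF assms(2)])

text \<open>Supports are taken to be initial segments of the indices; they are linearly ordered, so
  finitely many names have a common one.\<close>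

definition supports :: "nat => 'u => bool" where
  "supports k x \<longleftrightarrow> (\<forall>\<pi>\<in>fixer {..<k}. act_name \<pi> x = x)"

lemma supports_mono: "supports k x ==> k \<le> l ==> supports l x"
  using fixer_mono[of "{..<k}" "{..<l}"] by (auto simp: supports_def)

lemma sym_group_filter:
  assumes "is_name V x"
  shows "sym_group x \<in> sym_filter \<longleftrightarrow> (\<exists>k. supports k x)"
proof
  assume "sym_group x \<in> sym_filter"
  then show "\<exists>k. supports k x" using sym_filter_fixer[of "sym_group x"] by (auto simp: supports_def sym_group_def)
next
  assume "\<exists>k. supports k x"
  then obtain k where "fixer {..<k} \<subseteq> sym_group x"
    using fixer_carrier by (auto simp: supports_def sym_group_def)
  moreover have "fixer {..<k} \<in> sym_filter" by (rule sym_filter.base) simp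
  moreover have "subgroup (sym_group x) finitary_group"
  proof (rule group.subgroupI[OF group_finitary])
    show "sym_group x \<subseteq> perms" by (auto simp: sym_group_def)
    show "sym_group x \<noteq> {}" using act_name_id[OF assms] finitary_id unfolding sym_group_def by blast
    fix \<pi> assume \<pi>: "\<pi> \<in> sym_group x"
    then have "pinv \<pi> \<in> sym_group x"
      using act_name_inv(1)[OF _ assms, of \<pi>] finitary_inv[of \<pi>] by (simp add: sym_group_def)
    then show "inv\<^bsub>finitary_group\<^esub> \<pi> \<in> sym_group x"
      using inv_finitary \<pi> by (simp add: sym_group_def)
    fix \<sigma> assume "\<sigma> \<in> sym_group x"
    then show "\<pi> \<otimes>\<^bsub>finitary_group\<^esub> \<sigma> \<in> sym_group x"
      using \<pi> finitary_comp act_name_comp[of \<pi> \<sigma> x] by (simp add: sym_group_def) (simp add: finitary_group_def)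
  qed
  ultimately show "sym_group x \<in> sym_filter" using sym_filter.upward by blast
qed

abbreviation HS :: "'u => bool" where "HS \<equiv> hereditarily_symmetric V"

lemma HS_name: "HS x ==> is_name V x"
  by (cases rule: hereditarily_symmetric.cases) auto

lemma name_V: "is_name V x ==> x \<in> V"
  by (cases rule: is_name.cases) auto

lemma HS_V: "HS x ==> x \<in> V"
  using HS_name name_V by blast

lemma HS_child: "HS x ==> opair p y \<in> elts x ==> HS y"
  by (cases rule: hereditarily_symmetric.cases) auto

lemma HS_shape: "HS x ==> z \<in> elts x ==> \<exists>p\<in>P. \<exists>y. HS y \<and> z = opair p y"
proof -
  assume *: "HS x" "z \<in> elts x"
  then obtain p y where "p \<in> P" "z = opair p y"
    using is_name.cases[OF HS_name[OF *(1)]] by blast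
  with * HS_child show ?thesis by blast
qed

lemma HS_cond: "HS x ==> opair p y \<in> elts x ==> p \<in> P"
  using HS_shape[of x "opair p y"] by auto

lemma HS_supports: "HS x ==> \<exists>k. supports k x"
proof -
  assume x: "HS x"
  then have "sym_group x \<in> sym_filter" by cases
  then show ?thesis using sym_group_filter[OF HS_name[OF x]] by blast
qed

lemma HS_intro:
  assumes "x \<in> V" "\<And>z. z \<in> elts x ==> \<exists>p\<in>P. \<exists>y. HS y \<and> z = opair p y" "supports k x"
  shows "HS x"
proof -
  have name: "is_name V x" using assms(1,2) HS_name by (blast intro: is_name.intros)
  show ?thesis
    by (rule hereditarily_symmetric.intros[OF name]) (use sym_group_filter[OF name] assms(2,3) in fastforce)+
qed

text \<open>By conjugation with \<pi>, the image under \<pi> of a support of \<open>x\<close>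
  supports the moved name; \<open>l\<close> bounds this image.\<close>

lemma supports_act:
  assumes \<pi>: "\<pi> \<in> perms" and x: "is_name V x" and k: "supports k x"
  shows "\<exists>l. supports l (act_name \<pi> x)"
proof -
  obtain l where l: "\<pi> ` {..<k} \<subseteq> {..<l}" using finite_nat_iff_bounded[of "\<pi> ` {..<k}"] by auto
  have "act_name \<sigma> (act_name \<pi> x) = act_name \<pi> x" if \<sigma>: "\<sigma> \<in> fixer {..<l}" for \<sigma>
  proof -
    have "pinv \<pi> \<circ> (\<sigma> \<circ> \<pi>) \<in> fixer {..<k}"
      unfolding fixer_def
    proof (intro CollectI conjI ballI)
      show "pinv \<pi> \<circ> (\<sigma> \<circ> \<pi>) \<in> perms"
        using \<pi> \<sigma> finitary_comp finitary_inv fixer_carrier by metis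
      fix n assume "n \<in> {..<k}"
      then have "\<pi> n \<in> {..<l}" using l by blast
      then have "\<sigma> (\<pi> n) = \<pi> n" using \<sigma> by (simp add: fixer_def)
      then show "(pinv \<pi> \<circ> (\<sigma> \<circ> \<pi>)) n = n" using finitary_bij[OF \<pi>] by (simp add: bij_is_inj)
    qed
    then have "act_name (pinv \<pi>) (act_name \<sigma> (act_name \<pi> x)) = x"
      using k by (simp add: supports_def act_name_comp)
    then have "act_name \<pi> (act_name (pinv \<pi>) (act_name \<sigma> (act_name \<pi> x))) = act_name \<pi> x" by simp
    moreover have "is_name V (act_name \<sigma> (act_name \<pi> x))"
      using name_act[OF fixer_carrier[OF \<sigma>]] name_act[OF \<pi> x] by blast
    ultimately show ?thesis using act_name_inv(2)[OF \<pi>] by simp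
  qed
  then show ?thesis by (auto simp: supports_def)
qed

lemma HS_act: "\<pi> \<in> perms ==> HS x ==> HS (act_name \<pi> x)"
proof (induction x rule: name_induct)
  case (step x)
  obtain k where "supports k x" using HS_supports[OF step.prems(2)] by blast
  then obtain l where l: "supports l (act_name \<pi> x)"
    using supports_act[OF step.prems(1) HS_name[OF step.prems(2)]] by blast
  show ?case
  proof (rule HS_intro[OF _ _ l])
    show "act_name \<pi> x \<in> V" using act_name_V step.prems HS_V by blast
    fix z assume "z \<in> elts (act_name \<pi> x)"
    then obtain p y where z: "z = opair (act_cond \<pi> p) (act_name \<pi> y)" "opair p y \<in> elts x"
      by (auto simp: elts_act_name)
    then show "\<exists>p\<in>P. \<exists>y. HS y \<and> z = opair p y"
      using step.IH[OF z(2) step.prems(1) HS_child[OF step.prems(2) z(2)]]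
        act_cond_P[OF step.prems(1) HS_cond[OF step.prems(2) z(2)]] by blast
  qed
qed

text \<open>\<open>supports\<close> written with codes of permutations, as a formula over
  \<open>V\<close>.\<close>

definition sup_in :: "'u => 'u => bool" where
  "sup_in k x \<longleftrightarrow> (\<forall>u\<in>elts GG. (\<forall>n\<in>elts k. ap u n = n) --> actn u x = x)"

lemma sup_in_num: "sup_in (num k) x \<longleftrightarrow> supports k x"
  unfolding sup_in_def supports_def elts_GG fixer_def by (auto simp: elts_num actn_code)

lemma definable_sup_in [dintro]:
  "dterm V t ==> dterm V u ==> definable V (\<lambda>s. sup_in (t s) (u s))"
  by (rule definable_comp2[where R = sup_in])
    (unfold sup_in_def, intro dintro dterm_comp2[OF dterm_actn] GG_mem)

lemma definable_HS: "definable V (\<lambda>s. HS (s 0))"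
proof -
  define F :: "'u => 'u => 'u" where "F x g = mk {z \<in> elts (num 1). (\<forall>w\<in>elts x. \<exists>p\<in>elts PP. \<exists>y\<in>V. w = opair p y \<and> ap g y = num 1) \<and>
      (\<exists>k\<in>elts omega. sup_in k x)}" for x g :: 'u
  have F: "dterm V (\<lambda>s. F (s 0) (s 1))"
    unfolding F_def by (intro dintro num_mem PP_mem omega_mem)
  \<comment> \<open>The recursion theorem speaks of functions, so the predicate is replaced by its
    characteristic function with values 1 and 0.\<close>
  define H where "H x = mk {z \<in> elts (num 1 :: 'u). HS x}" for x
  have num1: "elts (num 1 :: 'u) = {mk {}}" by (auto simp: elts_num)
  have H1: "H x = num 1 \<longleftrightarrow> HS x" for x
  proof (cases "HS x")
    case False
    then have "elts (H x) = {}" by (simp add: H_def)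
    then have "H x \<noteq> num 1" using num1 by (metis insert_not_empty)
    with False show ?thesis by blast
  qed (simp add: H_def)
  have C: "dterm V (\<lambda>s. bun (bun (s 0)))" by (intro dintro)
  have "dterm V (\<lambda>s. H (s 0))"
  proof (rule recursion[OF C F wf_children])
    fix x :: 'u assume x: "x \<in> V"
    have "HS x \<longleftrightarrow> (\<forall>w\<in>elts x. \<exists>p\<in>elts PP. \<exists>y\<in>V. w = opair p y \<and> ap (Gr (bun (bun x)) H) y = num 1) \<and>
        (\<exists>k\<in>elts omega. sup_in k x)" (is "_ \<longleftrightarrow> ?A \<and> ?B")
    proof
      assume h: "HS x"
      have ?A
      proof
        fix w assume w: "w \<in> elts x"
        then obtain p y where py: "p \<in> P" "HS y" "w = opair p y" using HS_shape[OF h] by blast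
        then have "ap (Gr (bun (bun x)) H) y = num 1" using name_child[OF x, of p y] w H1 by simp
        then show "\<exists>p\<in>elts PP. \<exists>y\<in>V. w = opair p y \<and> ap (Gr (bun (bun x)) H) y = num 1"
          using py HS_V elts_PP by blast
      qed
      moreover have ?B using HS_supports[OF h] sup_in_num num_omega by blast
      ultimately show "?A \<and> ?B" by blast
    next
      assume ab: "?A \<and> ?B"
      then obtain k where "supports k x" using sup_in_num by (auto simp: elts_omega)
      then show "HS x"
      proof (rule HS_intro[OF x, rotated])
        fix z assume z: "z \<in> elts x"
        then obtain p y where py: "p \<in> P" "z = opair p y" "ap (Gr (bun (bun x)) H) y = num 1"
          using ab elts_PP by blast
        then have "HS y" using name_child[OF x, of p y] z H1 by simp
        then show "\<exists>p\<in>P. \<exists>y. HS y \<and> z = opair p y" using py by blast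
      qed
    qed
    then show "H x = F x (Gr (bun (bun x)) H)" unfolding H_def[of x] F_def by presburger
  qed
  then have "definable V (\<lambda>s. H (s 0) = num 1)" by (intro dintro num_mem)
  then show ?thesis by (simp only: H1)
qed

lemma dterm_check [dintro]:
  assumes "dterm V t" shows "dterm V (\<lambda>s. check (t s))"
proof -
  define F where "F x g = mk ((\<lambda>y. opair (mk {}) (ap g y)) ` elts x)" for x g :: 'u
  have F: "dterm V (\<lambda>s. F (s 0) (s 1))" unfolding F_def by (intro dintro empty_mem)
  have wf: "wf {(y, x). x \<in> V \<and> y \<in> elts x}" by (rule wf_subset[OF wf_elts]) auto
  have "dterm V (\<lambda>s. check (s 0))"
  proof (rule recursion[of "\<lambda>x. x", OF dterm_var F wf])
    fix x :: 'u
    have "(\<lambda>y. opair (mk {}) (ap (Gr x check) y)) ` elts x = (\<lambda>y. opair (mk {}) (check y)) ` elts x"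
      by (rule image_cong) simp_all
    then show "check x = F x (Gr x check)" unfolding F_def check.simps[of x] by simp
  qed
  then show ?thesis by (rule dterm_comp1) fact
qed

lemma check_V: "x \<in> V ==> check x \<in> V"
  using dterm_mem[OF dterm_check[OF dterm_var], of "\<lambda>_. x"] by (simp add: env_def)

lemma HS_check: "x \<in> V ==> HS (check x)"
proof (induction x rule: mem_induct)
  case (step x)
  show ?case
  proof (rule HS_intro[of _ 0])
    fix z assume "z \<in> elts (check x)"
    then show "\<exists>p\<in>P. \<exists>y. HS y \<and> z = opair p y"
      using step.IH V_trans[OF _ step.prems] by (auto simp: elts_check)
  qed (use check_V step.prems in \<open>auto simp: supports_def\<close>)
qed

lemma dterm_opn [dintro]:
  "dterm V t ==> dterm V u ==> dterm V (\<lambda>s. opn (t s) (u s))"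
  unfolding opn_def upn_def by (intro dintro empty_mem)

lemma HS_finite:
  assumes "finite A" "\<And>x. x \<in> A ==> HS x"
  shows "HS (mk (opair (mk {}) ` A))"
proof -
  have "\<exists>k. \<forall>x\<in>A. supports k x"
    using assms
  proof (induction A)
    case (insert x A)
    obtain k where k: "\<forall>x\<in>A. supports k x" using insert.IH insert.prems by (meson insertI2)
    obtain l where l: "supports l x" using HS_supports insert.prems by blast
    have "\<forall>y\<in>insert x A. supports (max k l) y" using k l supports_mono by (metis insert_iff max.cobounded1 max.cobounded2)
    then show ?case by blast
  qed simp
  then obtain k where k: "\<forall>x\<in>A. supports k x" by blast
  have el: "elts (mk (opair (mk {}) ` A)) = opair (mk {}) ` A" using assms(1) by (simp add: elts_mk_finite)
  show ?thesis
  proof (rule HS_intro)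
    show "mk (opair (mk {}) ` A) \<in> V" using assms HS_V by (intro finite_mem) auto
    show "supports k (mk (opair (mk {}) ` A))"
      unfolding supports_def
    proof
      fix \<pi> assume \<pi>: "\<pi> \<in> fixer {..<k}"
      have "elts (act_name \<pi> (mk (opair (mk {}) ` A))) = elts (mk (opair (mk {}) ` A))"
        unfolding elts_act_name el using k \<pi> by (force simp: supports_def)
      then show "act_name \<pi> (mk (opair (mk {}) ` A)) = mk (opair (mk {}) ` A)" by (rule elts_inject)
    qed
  qed (use assms(2) el in auto)
qed

lemma HS_opn: "HS x ==> HS y ==> HS (opn x y)"
proof -
  have upn: "HS (upn x y)" if "HS x" "HS y" for x y
  proof -
    have "HS (mk (opair (mk {}) ` {x, y}))" by (rule HS_finite) (use that in auto)
    then show ?thesis by (simp add: upn_def)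
  qed
  show "HS x ==> HS y ==> HS (opn x y)" by (simp add: opn_def upn)
qed

end

section \<open>Forcing\<close>

context
  notes conj_cong [fundef_cong]
begin

text \<open>Extensionality in density form: whatever one name offers as a member is, densely below
  \<open>p\<close>, matched by the other name. Membership is unfolded in place, so every recursive
  call descends in the first name and a single recursion suffices. The congruence rule lets the
  termination proof see that \<open>z\<close> occurs in \<open>x\<close>.\<close>

function feq :: "'u::set_universe set => 'u => 'u => 'u => bool" where
  "feq A x y p \<longleftrightarrow>
    (\<forall>q z. opair q z \<in> elts x --> (\<forall>r\<in>A. stronger r p \<and> stronger r q -->
      (\<exists>r'\<in>A. stronger r' r \<and> (\<exists>q' z'. opair q' z' \<in> elts y \<and> stronger r' q' \<and> feq A z z' r')))) \<and>
    (\<forall>q' z'. opair q' z' \<in> elts y --> (\<forall>r\<in>A. stronger r p \<and> stronger r q' -->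
      (\<exists>r'\<in>A. stronger r' r \<and> (\<exists>q z. opair q z \<in> elts x \<and> stronger r' q \<and> feq A z z' r'))))"
  by auto
termination
  by (relation "inv_image (mem_rel\<^sup>+) (\<lambda>(A, x, y, p). x)") (auto simp: wf_mem_rel_trancl opair_snd_mem_rel)

end

declare feq.simps [simp del]

context zfc_model
begin

definition forces_eq :: "'u => 'u => 'u => bool" where
  "forces_eq p x y \<longleftrightarrow> p \<in> P \<and> feq P x y p"

definition forces_mem :: "'u => 'u => 'u => bool" where
  "forces_mem p x y \<longleftrightarrow> p \<in> P \<and> (\<forall>r\<in>P. stronger r p -->
    (\<exists>r'\<in>P. stronger r' r \<and> (\<exists>q z. opair q z \<in> elts y \<and> stronger r' q \<and> forces_eq r' x z)))"

lemma definable_forces_eq: "definable V (\<lambda>s. forces_eq (s 0) (s 1) (s 2))"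
proof -
  define C where "C w = cprod (bun (bun (ufst w))) (bun (bun (usnd w)))" for w :: 'u
  \<comment> \<open>The recursion is on pairs of names, and its value is the set of all conditions
    forcing equality, so that the condition is no argument of the recursion.\<close>
  define H where "H w = mk {p \<in> elts PP. feq P (ufst w) (usnd w) p}" for w
  define F where "F w g = mk {p \<in> elts PP.
    (\<forall>c\<in>elts (ufst w). \<forall>q\<in>V. \<forall>z\<in>V. c = opair q z --> (\<forall>r\<in>elts PP. stronger r p \<and> stronger r q -->
      (\<exists>r'\<in>elts PP. stronger r' r \<and> (\<exists>c'\<in>elts (usnd w). \<exists>q'\<in>V. \<exists>z'\<in>V. c' = opair q' z' \<and> stronger r' q' \<and>
         r' \<in> elts (ap g (opair z z')))))) \<and>
    (\<forall>c'\<in>elts (usnd w). \<forall>q'\<in>V. \<forall>z'\<in>V. c' = opair q' z' --> (\<forall>r\<in>elts PP. stronger r p \<and> stronger r q' -->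
      (\<exists>r'\<in>elts PP. stronger r' r \<and> (\<exists>c\<in>elts (ufst w). \<exists>q\<in>V. \<exists>z\<in>V. c = opair q z \<and> stronger r' q \<and>
         r' \<in> elts (ap g (opair z z'))))))}" for w g
  have C: "dterm V (\<lambda>s. C (s 0))" unfolding C_def by (intro dintro)
  have F: "dterm V (\<lambda>s. F (s 0) (s 1))" unfolding F_def by (intro dintro PP_mem)
  have fst_snd: "ufst w \<in> V" "usnd w \<in> V" if "w \<in> V" for w
    using dterm_mem[OF dterm_ufst[OF dterm_var], of "\<lambda>_. w"] dterm_mem[OF dterm_usnd[OF dterm_var], of "\<lambda>_. w"] that
    by (simp_all add: env_def)
  have elts_C: "elts (C w) = {opair z z' | z z'. z \<in> elts (bun (bun (ufst w))) \<and> z' \<in> elts (bun (bun (usnd w)))}"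
    if "w \<in> V" for w
    unfolding C_def by (rule elts_cprod) (use fst_snd[OF that] Un_mem in auto)
  have wf: "wf {(y, x). x \<in> V \<and> y \<in> elts (C x)}"
  proof (rule wf_subset[OF wf_inv_image[OF wf_mem_rel_trancl], of _ ufst], clarify)
    fix v w assume w: "w \<in> V" "v \<in> elts (C w)"
    then obtain z z' where "v = opair z z'" "z \<in> elts (bun (bun (ufst w)))" unfolding elts_C[OF w(1)] by blast
    then show "(v, w) \<in> inv_image (mem_rel\<^sup>+) ufst"
      using child_mem_rel[OF fst_snd(1)[OF w(1)]] by (simp add: in_inv_image)
  qed
  have Hd: "dterm V (\<lambda>s. H (s 0))"
  proof (rule recursion[OF C F wf])
    fix w :: 'u assume w: "w \<in> V"
    define x y where "x = ufst w" and "y = usnd w"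
    have xy: "x \<in> V" "y \<in> V" using fst_snd[OF w] by (simp_all add: x_def y_def)
    have look: "r \<in> elts (ap (Gr (C w) H) (opair z z')) \<longleftrightarrow> r \<in> P \<and> feq P z z' r"
      if "opair q z \<in> elts x" "opair q' z' \<in> elts y" for q z q' z' r
    proof -
      have "opair z z' \<in> elts (C w)"
        unfolding elts_C[OF w] using name_child[OF xy(1) that(1)] name_child[OF xy(2) that(2)]
        by (simp add: x_def y_def)
      then have "ap (Gr (C w) H) (opair z z') = mk {p \<in> elts PP. feq P z z' p}" by (simp add: H_def)
      then show ?thesis unfolding elts_PP[symmetric] by simp
    qed
    have V1: "q \<in> V \<and> z \<in> V" if "opair q z \<in> elts x" for q z using opair_mem_elts[OF that xy(1)] .
    have V2: "q \<in> V \<and> z \<in> V" if "opair q z \<in> elts y" for q z using opair_mem_elts[OF that xy(2)] .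
    have "feq P x y p \<longleftrightarrow>
      (\<forall>c\<in>elts x. \<forall>q\<in>V. \<forall>z\<in>V. c = opair q z --> (\<forall>r\<in>P. stronger r p \<and> stronger r q -->
        (\<exists>r'\<in>P. stronger r' r \<and> (\<exists>c'\<in>elts y. \<exists>q'\<in>V. \<exists>z'\<in>V. c' = opair q' z' \<and> stronger r' q' \<and>
           r' \<in> elts (ap (Gr (C w) H) (opair z z')))))) \<and>
      (\<forall>c'\<in>elts y. \<forall>q'\<in>V. \<forall>z'\<in>V. c' = opair q' z' --> (\<forall>r\<in>P. stronger r p \<and> stronger r q' -->
        (\<exists>r'\<in>P. stronger r' r \<and> (\<exists>c\<in>elts x. \<exists>q\<in>V. \<exists>z\<in>V. c = opair q z \<and> stronger r' q \<and>
           r' \<in> elts (ap (Gr (C w) H) (opair z z'))))))" for p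
    proof -
      define E1 E2 where "E1 z r' \<longleftrightarrow> (\<exists>q' z'. opair q' z' \<in> elts y \<and> stronger r' q' \<and> feq P z z' r')"
        and "E2 z r' \<longleftrightarrow> (\<exists>c'\<in>elts y. \<exists>q'\<in>V. \<exists>z'\<in>V. c' = opair q' z' \<and> stronger r' q' \<and>
          r' \<in> elts (ap (Gr (C w) H) (opair z z')))" for z r'
      define E3 E4 where "E3 z' r' \<longleftrightarrow> (\<exists>q z. opair q z \<in> elts x \<and> stronger r' q \<and> feq P z z' r')"
        and "E4 z' r' \<longleftrightarrow> (\<exists>c\<in>elts x. \<exists>q\<in>V. \<exists>z\<in>V. c = opair q z \<and> stronger r' q \<and>
          r' \<in> elts (ap (Gr (C w) H) (opair z z')))" for z' r'
      have 1: "E1 z r' \<longleftrightarrow> E2 z r'" if "opair q z \<in> elts x" "r' \<in> P" for q z r'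
        using look[OF that(1)] V2 that(2) unfolding E1_def E2_def by blast
      have 2: "E3 z' r' \<longleftrightarrow> E4 z' r'" if "opair q' z' \<in> elts y" "r' \<in> P" for q' z' r'
        using look[OF _ that(1)] V1 that(2) unfolding E3_def E4_def by blast
      have X: "(\<forall>c\<in>elts v. \<forall>q\<in>V. \<forall>z\<in>V. c = opair q z --> X q z) \<longleftrightarrow> (\<forall>q z. opair q z \<in> elts v --> X q z)"
        if "v \<in> {x, y}" for v and X :: "'u => 'u => bool"
        using V1 V2 that by blast
      have A: "(\<forall>q z. opair q z \<in> elts x --> (\<forall>r\<in>P. stronger r p \<and> stronger r q --> (\<exists>r'\<in>P. stronger r' r \<and> E1 z r'))) \<longleftrightarrow>
          (\<forall>c\<in>elts x. \<forall>q\<in>V. \<forall>z\<in>V. c = opair q z --> (\<forall>r\<in>P. stronger r p \<and> stronger r q --> (\<exists>r'\<in>P. stronger r' r \<and> E2 z r')))"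
        unfolding X[OF insertI1] by (intro iff_allI imp_cong ball_cong bex_cong conj_cong refl 1)
      have B: "(\<forall>q z. opair q z \<in> elts y --> (\<forall>r\<in>P. stronger r p \<and> stronger r q --> (\<exists>r'\<in>P. stronger r' r \<and> E3 z r'))) \<longleftrightarrow>
          (\<forall>c\<in>elts y. \<forall>q\<in>V. \<forall>z\<in>V. c = opair q z --> (\<forall>r\<in>P. stronger r p \<and> stronger r q --> (\<exists>r'\<in>P. stronger r' r \<and> E4 z r')))"
        unfolding X[OF insertI2[OF singletonI]] by (intro iff_allI imp_cong ball_cong bex_cong conj_cong refl 2)
      show ?thesis
        unfolding feq.simps[of P x y p] using A B unfolding E1_def E2_def E3_def E4_def by simp
    qed
    then show "H w = F w (Gr (C w) H)"
      unfolding H_def[of w] F_def elts_PP x_def[symmetric] y_def[symmetric] by simp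
  qed
  have "definable V (\<lambda>s. s 0 \<in> elts (H (opair (s 1) (s 2))))"
    by (intro dintro dterm_comp1[OF Hd])
  moreover have "forces_eq p x y \<longleftrightarrow> p \<in> elts (H (opair x y))" for p x y
    unfolding forces_eq_def H_def elts_mk_Collect unfolding elts_PP by simp
  ultimately show ?thesis by simp
qed

lemma definable_forces_mem: "definable V (\<lambda>s. forces_mem (s 0) (s 1) (s 2))"
proof -
  have "definable V (\<lambda>s. s 0 \<in> elts PP \<and> (\<forall>r\<in>elts PP. stronger r (s 0) -->
    (\<exists>r'\<in>elts PP. stronger r' r \<and> (\<exists>q\<in>V. \<exists>z\<in>V. opair q z \<in> elts (s 2) \<and> stronger r' q \<and> forces_eq r' (s 1) z))))"
    by (intro dintro definable_comp3[OF definable_forces_eq] PP_mem)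
  then show ?thesis
  proof (rule definable_cong[THEN iffD1, rotated])
    fix s assume "env V s"
    then have "q \<in> V \<and> z \<in> V" if "opair q z \<in> elts (s 2)" for q z
      using opair_mem_elts[OF that] by (simp add: env_def)
    then show "(s 0 \<in> elts PP \<and> (\<forall>r\<in>elts PP. stronger r (s 0) -->
        (\<exists>r'\<in>elts PP. stronger r' r \<and> (\<exists>q\<in>V. \<exists>z\<in>V. opair q z \<in> elts (s 2) \<and> stronger r' q \<and> forces_eq r' (s 1) z)))) \<longleftrightarrow>
      forces_mem (s 0) (s 1) (s 2)"
      unfolding forces_mem_def elts_PP by blast
  qed
qed

text \<open>The quantifier ranges over hereditarily symmetric names only; this is the forcing
  relation of the symmetric model, not of the full generic extension.\<close>

primrec forces :: "fm => 'u => (nat => 'u) => bool" where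
  "forces (Mem i j) p s = forces_mem p (s i) (s j)"
| "forces (Equ i j) p s = forces_eq p (s i) (s j)"
| "forces (Neg \<phi>) p s = (p \<in> P \<and> (\<forall>q\<in>P. stronger q p --> \<not> forces \<phi> q s))"
| "forces (Conj \<phi> \<psi>) p s = (forces \<phi> p s \<and> forces \<psi> p s)"
| "forces (All i \<phi>) p s = (p \<in> P \<and> (\<forall>x. HS x --> forces \<phi> p (s(i := x))))"

lemma definable_forces: "definable V (\<lambda>s. forces \<phi> (s 0) (\<lambda>n. s (Suc n)))"
proof (induction \<phi>)
  case (Mem i j)
  show ?case unfolding forces.simps by (intro definable_comp3[OF definable_forces_mem] dintro)
next
  case (Equ i j)
  show ?case unfolding forces.simps by (intro definable_comp3[OF definable_forces_eq] dintro)
next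
  case (Neg \<phi>)
  have "definable V (\<lambda>s. (\<lambda>s. forces \<phi> (s 0) (\<lambda>n. s (Suc n))) (\<lambda>n. if n = 0 then s 0 else s (Suc n)))"
    by (rule definable_subst[OF Neg]) (intro dterm_if_const dintro)
  then have "definable V (\<lambda>s. forces \<phi> (s 0) (\<lambda>n. s (Suc (Suc n))))" by simp
  then have "definable V (\<lambda>s. s 0 \<in> elts PP \<and> (\<forall>q\<in>elts PP. stronger q (s 0) --> \<not> forces \<phi> q (\<lambda>n. s (Suc n))))"
    by (intro dintro PP_mem)
  then show ?case by (simp only: forces.simps elts_PP)
next
  case (Conj \<phi> \<psi>)
  then show ?case unfolding forces.simps by (intro dintro)
next
  case (All i \<phi>)
  have "definable V (\<lambda>s. (\<lambda>s. forces \<phi> (s 0) (\<lambda>n. s (Suc n)))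
      (\<lambda>n. if n = 0 then s 1 else if n = Suc i then s 0 else s (Suc n)))"
    by (rule definable_subst[OF All]) (intro dterm_if_const dintro)
  moreover have "(\<lambda>n. if Suc n = Suc i then s 0 else s (Suc (Suc n))) = (\<lambda>n. s (Suc (Suc n)))(i := s 0)" for s :: "nat => 'u"
    by auto
  ultimately have "definable V (\<lambda>s. forces \<phi> (s 1) ((\<lambda>n. s (Suc (Suc n)))(i := s 0)))" by simp
  then have "definable V (\<lambda>s. s 0 \<in> elts PP \<and> (\<forall>x\<in>V. HS x --> forces \<phi> (s 0) ((\<lambda>n. s (Suc n))(i := x))))"
    by (intro dintro definable_comp1[OF definable_HS] PP_mem) simp
  moreover have "(\<forall>x\<in>V. HS x --> R x) \<longleftrightarrow> (\<forall>x. HS x --> R x)" for R using HS_V by blast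
  ultimately show ?case by (simp only: forces.simps elts_PP)
qed

lemma forces_eq_mono: "forces_eq p x y ==> q \<in> P ==> stronger q p ==> forces_eq q x y"
  unfolding forces_eq_def feq.simps[of P x y] using stronger_trans by meson

lemma forces_mono: "forces \<phi> p s ==> q \<in> P ==> stronger q p ==> forces \<phi> q s"
proof (induction \<phi> arbitrary: s)
  case (Mem i j)
  then show ?case unfolding forces.simps forces_mem_def using stronger_trans by meson
next
  case (Equ i j)
  then show ?case using forces_eq_mono by simp
next
  case (Neg \<phi>)
  then show ?case using stronger_trans by (meson forces.simps(3))
qed auto

lemma forces_eq_dense:
  assumes p: "p \<in> P" and dense: "\<And>r. r \<in> P ==> stronger r p ==> \<exists>r'\<in>P. stronger r' r \<and> forces_eq r' x y"
  shows "forces_eq p x y"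
  unfolding forces_eq_def feq.simps[of P x y]
proof (intro conjI allI impI ballI p)
  fix q z r assume *: "opair q z \<in> elts x" "r \<in> P" "stronger r p \<and> stronger r q"
  then obtain r' where r': "r' \<in> P" "stronger r' r" "feq P x y r'" using dense by (auto simp: forces_eq_def)
  have "stronger r' r'" "stronger r' q" using r'(2) * stronger_trans by auto
  with r' have "\<exists>r''\<in>P. stronger r'' r' \<and> (\<exists>q' z'. opair q' z' \<in> elts y \<and> stronger r'' q' \<and> feq P z z' r'')"
    using *(1) unfolding feq.simps[of P x y r'] by blast
  then show "\<exists>r''\<in>P. stronger r'' r \<and> (\<exists>q' z'. opair q' z' \<in> elts y \<and> stronger r'' q' \<and> feq P z z' r'')"
    using r'(2) stronger_trans by blast
next
  fix q z r assume *: "opair q z \<in> elts y" "r \<in> P" "stronger r p \<and> stronger r q"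
  then obtain r' where r': "r' \<in> P" "stronger r' r" "feq P x y r'" using dense by (auto simp: forces_eq_def)
  have "stronger r' r'" "stronger r' q" using r'(2) * stronger_trans by auto
  with r' have "\<exists>r''\<in>P. stronger r'' r' \<and> (\<exists>q' z'. opair q' z' \<in> elts x \<and> stronger r'' q' \<and> feq P z' z r'')"
    using *(1) unfolding feq.simps[of P x y r'] by blast
  then show "\<exists>r''\<in>P. stronger r'' r \<and> (\<exists>q' z'. opair q' z' \<in> elts x \<and> stronger r'' q' \<and> feq P z' z r'')"
    using r'(2) stronger_trans by blast
qed

text \<open>Its contrapositive is what the truth lemma needs: if \<open>p\<close> does not force
  \<phi>, some stronger condition has no extension forcing \<phi>.\<close>

lemma forces_dense:
  "p \<in> P ==> (\<And>r. r \<in> P ==> stronger r p ==> \<exists>r'\<in>P. stronger r' r \<and> forces \<phi> r' s) ==> forces \<phi> p s"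
proof (induction \<phi> arbitrary: s)
  case (Mem i j)
  show ?case
    unfolding forces.simps forces_mem_def
  proof (intro conjI ballI impI Mem.prems(1))
    fix r assume "r \<in> P" "stronger r p"
    then obtain r' where r': "r' \<in> P" "stronger r' r" "forces_mem r' (s i) (s j)" using Mem.prems(2) by force
    then have "\<exists>r''\<in>P. stronger r'' r' \<and> (\<exists>q z. opair q z \<in> elts (s j) \<and> stronger r'' q \<and> forces_eq r'' (s i) z)"
      using stronger_refl unfolding forces_mem_def by blast
    then show "\<exists>r''\<in>P. stronger r'' r \<and> (\<exists>q z. opair q z \<in> elts (s j) \<and> stronger r'' q \<and> forces_eq r'' (s i) z)"
      using r'(2) stronger_trans by blast
  qed
next
  case (Equ i j)
  then show ?case using forces_eq_dense by simp
next
  case (Neg \<phi>)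
  have "\<not> forces \<phi> q s" if q: "q \<in> P" "stronger q p" for q
  proof
    assume f: "forces \<phi> q s"
    obtain r' where "r' \<in> P" "stronger r' q" "forces (Neg \<phi>) r' s" using Neg.prems(2)[OF q] by blast
    moreover from this have "forces \<phi> r' s" using forces_mono[OF f] by blast
    ultimately show False by auto
  qed
  then show ?case using Neg.prems(1) by simp
next
  case (Conj \<phi> \<psi>)
  have "forces \<phi> p s" by (rule Conj.IH(1)[OF Conj.prems(1)]) (use Conj.prems(2) in force)
  moreover have "forces \<psi> p s" by (rule Conj.IH(2)[OF Conj.prems(1)]) (use Conj.prems(2) in force)
  ultimately show ?case by simp
next
  case (All i \<phi>)
  have "forces \<phi> p (s(i := x))" if "HS x" for x
  proof (rule All.IH[OF All.prems(1)])
    fix r assume "r \<in> P" "stronger r p"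
    then obtain r' where "r' \<in> P" "stronger r' r" "forces (All i \<phi>) r' s" using All.prems(2) by blast
    with that show "\<exists>r'\<in>P. stronger r' r \<and> forces \<phi> r' (s(i := x))" by auto
  qed
  then show ?case using All.prems(1) by simp
qed

lemma name_sub:
  assumes "is_name V w" "opair q z \<in> elts w"
  shows "q \<in> P \<and> is_name V z"
  using assms(1)
proof cases
  case 1
  then obtain p y where "p \<in> P" "is_name V y" "opair q z = opair p y" using assms(2) by blast
  then show ?thesis by simp
qed

text \<open>A condition below the moved one is pulled back by the inverse permutation, extended
  there, and pushed forward again.\<close>

lemma forces_eq_act:
  assumes \<pi>: "\<pi> \<in> perms"
  shows "is_name V x ==> is_name V y ==> forces_eq p x y ==> forces_eq (act_cond \<pi> p) (act_name \<pi> x) (act_name \<pi> y)"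
proof (induction x arbitrary: y p rule: name_induct)
  case (step x)
  have p: "p \<in> P" and f: "feq P x y p" using step.prems(3) by (auto simp: forces_eq_def)
  have inv: "pinv \<pi> \<in> perms" using finitary_inv[OF \<pi>] .
  have sub: "q \<in> P \<and> is_name V z" if "is_name V w" "opair q z \<in> elts w" for w q z
    using name_sub[OF that] .
  have low: "act_cond (pinv \<pi>) r \<in> P \<and> stronger (act_cond (pinv \<pi>) r) q"
    if "r \<in> P" "q \<in> P" "stronger r (act_cond \<pi> q)" for r q
    using that act_cond_P[OF inv] stronger_act[of r "act_cond \<pi> q" "pinv \<pi>"] act_cond_inv(1)[OF \<pi>] by simp
  have up: "stronger (act_cond \<pi> r') r" if "r \<in> P" "stronger r' (act_cond (pinv \<pi>) r)" for r r'
    using stronger_act[OF that(2), of \<pi>] act_cond_inv(2)[OF \<pi> that(1)] by simp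
  show ?case
    unfolding forces_eq_def feq.simps[of P "act_name \<pi> x"]
  proof (intro conjI allI impI ballI act_cond_P[OF \<pi> p])
    fix q1 z1 r assume *: "opair q1 z1 \<in> elts (act_name \<pi> x)" "r \<in> P" "stronger r (act_cond \<pi> p) \<and> stronger r q1"
    then obtain q z where qz: "q1 = act_cond \<pi> q" "z1 = act_name \<pi> z" "opair q z \<in> elts x" by (auto simp: elts_act_name)
    define r0 where "r0 = act_cond (pinv \<pi>) r"
    have r0: "r0 \<in> P" "stronger r0 p" "stronger r0 q"
      using low[of r p] low[of r q] * p qz sub[OF step.prems(1) qz(3)] by (auto simp: r0_def)
    then obtain r' q' z' where r': "r' \<in> P" "stronger r' r0" "opair q' z' \<in> elts y" "stronger r' q'" "feq P z z' r'"
      using f qz(3) unfolding feq.simps[of P x y p] by blast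
    have "forces_eq (act_cond \<pi> r') (act_name \<pi> z) (act_name \<pi> z')"
      by (rule step.IH[OF qz(3)]) (use sub[OF step.prems(1) qz(3)] sub[OF step.prems(2) r'(3)] r' in \<open>auto simp: forces_eq_def\<close>)
    then show "\<exists>r'\<in>P. stronger r' r \<and> (\<exists>q' z'. opair q' z' \<in> elts (act_name \<pi> y) \<and> stronger r' q' \<and> feq P z1 z' r')"
      using up[OF *(2)] r' stronger_act[OF r'(4), of \<pi>] unfolding forces_eq_def elts_act_name qz(2) r0_def by blast
  next
    fix q1 z1 r assume *: "opair q1 z1 \<in> elts (act_name \<pi> y)" "r \<in> P" "stronger r (act_cond \<pi> p) \<and> stronger r q1"
    then obtain q z where qz: "q1 = act_cond \<pi> q" "z1 = act_name \<pi> z" "opair q z \<in> elts y" by (auto simp: elts_act_name)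
    define r0 where "r0 = act_cond (pinv \<pi>) r"
    have r0: "r0 \<in> P" "stronger r0 p" "stronger r0 q"
      using low[of r p] low[of r q] * p qz sub[OF step.prems(2) qz(3)] by (auto simp: r0_def)
    then obtain r' q' z' where r': "r' \<in> P" "stronger r' r0" "opair q' z' \<in> elts x" "stronger r' q'" "feq P z' z r'"
      using f qz(3) unfolding feq.simps[of P x y p] by blast
    have "forces_eq (act_cond \<pi> r') (act_name \<pi> z') (act_name \<pi> z)"
      by (rule step.IH[OF r'(3)]) (use sub[OF step.prems(2) qz(3)] sub[OF step.prems(1) r'(3)] r' in \<open>auto simp: forces_eq_def\<close>)
    then show "\<exists>r'\<in>P. stronger r' r \<and> (\<exists>q z. opair q z \<in> elts (act_name \<pi> x) \<and> stronger r' q \<and> feq P z z1 r')"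
      using up[OF *(2)] r' stronger_act[OF r'(4), of \<pi>] unfolding forces_eq_def elts_act_name qz(2) r0_def by blast
  qed
qed

lemma forces_mem_act:
  assumes \<pi>: "\<pi> \<in> perms" and xy: "is_name V x" "is_name V y" and f: "forces_mem p x y"
  shows "forces_mem (act_cond \<pi> p) (act_name \<pi> x) (act_name \<pi> y)"
  unfolding forces_mem_def
proof (intro conjI ballI impI)
  have p: "p \<in> P" using f by (simp add: forces_mem_def)
  show "act_cond \<pi> p \<in> P" using act_cond_P[OF \<pi> p] .
  fix r assume r: "r \<in> P" "stronger r (act_cond \<pi> p)"
  define r0 where "r0 = act_cond (pinv \<pi>) r"
  have r0: "r0 \<in> P" "stronger r0 p"
    using act_cond_P[OF finitary_inv[OF \<pi>] r(1)] stronger_act[OF r(2), of "pinv \<pi>"] act_cond_inv(1)[OF \<pi> p]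
    by (simp_all add: r0_def)
  then obtain r' q z where r': "r' \<in> P" "stronger r' r0" "opair q z \<in> elts y" "stronger r' q" "forces_eq r' x z"
    using f unfolding forces_mem_def by blast
  have "is_name V z" using name_sub[OF xy(2) r'(3)] by blast
  then have "forces_eq (act_cond \<pi> r') (act_name \<pi> x) (act_name \<pi> z)"
    using forces_eq_act[OF \<pi> xy(1)] r'(5) by blast
  moreover have "stronger (act_cond \<pi> r') r"
    using stronger_act[OF r'(2), of \<pi>] act_cond_inv(2)[OF \<pi> r(1)] by (simp add: r0_def)
  ultimately show "\<exists>r'\<in>P. stronger r' r \<and> (\<exists>q z. opair q z \<in> elts (act_name \<pi> y) \<and> stronger r' q \<and> forces_eq r' (act_name \<pi> x) z)"
    using r'(3) stronger_act[OF r'(4), of \<pi>] act_cond_P[OF \<pi> r'(1)] unfolding elts_act_name by blast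
qed

text \<open>The symmetry lemma. For a negation the induction hypothesis is applied to the inverse
  permutation, hence the generalisation over \<pi>; for a quantifier the witness is pulled
  back.\<close>

lemma forces_act:
  "\<pi> \<in> perms ==> (\<And>n. HS (s n)) ==> forces \<phi> p s ==> forces \<phi> (act_cond \<pi> p) (\<lambda>n. act_name \<pi> (s n))"
proof (induction \<phi> arbitrary: s p \<pi>)
  case (Mem i j)
  then show ?case using forces_mem_act HS_name by simp
next
  case (Equ i j)
  then show ?case using forces_eq_act HS_name by simp
next
  case (Neg \<phi>)
  note \<pi> = Neg.prems(1)
  have p: "p \<in> P" using Neg.prems(3) by simp
  have "\<not> forces \<phi> q (\<lambda>n. act_name \<pi> (s n))" if q: "q \<in> P" "stronger q (act_cond \<pi> p)" for q
  proof
    assume "forces \<phi> q (\<lambda>n. act_name \<pi> (s n))"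
    then have "forces \<phi> (act_cond (pinv \<pi>) q) (\<lambda>n. act_name (pinv \<pi>) (act_name \<pi> (s n)))"
      by (rule Neg.IH[OF finitary_inv[OF \<pi>], rotated]) (rule HS_act[OF \<pi> Neg.prems(2)])
    then have "forces \<phi> (act_cond (pinv \<pi>) q) s"
      using act_name_inv(1)[OF \<pi>] HS_name[OF Neg.prems(2)] by simp
    moreover have "stronger (act_cond (pinv \<pi>) q) p"
      using stronger_act[OF q(2), of "pinv \<pi>"] act_cond_inv(1)[OF \<pi> p] by simp
    ultimately show False using Neg.prems(3) act_cond_P[OF finitary_inv[OF \<pi>] q(1)] by auto
  qed
  then show ?case using act_cond_P[OF \<pi> p] by simp
next
  case (Conj \<phi> \<psi>)
  then show ?case by simp
next
  case (All i \<phi>)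
  note \<pi> = All.prems(1)
  have "forces \<phi> (act_cond \<pi> p) ((\<lambda>n. act_name \<pi> (s n))(i := x))" if x: "HS x" for x
  proof -
    have x': "HS (act_name (pinv \<pi>) x)" using HS_act[OF finitary_inv[OF \<pi>] x] .
    then have "forces \<phi> p (s(i := act_name (pinv \<pi>) x))" using All.prems(3) by simp
    then have "forces \<phi> (act_cond \<pi> p) (\<lambda>n. act_name \<pi> ((s(i := act_name (pinv \<pi>) x)) n))"
      by (rule All.IH[OF \<pi>, rotated]) (use x' All.prems(2) in simp)
    moreover have "(\<lambda>n. act_name \<pi> ((s(i := act_name (pinv \<pi>) x)) n)) = (\<lambda>n. act_name \<pi> (s n))(i := x)"
      using act_name_inv(2)[OF \<pi> HS_name[OF x]] by auto
    ultimately show ?thesis by simp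
  qed
  then show ?case using act_cond_P[OF \<pi>] All.prems(3) by simp
qed

end

section \<open>Generic filters and the truth lemma\<close>

locale cohen = zfc_model V for V :: "'u::set_universe set" +
  fixes G :: "'u set"
  assumes generic: "generic V G"
begin

lemma G_P: "p \<in> G ==> p \<in> P"
  and G_up: "q \<in> G ==> p \<in> P ==> stronger q p ==> p \<in> G"
  and G_dir: "p \<in> G ==> q \<in> G ==> \<exists>r\<in>G. stronger r p \<and> stronger r q"
  and G_meets: "D \<in> V ==> dense_in_Add V (elts D) ==> \<exists>p. p \<in> G \<and> p \<in> elts D"
  using generic unfolding generic_def by blast+

lemma empty_G [simp]: "mk {} \<in> G"
proof -
  obtain p where "p \<in> G" using generic unfolding generic_def by blast
  then show ?thesis using G_up[of p "mk {}"] by (simp add: stronger_def)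
qed

lemma generic_dense:
  assumes "definable V (\<lambda>s. Q (s 0))" "\<And>p. p \<in> P ==> \<exists>q\<in>P. stronger q p \<and> Q q"
  shows "\<exists>p\<in>G. Q p"
proof -
  have "mk {p \<in> elts PP. Q p} \<in> V" by (rule separation[OF PP_mem assms(1)])
  moreover have "dense_in_Add V (elts (mk {p \<in> elts PP. Q p}))"
    using assms(2) unfolding dense_in_Add_def elts_mk_Collect unfolding elts_PP by blast
  ultimately show ?thesis using G_meets by fastforce
qed

text \<open>Density below \<open>p\<close> is completed to density by adding the conditions
  incompatible with \<open>p\<close>, none of which lies in the filter.\<close>

lemma generic_below:
  assumes "definable V (\<lambda>s. Q (s 0))" "p \<in> G" "\<And>q. q \<in> P ==> stronger q p ==> \<exists>r\<in>P. stronger r q \<and> Q r"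
  shows "\<exists>r\<in>G. stronger r p \<and> Q r"
proof -
  have pV: "p \<in> V" using P_V[OF G_P[OF assms(2)]] .
  have "definable V (\<lambda>s. stronger (s 0) p \<and> Q (s 0) \<or> \<not> (\<exists>t\<in>elts PP. stronger t (s 0) \<and> stronger t p))"
    by (intro dintro assms(1) pV PP_mem)
  then have "\<exists>r\<in>G. stronger r p \<and> Q r \<or> \<not> (\<exists>t\<in>elts PP. stronger t r \<and> stronger t p)"
  proof (rule generic_dense)
    fix q assume q: "q \<in> P"
    show "\<exists>r\<in>P. stronger r q \<and> (stronger r p \<and> Q r \<or> \<not> (\<exists>t\<in>elts PP. stronger t r \<and> stronger t p))"
    proof (cases "\<exists>t\<in>P. stronger t q \<and> stronger t p")
      case True
      then obtain t r where "t \<in> P" "stronger t q" "stronger t p" "r \<in> P" "stronger r t" "Q r"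
        using assms(3) by blast
      then show ?thesis using stronger_trans by blast
    next
      case False
      then show ?thesis using q stronger_refl[of q] unfolding elts_PP by blast
    qed
  qed
  then show ?thesis using G_dir[OF assms(2)] G_P unfolding elts_PP by blast
qed

lemma truth_eq:
  "is_name V x ==> is_name V y ==> interp G x = interp G y \<longleftrightarrow> (\<exists>p\<in>G. forces_eq p x y)"
proof (induction x arbitrary: y rule: name_induct)
  case (step x)
  have sub: "q \<in> P \<and> is_name V z" if "is_name V w" "opair q z \<in> elts w" for w q z
    using name_sub[OF that] .
  have xyV: "x \<in> V" "y \<in> V" using step.prems name_V by auto
  have cV: "q \<in> V \<and> z \<in> V" if "opair q z \<in> elts x \<or> opair q z \<in> elts y" for q z
    using opair_mem_elts xyV that by blast
  have IH: "interp G z = interp G z' \<longleftrightarrow> (\<exists>p\<in>G. forces_eq p z z')" if "opair q z \<in> elts x" "opair q' z' \<in> elts y" for q z q' z'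
    using step.IH[OF that(1)] sub[OF step.prems(1) that(1)] sub[OF step.prems(2) that(2)] by blast
  show ?case
  proof
    assume "\<exists>p\<in>G. forces_eq p x y"
    then obtain p where p: "p \<in> G" "feq P x y p" by (auto simp: forces_eq_def)
    have "elts (interp G x) = elts (interp G y)"
    proof (intro equalityI subsetI)
      fix v assume "v \<in> elts (interp G x)"
      then obtain q z where qz: "q \<in> G" "opair q z \<in> elts x" "v = interp G z" by (auto simp: elts_interp)
      obtain r where r: "r \<in> G" "stronger r p" "stronger r q" using G_dir[OF p(1) qz(1)] by blast
      define Q where "Q r' \<longleftrightarrow> (\<exists>q'\<in>V. \<exists>z'\<in>V. opair q' z' \<in> elts y \<and> stronger r' q' \<and> forces_eq r' z z')" for r'
      have "definable V (\<lambda>s. Q (s 0))"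
        unfolding Q_def using cV qz(2) by (intro dintro definable_comp3[OF definable_forces_eq] xyV) blast
      moreover have "\<exists>r'\<in>P. stronger r' t \<and> Q r'" if t: "t \<in> P" "stronger t r" for t
      proof -
        have "stronger t p \<and> stronger t q" using t r stronger_trans by blast
        then obtain r' q' z' where "r' \<in> P" "stronger r' t" "opair q' z' \<in> elts y" "stronger r' q'" "feq P z z' r'"
          using p(2) qz(2) t(1) unfolding feq.simps[of P x y p] by blast
        then show ?thesis unfolding Q_def forces_eq_def using cV by blast
      qed
      ultimately obtain r' where "r' \<in> G" "Q r'" using generic_below[OF _ r(1)] by blast
      then obtain q' z' where q': "opair q' z' \<in> elts y" "stronger r' q'" "forces_eq r' z z'" unfolding Q_def by blast
      then have "q' \<in> G" using G_up[OF \<open>r' \<in> G\<close>] sub[OF step.prems(2)] by blast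
      then show "v \<in> elts (interp G y)"
        using q' IH[OF qz(2) q'(1)] \<open>r' \<in> G\<close> qz(3) unfolding elts_interp by blast
    next
      fix v assume "v \<in> elts (interp G y)"
      then obtain q z where qz: "q \<in> G" "opair q z \<in> elts y" "v = interp G z" by (auto simp: elts_interp)
      obtain r where r: "r \<in> G" "stronger r p" "stronger r q" using G_dir[OF p(1) qz(1)] by blast
      define Q where "Q r' \<longleftrightarrow> (\<exists>q'\<in>V. \<exists>z'\<in>V. opair q' z' \<in> elts x \<and> stronger r' q' \<and> forces_eq r' z' z)" for r'
      have "definable V (\<lambda>s. Q (s 0))"
        unfolding Q_def using cV qz(2) by (intro dintro definable_comp3[OF definable_forces_eq] xyV) blast
      moreover have "\<exists>r'\<in>P. stronger r' t \<and> Q r'" if t: "t \<in> P" "stronger t r" for t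
      proof -
        have "stronger t p \<and> stronger t q" using t r stronger_trans by blast
        then obtain r' q' z' where "r' \<in> P" "stronger r' t" "opair q' z' \<in> elts x" "stronger r' q'" "feq P z' z r'"
          using p(2) qz(2) t(1) unfolding feq.simps[of P x y p] by blast
        then show ?thesis unfolding Q_def forces_eq_def using cV by blast
      qed
      ultimately obtain r' where "r' \<in> G" "Q r'" using generic_below[OF _ r(1)] by blast
      then obtain q' z' where q': "opair q' z' \<in> elts x" "stronger r' q'" "forces_eq r' z' z" unfolding Q_def by blast
      then have "q' \<in> G" using G_up[OF \<open>r' \<in> G\<close>] sub[OF step.prems(1)] by blast
      then show "v \<in> elts (interp G x)"
      proof -
        have "interp G z' = v" using q' IH[OF q'(1) qz(2)] \<open>r' \<in> G\<close> qz(3) by blast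
        then show ?thesis using \<open>q' \<in> G\<close> q'(1) unfolding elts_interp by blast
      qed
    qed
    then show "interp G x = interp G y" by (rule elts_inject)
  next
    assume eq: "interp G x = interp G y"
    \<comment> \<open>\<open>A\<close> and \<open>B\<close> are the two ways to refute equality: a
      member offered by one name at \<open>p\<close> is matched by the other name under no extension
      of \<open>p\<close>. Together with the conditions forcing equality they form a dense
      set.\<close>
    define A where "A p \<longleftrightarrow> (\<exists>q\<in>V. \<exists>z\<in>V. opair q z \<in> elts x \<and> stronger p q \<and>
        (\<forall>p'\<in>elts PP. stronger p' p --> \<not> (\<exists>q'\<in>V. \<exists>z'\<in>V. opair q' z' \<in> elts y \<and> stronger p' q' \<and> forces_eq p' z z')))" for p
    define B where "B p \<longleftrightarrow> (\<exists>q'\<in>V. \<exists>z'\<in>V. opair q' z' \<in> elts y \<and> stronger p q' \<and>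
        (\<forall>p'\<in>elts PP. stronger p' p --> \<not> (\<exists>q\<in>V. \<exists>z\<in>V. opair q z \<in> elts x \<and> stronger p' q \<and> forces_eq p' z z')))" for p
    have "definable V (\<lambda>s. forces_eq (s 0) x y \<or> A (s 0) \<or> B (s 0))"
      unfolding A_def B_def by (intro dintro definable_comp3[OF definable_forces_eq] xyV PP_mem)
    moreover have "\<exists>q\<in>P. stronger q p \<and> (forces_eq q x y \<or> A q \<or> B q)" if p: "p \<in> P" for p
    proof (cases "feq P x y p")
      case True
      then show ?thesis using p stronger_refl[of p] unfolding forces_eq_def by blast
    next
      case False
      then consider
        q z r where "opair q z \<in> elts x" "r \<in> P" "stronger r p" "stronger r q"
          "\<not> (\<exists>r'\<in>P. stronger r' r \<and> (\<exists>q' z'. opair q' z' \<in> elts y \<and> stronger r' q' \<and> feq P z z' r'))"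
        | q' z' r where "opair q' z' \<in> elts y" "r \<in> P" "stronger r p" "stronger r q'"
          "\<not> (\<exists>r'\<in>P. stronger r' r \<and> (\<exists>q z. opair q z \<in> elts x \<and> stronger r' q \<and> feq P z z' r'))"
        unfolding feq.simps[of P x y p] by blast
      then show ?thesis
      proof cases
        case (1 q z r)
        then have "A r" unfolding A_def elts_PP forces_eq_def using cV by blast
        then show ?thesis using 1 by blast
      next
        case (2 q' z' r)
        then have "B r" unfolding B_def elts_PP forces_eq_def using cV by blast
        then show ?thesis using 2 by blast
      qed
    qed
    ultimately have "\<exists>p\<in>G. forces_eq p x y \<or> A p \<or> B p" by (rule generic_dense)
    then obtain p where p: "p \<in> G" "forces_eq p x y \<or> A p \<or> B p" by blast
    have "\<not> A p"
    proof
      assume "A p"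
      then obtain q z where qz: "opair q z \<in> elts x" "stronger p q"
        "\<forall>p'\<in>P. stronger p' p --> \<not> (\<exists>q'\<in>V. \<exists>z'\<in>V. opair q' z' \<in> elts y \<and> stronger p' q' \<and> forces_eq p' z z')"
        unfolding A_def elts_PP by blast
      then have "q \<in> G" using G_up[OF p(1)] sub[OF step.prems(1)] by blast
      then have "interp G z \<in> elts (interp G y)" using qz(1) unfolding eq[symmetric] elts_interp by blast
      then obtain q' z' where q': "q' \<in> G" "opair q' z' \<in> elts y" "interp G z = interp G z'" by (auto simp: elts_interp)
      then obtain r where r: "r \<in> G" "forces_eq r z z'" using IH[OF qz(1) q'(2)] by blast
      obtain t where t: "t \<in> G" "stronger t r" "stronger t q'" using G_dir[OF r(1) q'(1)] by blast
      obtain t' where t': "t' \<in> G" "stronger t' t" "stronger t' p" using G_dir[OF t(1) p(1)] by blast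
      have "forces_eq t' z z'" "stronger t' q'"
        using forces_eq_mono[OF r(2) G_P[OF t'(1)]] t t' stronger_trans by blast+
      then show False using qz(3) t'(3) G_P[OF t'(1)] q'(2) cV by blast
    qed
    moreover have "\<not> B p"
    proof
      assume "B p"
      then obtain q z where qz: "opair q z \<in> elts y" "stronger p q"
        "\<forall>p'\<in>P. stronger p' p --> \<not> (\<exists>q'\<in>V. \<exists>z'\<in>V. opair q' z' \<in> elts x \<and> stronger p' q' \<and> forces_eq p' z' z)"
        unfolding B_def elts_PP by blast
      then have "q \<in> G" using G_up[OF p(1)] sub[OF step.prems(2)] by blast
      then have "interp G z \<in> elts (interp G x)" using qz(1) unfolding eq elts_interp by blast
      then obtain q' z' where q': "q' \<in> G" "opair q' z' \<in> elts x" "interp G z' = interp G z" by (auto simp: elts_interp)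
      then obtain r where r: "r \<in> G" "forces_eq r z' z" using IH[OF q'(2) qz(1)] by blast
      obtain t where t: "t \<in> G" "stronger t r" "stronger t q'" using G_dir[OF r(1) q'(1)] by blast
      obtain t' where t': "t' \<in> G" "stronger t' t" "stronger t' p" using G_dir[OF t(1) p(1)] by blast
      have "forces_eq t' z' z" "stronger t' q'"
        using forces_eq_mono[OF r(2) G_P[OF t'(1)]] t t' stronger_trans by blast+
      then show False using qz(3) t'(3) G_P[OF t'(1)] q'(2) cV by blast
    qed
    ultimately show "\<exists>p\<in>G. forces_eq p x y" using p by blast
  qed
qed

lemma truth_mem:
  assumes x: "is_name V x" and y: "is_name V y"
  shows "interp G x \<in> elts (interp G y) \<longleftrightarrow> (\<exists>p\<in>G. forces_mem p x y)"
proof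
  have sub: "q \<in> P \<and> is_name V z" if "opair q z \<in> elts y" for q z
    using name_sub[OF y that] .
  have xyV: "x \<in> V" "y \<in> V" using x y name_V by auto
  {
    assume "interp G x \<in> elts (interp G y)"
    then obtain q z where qz: "q \<in> G" "opair q z \<in> elts y" "interp G x = interp G z" by (auto simp: elts_interp)
    then obtain p where p: "p \<in> G" "forces_eq p x z" using truth_eq[OF x] sub by blast
    obtain r where r: "r \<in> G" "stronger r p" "stronger r q" using G_dir[OF p(1) qz(1)] by blast
    have "forces_mem r x y"
      unfolding forces_mem_def
      using G_P[OF r(1)] r qz(2) forces_eq_mono[OF p(2)] stronger_trans stronger_refl by blast
    then show "\<exists>p\<in>G. forces_mem p x y" using r(1) by blast
  next
    assume "\<exists>p\<in>G. forces_mem p x y"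
    then obtain p where p: "p \<in> G" "forces_mem p x y" by blast
    define Q where "Q r \<longleftrightarrow> (\<exists>q\<in>V. \<exists>z\<in>V. opair q z \<in> elts y \<and> stronger r q \<and> forces_eq r x z)" for r
    have "definable V (\<lambda>s. Q (s 0))"
      unfolding Q_def by (intro dintro definable_comp3[OF definable_forces_eq] xyV)
    moreover have "\<exists>r\<in>P. stronger r t \<and> Q r" if "t \<in> P" "stronger t p" for t
      using p(2) that opair_mem_elts[OF _ xyV(2)] unfolding forces_mem_def Q_def by blast
    ultimately obtain r where "r \<in> G" "Q r" using generic_below[OF _ p(1)] by blast
    then obtain q z where qz: "opair q z \<in> elts y" "stronger r q" "forces_eq r x z" unfolding Q_def by blast
    then have "q \<in> G" "interp G x = interp G z"
      using G_up[OF \<open>r \<in> G\<close>] sub truth_eq[OF x] \<open>r \<in> G\<close> by blast+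
    then show "interp G x \<in> elts (interp G y)" using qz(1) unfolding elts_interp by blast
  }
qed

abbreviation M :: "'u set" where "M \<equiv> Cohen_first_model V G"

lemma M_I: "HS x ==> interp G x \<in> M"
  by (auto simp: Cohen_first_model_def)

lemma M_E: "a \<in> M ==> \<exists>x. HS x \<and> a = interp G x"
  by (auto simp: Cohen_first_model_def)

lemma truth: "(\<And>n. HS (s n)) ==> sat M \<phi> (\<lambda>n. interp G (s n)) \<longleftrightarrow> (\<exists>p\<in>G. forces \<phi> p s)"
proof (induction \<phi> arbitrary: s)
  case (Mem i j)
  then show ?case using truth_mem HS_name by simp
next
  case (Equ i j)
  then show ?case using truth_eq HS_name by simp
next
  case (Neg \<phi>)
  have sV: "s n \<in> V" for n using HS_V[OF Neg.prems] .
  have dfn: "definable V (\<lambda>e. forces \<phi> (e 0) s)"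
  proof -
    have "definable V (\<lambda>e. (\<lambda>s. forces \<phi> (s 0) (\<lambda>n. s (Suc n))) (\<lambda>n. if n = 0 then e 0 else s (n - 1)))"
      by (rule definable_subst[OF definable_forces]) (intro dterm_if_const dintro sV)
    then show ?thesis by simp
  qed
  show ?case
  proof
    assume "\<exists>p\<in>G. forces (Neg \<phi>) p s"
    then obtain p where p: "p \<in> G" "\<forall>q\<in>P. stronger q p --> \<not> forces \<phi> q s" by auto
    have "\<not> (\<exists>q\<in>G. forces \<phi> q s)"
    proof
      assume "\<exists>q\<in>G. forces \<phi> q s"
      then obtain q where q: "q \<in> G" "forces \<phi> q s" by blast
      obtain r where "r \<in> G" "stronger r p" "stronger r q" using G_dir[OF p(1) q(1)] by blast
      then show False using p(2) forces_mono[OF q(2)] G_P by blast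
    qed
    then show "sat M (Neg \<phi>) (\<lambda>n. interp G (s n))" using Neg by simp
  next
    assume "sat M (Neg \<phi>) (\<lambda>n. interp G (s n))"
    then have no: "\<not> (\<exists>q\<in>G. forces \<phi> q s)" using Neg by simp
    have "definable V (\<lambda>e. forces \<phi> (e 0) s \<or> (\<forall>q\<in>elts PP. stronger q (e 0) --> \<not> forces \<phi> q s))"
      by (intro dintro PP_mem dfn definable_comp1[OF dfn])
    then have "\<exists>p\<in>G. forces \<phi> p s \<or> (\<forall>q\<in>elts PP. stronger q p --> \<not> forces \<phi> q s)"
    proof (rule generic_dense)
      fix p assume p: "p \<in> P"
      show "\<exists>q\<in>P. stronger q p \<and> (forces \<phi> q s \<or> (\<forall>r\<in>elts PP. stronger r q --> \<not> forces \<phi> r s))"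
      proof (cases "\<exists>q\<in>P. stronger q p \<and> forces \<phi> q s")
        case False
        then show ?thesis using p stronger_refl unfolding elts_PP by blast
      qed blast
    qed
    then show "\<exists>p\<in>G. forces (Neg \<phi>) p s" using no G_P unfolding elts_PP by auto
  qed
next
  case (Conj \<phi> \<psi>)
  show ?case
  proof
    assume "sat M (Conj \<phi> \<psi>) (\<lambda>n. interp G (s n))"
    then obtain p q where pq: "p \<in> G" "forces \<phi> p s" "q \<in> G" "forces \<psi> q s" using Conj by auto
    obtain r where "r \<in> G" "stronger r p" "stronger r q" using G_dir[OF pq(1,3)] by blast
    then show "\<exists>p\<in>G. forces (Conj \<phi> \<psi>) p s" using pq forces_mono G_P by (intro bexI[of _ r]) auto
  qed (use Conj in auto)
next
  case (All i \<phi>)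
  have sV: "s n \<in> V" for n using HS_V[OF All.prems] .
  have upd: "(\<lambda>n. interp G ((s(i := x)) n)) = (\<lambda>n. interp G (s n))(i := interp G x)" for x by auto
  have IH: "sat M \<phi> ((\<lambda>n. interp G (s n))(i := interp G x)) \<longleftrightarrow> (\<exists>p\<in>G. forces \<phi> p (s(i := x)))" if "HS x" for x
  proof -
    have "HS ((s(i := x)) n)" for n using All.prems that by simp
    from All.IH[of "s(i := x)", OF this] show ?thesis by (simp only: upd)
  qed
  show ?case
  proof
    assume "\<exists>p\<in>G. forces (All i \<phi>) p s"
    then show "sat M (All i \<phi>) (\<lambda>n. interp G (s n))" using IH M_E by fastforce
  next
    assume "sat M (All i \<phi>) (\<lambda>n. interp G (s n))"
    then have all: "\<exists>p\<in>G. forces \<phi> p (s(i := x))" if "HS x" for x using IH[OF that] M_I[OF that] by simp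
    have dfn: "definable V (\<lambda>e. forces \<phi> (e 0) (s(i := e 1)))"
    proof -
      have "definable V (\<lambda>e. (\<lambda>s. forces \<phi> (s 0) (\<lambda>n. s (Suc n))) (\<lambda>n. if n = 0 then e 0 else if n = Suc i then e 1 else s (n - 1)))"
        by (rule definable_subst[OF definable_forces]) (intro dterm_if_const dintro sV)
      moreover have "(\<lambda>n. if Suc n = 0 then e 0 else if Suc n = Suc i then e 1 else s (Suc n - 1)) = s(i := e 1)" for e :: "nat => 'u"
        by (rule ext) simp
      ultimately show ?thesis by (simp only: if_True refl)
    qed
    \<comment> \<open>Dense are the conditions that either force all instances or refute one
      instance given by a single name.\<close>
    have "definable V (\<lambda>e. (\<forall>x\<in>V. HS x --> forces \<phi> (e 0) (s(i := x))) \<or>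
        (\<exists>x\<in>V. HS x \<and> (\<forall>q\<in>elts PP. stronger q (e 0) --> \<not> forces \<phi> q (s(i := x)))))"
      by (intro dintro PP_mem definable_comp1[OF definable_HS] definable_comp2[OF dfn])
    then have "\<exists>p\<in>G. (\<forall>x\<in>V. HS x --> forces \<phi> p (s(i := x))) \<or>
        (\<exists>x\<in>V. HS x \<and> (\<forall>q\<in>elts PP. stronger q p --> \<not> forces \<phi> q (s(i := x))))"
    proof (rule generic_dense)
      fix p assume p: "p \<in> P"
      show "\<exists>q\<in>P. stronger q p \<and> ((\<forall>x\<in>V. HS x --> forces \<phi> q (s(i := x))) \<or>
          (\<exists>x\<in>V. HS x \<and> (\<forall>r\<in>elts PP. stronger r q --> \<not> forces \<phi> r (s(i := x)))))"
      proof (cases "\<forall>x\<in>V. HS x --> forces \<phi> p (s(i := x))")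
        case True
        then show ?thesis using p stronger_refl by blast
      next
        case False
        then obtain x where x: "x \<in> V" "HS x" "\<not> forces \<phi> p (s(i := x))" by blast
        then obtain r where "r \<in> P" "stronger r p" "\<not> (\<exists>r'\<in>P. stronger r' r \<and> forces \<phi> r' (s(i := x)))"
          using forces_dense[OF p, of \<phi> "s(i := x)"] by blast
        then show ?thesis using x unfolding elts_PP by blast
      qed
    qed
    then obtain p where p: "p \<in> G" "(\<forall>x\<in>V. HS x --> forces \<phi> p (s(i := x))) \<or>
        (\<exists>x\<in>V. HS x \<and> (\<forall>q\<in>P. stronger q p --> \<not> forces \<phi> q (s(i := x))))" unfolding elts_PP by blast
    have "\<not> (\<exists>x\<in>V. HS x \<and> (\<forall>q\<in>P. stronger q p --> \<not> forces \<phi> q (s(i := x))))"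
    proof
      assume "\<exists>x\<in>V. HS x \<and> (\<forall>q\<in>P. stronger q p --> \<not> forces \<phi> q (s(i := x)))"
      then obtain x where x: "HS x" "\<forall>q\<in>P. stronger q p --> \<not> forces \<phi> q (s(i := x))" by blast
      obtain q where q: "q \<in> G" "forces \<phi> q (s(i := x))" using all[OF x(1)] by blast
      obtain r where "r \<in> G" "stronger r p" "stronger r q" using G_dir[OF p(1) q(1)] by blast
      then show False using x(2) forces_mono[OF q(2)] G_P by blast
    qed
    then have "forces (All i \<phi>) p s" using p HS_V G_P[OF p(1)] unfolding forces.simps by blast
    then show "\<exists>p\<in>G. forces (All i \<phi>) p s" using p(1) by blast
  qed
qed

end

section \<open>Cohen's first model\<close>

text \<open>Beyond this bound the parameters may be changed at will. An assignment has infinitely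
  many of them, and only finitely many names are sure to have a common support.\<close>

primrec var_bound :: "fm => nat" where
  "var_bound (Mem i j) = Suc (max i j)"
| "var_bound (Equ i j) = Suc (max i j)"
| "var_bound (Neg \<phi>) = var_bound \<phi>"
| "var_bound (Conj \<phi> \<psi>) = max (var_bound \<phi>) (var_bound \<psi>)"
| "var_bound (All i \<phi>) = var_bound \<phi>"

lemma sat_agree: "(\<And>n. n < var_bound \<phi> ==> s n = t n) ==> sat N \<phi> s \<longleftrightarrow> sat N \<phi> t"
proof (induction \<phi> arbitrary: s t)
  case (All i \<phi>)
  have "sat N \<phi> (s(i := x)) \<longleftrightarrow> sat N \<phi> (t(i := x))" for x
    by (rule All.IH) (use All.prems in auto)
  then show ?case by simp
next
  case (Conj \<phi> \<psi>)
  have "sat N \<phi> s \<longleftrightarrow> sat N \<phi> t" "sat N \<psi> s \<longleftrightarrow> sat N \<psi> t"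
    by (rule Conj.IH; use Conj.prems in simp)+
  then show ?case by simp
next
  case (Neg \<phi>)
  have "sat N \<phi> s \<longleftrightarrow> sat N \<phi> t" by (rule Neg.IH) (use Neg.prems in simp)
  then show ?case by simp
qed simp_all

context zfc_model
begin

text \<open>One inclusion for all permutations of the group gives equality, by applying it to the
  inverse.\<close>

lemma supports_closed:
  assumes x: "is_name V x"
    and closed: "\<And>\<pi> p y. \<pi> \<in> fixer {..<k} ==> opair p y \<in> elts x ==> opair (act_cond \<pi> p) (act_name \<pi> y) \<in> elts x"
  shows "supports k x"
  unfolding supports_def
proof
  fix \<pi> assume \<pi>: "\<pi> \<in> fixer {..<k}"
  note c = fixer_carrier[OF \<pi>]
  have "elts (act_name \<pi> x) = elts x"
  proof (intro equalityI subsetI)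
    fix z assume "z \<in> elts (act_name \<pi> x)"
    then show "z \<in> elts x" using closed[OF \<pi>] by (auto simp: elts_act_name)
  next
    fix z assume z: "z \<in> elts x"
    then obtain p y where py: "p \<in> P" "is_name V y" "z = opair p y" using x by (blast elim: is_name.cases)
    have "opair (act_cond (pinv \<pi>) p) (act_name (pinv \<pi>) y) \<in> elts x"
      using closed[OF fixer_inv[OF \<pi>]] z py(3) by blast
    then have "opair (act_cond \<pi> (act_cond (pinv \<pi>) p)) (act_name \<pi> (act_name (pinv \<pi>) y)) \<in> elts (act_name \<pi> x)"
      unfolding elts_act_name by blast
    then show "z \<in> elts (act_name \<pi> x)"
      using act_cond_inv(2)[OF c py(1)] act_name_inv(2)[OF c py(2)] py(3) by simp
  qed
  then show "act_name \<pi> x = x" by (rule elts_inject)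
qed

lemma supports_finite:
  assumes "\<And>n::nat. HS (f n)"
  shows "\<exists>k. \<forall>n<m. supports k (f n)"
proof (induction m)
  case (Suc m)
  then obtain k where k: "\<forall>n<m. supports k (f n)" by blast
  obtain l where l: "supports l (f m)" using HS_supports[OF assms] by blast
  have "\<forall>n<Suc m. supports (max k l) (f n)"
    using k l supports_mono by (auto simp: less_Suc_eq)
  then show ?case by blast
qed simp

text \<open>A rank of names by ordinals of \<open>V\<close>; it will bound the ordinals that names
  can denote.\<close>

lemma ordinal_rank:
  obtains H where "\<forall>x\<in>V. H x \<in> V \<and> is_ord (H x) \<and> (\<forall>p y. opair p y \<in> elts x --> H y \<in> elts (H x))"
proof -
  have C: "dterm V (\<lambda>s. bun (bun (s 0)))" by (intro dintro)
  have F: "dterm V (\<lambda>s. (\<lambda>x g. bun (mk ((\<lambda>y. suc (ap g y)) ` elts (bun (bun x))))) (s 0) (s 1))" by (intro dintro)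
  obtain H where H: "dterm V (\<lambda>s. H (s 0))"
    "\<And>x. x \<in> V ==> H x = bun (mk ((\<lambda>y. suc (ap (Gr (bun (bun x)) H) y)) ` elts (bun (bun x))))"
    using recursion_exists[OF C F wf_children] by blast
  have HV: "H x \<in> V" if "x \<in> V" for x using dterm_mem[OF H(1), of "\<lambda>_. x"] that by (simp add: env_def)
  have chV: "y \<in> V" if "x \<in> V" "y \<in> elts (bun (bun x))" for x y
    using V_trans[OF that(2)] Un_mem that(1) by blast
  have elts_H: "elts (H x) = (\<Union>y\<in>elts (bun (bun x)). elts (suc (H y)))" if x: "x \<in> V" for x
  proof -
    have "dterm V (\<lambda>s. mk ((\<lambda>y. suc (H y)) ` elts (s 0)))" by (intro dintro dterm_comp1[OF H(1)])
    from dterm_mem[OF this, of "\<lambda>_. bun (bun x)"] have "mk ((\<lambda>y. suc (H y)) ` elts (bun (bun x))) \<in> V"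
      using x Un_mem by (simp add: env_def)
    moreover have "(\<lambda>y. suc (ap (Gr (bun (bun x)) H) y)) ` elts (bun (bun x)) = (\<lambda>y. suc (H y)) ` elts (bun (bun x))"
      by (rule image_cong) simp_all
    ultimately show ?thesis unfolding H(2)[OF x] by (simp add: elts_Un)
  qed
  have ord: "is_ord (H x)" if "x \<in> V" for x
    using that
  proof (induction x rule: wf_induct_rule[OF wf_children])
    case (1 x)
    have "is_ord \<beta> \<and> elts \<beta> \<subseteq> elts (H x)" if "\<beta> \<in> elts (H x)" for \<beta>
    proof -
      obtain y where y: "y \<in> elts (bun (bun x))" "\<beta> \<in> elts (suc (H y))"
        using \<open>\<beta> \<in> elts (H x)\<close> unfolding elts_H[OF 1(2)] by blast
      have o: "is_ord (suc (H y))" using 1(1)[of y] 1(2) y(1) chV ord_suc by blast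
      then have "elts \<beta> \<subseteq> elts (suc (H y))" using ord_trans[OF o y(2)] by blast
      moreover have "elts (suc (H y)) \<subseteq> elts (H x)" unfolding elts_H[OF 1(2)] using y(1) by blast
      ultimately show ?thesis using ord_mem[OF o y(2)] by blast
    qed
    then show ?case using ordI[of "H x"] by blast
  qed
  have "H y \<in> elts (H x)" if "x \<in> V" "opair p y \<in> elts x" for x p y
    unfolding elts_H[OF that(1)] using name_child[OF that] by auto
  then show ?thesis using that[of H] HV ord by blast
qed

lemma P_union:
  assumes "p \<in> P" "q \<in> P" "\<And>x i j. opair x i \<in> elts p ==> opair x j \<in> elts q ==> i = j"
  shows "\<exists>r\<in>P. elts r = elts p \<union> elts q"
proof -
  have r: "bun (mk {p, q}) \<in> V" "elts (bun (mk {p, q})) = elts p \<union> elts q"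
    using Un_pair_mem elts_Un_pair P_V assms by auto
  have "bun (mk {p, q}) \<in> P"
    unfolding Add_def mem_Collect_eq r(2)
  proof (intro conjI r(1) allI impI)
    fix x i j assume "opair x i \<in> elts p \<union> elts q \<and> opair x j \<in> elts p \<union> elts q"
    then show "i = j" using assms(1,2) assms(3)[of x i j] assms(3)[of x j i] unfolding Add_def by blast
  qed (use finite_P assms P_shape in auto)
  with r(2) show ?thesis by blast
qed

lemma P_bound: "p \<in> P ==> \<exists>N. \<forall>n m i. entry n m i \<in> elts p --> n < N \<and> m < N"
proof -
  assume p: "p \<in> P"
  define f where "f z = (THE k. \<exists>n m. ufst z = opair (num n) (num m) \<and> k = Suc (max n m))" for z :: 'u
  have f: "f (entry n m i) = Suc (max n m)" for n m i
    unfolding f_def by (intro the_equality) auto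
  obtain N where N: "f ` elts p \<subseteq> {..<N}" using finite_P[OF p] finite_nat_iff_bounded[of "f ` elts p"] by auto
  have "n < N \<and> m < N" if "entry n m i \<in> elts p" for n m i
    using N that f[of n m i] by (auto simp: image_subset_iff)
  then show ?thesis by blast
qed

lemma P_finite_set:
  assumes "finite S" "\<And>n m i j. (n, m, i) \<in> S ==> (n, m, j) \<in> S ==> i = j" "\<And>n m i. (n, m, i) \<in> S ==> i \<in> {0, 1}"
  shows "\<exists>q\<in>P. elts q = {entry n m (num i) | n m i. (n, m, i) \<in> S}"
proof -
  define A :: "'u set" where "A = {entry n m (num i) | n m i. (n, m, i) \<in> S}"
  have "A = (\<lambda>(n, m, i). entry n m (num i)) ` S" by (force simp: A_def)
  then have fin: "finite A" using assms(1) by simp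
  then have el: "elts (mk A) = A" by (rule elts_mk_finite)
  have "mk A \<in> P"
    unfolding Add_def mem_Collect_eq el
  proof (intro conjI allI impI ballI fin)
    show "mk A \<in> V" by (rule finite_mem[OF fin]) (auto simp: A_def)
    show "\<exists>n m. \<exists>i\<in>{0, 1}. z = entry n m (num i)" if "z \<in> A" for z
      using that assms(3) unfolding A_def by blast
    show "i = j" if "opair x i \<in> A \<and> opair x j \<in> A" for x i j
      using that assms(2) unfolding A_def by auto
  qed
  with el show ?thesis unfolding A_def by blast
qed

end

section \<open>Closure properties of the symmetric model\<close>

context cohen
begin

lemma M_trans: "x \<in> M ==> elts x \<subseteq> M"
  using M_E M_I HS_child by (fastforce simp: elts_interp)

lemma V_subset_M: "x \<in> V ==> x \<in> M"
  using M_I[OF HS_check] interp_check[OF empty_G] by metis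

text \<open>The name \<beta> keeps \<open>y\<close> at a condition \<open>p\<close> that lies below
  one under which \<alpha> offers \<open>y\<close> and that forces the formula of \<open>y\<close>.
  By the symmetry lemma a common support of \<alpha> and the parameters supports \<beta>.\<close>

lemma M_separation:
  assumes a: "a \<in> M" and Q: "definable M (\<lambda>s. Q (s 0))"
  shows "mk {x \<in> elts a. Q x} \<in> M"
proof -
  obtain \<phi> c where c: "env M c" and \<phi>: "\<And>s. env M s ==> Q (s 0) \<longleftrightarrow> sat M \<phi> (interleave s c)"
    using Q unfolding definable_def by blast
  obtain \<alpha> where \<alpha>: "HS \<alpha>" "a = interp G \<alpha>" using M_E[OF a] by blast
  have "\<forall>n. \<exists>x. HS x \<and> c n = interp G x" using c M_E by (auto simp: env_def)
  then obtain \<gamma>0 where \<gamma>0: "\<And>n. HS (\<gamma>0 n)" "\<And>n. c n = interp G (\<gamma>0 n)" by metis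
  \<comment> \<open>Parameters beyond those occurring are replaced by the empty set, so that
    finitely many names remain and have a common support.\<close>
  define \<gamma> where "\<gamma> n = (if n < var_bound \<phi> then \<gamma>0 n else check (mk {}))" for n
  have \<gamma>: "HS (\<gamma> n)" for n using \<gamma>0 HS_check by (simp add: \<gamma>_def)
  define \<sigma> where "\<sigma> y = interleave (\<lambda>_. y) \<gamma>" for y
  have \<sigma>: "HS (\<sigma> y n)" if "HS y" for y n using that \<gamma> by (simp add: \<sigma>_def interleave_def)
  have truth\<sigma>: "Q (interp G y) \<longleftrightarrow> (\<exists>p\<in>G. forces \<phi> p (\<sigma> y))" if y: "HS y" for y
  proof -
    have "env M (\<lambda>_. interp G y)" using M_I[OF y] by (simp add: env_def)
    then have "Q (interp G y) \<longleftrightarrow> sat M \<phi> (interleave (\<lambda>_. interp G y) c)"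
      using \<phi>[of "\<lambda>_. interp G y"] by simp
    also have "\<dots> \<longleftrightarrow> sat M \<phi> (\<lambda>n. interp G (\<sigma> y n))"
      by (rule sat_agree) (auto simp: \<sigma>_def \<gamma>_def interleave_def \<gamma>0)
    also have "\<dots> \<longleftrightarrow> (\<exists>p\<in>G. forces \<phi> p (\<sigma> y))" by (rule truth) (rule \<sigma>[OF y])
    finally show ?thesis .
  qed
  obtain k0 where "\<forall>n<Suc (var_bound \<phi>). supports k0 (\<gamma> n)"
    using supports_finite[of \<gamma> "Suc (var_bound \<phi>)"] \<gamma> by blast
  moreover obtain k1 where "supports k1 \<alpha>" using HS_supports[OF \<alpha>(1)] by blast
  moreover define k where "k = max k0 k1"
  ultimately have k: "supports k \<alpha>" "n \<le> var_bound \<phi> ==> supports k (\<gamma> n)" for n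
    using supports_mono[of k1 \<alpha> k] supports_mono[of k0 _ k] by (auto simp: k_def less_Suc_eq_le)
  have k\<gamma>: "supports k (\<gamma> n)" for n
  proof (cases "n < var_bound \<phi>")
    case False
    then have "\<gamma> n = \<gamma> (var_bound \<phi>)" by (simp add: \<gamma>_def)
    then show ?thesis using k(2)[of "var_bound \<phi>"] by simp
  qed (use k(2) in simp)
  define ok where "ok p y \<longleftrightarrow> (\<exists>q\<in>V. opair q y \<in> elts \<alpha> \<and> stronger p q) \<and> forces \<phi> p (\<sigma> y)" for p y
  define \<beta> where "\<beta> = mk {w \<in> elts (cprod PP (bun (bun \<alpha>))). ok (ufst w) (usnd w)}"
  have \<alpha>V: "\<alpha> \<in> V" using HS_V[OF \<alpha>(1)] .
  have chV: "bun (bun \<alpha>) \<in> V" using \<alpha>V Un_mem by blast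
  have okd: "definable V (\<lambda>e. ok (e 0) (e 1))"
  proof -
    have "definable V (\<lambda>e. (\<lambda>s. forces \<phi> (s 0) (\<lambda>n. s (Suc n)))
        (\<lambda>n. if n = 0 then e 0 else if even (n - 1) then e 1 else \<gamma> ((n - 1) div 2)))"
      by (rule definable_subst[OF definable_forces]) (intro dterm_if_const dintro HS_V[OF \<gamma>])
    moreover have "(\<lambda>n. if Suc n = 0 then e 0 else if even (Suc n - 1) then e 1 else \<gamma> ((Suc n - 1) div 2)) = \<sigma> (e 1)"
      for e :: "nat => 'u" by (rule ext) (simp add: \<sigma>_def interleave_def)
    ultimately have "definable V (\<lambda>e. forces \<phi> (e 0) (\<sigma> (e 1)))" by (simp only: if_True refl)
    then show ?thesis unfolding ok_def by (intro dintro \<alpha>V)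
  qed
  have \<beta>V: "\<beta> \<in> V"
    unfolding \<beta>_def
    by (rule separation[OF cprod_mem[OF PP_mem chV]]) (intro definable_comp2[OF okd] dintro)
  have mem\<beta>: "z \<in> elts \<beta> \<longleftrightarrow> (\<exists>p y. z = opair p y \<and> p \<in> P \<and> ok p y)" for z
  proof
    assume "z \<in> elts \<beta>"
    then show "\<exists>p y. z = opair p y \<and> p \<in> P \<and> ok p y"
      unfolding \<beta>_def elts_mk_Collect unfolding elts_cprod[OF PP_mem chV] elts_PP by auto
  next
    assume "\<exists>p y. z = opair p y \<and> p \<in> P \<and> ok p y"
    then obtain p y where py: "z = opair p y" "p \<in> P" "ok p y" by blast
    then have "y \<in> elts (bun (bun \<alpha>))" using name_child[OF \<alpha>V] unfolding ok_def by blast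
    then show "z \<in> elts \<beta>"
      unfolding \<beta>_def elts_mk_Collect unfolding elts_cprod[OF PP_mem chV] elts_PP using py by auto
  qed
  have okHS: "HS y" if "ok p y" for p y using that HS_child[OF \<alpha>(1)] unfolding ok_def by blast
  have "is_name V \<beta>" by (rule is_name.intros[OF \<beta>V]) (use mem\<beta> okHS HS_name in blast)
  have "supports k \<beta>"
  proof (rule supports_closed[OF \<open>is_name V \<beta>\<close>])
    fix \<pi> p y assume \<pi>: "\<pi> \<in> fixer {..<k}" and "opair p y \<in> elts \<beta>"
    then have py: "p \<in> P" "ok p y" using mem\<beta> by auto
    obtain q where q: "opair q y \<in> elts \<alpha>" "stronger p q" using py(2) unfolding ok_def by blast
    have "opair (act_cond \<pi> q) (act_name \<pi> y) \<in> elts (act_name \<pi> \<alpha>)" using q(1) unfolding elts_act_name by blast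
    then have q': "opair (act_cond \<pi> q) (act_name \<pi> y) \<in> elts \<alpha>" using k(1) \<pi> by (simp add: supports_def)
    have "forces \<phi> (act_cond \<pi> p) (\<lambda>n. act_name \<pi> (\<sigma> y n))"
      by (rule forces_act[OF fixer_carrier[OF \<pi>]]) (use \<sigma> okHS py(2) in \<open>auto simp: ok_def\<close>)
    moreover have "(\<lambda>n. act_name \<pi> (\<sigma> y n)) = \<sigma> (act_name \<pi> y)"
      using k\<gamma> \<pi> by (auto simp: \<sigma>_def interleave_def supports_def)
    ultimately have "ok (act_cond \<pi> p) (act_name \<pi> y)"
      unfolding ok_def using q' stronger_act[OF q(2)] opair_mem_elts[OF q' \<alpha>V] by auto
    then show "opair (act_cond \<pi> p) (act_name \<pi> y) \<in> elts \<beta>"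
      using mem\<beta> act_cond_P[OF fixer_carrier[OF \<pi>] py(1)] by blast
  qed
  then have "HS \<beta>" by (rule HS_intro[OF \<beta>V, rotated]) (use mem\<beta> okHS in blast)
  have "elts (interp G \<beta>) = {x \<in> elts a. Q x}"
  proof (intro equalityI subsetI)
    fix x assume "x \<in> elts (interp G \<beta>)"
    then obtain p y where py: "p \<in> G" "x = interp G y" "ok p y" using mem\<beta> unfolding elts_interp by auto
    then obtain q where q: "opair q y \<in> elts \<alpha>" "stronger p q" unfolding ok_def by blast
    have "q \<in> G" using G_up[OF py(1) HS_cond[OF \<alpha>(1) q(1)] q(2)] .
    then have "x \<in> elts a" using q(1) py(2) unfolding \<alpha>(2) elts_interp by blast
    moreover have "Q x" using truth\<sigma>[OF okHS[OF py(3)]] py unfolding ok_def by blast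
    ultimately show "x \<in> {x \<in> elts a. Q x}" by blast
  next
    fix x assume "x \<in> {x \<in> elts a. Q x}"
    then have x: "x \<in> elts a" "Q x" by auto
    then obtain q y where qy: "q \<in> G" "opair q y \<in> elts \<alpha>" "x = interp G y" unfolding \<alpha>(2) elts_interp by blast
    obtain p where p: "p \<in> G" "forces \<phi> p (\<sigma> y)" using truth\<sigma>[OF HS_child[OF \<alpha>(1) qy(2)]] x(2) qy(3) by blast
    obtain r where r: "r \<in> G" "stronger r p" "stronger r q" using G_dir[OF p(1) qy(1)] by blast
    have "ok r y"
      unfolding ok_def using qy(2) r forces_mono[OF p(2)] G_P opair_mem_elts[OF qy(2) \<alpha>V] by blast
    then have "opair r y \<in> elts \<beta>" using mem\<beta> G_P[OF r(1)] by blast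
    then show "x \<in> elts (interp G \<beta>)" using r(1) qy(3) unfolding elts_interp by blast
  qed
  then have "mk {x \<in> elts a. Q x} = interp G \<beta>" using mk_elts[of "interp G \<beta>"] by simp
  then show ?thesis using M_I[OF \<open>HS \<beta>\<close>] by simp
qed

sublocale MM: pair_class M
proof
  show "elts x \<subseteq> M" if "x \<in> M" for x using M_trans[OF that] .
  show "mk {} \<in> M" using V_subset_M[OF empty_mem] .
  show "mk A \<in> M" if A: "finite A" "A \<subseteq> M" for A
  proof -
    have "A \<subseteq> interp G ` {x. HS x}" using A(2) M_E by blast
    then obtain B where B: "B \<subseteq> {x. HS x}" "finite B" "A = interp G ` B"
      using finite_subset_image[OF A(1)] by blast
    have HS: "HS (mk (opair (mk {}) ` B))" by (rule HS_finite) (use B in auto)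
    have el: "elts (mk (opair (mk {}) ` B)) = opair (mk {}) ` B" using B(2) by (simp add: elts_mk_finite)
    have "elts (interp G (mk (opair (mk {}) ` B))) = A"
    proof (intro equalityI subsetI)
      fix v assume "v \<in> A"
      then obtain x where "x \<in> B" "v = interp G x" using B(3) by blast
      then show "v \<in> elts (interp G (mk (opair (mk {}) ` B)))"
        unfolding elts_interp el by (intro CollectI exI[of _ "mk {}"] exI[of _ x]) simp
    qed (use B(3) in \<open>auto simp: elts_interp el\<close>)
    then have "mk A = interp G (mk (opair (mk {}) ` B))" using mk_elts[of "interp G (mk (opair (mk {}) ` B))"] by simp
    then show ?thesis using M_I[OF HS] by simp
  qed
qed (rule M_separation)

text \<open>A superset is enough, since separation trims it to the product. All pairs of children
  are taken with the trivial condition, whether or not the filter realises them, which makes the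
  symmetry immediate.\<close>

lemma product_superset:
  assumes "HS \<alpha>" "HS \<beta>"
  shows "\<exists>z\<in>M. \<forall>x\<in>elts (interp G \<alpha>). \<forall>y\<in>elts (interp G \<beta>). opair x y \<in> elts z"
proof -
  have V: "\<alpha> \<in> V" "\<beta> \<in> V" using assms HS_V by auto
  define ch where "ch x = mk {y \<in> elts (bun (bun x)). \<exists>q\<in>V. opair q y \<in> elts x}" for x :: 'u
  have chd: "dterm V (\<lambda>s. ch (s 0))" unfolding ch_def by (intro dintro)
  have chV: "ch x \<in> V" if "x \<in> V" for x using dterm_mem[OF chd, of "\<lambda>_. x"] that by (simp add: env_def)
  have mem_ch: "y \<in> elts (ch x) \<longleftrightarrow> (\<exists>q. opair q y \<in> elts x)" if "x \<in> V" for x y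
    unfolding ch_def elts_mk_Collect using name_child[OF that] opair_mem_elts[OF _ that] by blast
  define \<zeta> where "\<zeta> = mk ((\<lambda>w. opair (mk {}) (opn (ufst w) (usnd w))) ` elts (cprod (ch \<alpha>) (ch \<beta>)))"
  have "dterm V (\<lambda>s. mk ((\<lambda>w. opair (mk {}) (opn (ufst w) (usnd w))) ` elts (cprod (ch \<alpha>) (ch \<beta>))))"
    by (intro dintro empty_mem chV V)
  from dterm_mem[OF this env_empty] have \<zeta>V: "\<zeta> \<in> V" by (simp only: \<zeta>_def)
  have mem\<zeta>: "z \<in> elts \<zeta> \<longleftrightarrow> (\<exists>y y'. y \<in> elts (ch \<alpha>) \<and> y' \<in> elts (ch \<beta>) \<and> z = opair (mk {}) (opn y y'))" for z
    unfolding \<zeta>_def unfolding elts_mk_image unfolding elts_cprod[OF chV[OF V(1)] chV[OF V(2)]] by force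
  have HSy: "HS y" if "y \<in> elts (ch \<alpha>) \<or> y \<in> elts (ch \<beta>)" for y
    using that mem_ch V assms HS_child by blast
  have name: "is_name V \<zeta>"
    by (rule is_name.intros[OF \<zeta>V]) (use mem\<zeta> HSy HS_opn HS_name empty_P in blast)
  obtain k l where "supports k \<alpha>" "supports l \<beta>" using HS_supports assms by blast
  then have s: "supports (max k l) \<alpha>" "supports (max k l) \<beta>" by (auto intro: supports_mono)
  have "supports (max k l) \<zeta>"
  proof (rule supports_closed[OF name])
    fix \<pi> p y assume \<pi>: "\<pi> \<in> fixer {..<max k l}" and py: "opair p y \<in> elts \<zeta>"
    have cl: "act_name \<pi> v \<in> elts (ch x)" if vx: "v \<in> elts (ch x)" and x: "x \<in> V" "supports (max k l) x" for v x
    proof -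
      obtain q where "opair q v \<in> elts x" using vx mem_ch[OF x(1)] by blast
      then have "opair (act_cond \<pi> q) (act_name \<pi> v) \<in> elts (act_name \<pi> x)" unfolding elts_act_name by blast
      then show ?thesis using x(2) \<pi> mem_ch[OF x(1)] by (auto simp: supports_def)
    qed
    obtain v v' where v: "v \<in> elts (ch \<alpha>)" "v' \<in> elts (ch \<beta>)" "p = mk {}" "y = opn v v'"
      using py mem\<zeta> by auto
    then have "act_name \<pi> v \<in> elts (ch \<alpha>)" "act_name \<pi> v' \<in> elts (ch \<beta>)" using cl V s by auto
    then show "opair (act_cond \<pi> p) (act_name \<pi> y) \<in> elts \<zeta>"
      unfolding mem\<zeta> v(3,4) act_cond_empty act_name_opn by blast
  qed
  then have "HS \<zeta>"
    by (rule HS_intro[OF \<zeta>V, rotated]) (use mem\<zeta> HSy HS_opn empty_P in blast)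
  moreover have "opair x y \<in> elts (interp G \<zeta>)" if x: "x \<in> elts (interp G \<alpha>)" and y: "y \<in> elts (interp G \<beta>)" for x y
  proof -
    obtain v where v: "x = interp G v" "v \<in> elts (ch \<alpha>)" using x mem_ch[OF V(1)] unfolding elts_interp by blast
    obtain v' where v': "y = interp G v'" "v' \<in> elts (ch \<beta>)" using y mem_ch[OF V(2)] unfolding elts_interp by blast
    have "opair (mk {}) (opn v v') \<in> elts \<zeta>" using mem\<zeta> v v' by blast
    then have "interp G (opn v v') \<in> elts (interp G \<zeta>)" unfolding elts_interp using empty_G by blast
    then show ?thesis using interp_opn[OF empty_G] v(1) v'(1) by simp
  qed
  ultimately show ?thesis using M_I by blast
qed

sublocale MM: weak_class M
proof
  fix a b assume ab: "a \<in> M" "b \<in> M"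
  then obtain \<alpha> \<beta> where "HS \<alpha>" "a = interp G \<alpha>" "HS \<beta>" "b = interp G \<beta>" using M_E by blast
  then obtain z where z: "z \<in> M" "\<forall>x\<in>elts a. \<forall>y\<in>elts b. opair x y \<in> elts z" using product_superset by blast
  have "mk {w \<in> elts z. \<exists>x\<in>elts a. \<exists>y\<in>elts b. w = opair x y} \<in> M"
    by (rule MM.separation[OF z(1)]) (intro dintro ab)
  moreover have "elts (mk {w \<in> elts z. \<exists>x\<in>elts a. \<exists>y\<in>elts b. w = opair x y}) = {opair x y | x y. x \<in> elts a \<and> y \<in> elts b}"
    unfolding elts_mk_Collect using z(2) by blast
  ultimately show "\<exists>c\<in>M. elts c = {opair x y | x y. x \<in> elts a \<and> y \<in> elts b}" by blast
qed

text \<open>The rank of a name bounds the ordinal that it denotes, and \<open>V\<close> is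
  transitive.\<close>

lemma M_ord_V:
  assumes "\<alpha> \<in> M" "is_ord \<alpha>" shows "\<alpha> \<in> V"
proof -
  obtain H where H: "\<forall>x\<in>V. H x \<in> V \<and> is_ord (H x) \<and> (\<forall>p y. opair p y \<in> elts x --> H y \<in> elts (H x))"
    by (rule ordinal_rank)
  have le: "elts (interp G x) \<subseteq> elts (H x)" if "x \<in> V" "is_ord (interp G x)" for x
    using that
  proof (induction x rule: name_induct)
    case (step x)
    show ?case
    proof
      fix v assume v: "v \<in> elts (interp G x)"
      then obtain p y where py: "opair p y \<in> elts x" "v = interp G y" by (auto simp: elts_interp)
      have y: "y \<in> V" using opair_mem_elts[OF py(1) step.prems(1)] by blast
      have o: "is_ord v" using ord_mem[OF step.prems(2) v] .
      then have "elts v \<subseteq> elts (H y)" using step.IH[OF py(1) y] py(2) by simp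
      then have "v = H y \<or> v \<in> elts (H y)" using ord_subset_iff[OF o] H y by blast
      moreover have "H y \<in> elts (H x)" "is_ord (H x)" using H step.prems(1) py(1) by blast+
      ultimately show "v \<in> elts (H x)" using ord_trans by blast
    qed
  qed
  obtain x where x: "HS x" "\<alpha> = interp G x" using M_E[OF assms(1)] by blast
  then have "elts \<alpha> \<subseteq> elts (H x)" using le HS_V assms(2) by blast
  moreover have "is_ord (H x)" "H x \<in> V" using H HS_V[OF x(1)] by blast+
  ultimately show ?thesis using ord_subset_iff[OF assms(2)] V_trans by blast
qed

lemma psurj_V_M: "psurj V a b ==> psurj M a b"
  unfolding psurj_def using V_subset_M by blast

lemma injects_V_M: "injects V a b ==> injects M a b"
  unfolding injects_def using V_subset_M by blast

section \<open>The generic reals\<close>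

text \<open>\<open>gen n\<close> is the characteristic function of the Cohen real with index
  \<open>n\<close>.\<close>

definition gen :: "nat => nat => bool" where
  "gen n m \<longleftrightarrow> (\<exists>p\<in>G. entry n m (num 1) \<in> elts p)"

lemma G_decides: "\<exists>p\<in>G. \<exists>i\<in>{0, 1}. entry n m (num i) \<in> elts p"
proof -
  have "\<exists>p\<in>G. entry n m (num 0) \<in> elts p \<or> entry n m (num 1) \<in> elts p"
  proof (rule generic_dense)
    show "definable V (\<lambda>s. entry n m (num 0) \<in> elts (s 0) \<or> entry n m (num 1) \<in> elts (s 0))"
      by (intro dintro) (simp_all del: num.simps)
    fix p assume p: "p \<in> P"
    show "\<exists>q\<in>P. stronger q p \<and> (entry n m (num 0) \<in> elts q \<or> entry n m (num 1) \<in> elts q)"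
    proof (cases "\<exists>i. entry n m i \<in> elts p")
      case True
      then obtain i where i: "entry n m i \<in> elts p" by blast
      then have "i = num 0 \<or> i = num 1" using P_shape[OF p i] by auto
      then show ?thesis using p i stronger_refl by blast
    next
      case False
      have "\<exists>q\<in>P. elts q = {entry n' m' (num i) | n' m' i. (n', m', i) \<in> {(n, m, 0)}}"
        by (rule P_finite_set) auto
      then obtain q where q: "q \<in> P" "elts q = {entry n m (num 0)}" by auto
      have "\<exists>r\<in>P. elts r = elts p \<union> elts q" by (rule P_union[OF p q(1)]) (use False q(2) in auto)
      then show ?thesis using q(2) by (auto simp: stronger_def)
    qed
  qed
  then show ?thesis by blast
qed

lemma G_fun: "p \<in> G ==> q \<in> G ==> opair x i \<in> elts p ==> opair x j \<in> elts q ==> i = j"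
proof -
  assume *: "p \<in> G" "q \<in> G" "opair x i \<in> elts p" "opair x j \<in> elts q"
  obtain r where "r \<in> G" "stronger r p" "stronger r q" using G_dir[OF *(1,2)] by blast
  then have "r \<in> P" "opair x i \<in> elts r" "opair x j \<in> elts r" using * G_P by (auto simp: stronger_def)
  then show "i = j" unfolding Add_def by blast
qed

lemma gen_0: "\<not> gen n m \<longleftrightarrow> (\<exists>p\<in>G. entry n m (num 0) \<in> elts p)"
  using G_decides[of n m] G_fun num_eq_iff[of 0 1] unfolding gen_def
  by (metis insert_iff singletonD zero_neq_one)

text \<open>The generic reals determine the filter, so that membership of a permuted condition in
  \<open>G\<close> can be checked bit by bit.\<close>

lemma G_iff:
  assumes p: "p \<in> P"
  shows "p \<in> G \<longleftrightarrow> (\<forall>n m i. entry n m (num i) \<in> elts p --> gen n m = (i = 1))"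
proof
  assume pG: "p \<in> G"
  show "\<forall>n m i. entry n m (num i) \<in> elts p --> gen n m = (i = 1)"
  proof (intro allI impI)
    fix n m i assume z: "entry n m (num i) \<in> elts p"
    then have "i \<in> {0, 1}" using P_shape[OF p z] by auto
    then show "gen n m = (i = 1)" using z pG gen_0 unfolding gen_def by (metis insert_iff singletonD zero_neq_one)
  qed
next
  assume *: "\<forall>n m i. entry n m (num i) \<in> elts p --> gen n m = (i = 1)"
  have each: "\<exists>q\<in>G. z \<in> elts q" if z: "z \<in> elts p" for z
  proof -
    obtain n m i where zi: "i \<in> {0, 1}" "z = entry n m (num i)" using P_shape[OF p z] by blast
    then have "gen n m = (i = 1)" using * z by blast
    then show ?thesis using zi gen_0 unfolding gen_def by (cases "i = 1") auto
  qed
  have "\<exists>r\<in>G. S \<subseteq> elts r" if "finite S" "S \<subseteq> elts p" for S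
    using that
  proof (induction S)
    case empty
    then show ?case using empty_G by blast
  next
    case (insert z S)
    then obtain r q where "r \<in> G" "S \<subseteq> elts r" "q \<in> G" "z \<in> elts q" using each by (meson insert_subset)
    moreover from this obtain t where "t \<in> G" "stronger t r" "stronger t q" using G_dir by blast
    ultimately show ?case by (intro bexI[of _ t]) (auto simp: stronger_def)
  qed
  then obtain r where "r \<in> G" "elts p \<subseteq> elts r" using finite_P[OF p] by blast
  then show "p \<in> G" using G_up p by (simp add: stronger_def)
qed

lemma gen_distinct:
  assumes "n \<noteq> n'"
  shows "\<exists>m. gen n m \<noteq> gen n' m"
proof -
  have "\<exists>p\<in>G. \<exists>m\<in>elts omega. opair (opair (num n) m) (num 1) \<in> elts p \<and> opair (opair (num n') m) (num 0) \<in> elts p"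
  proof (rule generic_dense)
    show "definable V (\<lambda>s. \<exists>m\<in>elts omega. opair (opair (num n) m) (num 1) \<in> elts (s 0) \<and> opair (opair (num n') m) (num 0) \<in> elts (s 0))"
      by (intro dintro omega_mem) (simp_all del: num.simps)
    fix p assume p: "p \<in> P"
    obtain N where N: "\<forall>n m i. entry n m i \<in> elts p --> n < N \<and> m < N" using P_bound[OF p] by blast
    \<comment> \<open>The column \<open>N\<close> lies beyond the domain of \<open>p\<close>, so
      both bits are still free there.\<close>
    define S where "S = {(n, N, 1::nat), (n', N, 0)}"
    have S1: "finite S" and S2: "\<And>a b i j. (a, b, i) \<in> S ==> (a, b, j) \<in> S ==> i = j"
      and S3: "\<And>a b i. (a, b, i) \<in> S ==> i \<in> {0, 1}"
      using assms by (auto simp: S_def)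
    have "\<exists>q\<in>P. elts q = {entry n m (num i) | n m i. (n, m, i) \<in> S}"
      by (rule P_finite_set[OF S1]) (use S2 S3 in blast)+
    then obtain q where q: "q \<in> P" "elts q = {entry n m (num i) | n m i. (n, m, i) \<in> S}" by blast
    have "\<exists>r\<in>P. elts r = elts p \<union> elts q"
    proof (rule P_union[OF p q(1)])
      fix x i j assume x: "opair x i \<in> elts p" and "opair x j \<in> elts q"
      then obtain k where "x = opair (num k) (num N)" unfolding q(2) S_def by auto
      with x N show "i = j" by blast
    qed
    then obtain r where "r \<in> P" "elts r = elts p \<union> elts q" by blast
    moreover have "entry n N (num 1) \<in> elts q" "entry n' N (num 0) \<in> elts q"
      unfolding q(2) S_def by blast+
    ultimately show "\<exists>q\<in>P. stronger q p \<and> (\<exists>m\<in>elts omega. opair (opair (num n) m) (num 1) \<in> elts q \<and> opair (opair (num n') m) (num 0) \<in> elts q)"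
      using num_omega[of N] unfolding stronger_def by blast
  qed
  then obtain p m where "p \<in> G" "entry n m (num 1) \<in> elts p" "entry n' m (num 0) \<in> elts p"
    by (auto simp: elts_omega)
  then have "gen n m" "\<not> gen n' m" using gen_0 unfolding gen_def by blast+
  then show ?thesis by blast
qed

end

context weak_class
begin

text \<open>A form with a single set quantifier, through which injectability can enter a definable
  dense set.\<close>

lemma injects_ap:
  assumes "a \<in> N" "b \<in> N"
  shows "injects N a b \<longleftrightarrow>
    (\<exists>f\<in>N. (\<forall>x\<in>elts a. ap f x \<in> elts b) \<and> (\<forall>x\<in>elts a. \<forall>y\<in>elts a. ap f x = ap f y --> x = y))"
proof
  assume "injects N a b"
  then obtain F where F: "Gr a F \<in> N" "inj_on F (elts a)" "\<forall>x\<in>elts a. F x \<in> elts b" by (rule injectsE)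
  then show "\<exists>f\<in>N. (\<forall>x\<in>elts a. ap f x \<in> elts b) \<and> (\<forall>x\<in>elts a. \<forall>y\<in>elts a. ap f x = ap f y --> x = y)"
    by (intro bexI[of _ "Gr a F"]) (auto simp: inj_on_def)
next
  assume "\<exists>f\<in>N. (\<forall>x\<in>elts a. ap f x \<in> elts b) \<and> (\<forall>x\<in>elts a. \<forall>y\<in>elts a. ap f x = ap f y --> x = y)"
  then obtain f where f: "f \<in> N" "\<forall>x\<in>elts a. ap f x \<in> elts b" "\<forall>x\<in>elts a. \<forall>y\<in>elts a. ap f x = ap f y --> x = y" by blast
  have d: "dterm N (\<lambda>s. ap f (s 0))" by (intro dintro f)
  have "Gr a (ap f) \<in> N" by (rule Gr_mem_dterm[OF assms _ d]) (use f(2) in blast)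
  then show "injects N a b" unfolding injects_def inj_on_def using f(2,3) by blast
qed

end

section \<open>Names for finite tuples of generic reals\<close>

context zfc_model
begin

text \<open>The least bound is a finite-to-one function into \<omega>. As a von Neumann numeral it
  is the set of the numbers that are not bounds, which gives the term \<nu>.\<close>

lemma countable_by_bound:
  assumes Q: "Q \<in> V" and bd: "definable V (\<lambda>s. bd (s 0) (s 1))"
    and mono: "\<And>x m n. bd (num m) x ==> m \<le> n ==> bd (num n) x"
    and ex: "\<And>x. x \<in> elts Q ==> \<exists>n. bd (num n) x"
    and fin: "\<And>n. finite {x \<in> elts Q. bd (num n) x}"
  shows "psurj V omega Q"
proof -
  define \<nu> where "\<nu> x = mk {m \<in> elts omega. \<not> bd m x}" for x
  have \<nu>: "dterm V (\<lambda>s. \<nu> (s 0))" unfolding \<nu>_def by (intro dintro definable_comp2[OF bd] omega_mem)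
  have val: "\<nu> x = num (LEAST n. bd (num n) x)" if x: "x \<in> elts Q" for x
  proof (rule elts_inject)
    define L where "L = (LEAST n. bd (num n) x)"
    have iff: "\<not> bd (num n) x \<longleftrightarrow> n < L" for n
      using mono[OF LeastI_ex[OF ex[OF x]], of n] Least_le[of "\<lambda>n. bd (num n) x" n] not_le unfolding L_def by blast
    have "elts (\<nu> x) = {m \<in> range num. \<not> bd m x}" unfolding \<nu>_def elts_mk_Collect unfolding elts_omega ..
    also have "\<dots> = num ` {n. \<not> bd (num n) x}" by blast
    also have "\<dots> = elts (num L)" unfolding iff elts_num lessThan_def ..
    finally show "elts (\<nu> x) = elts (num (LEAST n. bd (num n) x))" by (simp only: L_def)
  qed
  show ?thesis
  proof (rule countable_if_finite_to_one[OF Q \<nu>])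
    show "\<nu> x \<in> elts omega" if "x \<in> elts Q" for x using val[OF that] by simp
    fix n
    have "{x \<in> elts Q. \<nu> x = num n} \<subseteq> {x \<in> elts Q. bd (num n) x}"
    proof
      fix x assume "x \<in> {x \<in> elts Q. \<nu> x = num n}"
      then have x: "x \<in> elts Q" "(LEAST n. bd (num n) x) = n" using val by auto
      then show "x \<in> {x \<in> elts Q. bd (num n) x}" using LeastI_ex[OF ex[OF x(1)]] by simp
    qed
    then show "finite {x \<in> elts Q. \<nu> x = num n}" using fin finite_subset by blast
  qed
qed

lemma countable_PP: "psurj V omega PP"
proof (rule countable_by_bound[where bd = "\<lambda>n p. \<forall>z\<in>elts p. \<exists>a\<in>elts n. \<exists>b\<in>elts n. \<exists>i\<in>elts (num 2). z = opair (opair a b) i"])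
  show "definable V (\<lambda>s. \<forall>z\<in>elts (s 1). \<exists>a\<in>elts (s 0). \<exists>b\<in>elts (s 0). \<exists>i\<in>elts (num 2). z = opair (opair a b) i)"
    by (intro dintro num_mem)
  show "\<exists>n. \<forall>z\<in>elts p. \<exists>a\<in>elts (num n). \<exists>b\<in>elts (num n). \<exists>i\<in>elts (num 2). z = opair (opair a b) i" if "p \<in> elts PP" for p
  proof -
    have p: "p \<in> P" using that elts_PP by simp
    obtain K where K: "\<forall>n m i. entry n m i \<in> elts p --> n < K \<and> m < K" using P_bound[OF p] by blast
    have "\<exists>a\<in>elts (num K). \<exists>b\<in>elts (num K). \<exists>i\<in>elts (num 2). z = opair (opair a b) i" if z: "z \<in> elts p" for z
    proof -
      obtain n m i where zi: "i \<in> {0, 1}" "z = entry n m (num i)" using P_shape[OF p z] by blast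
      then have "n < K" "m < K" "i < 2" using K z by auto
      then have "num n \<in> elts (num K)" "num m \<in> elts (num K)" "num i \<in> elts (num 2)" by (simp_all only: num_mem_iff)
      then show ?thesis using zi(2) by blast
    qed
    then show ?thesis by blast
  qed
  fix n
  let ?F = "(\<lambda>(a, b, i). entry a b (num i)) ` ({..<n} \<times> {..<n} \<times> {..<2::nat}) :: 'u set"
  have "{p \<in> elts PP. \<forall>z\<in>elts p. \<exists>a\<in>elts (num n). \<exists>b\<in>elts (num n). \<exists>i\<in>elts (num 2). z = opair (opair a b) i} \<subseteq> mk ` Pow ?F"
  proof
    fix p assume p: "p \<in> {p \<in> elts PP. \<forall>z\<in>elts p. \<exists>a\<in>elts (num n). \<exists>b\<in>elts (num n). \<exists>i\<in>elts (num 2). z = opair (opair a b) i}"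
    have "elts p \<subseteq> ?F"
    proof
      fix z assume "z \<in> elts p"
      then obtain a b i where "a \<in> elts (num n)" "b \<in> elts (num n)" "i \<in> elts (num 2)" "z = opair (opair a b) i" using p by blast
      then show "z \<in> ?F" unfolding elts_num by force
    qed
    then show "p \<in> mk ` Pow ?F" using mk_elts[of p] by (metis PowI image_eqI)
  qed
  then show "finite {p \<in> elts PP. \<forall>z\<in>elts p. \<exists>a\<in>elts (num n). \<exists>b\<in>elts (num n). \<exists>i\<in>elts (num 2). z = opair (opair a b) i}"
    by (rule finite_subset) simp
qed (auto simp: elts_num)

lemma countable_GG: "psurj V omega GG"
proof (rule countable_by_bound[where bd = "\<lambda>n u. \<forall>x\<in>elts omega. x \<notin> elts n --> ap u x = x"])
  show "definable V (\<lambda>s. \<forall>x\<in>elts omega. x \<notin> elts (s 0) --> ap (s 1) x = x)" by (intro dintro omega_mem)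
  have bd: "(\<forall>x\<in>elts (omega :: 'u). x \<notin> elts (num n) --> ap (code \<pi>) x = x) \<longleftrightarrow> (\<forall>i\<ge>n. \<pi> i = i)" for \<pi> n
    by (simp add: elts_omega not_less)
  show "\<exists>n. \<forall>x\<in>elts omega. x \<notin> elts (num n) --> ap u x = x" if u: "u \<in> elts GG" for u
  proof -
    obtain \<pi> where \<pi>: "u = code \<pi>" "finite {n. \<pi> n \<noteq> n}" using u unfolding elts_GG by (auto simp: finitary_group_def)
    then obtain n where "{n. \<pi> n \<noteq> n} \<subseteq> {..<n}" using finite_nat_iff_bounded by blast
    then have "\<forall>i\<ge>n. \<pi> i = i" by (metis (mono_tags) lessThan_iff mem_Collect_eq not_le subsetD)
    then show ?thesis using bd \<pi>(1) by blast
  qed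
  fix n
  let ?S = "{u \<in> elts GG. \<forall>x\<in>elts omega. x \<notin> elts (num n) --> ap u x = x}"
  let ?F = "(\<lambda>(a, b). opair (num a) (num b)) ` ({..<n} \<times> {..<n}) :: 'u set"
  have S: "\<exists>\<pi>. u = code \<pi> \<and> bij \<pi> \<and> (\<forall>i\<ge>n. \<pi> i = i)" if u: "u \<in> ?S" for u
  proof -
    from u obtain \<pi> where "u = code \<pi>" "bij \<pi>" unfolding elts_GG by (auto simp: finitary_group_def)
    then show ?thesis using u bd by blast
  qed
  \<comment> \<open>A permutation that is the identity from \<open>n\<close> on is determined by the
    part of its graph inside n \<times> n, for which there are finitely many possibilities.\<close>
  have "inj_on (\<lambda>u. elts u \<inter> ?F) ?S"
  proof (rule inj_onI)
    fix u u' assume "u \<in> ?S" "u' \<in> ?S" and eq: "elts u \<inter> ?F = elts u' \<inter> ?F"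
    obtain \<pi> where \<pi>: "u = code \<pi>" "bij \<pi>" "\<forall>i\<ge>n. \<pi> i = i" using S[OF \<open>u \<in> ?S\<close>] by blast
    obtain \<sigma> where \<sigma>: "u' = code \<sigma>" "bij \<sigma>" "\<forall>i\<ge>n. \<sigma> i = i" using S[OF \<open>u' \<in> ?S\<close>] by blast
    have "\<pi> i = \<sigma> i" for i
    proof (cases "i < n")
      case True
      have "\<pi> i < n"
      proof (rule ccontr)
        assume "\<not> \<pi> i < n"
        then have "\<pi> (\<pi> i) = \<pi> i" using \<pi>(3) by simp
        then have "\<pi> i = i" using \<pi>(2) by (metis bij_pointE)
        then show False using True \<open>\<not> \<pi> i < n\<close> by simp
      qed
      then have "opair (num i) (num (\<pi> i)) \<in> elts u \<inter> ?F" using True unfolding \<pi>(1) elts_code by force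
      then have "opair (num i) (num (\<pi> i)) \<in> elts u' \<inter> ?F" by (simp only: eq)
      then have "opair (num i) (num (\<pi> i)) \<in> elts (code \<sigma> :: 'u)" by (simp only: \<sigma>(1) Int_iff)
      then show ?thesis unfolding elts_code by auto
    qed (use \<pi> \<sigma> in simp)
    then show "u = u'" using \<pi>(1) \<sigma>(1) by (simp add: code_inject fun_eq_iff)
  qed
  moreover have "finite ((\<lambda>u. elts u \<inter> ?F) ` ?S)" by (rule finite_subset[of _ "Pow ?F"]) auto
  ultimately show "finite ?S" by (rule finite_imageD[rotated])
next
  fix x :: 'u and m n :: nat assume *: "\<forall>y\<in>elts omega. y \<notin> elts (num m) --> ap x y = y" "m \<le> n"
  have "elts (num m :: 'u) \<subseteq> elts (num n)" using *(2) by (auto simp: elts_num)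
  then show "\<forall>y\<in>elts omega. y \<notin> elts (num n) --> ap x y = y" using *(1) by blast
qed (rule GG_mem)

text \<open>The canonical name of the sequence of the first \<open>k\<close> Cohen reals, coded as
  the subset of k \<times> \<omega> whose section at \<open>i\<close> is the real with index
  \<open>i\<close>. The doubled entry inside is the one-point condition \<open>unit\<close>.\<close>

definition rnm :: "'u => 'u" where
  "rnm k = mk ((\<lambda>w. opair (mk {opair w (num 1), opair w (num 1)}) (check w)) ` elts (cprod k omega))"

lemma dterm_rnm [dintro]: "dterm V t ==> dterm V (\<lambda>s. rnm (t s))"
  unfolding rnm_def by (intro dintro num_mem omega_mem)

definition unit :: "nat => nat => 'u" where "unit n m = mk {entry n m (num 1)}"

lemma unit_P: "unit n m \<in> P"
  unfolding unit_def Add_def using finite_mem[of "{entry n m (num 1)}"] by auto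

lemma elts_rnm: "elts (rnm (num k)) = {opair (unit i m) (check (opair (num i) (num m))) | i m. i < k}"
proof -
  have "elts (cprod (num k :: 'u) omega) = {opair (num i) (num m) | i m. i < k}"
    unfolding elts_cprod[OF num_mem omega_mem] elts_num elts_omega by auto
  then show ?thesis unfolding rnm_def elts_mk_image unit_def by (auto simp: image_iff)
qed

lemma act_unit: "act_cond \<pi> (unit n m) = unit (\<pi> n) m"
proof (rule elts_inject)
  show "elts (act_cond \<pi> (unit n m)) = elts (unit (\<pi> n) m :: 'u)"
    unfolding elts_act_cond unit_def elts_mk_singleton by auto
qed

lemma elts_act_rnm: "elts (act_name \<pi> (rnm (num k))) = {opair (unit (\<pi> i) m) (check (opair (num i) (num m))) | i m. i < k}"
proof (intro equalityI subsetI)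
  fix z assume "z \<in> elts (act_name \<pi> (rnm (num k)))"
  then obtain p y where "opair p y \<in> elts (rnm (num k))" "z = opair (act_cond \<pi> p) (act_name \<pi> y)" unfolding elts_act_name by blast
  moreover from this obtain i m where "i < k" "p = unit i m" "y = check (opair (num i) (num m))" unfolding elts_rnm by auto
  ultimately show "z \<in> {opair (unit (\<pi> i) m) (check (opair (num i) (num m))) | i m. i < k}"
    unfolding act_unit act_name_check by (auto simp only: act_unit act_name_check)
next
  fix z assume "z \<in> {opair (unit (\<pi> i) m) (check (opair (num i) (num m))) | i m. i < k}"
  then obtain i m where "i < k" "z = opair (unit (\<pi> i) m) (check (opair (num i) (num m)))" by blast
  then have "opair (unit i m) (check (opair (num i) (num m))) \<in> elts (rnm (num k))"
    "z = opair (act_cond \<pi> (unit i m)) (act_name \<pi> (check (opair (num i) (num m))))"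
    unfolding elts_rnm act_unit act_name_check by blast+
  then show "z \<in> elts (act_name \<pi> (rnm (num k)))" unfolding elts_act_name by blast
qed

lemma HS_rnm: "HS (rnm (num k))"
proof (rule HS_intro)
  show "rnm (num k) \<in> V" using dterm_mem[OF dterm_rnm[OF dterm_const[OF num_mem]] env_empty] .
  show "\<exists>p\<in>P. \<exists>y. HS y \<and> z = opair p y" if "z \<in> elts (rnm (num k))" for z
    using that unfolding elts_rnm using unit_P HS_check by fastforce
  show "supports k (rnm (num k))"
    unfolding supports_def
  proof
    fix \<pi> assume "\<pi> \<in> fixer {..<k}"
    then have "\<pi> i = i" if "i < k" for i using that by (simp add: fixer_def)
    then have "elts (act_name \<pi> (rnm (num k))) = elts (rnm (num k))" unfolding elts_act_rnm elts_rnm by force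
    then show "act_name \<pi> (rnm (num k)) = rnm (num k)" by (rule elts_inject)
  qed
qed

text \<open>The images of the canonical names under finitary permutations. Every finite sequence of
  distinct indices begins such a permutation, so all finite sequences of distinct Cohen reals are
  named.\<close>

definition BB :: 'u where "BB = mk ((\<lambda>w. actn (ufst w) (rnm (usnd w))) ` elts (cprod GG omega))"

lemma BB_mem [simp]: "BB \<in> V"
proof -
  have "dterm V (\<lambda>s. mk ((\<lambda>w. actn (ufst w) (rnm (usnd w))) ` elts (cprod GG omega)))"
    by (intro dintro dterm_comp2[OF dterm_actn] GG_mem omega_mem)
  from dterm_mem[OF this env_empty] show ?thesis by (simp only: BB_def)
qed

lemma elts_BB: "elts BB = {act_name \<pi> (rnm (num k)) | \<pi> k. \<pi> \<in> perms}"
proof -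
  have "elts (cprod GG omega) = {opair (code \<pi>) (num k) | \<pi> k. \<pi> \<in> perms}"
    unfolding elts_cprod[OF GG_mem omega_mem] elts_GG elts_omega by auto
  then have "elts BB = (\<lambda>w. actn (ufst w) (rnm (usnd w))) ` {opair (code \<pi>) (num k) | \<pi> k. \<pi> \<in> perms}"
    unfolding BB_def elts_mk_image by (simp only:)
  also have "\<dots> = {actn (ufst (opair (code \<pi>) (num k))) (rnm (usnd (opair (code \<pi> :: 'u) (num k)))) | \<pi> k. \<pi> \<in> perms}" by blast
  finally have "elts BB = {actn (code \<pi>) (rnm (num k)) | \<pi> k. \<pi> \<in> perms}" by (simp only: ufst_opair usnd_opair)
  moreover have "\<dots> = {act_name \<pi> (rnm (num k)) | \<pi> k. \<pi> \<in> perms}"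
    by (intro Collect_cong ex_cong1) (auto simp: actn_code)
  ultimately show ?thesis by simp
qed

lemma HS_BB: "r \<in> elts BB ==> HS r"
  unfolding elts_BB using HS_act HS_rnm by blast

lemma countable_BB: "psurj V omega BB"
proof -
  have W: "cprod GG omega \<in> V" by (simp add: cprod_mem)
  have "psurj V (cprod GG omega) BB"
  proof (rule psurjI[OF W order_refl])
    show "Gr (cprod GG omega) (\<lambda>w. actn (ufst w) (rnm (usnd w))) \<in> V"
      by (rule Gr_mem_dterm[OF W BB_mem]) (auto simp: BB_def intro!: dintro dterm_comp2[OF dterm_actn])
  qed (auto simp: BB_def)
  moreover have "psurj V omega (cprod GG omega)"
    using psurj_trans[OF psurj_omega_square psurj_cprod[OF countable_GG psurj_subset]] W cprod_mem by simp
  ultimately show ?thesis using psurj_trans[OF _ _ omega_mem W BB_mem] by blast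
qed

definition QQ :: 'u where "QQ = cprod PP BB"

lemma QQ_mem [simp]: "QQ \<in> V" by (simp add: QQ_def cprod_mem)

lemma countable_QQ: "psurj V omega QQ"
  using psurj_trans[OF psurj_omega_square psurj_cprod[OF countable_PP countable_BB]] cprod_mem
  by (simp add: QQ_def)

text \<open>The inverse of \<sigma> composed with \<pi> fixes the support, so the action on
  \<open>y\<close> depends only on the values of the permutation below \<open>k\<close>.\<close>

lemma act_agree:
  assumes "supports k y" "is_name V y" "\<pi> \<in> perms" "\<sigma> \<in> perms" "\<forall>i<k. \<pi> i = \<sigma> i"
  shows "act_name \<pi> y = act_name \<sigma> y"
proof -
  have "pinv \<sigma> \<circ> \<pi> \<in> fixer {..<k}"
    unfolding fixer_def using finitary_comp[OF finitary_inv[OF assms(4)] assms(3)] assms(5)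
      inv_f_f[OF bij_is_inj[OF finitary_bij[OF assms(4)]]] by auto
  then have "act_name (pinv \<sigma>) (act_name \<pi> y) = y" using assms(1) by (simp add: supports_def act_name_comp)
  then have "act_name \<sigma> (act_name (pinv \<sigma>) (act_name \<pi> y)) = act_name \<sigma> y" by simp
  then show ?thesis using act_name_inv(2)[OF assms(4) name_act[OF assms(3,2)]] by simp
qed

end

context cohen
begin

definition breal :: "(nat => nat) => nat => 'u" where "breal \<pi> k = interp G (act_name \<pi> (rnm (num k)))"

lemma unit_G: "unit n m \<in> G \<longleftrightarrow> gen n m"
  unfolding G_iff[OF unit_P] by (auto simp: unit_def)

lemma elts_breal: "elts (breal \<pi> k) = {opair (num i) (num m) | i m. i < k \<and> gen (\<pi> i) m}"
proof (intro equalityI subsetI)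
  fix z assume "z \<in> elts (breal \<pi> k)"
  then obtain p y where "z = interp G y" "p \<in> G" "opair p y \<in> elts (act_name \<pi> (rnm (num k)))"
    unfolding breal_def elts_interp by blast
  moreover from this obtain i m where "i < k" "p = unit (\<pi> i) m" "y = check (opair (num i) (num m))"
    unfolding elts_act_rnm by auto
  ultimately show "z \<in> {opair (num i) (num m) | i m. i < k \<and> gen (\<pi> i) m}"
    using unit_G interp_check[OF empty_G] by auto
next
  fix z :: 'u assume "z \<in> {opair (num i) (num m) | i m. i < k \<and> gen (\<pi> i) m}"
  then obtain i m where *: "i < k" "gen (\<pi> i) m" "z = opair (num i) (num m)" by blast
  then have "opair (unit (\<pi> i) m) (check (opair (num i) (num m))) \<in> elts (act_name \<pi> (rnm (num k)))" unfolding elts_act_rnm by blast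
  moreover have "unit (\<pi> i) m \<in> G" "z = interp G (check (opair (num i) (num m)))" using * unit_G interp_check[OF empty_G] by auto
  ultimately show "z \<in> elts (breal \<pi> k)" unfolding breal_def elts_interp by blast
qed

text \<open>Cohen reals with different indices differ, so a sequence determines its indices; this is
  what makes the later assignment of elements to sequences single-valued.\<close>

lemma breal_inject: "breal \<pi> k = breal \<sigma> k \<longleftrightarrow> (\<forall>i<k. \<pi> i = \<sigma> i)"
proof
  assume eq: "breal \<pi> k = breal \<sigma> k"
  show "\<forall>i<k. \<pi> i = \<sigma> i"
  proof (intro allI impI, rule ccontr)
    fix i assume i: "i < k" "\<pi> i \<noteq> \<sigma> i"
    then obtain m where "gen (\<pi> i) m \<noteq> gen (\<sigma> i) m" using gen_distinct by blast
    then have "(opair (num i) (num m) \<in> elts (breal \<pi> k)) \<noteq> (opair (num i) (num m) \<in> elts (breal \<sigma> k))"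
      unfolding elts_breal using i(1) by auto
    with eq show False by simp
  qed
next
  assume "\<forall>i<k. \<pi> i = \<sigma> i"
  then have "elts (breal \<pi> k) = elts (breal \<sigma> k)" unfolding elts_breal by force
  then show "breal \<pi> k = breal \<sigma> k" by (rule elts_inject)
qed

definition BM :: 'u where "BM = interp G (mk ((\<lambda>r. opair (mk {}) r) ` elts BB))"

lemma BM: "BM \<in> M \<and> elts BM = interp G ` elts BB"
proof -
  let ?b = "mk ((\<lambda>r. opair (mk {}) r) ` elts BB)"
  have "dterm V (\<lambda>s. mk ((\<lambda>r. opair (mk {}) r) ` elts BB))" by (intro dintro empty_mem BB_mem)
  from dterm_mem[OF this env_empty] have V: "?b \<in> V" .
  have sh: "\<exists>p\<in>P. \<exists>y. HS y \<and> z = opair p y" if "z \<in> elts ?b" for z using that HS_BB empty_P by auto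
  then have name: "is_name V ?b" using HS_name by (intro is_name.intros[OF V]) blast
  have "supports 0 ?b"
  proof (rule supports_closed[OF name])
    fix \<pi> p y assume \<pi>: "\<pi> \<in> fixer {..<0}" and "opair p y \<in> elts ?b"
    then obtain \<sigma> k where "p = mk {}" "y = act_name \<sigma> (rnm (num k))" "\<sigma> \<in> perms"
      unfolding elts_mk_image unfolding elts_BB by auto
    moreover from this have "act_name \<pi> y \<in> elts BB"
      unfolding elts_BB using finitary_comp[OF fixer_carrier[OF \<pi>]] act_name_comp by blast
    ultimately show "opair (act_cond \<pi> p) (act_name \<pi> y) \<in> elts ?b" by simp
  qed
  then have "HS ?b" by (rule HS_intro[OF V, rotated]) (rule sh)
  moreover have "elts (interp G ?b) = interp G ` elts BB"
  proof (intro equalityI subsetI)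
    fix x assume "x \<in> interp G ` elts BB"
    then obtain r where "r \<in> elts BB" "x = interp G r" by blast
    then have "mk {} \<in> G" "opair (mk {}) r \<in> elts ?b" "x = interp G r" using empty_G unfolding elts_mk_image by blast+
    then show "x \<in> elts (interp G ?b)" unfolding elts_interp by blast
  qed (auto simp: elts_interp)
  ultimately show ?thesis unfolding BM_def using M_I by blast
qed

lemmas BM_mem [simp] = BM[THEN conjunct1] and elts_BM = BM[THEN conjunct2]

lemma elts_BM_breal: "elts BM = {breal \<pi> k | \<pi> k. \<pi> \<in> perms}"
  unfolding elts_BM elts_BB breal_def by auto

section \<open>Covering functions of the symmetric model by functions of the ground model\<close>

lemma truth_pair:
  assumes "HS x" "HS y" "HS f"
  shows "opair (interp G x) (interp G y) \<in> elts (interp G f) \<longleftrightarrow> (\<exists>p\<in>G. forces_mem p (opn x y) f)"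
  using truth_mem[OF HS_name[OF HS_opn[OF assms(1,2)]] HS_name[OF assms(3)]] interp_opn[OF empty_G] by simp

lemma forces_mem_mono: "forces_mem p x y ==> q \<in> P ==> stronger q p ==> forces_mem q x y"
  using forces_mono[of "Mem 0 1" p "\<lambda>n. if n = 0 then x else y"] by simp

text \<open>The value of the function at \<open>x\<close> and \<open>b\<close> is forced by some
  condition \<open>p\<close> for a name \<open>r\<close> of \<open>b\<close>, so in \<open>V\<close>
  it can be recovered from \<open>x\<close>, \<open>p\<close> and \<open>r\<close>. As
  \<open>QQ\<close> is countable in \<open>V\<close>, the passage from \<open>M\<close> to
  \<open>V\<close> costs only a countable factor.\<close>

lemma covering:
  assumes D: "D \<in> V" and E: "E \<in> V" and s: "psurj M (cprod D BM) E"
  shows "psurj V (cprod D QQ) E"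
proof -
  obtain d F where d: "d \<in> M" "elts d \<subseteq> elts (cprod D BM)" "Gr d F \<in> M" "\<forall>x\<in>elts d. F x \<in> elts E" "\<forall>y\<in>elts E. \<exists>x\<in>elts d. F x = y"
    by (rule MM.psurjE[OF s])
  obtain f where f: "HS f" "Gr d F = interp G f" using M_E[OF d(3)] by blast
  define R where "R w y \<longleftrightarrow> forces_mem (ufst (usnd w)) (opn (opn (check (ufst w)) (usnd (usnd w))) (check y)) f" for w y
  have R: "definable V (\<lambda>s. R (s 0) (s 1))"
    unfolding R_def by (intro definable_comp3[OF definable_forces_mem] dintro HS_V[OF f(1)])
  \<comment> \<open>The value is required to be the only one in \<open>E\<close>; triples whose
    condition forces several values are left out of the domain.\<close>
  define R1 where "R1 w y \<longleftrightarrow> R w y \<and> (\<forall>y'\<in>elts E. R w y' --> y' = y)" for w y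
  have R1: "definable V (\<lambda>s. R1 (s 0) (s 1))"
    unfolding R1_def by (intro dintro definable_comp2[OF R] E)
  define e where "e = mk {w \<in> elts (cprod D QQ). \<exists>y\<in>elts E. R1 w y}"
  have DQ: "cprod D QQ \<in> V" using D by (simp add: cprod_mem)
  have eV: "e \<in> V" unfolding e_def by (rule separation[OF DQ]) (intro dintro definable_comp2[OF R1] E)
  define F' where "F' w = (THE y. y \<in> elts E \<and> R1 w y)" for w
  have F': "y \<in> elts E ==> R1 w y \<longleftrightarrow> y = F' w" and F'E: "F' w \<in> elts E" if w: "w \<in> elts e" for w y
  proof -
    obtain y0 where y0: "y0 \<in> elts E" "R1 w y0" using w unfolding e_def by auto
    have "F' w = y0" unfolding F'_def by (rule the_equality) (use y0 R1_def in blast)+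
    note F0 = this
    have un: "y' = y0" if "y' \<in> elts E" "R1 w y'" for y' using y0 that unfolding R1_def by blast
    show "y \<in> elts E ==> R1 w y \<longleftrightarrow> y = F' w" unfolding F0 using un y0(2) by blast
    show "F' w \<in> elts E" unfolding F0 by (rule y0(1))
  qed
  show ?thesis
  proof (rule psurjI[OF eV _ _ F'E])
    show "Gr e F' \<in> V" by (rule Gr_mem_rel[OF eV E _ R1]) (use F' F'E in auto)
    show "\<exists>w\<in>elts e. F' w = y" if y: "y \<in> elts E" for y
    proof -
      obtain z where z: "z \<in> elts d" "F z = y" using d(5) y by blast
      then obtain x b where xb: "z = opair x b" "x \<in> elts D" "b \<in> elts BM"
        using d(2) unfolding MM.elts_cprod[OF V_subset_M[OF D] BM_mem] by blast
      obtain r where r: "r \<in> elts BB" "b = interp G r" using xb(3) unfolding elts_BM by blast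
      have xV: "x \<in> V" "y \<in> V" using V_trans xb(2) D y E by blast+
      have hs: "HS (opn (check x) r)" using HS_opn HS_check[OF xV(1)] HS_BB[OF r(1)] by blast
      have int: "interp G (opn (check x) r) = z" using interp_opn[OF empty_G] interp_check[OF empty_G] r(2) xb(1) by simp
      have tr: "opair z y' \<in> elts (Gr d F) \<longleftrightarrow> (\<exists>p\<in>G. forces_mem p (opn (opn (check x) r) (check y')) f)" if "y' \<in> V" for y'
        using truth_pair[OF hs HS_check[OF that] f(1)] int interp_check[OF empty_G] f(2) by simp
      obtain p where p: "p \<in> G" "forces_mem p (opn (opn (check x) r) (check y)) f"
        using tr[OF xV(2)] z by (auto simp: opair_Gr)
      define w where "w = opair x (opair p r)"
      have "y' = y" if "y' \<in> elts E" "R w y'" for y'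
        using tr[OF V_trans[OF that(1) E]] that(2) p(1) z by (auto simp: opair_Gr R_def w_def)
      then have "R1 w y" using p(2) by (auto simp: R1_def R_def w_def)
      moreover have "w \<in> elts (cprod D QQ)"
        using xb(2) p(1) r(1) D G_P unfolding w_def QQ_def by (simp add: cprod_mem elts_PP)
      ultimately have "w \<in> elts e" using y unfolding e_def by auto
      then show ?thesis using F' \<open>R1 w y\<close> y by blast
    qed
  qed (auto simp: e_def)
qed

lemma covering_bound:
  assumes \<kappa>: "\<kappa> \<in> V" "is_ord \<kappa>" "infinite (elts \<kappa>)" and E: "E \<in> V" and s: "psurj M (cprod \<kappa> BM) E"
  shows "psurj V \<kappa> E"
  using psurj_trans[OF psurj_times_countable[OF \<kappa> QQ_mem countable_QQ \<kappa>(1) psurj_subset[OF \<kappa>(1,1) order_refl]]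
      covering[OF \<kappa>(1) E s]] \<kappa>(1) E cprod_mem QQ_mem by blast

text \<open>Below any condition \<open>q\<close>, either some index is kept from being covered, or
  the pairs in \<open>QQ\<close> with condition below \<open>q\<close> cover \<kappa> by sections
  lying in \<open>V\<close>, to which \<open>hyp\<close> applies. The first alternative contradicts
  \<open>cover\<close>, so the filter meets a condition with a large section, and all indices of
  that section are related to one sequence.\<close>

lemma generic_section:
  assumes \<kappa>: "\<kappa> \<in> V" and \<delta>: "\<delta> \<in> V" and Rel: "Rel \<in> M"
    and cover: "\<And>i. i \<in> elts \<kappa> ==> \<exists>b\<in>elts BM. opair b i \<in> elts Rel"
    and hyp: "\<And>S. S \<in> V ==> (\<And>i. i \<in> elts \<kappa> ==> \<exists>w\<in>elts QQ. opair w i \<in> elts S) ==>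
      \<exists>w\<in>elts QQ. injects V \<delta> (mk {i \<in> elts \<kappa>. opair w i \<in> elts S})"
  shows "\<exists>b\<in>elts BM. \<exists>S\<in>V. injects V \<delta> S \<and> (\<forall>i\<in>elts S. i \<in> elts \<kappa> \<and> opair b i \<in> elts Rel)"
proof -
  obtain \<rho> where \<rho>: "HS \<rho>" "Rel = interp G \<rho>" using M_E[OF Rel] by blast
  define Fo where "Fo p r i \<longleftrightarrow> forces_mem p (opn r (check i)) \<rho>" for p r i
  have Fo: "definable V (\<lambda>s. Fo (s 0) (s 1) (s 2))"
    unfolding Fo_def by (intro definable_comp3[OF definable_forces_mem] dintro HS_V[OF \<rho>(1)])
  define sc where "sc p r = mk {i \<in> elts \<kappa>. Fo p r i}" for p r
  have sc: "dterm V (\<lambda>s. sc (s 0) (s 1))"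
    unfolding sc_def by (intro dintro definable_comp3[OF Fo] \<kappa>)
  have scV: "sc p r \<in> V" if "p \<in> V" "r \<in> V" for p r
    using dterm_mem[OF sc, of "\<lambda>n. if n = 0 then p else r"] that by (simp add: env_def)
  define inj where "inj a b \<longleftrightarrow> (\<exists>f\<in>V. (\<forall>x\<in>elts a. ap f x \<in> elts b) \<and> (\<forall>x\<in>elts a. \<forall>y\<in>elts a. ap f x = ap f y --> x = y))" for a b :: 'u
  have injd: "definable V (\<lambda>s. inj (s 0) (s 1))" unfolding inj_def by (intro dintro)
  define W where "W q \<longleftrightarrow> (\<exists>r\<in>elts BB. inj \<delta> (sc q r)) \<or>
      (\<exists>i\<in>elts \<kappa>. \<forall>p\<in>elts PP. stronger p q --> (\<forall>r\<in>elts BB. \<not> Fo p r i))" for q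
  have "definable V (\<lambda>s. W (s 0))"
    unfolding W_def by (intro dintro definable_comp2[OF injd] dterm_comp2[OF sc] definable_comp3[OF Fo] \<kappa> \<delta> PP_mem BB_mem)
  then have "\<exists>q\<in>G. W q"
  proof (rule generic_dense)
    fix q assume q: "q \<in> P"
    note qV = P_V[OF q]
    show "\<exists>p\<in>P. stronger p q \<and> W p"
    proof (cases "\<exists>i\<in>elts \<kappa>. \<forall>p\<in>elts PP. stronger p q --> (\<forall>r\<in>elts BB. \<not> Fo p r i)")
      case True
      then show ?thesis using q stronger_refl unfolding W_def by blast
    next
      case False
      define S where "S = mk {z \<in> elts (cprod QQ \<kappa>). stronger (ufst (ufst z)) q \<and> Fo (ufst (ufst z)) (usnd (ufst z)) (usnd z)}"
      have SV: "S \<in> V" unfolding S_def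
        by (rule separation[OF cprod_mem[OF QQ_mem \<kappa>]]) (intro dintro definable_comp3[OF Fo] qV)
      have memS: "opair (opair p r) i \<in> elts S \<longleftrightarrow> p \<in> P \<and> r \<in> elts BB \<and> i \<in> elts \<kappa> \<and> stronger p q \<and> Fo p r i" for p r i
        unfolding S_def elts_mk_Collect using \<kappa> by (auto simp: QQ_def cprod_mem elts_PP)
      have "\<exists>w\<in>elts QQ. opair w i \<in> elts S" if i: "i \<in> elts \<kappa>" for i
      proof -
        obtain p r where "p \<in> P" "stronger p q" "r \<in> elts BB" "Fo p r i" using False i elts_PP by blast
        then have "opair (opair p r) i \<in> elts S" "opair p r \<in> elts QQ" using memS i by (auto simp: QQ_def elts_PP)
        then show ?thesis by blast
      qed
      from hyp[OF SV this] obtain w where w: "w \<in> elts QQ" "injects V \<delta> (mk {i \<in> elts \<kappa>. opair w i \<in> elts S})" by blast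
      obtain p r where pr: "w = opair p r" "p \<in> P" "r \<in> elts BB"
        using w(1) unfolding QQ_def elts_cprod[OF PP_mem BB_mem] elts_PP by blast
      have rV: "r \<in> V" using V_trans[OF pr(3) BB_mem] .
      show ?thesis
      \<comment> \<open>If \<delta> is empty, the section of \<open>w\<close> may be empty too, and
        nothing places its condition below \<open>q\<close>; then \<open>q\<close> itself
        serves.\<close>
      proof (cases "elts \<delta> = {}")
        case True
        then have "inj \<delta> (sc q r)" unfolding inj_def using empty_mem by blast
        then show ?thesis using q stronger_refl pr(3) unfolding W_def by blast
      next
        case False
        obtain F where F: "inj_on F (elts \<delta>)" "\<forall>x\<in>elts \<delta>. F x \<in> elts (mk {i \<in> elts \<kappa>. opair w i \<in> elts S})" "Gr \<delta> F \<in> V"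
          using w(2) by (rule injectsE)
        then have st: "stronger p q" using False memS unfolding pr(1) by auto
        have "injects V \<delta> (sc p r)"
          unfolding injects_def using F memS unfolding pr(1) sc_def by (intro exI[of _ F]) auto
        then have "inj \<delta> (sc p r)"
          using injects_ap[OF \<delta> scV[OF P_V[OF pr(2)] rV]] unfolding inj_def by blast
        then show ?thesis using pr st unfolding W_def by blast
      qed
    qed
  qed
  then obtain q where q: "q \<in> G" "W q" by blast
  have "\<not> (\<exists>i\<in>elts \<kappa>. \<forall>p\<in>elts PP. stronger p q --> (\<forall>r\<in>elts BB. \<not> Fo p r i))"
  proof
    assume "\<exists>i\<in>elts \<kappa>. \<forall>p\<in>elts PP. stronger p q --> (\<forall>r\<in>elts BB. \<not> Fo p r i)"
    then obtain i where i: "i \<in> elts \<kappa>" "\<forall>p\<in>P. stronger p q --> (\<forall>r\<in>elts BB. \<not> Fo p r i)" unfolding elts_PP by blast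
    obtain r where r: "r \<in> elts BB" "opair (interp G r) i \<in> elts Rel" using cover[OF i(1)] unfolding elts_BM by blast
    then obtain p where p: "p \<in> G" "Fo p r i"
      using truth_pair[OF HS_BB[OF r(1)] HS_check[OF V_trans[OF i(1) \<kappa>]] \<rho>(1)] interp_check[OF empty_G] \<rho>(2)
      unfolding Fo_def by auto
    obtain t where t: "t \<in> G" "stronger t p" "stronger t q" using G_dir[OF p(1) q(1)] by blast
    have "Fo t r i" using forces_mem_mono[OF _ G_P[OF t(1)] t(2)] p(2) unfolding Fo_def by blast
    then show False using i(2) t(3) G_P[OF t(1)] r(1) by blast
  qed
  then obtain r where r: "r \<in> elts BB" "inj \<delta> (sc q r)" using q(2) unfolding W_def by blast
  have V: "q \<in> V" "r \<in> V" using P_V[OF G_P[OF q(1)]] V_trans[OF r(1) BB_mem] by auto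
  have "injects V \<delta> (sc q r)" using injects_ap[OF \<delta> scV[OF V]] r(2) unfolding inj_def by blast
  moreover have "i \<in> elts \<kappa> \<and> opair (interp G r) i \<in> elts Rel" if i: "i \<in> elts (sc q r)" for i
  proof -
    have "i \<in> elts \<kappa>" "Fo q r i" using i unfolding sc_def by auto
    then show ?thesis
      using truth_pair[OF HS_BB[OF r(1)] HS_check[OF V_trans[OF _ \<kappa>]] \<rho>(1), of i] interp_check[OF empty_G] \<rho>(2) q(1)
      unfolding Fo_def by auto
  qed
  moreover have "interp G r \<in> elts BM" using r(1) unfolding elts_BM by blast
  ultimately show ?thesis using scV[OF V] by blast
qed

text \<open>An index is a pair from the name \<xi> of \<open>X\<close>, consisting of
  \<open>p\<close> and \<open>y\<close>, together with a number \<open>k\<close> supporting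
  \<open>y\<close>. A sequence of \<open>k\<close> Cohen reals determines its indices and thereby
  the moved name of \<open>y\<close>, whose interpretation is the element it stands for. Closing the
  assignment under the permutations that fix a support of \<xi> gives it a symmetric name.\<close>

lemma decomposition:
  assumes X: "X \<in> M"
  obtains D d h where "D \<in> V" "d \<in> M" "elts d \<subseteq> elts (cprod D BM)" "Gr d h \<in> M" "h ` elts d = elts X"
    "\<forall>x\<in>elts D. \<exists>k y. HS y \<and> supports k y \<and>
      (\<forall>b. opair x b \<in> elts d --> (\<exists>\<pi>\<in>perms. b = breal \<pi> k)) \<and>
      (\<forall>\<pi>\<in>perms. opair x (breal \<pi> k) \<in> elts d --> h (opair x (breal \<pi> k)) = interp G (act_name \<pi> y))"
proof -
  obtain \<xi> where \<xi>: "HS \<xi>" "X = interp G \<xi>" using M_E[OF X] by blast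
  note \<xi>V = HS_V[OF \<xi>(1)]
  obtain k0 where k0: "supports k0 \<xi>" using HS_supports[OF \<xi>(1)] by blast
  define D where "D = mk {v \<in> elts (cprod \<xi> omega). sup_in (usnd v) (usnd (ufst v)) \<and> elts (num k0) \<subseteq> elts (usnd v)}"
  have DV: "D \<in> V" unfolding D_def
    by (rule separation[OF cprod_mem[OF \<xi>V omega_mem]]) (intro dintro num_mem)
  have memD: "v \<in> elts D \<longleftrightarrow> (\<exists>p y k. v = opair (opair p y) (num k) \<and> opair p y \<in> elts \<xi> \<and> supports k y \<and> k0 \<le> k)" for v
  proof -
    have sub: "elts (num k0 :: 'u) \<subseteq> elts (num k) \<longleftrightarrow> k0 \<le> k" for k
      using ord_subset_iff[OF ord_num[of k0] ord_num[of k], where ?'a = 'u] by (auto simp: le_less)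
    show ?thesis
    proof
      assume "v \<in> elts D"
      then obtain z k where "v = opair z (num k)" "z \<in> elts \<xi>" "sup_in (num k) (usnd z)" "k0 \<le> k"
        unfolding D_def elts_mk_Collect unfolding elts_cprod[OF \<xi>V omega_mem] elts_omega by (auto simp del: elts_num simp: sub)
      moreover obtain p y where "z = opair p y" using HS_shape[OF \<xi>(1) \<open>z \<in> elts \<xi>\<close>] by blast
      ultimately show "\<exists>p y k. v = opair (opair p y) (num k) \<and> opair p y \<in> elts \<xi> \<and> supports k y \<and> k0 \<le> k"
        by (auto simp: sup_in_num)
    next
      assume "\<exists>p y k. v = opair (opair p y) (num k) \<and> opair p y \<in> elts \<xi> \<and> supports k y \<and> k0 \<le> k"
      then obtain p y k where "v = opair (opair p y) (num k)" "opair p y \<in> elts \<xi>" "supports k y" "k0 \<le> k" by blast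
      then show "v \<in> elts D"
        unfolding D_def elts_mk_Collect unfolding elts_cprod[OF \<xi>V omega_mem] elts_omega
        by (auto simp del: elts_num simp: sup_in_num sub)
    qed
  qed
  \<comment> \<open>The entry of the function for the index \<open>v\<close> and the permutation
    coded by \<open>u\<close>: under the moved condition, the moved sequence is sent to the moved
    name.\<close>
  define en where "en u v = opair (actc u (ufst (ufst v)))
      (opn (opn (check v) (actn u (rnm (usnd v)))) (actn u (usnd (ufst v))))" for u v
  have den: "dterm V (\<lambda>s. en (s 0) (s 1))"
    unfolding en_def by (intro dintro dterm_comp2[OF dterm_actc] dterm_comp2[OF dterm_actn])
  have en: "en (code \<pi>) (opair (opair p y) (num k)) = opair (act_cond \<pi> p)
      (opn (opn (check (opair (opair p y) (num k))) (act_name \<pi> (rnm (num k)))) (act_name \<pi> y))"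
    if "\<pi> \<in> perms" "p \<in> V" for \<pi> p y k
    using that by (simp add: en_def actc_code actn_code)
  \<comment> \<open>Only permutations fixing everything below \<open>k0\<close> are used; they fix
    \<xi>, so the moved pairs belong to \<xi> again.\<close>
  define I where "I = mk {z \<in> elts (cprod GG D). \<forall>n\<in>elts (num k0). ap (ufst z) n = n}"
  have IV: "I \<in> V" unfolding I_def by (rule separation[OF cprod_mem[OF GG_mem DV]]) (intro dintro num_mem)
  have memI: "z \<in> elts I \<longleftrightarrow> (\<exists>\<pi> v. \<pi> \<in> fixer {..<k0} \<and> v \<in> elts D \<and> z = opair (code \<pi>) v)" for z
    unfolding I_def elts_mk_Collect unfolding elts_cprod[OF GG_mem DV] elts_GG fixer_def
    by (auto simp: elts_num)
  define H where "H = mk ((\<lambda>z. en (ufst z) (usnd z)) ` elts I)"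
  have "dterm V (\<lambda>s. mk ((\<lambda>z. en (ufst z) (usnd z)) ` elts I))" by (intro dintro dterm_comp2[OF den] IV)
  from dterm_mem[OF this env_empty] have HV: "H \<in> V" by (simp only: H_def)
  have memH: "z \<in> elts H \<longleftrightarrow> (\<exists>\<pi> p y k. \<pi> \<in> fixer {..<k0} \<and> opair p y \<in> elts \<xi> \<and> supports k y \<and> k0 \<le> k \<and>
      z = opair (act_cond \<pi> p) (opn (opn (check (opair (opair p y) (num k))) (act_name \<pi> (rnm (num k)))) (act_name \<pi> y)))" for z
  proof -
    have "z \<in> elts H \<longleftrightarrow> (\<exists>\<pi> v. \<pi> \<in> fixer {..<k0} \<and> v \<in> elts D \<and> z = en (code \<pi>) v)"
      unfolding H_def elts_mk_image image_iff Bex_def memI by (metis ufst_opair usnd_opair)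
    moreover have pV: "p \<in> V" if "opair p y \<in> elts \<xi>" for p y using opair_mem_elts[OF that \<xi>V] by blast
    ultimately show ?thesis unfolding memD using en[OF fixer_carrier pV] by (metis (no_types, lifting))
  qed
  have shape: "\<exists>p\<in>P. \<exists>y. HS y \<and> z = opair p y" if z: "z \<in> elts H" for z
  proof -
    obtain \<pi> p y k where *: "\<pi> \<in> fixer {..<k0}" "opair p y \<in> elts \<xi>"
      "z = opair (act_cond \<pi> p) (opn (opn (check (opair (opair p y) (num k))) (act_name \<pi> (rnm (num k)))) (act_name \<pi> y))"
      using z memH by blast
    note c = fixer_carrier[OF *(1)]
    have "opair p y \<in> V" using V_trans[OF *(2) \<xi>V] .
    then have "HS (check (opair (opair p y) (num k)))" using HS_check by simp
    then have "HS (opn (opn (check (opair (opair p y) (num k))) (act_name \<pi> (rnm (num k)))) (act_name \<pi> y))"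
      using HS_opn HS_act[OF c] HS_rnm HS_child[OF \<xi>(1) *(2)] by blast
    then show ?thesis using *(3) act_cond_P[OF c HS_cond[OF \<xi>(1) *(2)]] by blast
  qed
  then have name: "is_name V H" using HS_name by (intro is_name.intros[OF HV]) blast
  have "supports k0 H"
  proof (rule supports_closed[OF name])
    fix \<sigma> q z assume \<sigma>: "\<sigma> \<in> fixer {..<k0}" and "opair q z \<in> elts H"
    then obtain \<pi> p y k where *: "\<pi> \<in> fixer {..<k0}" "opair p y \<in> elts \<xi>" "supports k y" "k0 \<le> k" "q = act_cond \<pi> p"
      "z = opn (opn (check (opair (opair p y) (num k))) (act_name \<pi> (rnm (num k)))) (act_name \<pi> y)"
      using memH by auto
    have "opair (act_cond \<sigma> q) (act_name \<sigma> z) = opair (act_cond (\<sigma> \<circ> \<pi>) p)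
        (opn (opn (check (opair (opair p y) (num k))) (act_name (\<sigma> \<circ> \<pi>) (rnm (num k)))) (act_name (\<sigma> \<circ> \<pi>) y))"
      unfolding *(5,6) act_name_opn act_name_check act_name_comp act_cond_comp ..
    then show "opair (act_cond \<sigma> q) (act_name \<sigma> z) \<in> elts H"
      unfolding memH using *(2,3,4) fixer_comp[OF \<sigma> *(1)] by blast
  qed
  then have HSH: "HS H" by (rule HS_intro[OF HV, rotated]) (rule shape)
  define HM where "HM = interp G H"
  have HMM: "HM \<in> M" unfolding HM_def using M_I[OF HSH] .
  have memHM: "w \<in> elts HM \<longleftrightarrow> (\<exists>\<pi> p y k. \<pi> \<in> fixer {..<k0} \<and> opair p y \<in> elts \<xi> \<and> supports k y \<and> k0 \<le> k \<and> act_cond \<pi> p \<in> G \<and>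
      w = opair (opair (opair (opair p y) (num k)) (breal \<pi> k)) (interp G (act_name \<pi> y)))" for w
  proof -
    have int: "interp G (opn (opn (check (opair (opair p y) (num k))) (act_name \<pi> (rnm (num k)))) (act_name \<pi> y)) =
        opair (opair (opair (opair p y) (num k)) (breal \<pi> k)) (interp G (act_name \<pi> y))" for \<pi> p y k
      using interp_opn[OF empty_G] interp_check[OF empty_G] by (simp add: breal_def)
    show ?thesis
    proof
      assume "w \<in> elts HM"
      then obtain q z where "q \<in> G" "opair q z \<in> elts H" "w = interp G z" unfolding HM_def elts_interp by blast
      then show "\<exists>\<pi> p y k. \<pi> \<in> fixer {..<k0} \<and> opair p y \<in> elts \<xi> \<and> supports k y \<and> k0 \<le> k \<and> act_cond \<pi> p \<in> G \<and>
          w = opair (opair (opair (opair p y) (num k)) (breal \<pi> k)) (interp G (act_name \<pi> y))"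
        unfolding memH using int by auto
    next
      assume "\<exists>\<pi> p y k. \<pi> \<in> fixer {..<k0} \<and> opair p y \<in> elts \<xi> \<and> supports k y \<and> k0 \<le> k \<and> act_cond \<pi> p \<in> G \<and>
          w = opair (opair (opair (opair p y) (num k)) (breal \<pi> k)) (interp G (act_name \<pi> y))"
      then obtain \<pi> p y k where *: "\<pi> \<in> fixer {..<k0}" "opair p y \<in> elts \<xi>" "supports k y" "k0 \<le> k" "act_cond \<pi> p \<in> G"
        "w = opair (opair (opair (opair p y) (num k)) (breal \<pi> k)) (interp G (act_name \<pi> y))" by blast
      let ?z = "opn (opn (check (opair (opair p y) (num k))) (act_name \<pi> (rnm (num k)))) (act_name \<pi> y)"
      have "opair (act_cond \<pi> p) ?z \<in> elts H" unfolding memH using * by blast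
      moreover have "w = interp G ?z" using int *(6) by simp
      ultimately show "w \<in> elts HM" unfolding HM_def elts_interp using *(5) by blast
    qed
  qed
  have DM: "D \<in> M" using V_subset_M[OF DV] .
  define d where "d = mk {z \<in> elts (cprod D BM). \<exists>x\<in>elts X. opair z x \<in> elts HM}"
  have dM: "d \<in> M" unfolding d_def
    by (rule MM.separation[OF MM.cprod_mem[OF DM BM_mem]]) (intro dintro X HMM)
  have uniq: "x = x'" if z: "opair z x \<in> elts HM" "opair z x' \<in> elts HM" for z x x'
  proof -
    obtain \<pi> p y k where 1: "\<pi> \<in> fixer {..<k0}" "opair p y \<in> elts \<xi>" "supports k y"
      "z = opair (opair (opair p y) (num k)) (breal \<pi> k)" "x = interp G (act_name \<pi> y)"
      using z(1)[unfolded memHM] by auto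
    obtain \<sigma> p' y' k' where 2: "\<sigma> \<in> fixer {..<k0}" "z = opair (opair (opair p' y') (num k')) (breal \<sigma> k')" "x' = interp G (act_name \<sigma> y')"
      using z(2)[unfolded memHM] by auto
    have eq: "y' = y" "k' = k" "breal \<pi> k = breal \<sigma> k" using 1(4) 2(2) by auto
    then have "act_name \<pi> y = act_name \<sigma> y"
      using act_agree[OF 1(3) HS_name[OF HS_child[OF \<xi>(1) 1(2)]] fixer_carrier[OF 1(1)] fixer_carrier[OF 2(1)]] breal_inject by blast
    then show ?thesis using 1(5) 2(3) eq by simp
  qed
  define h where "h z = ap HM z" for z
  have h: "h z = x" if "opair z x \<in> elts HM" for z x
  proof -
    have "opair z x' \<in> elts HM \<longleftrightarrow> x' = x" for x' using uniq that by blast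
    then show ?thesis by (simp add: h_def ap_def)
  qed
  have "Gr d h \<in> M"
  proof (rule MM.Gr_mem_dterm[OF dM X])
    show "h ` elts d \<subseteq> elts X" using h by (auto simp: d_def)
    show "dterm M (\<lambda>s. h (s 0))" unfolding h_def by (intro dintro HMM)
  qed
  have entry: "opair (opair (opair (opair p y) (num k)) (breal \<pi> k)) (interp G (act_name \<pi> y)) \<in> elts HM \<and>
      opair (opair (opair p y) (num k)) (breal \<pi> k) \<in> elts d \<and> interp G (act_name \<pi> y) \<in> elts X"
    if *: "\<pi> \<in> fixer {..<k0}" "opair p y \<in> elts \<xi>" "supports k y" "k0 \<le> k" "act_cond \<pi> p \<in> G" for \<pi> p y k
  proof -
    have "opair (act_cond \<pi> p) (act_name \<pi> y) \<in> elts (act_name \<pi> \<xi>)" using *(2) unfolding elts_act_name by blast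
    then have "opair (act_cond \<pi> p) (act_name \<pi> y) \<in> elts \<xi>" using k0 *(1) by (simp add: supports_def)
    then have x: "interp G (act_name \<pi> y) \<in> elts X" using *(5) unfolding \<xi>(2) elts_interp by blast
    have H: "opair (opair (opair (opair p y) (num k)) (breal \<pi> k)) (interp G (act_name \<pi> y)) \<in> elts HM"
      unfolding memHM using * by blast
    have "opair (opair p y) (num k) \<in> elts D" unfolding memD using * by blast
    moreover have "breal \<pi> k \<in> elts BM" unfolding elts_BM_breal using fixer_carrier[OF *(1)] by blast
    ultimately have "opair (opair (opair p y) (num k)) (breal \<pi> k) \<in> elts d"
      unfolding d_def elts_mk_Collect using H x DM by auto
    with H x show ?thesis by blast
  qed
  \<comment> \<open>The identity permutation already reaches every element of \<open>X\<close>;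
    enlarging a support of \<open>y\<close> to at least \<open>k0\<close> makes the index
    admissible.\<close>
  have "h ` elts d = elts X"
  proof (intro equalityI subsetI)
    fix x assume "x \<in> elts X"
    then obtain p y where py: "p \<in> G" "opair p y \<in> elts \<xi>" "x = interp G y" unfolding \<xi>(2) elts_interp by blast
    obtain l where "supports l y" using HS_supports[OF HS_child[OF \<xi>(1) py(2)]] by blast
    then have "supports (max l k0) y" using supports_mono by force
    moreover have "id \<in> fixer {..<k0}" by (simp add: fixer_def)
    moreover have "act_cond id p = p" "act_name id y = y"
      using act_cond_id[OF G_P[OF py(1)]] act_name_id[OF HS_name[OF HS_child[OF \<xi>(1) py(2)]]] by auto
    ultimately have "opair (opair (opair (opair p y) (num (max l k0))) (breal id (max l k0))) x \<in> elts HM"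
      "opair (opair (opair p y) (num (max l k0))) (breal id (max l k0)) \<in> elts d"
      using entry[of id p y "max l k0"] py by auto
    then show "x \<in> h ` elts d" using h by blast
  qed (use h in \<open>auto simp: d_def\<close>)
  moreover have "\<forall>x\<in>elts D. \<exists>k y. HS y \<and> supports k y \<and>
      (\<forall>b. opair x b \<in> elts d --> (\<exists>\<pi>\<in>perms. b = breal \<pi> k)) \<and>
      (\<forall>\<pi>\<in>perms. opair x (breal \<pi> k) \<in> elts d --> h (opair x (breal \<pi> k)) = interp G (act_name \<pi> y))"
  proof
    fix x assume "x \<in> elts D"
    then obtain p y k where x: "x = opair (opair p y) (num k)" "opair p y \<in> elts \<xi>" "supports k y" using memD by blast
    have hs: "HS y" using HS_child[OF \<xi>(1) x(2)] .
    have 1: "\<exists>\<pi>\<in>fixer {..<k0}. b = breal \<pi> k \<and> h (opair x b) = interp G (act_name \<pi> y)" if b: "opair x b \<in> elts d" for b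
    proof -
      obtain v where v: "opair (opair x b) v \<in> elts HM" using b unfolding d_def by auto
      then obtain \<pi> where "\<pi> \<in> fixer {..<k0}" "b = breal \<pi> k" "v = interp G (act_name \<pi> y)" using memHM x(1) by auto
      then show ?thesis using h[OF v] by blast
    qed
    have 2: "h (opair x (breal \<pi> k)) = interp G (act_name \<pi> y)"
      if \<pi>: "\<pi> \<in> perms" "opair x (breal \<pi> k) \<in> elts d" for \<pi>
    proof -
      obtain \<sigma> where \<sigma>: "\<sigma> \<in> fixer {..<k0}" "breal \<pi> k = breal \<sigma> k" "h (opair x (breal \<pi> k)) = interp G (act_name \<sigma> y)"
        using 1[OF \<pi>(2)] by blast
      then show ?thesis using act_agree[OF x(3) HS_name[OF hs] \<pi>(1) fixer_carrier[OF \<sigma>(1)]] breal_inject by simp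
    qed
    show "\<exists>k y. HS y \<and> supports k y \<and>
        (\<forall>b. opair x b \<in> elts d --> (\<exists>\<pi>\<in>perms. b = breal \<pi> k)) \<and>
        (\<forall>\<pi>\<in>perms. opair x (breal \<pi> k) \<in> elts d --> h (opair x (breal \<pi> k)) = interp G (act_name \<pi> y))"
      using hs x(3) 1 2 fixer_carrier by blast
  qed
  moreover have "elts d \<subseteq> elts (cprod D BM)" by (auto simp: d_def)
  ultimately show ?thesis using that[OF DV dM _ \<open>Gr d h \<in> M\<close>] by blast
qed

end

text \<open>A product of one transposition for each position. Since \<open>a i = b j\<close> is
  allowed only for \<open>i = j\<close>, the transpositions are disjoint and later ones do not
  disturb earlier ones.\<close>

lemma finitary_swaps:
  fixes a b :: "nat => nat"
  assumes "inj_on a {..<k}" "inj_on b {..<k}" "\<forall>i<k. \<forall>j<k. a i = b j --> i = j"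
  shows "\<exists>\<tau>\<in>perms. (\<forall>i<k. \<tau> (a i) = b i \<and> \<tau> (b i) = a i) \<and> (\<forall>x. x \<notin> a ` {..<k} --> x \<notin> b ` {..<k} --> \<tau> x = x)"
  using assms
proof (induction k)
  case 0
  then show ?case by (intro bexI[of _ id]) (auto simp: carrier_finitary)
next
  case (Suc k)
  have "inj_on a {..<k}" "inj_on b {..<k}" using Suc.prems(1,2) by (auto simp: lessThan_Suc)
  with Suc obtain \<tau> where \<tau>: "\<tau> \<in> perms" "\<forall>i<k. \<tau> (a i) = b i \<and> \<tau> (b i) = a i"
    "\<forall>x. x \<notin> a ` {..<k} --> x \<notin> b ` {..<k} --> \<tau> x = x" by auto
  define s where "s x = (if x = a k then b k else if x = b k then a k else x)" for x
  have "s (s x) = x" for x by (simp add: s_def)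
  then have "bij s" by (rule involuntory_imp_bij)
  moreover have "{x. s x \<noteq> x} \<subseteq> {a k, b k}" by (auto simp: s_def)
  ultimately have s: "s \<in> perms" using finite_subset by (auto simp: carrier_finitary)
  have ne: "a i \<noteq> a k" "b i \<noteq> b k" "a i \<noteq> b k" "b i \<noteq> a k" if "i < k" for i
    using that Suc.prems inj_onD[OF Suc.prems(1), of i k] inj_onD[OF Suc.prems(2), of i k] by (fastforce simp: less_Suc_eq)+
  have "a k \<notin> a ` {..<k}" "a k \<notin> b ` {..<k}" "b k \<notin> a ` {..<k}" "b k \<notin> b ` {..<k}" using ne by force+
  then have "\<tau> (a k) = a k" "\<tau> (b k) = b k" using \<tau>(3) by auto
  then have "\<forall>i<Suc k. (s \<circ> \<tau>) (a i) = b i \<and> (s \<circ> \<tau>) (b i) = a i" using \<tau>(2) ne by (auto simp: less_Suc_eq s_def)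
  moreover have "\<forall>x. x \<notin> a ` {..<Suc k} --> x \<notin> b ` {..<Suc k} --> (s \<circ> \<tau>) x = x" using \<tau>(3) by (auto simp: s_def lessThan_Suc)
  ultimately show ?case using finitary_comp[OF s \<tau>(1)] by blast
qed

section \<open>Moving sequences of Cohen reals inside the generic filter\<close>

context cohen
begin

lemma gen_separate: "finite F ==> \<exists>N. \<forall>a\<in>F. \<forall>b\<in>F. (\<forall>m<N. gen a m = gen b m) --> a = b"
proof -
  assume F: "finite F"
  define g where "g z = (LEAST m. gen (fst z) m \<noteq> gen (snd z) m)" for z
  have g: "gen a (g (a, b)) \<noteq> gen b (g (a, b))" if "a \<noteq> b" for a b
    unfolding g_def using LeastI_ex[OF gen_distinct[OF that]] by simp
  obtain N where N: "g ` (F \<times> F) \<subseteq> {..<N}" using F finite_nat_iff_bounded[of "g ` (F \<times> F)"] by auto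
  have "a = b" if "a \<in> F" "b \<in> F" "\<forall>m<N. gen a m = gen b m" for a b
  proof (rule ccontr)
    assume "a \<noteq> b"
    moreover have "g (a, b) < N" using N that(1,2) by auto
    ultimately show False using g that(3) by blast
  qed
  then show ?thesis by blast
qed

text \<open>The moved condition prescribes for \<open>\<tau> n\<close> what \<open>q\<close>
  prescribes for \<open>n\<close>; the generic reals obey it if the two reals agree at the bits that
  \<open>q\<close> mentions.\<close>

lemma act_cond_G:
  assumes \<tau>: "\<tau> \<in> perms" and q: "q \<in> G"
    and inv: "\<forall>n m i. entry n m i \<in> elts q --> gen (\<tau> n) m = gen n m"
  shows "act_cond \<tau> q \<in> G"
  unfolding G_iff[OF act_cond_P[OF \<tau> G_P[OF q]]]
proof (intro allI impI)
  fix n m i assume "entry n m (num i) \<in> elts (act_cond \<tau> q)"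
  then obtain n' where n': "n = \<tau> n'" "entry n' m (num i) \<in> elts q" unfolding elts_act_cond by auto
  then have "gen n' m = (i = 1)" using q unfolding G_iff[OF G_P[OF q]] by blast
  then show "gen n m = (i = 1)" using inv n' by blast
qed

text \<open>Given a condition, some index above \<open>K\<close> lies beyond its domain, where any
  finite pattern can be added. The set \<open>T\<close> carries the pattern into \<open>V\<close>,
  so that the dense set is definable.\<close>

lemma gen_pattern: "\<exists>c\<ge>K. \<forall>m<N. gen c m = A m"
proof -
  define T where "T = (mk ((\<lambda>m. opair (num m) (num (if A m then 1 else 0))) ` {..<N}) :: 'u)"
  have T: "T \<in> V" "elts T = (\<lambda>m. opair (num m) (num (if A m then 1 else 0))) ` {..<N}"
  proof -
    show V: "T \<in> V" unfolding T_def by (rule finite_mem) auto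
    show "elts T = (\<lambda>m. opair (num m) (num (if A m then 1 else 0))) ` {..<N}" unfolding T_def by (rule elts_mk_finite) simp
  qed
  have "\<exists>p\<in>G. \<exists>c\<in>elts omega. c \<notin> elts (num K) \<and> (\<forall>z\<in>elts T. opair (opair c (ufst z)) (usnd z) \<in> elts p)"
  proof (rule generic_dense)
    show "definable V (\<lambda>s. \<exists>c\<in>elts omega. c \<notin> elts (num K) \<and> (\<forall>z\<in>elts T. opair (opair c (ufst z)) (usnd z) \<in> elts (s 0)))"
      by (intro dintro omega_mem T(1) num_mem)
    fix p assume p: "p \<in> P"
    obtain M where M: "\<forall>n m i. entry n m i \<in> elts p --> n < M \<and> m < M" using P_bound[OF p] by blast
    define c where "c = max M K"
    define S where "S = (\<lambda>m. (c, m, if A m then 1 else 0 :: nat)) ` {..<N}"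
    have S1: "finite S" and S2: "\<And>a b i j. (a, b, i) \<in> S ==> (a, b, j) \<in> S ==> i = j"
      and S3: "\<And>a b i. (a, b, i) \<in> S ==> i \<in> {0, 1}"
      by (auto simp: S_def)
    have "\<exists>q\<in>P. elts q = {entry n m (num i) | n m i. (n, m, i) \<in> S}"
      by (rule P_finite_set[OF S1]) (use S2 S3 in blast)+
    then obtain q where q: "q \<in> P" "elts q = {entry n m (num i) | n m i. (n, m, i) \<in> S}" by blast
    have "\<exists>r\<in>P. elts r = elts p \<union> elts q"
    proof (rule P_union[OF p q(1)])
      fix x i j assume x: "opair x i \<in> elts p" and "opair x j \<in> elts q"
      then obtain m where "x = opair (num c) (num m)" unfolding q(2) S_def by auto
      with x M have "c < M" by blast
      then show "i = j" by (simp add: c_def)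
    qed
    then obtain r where "r \<in> P" "elts r = elts p \<union> elts q" by blast
    moreover have "\<forall>z\<in>elts T. opair (opair (num c) (ufst z)) (usnd z) \<in> elts q"
      unfolding q(2) S_def T(2) by fastforce
    moreover have "num c \<notin> elts (num K :: 'u)" by (simp add: c_def)
    ultimately show "\<exists>q\<in>P. stronger q p \<and> (\<exists>c\<in>elts omega. c \<notin> elts (num K) \<and> (\<forall>z\<in>elts T. opair (opair c (ufst z)) (usnd z) \<in> elts q))"
      using num_omega[of c] unfolding stronger_def by blast
  qed
  then obtain p c where pc: "p \<in> G" "num c \<notin> elts (num K :: 'u)" "\<forall>z\<in>elts T. opair (opair (num c) (ufst z)) (usnd z) \<in> elts p"
    by (auto simp: elts_omega)
  have "gen c m = A m" if "m < N" for m
  proof -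
    have "entry c m (num (if A m then 1 else 0)) \<in> elts p" using pc(3) that unfolding T(2) by fastforce
    then show ?thesis using pc(1) unfolding G_iff[OF G_P[OF pc(1)]] by (auto split: if_splits)
  qed
  moreover have "c \<ge> K" using pc(2) by (simp add: not_less)
  ultimately show ?thesis by blast
qed

lemma gen_copy: "\<exists>c\<ge>K. \<forall>m<N. gen c m = gen n m"
  by (rule gen_pattern)

lemma gen_prescribed: "\<exists>k. gen k n \<and> (\<forall>m<n. \<not> gen k m)"
proof -
  obtain k where "\<forall>m<Suc n. gen k m = (m = n)" using gen_pattern[of 0 "Suc n" "\<lambda>m. m = n"] by blast
  then show ?thesis by (intro exI[of _ k]) auto
qed

text \<open>Closeness in the product topology on sequences of length \<open>k\<close>: the basic
  neighbourhood that fixes the first \<open>n\<close> bits of every component.\<close>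

definition near :: "nat => (nat => nat) => (nat => nat) => nat => bool" where
  "near k \<pi> \<sigma> n \<longleftrightarrow> (\<forall>i<k. \<forall>m<n. gen (\<pi> i) m = gen (\<sigma> i) m)"

lemma near_mono: "near k \<pi> \<sigma> n ==> m \<le> n ==> near k \<pi> \<sigma> m"
  by (auto simp: near_def)

lemma near_trans: "near k \<pi> \<sigma> n ==> near k \<sigma> \<tau> n ==> near k \<pi> \<tau> n"
  by (auto simp: near_def)

text \<open>If the sets of permutations giving the values \<open>x\<close> and \<open>x'\<close> have the same closure, then
  \<open>x = x'\<close>: choose a point of the first set with as many coordinates as possible locally
  constant and a second point with the same value whose remaining coordinates are new.  A condition
  forcing the two values equal is carried by a permutation, moving the first point into the second
  set and fixing the other one, to a condition of the generic filter.\<close>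

lemma closure_determines_value:
  assumes y: "HS y" "supports k y" and c1: "A1 \<subseteq> perms" and c2: "A2 \<subseteq> perms" and ne: "A1 \<noteq> {}"
    and v1: "\<forall>\<pi>\<in>A1. interp G (act_name \<pi> y) = x" and v2: "\<forall>\<pi>\<in>A2. interp G (act_name \<pi> y) = x'"
    and d1: "\<forall>\<pi>\<in>A1. \<forall>n. \<exists>\<sigma>\<in>A2. near k \<pi> \<sigma> n" and d2: "\<forall>\<pi>\<in>A2. \<forall>n. \<exists>\<sigma>\<in>A1. near k \<pi> \<sigma> n"
  shows "x = x'"
proof -
  \<comment> \<open>\<open>J\<close> is a set of positions at which \<open>A1\<close> is constant in
    the neighbourhood of \<pi> given by \<open>n\<close>.\<close>
  define rigid where "rigid \<pi> n J \<longleftrightarrow> \<pi> \<in> A1 \<and> J \<subseteq> {..<k} \<and> (\<forall>\<sigma>\<in>A1. near k \<pi> \<sigma> n --> (\<forall>i\<in>J. \<sigma> i = \<pi> i))" for \<pi> n J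
  define C where "C = {card J | \<pi> n J. rigid \<pi> n J}"
  have "C \<subseteq> {..k}" unfolding C_def rigid_def using card_mono[of "{..<k}"] by fastforce
  then have fin: "finite C" by (rule finite_subset) simp
  obtain \<pi>0 where "\<pi>0 \<in> A1" using ne by blast
  then have "rigid \<pi>0 0 {}" by (simp add: rigid_def)
  then have "C \<noteq> {}" unfolding C_def by blast
  then have "Max C \<in> C" using fin by simp
  then obtain \<pi> n J where r: "rigid \<pi> n J" "card J = Max C" unfolding C_def by auto
  have max: "card J' \<le> card J" if "rigid \<pi>' n' J'" for \<pi>' n' J'
  proof -
    have "card J' \<in> C" using that unfolding C_def by blast
    then show ?thesis using Max_ge[OF fin] r(2) by simp
  qed
  have \<pi>: "\<pi> \<in> A1" and J: "J \<subseteq> {..<k}" using r(1) unfolding rigid_def by auto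
  have rJ: "\<sigma> i = \<pi> i" if "\<sigma> \<in> A1" "near k \<pi> \<sigma> n" "i \<in> J" for \<sigma> i using r(1) that unfolding rigid_def by blast
  have bijA: "inj \<sigma>" if "\<sigma> \<in> A1 \<union> A2" for \<sigma> using that c1 c2 finitary_bij bij_is_inj by blast
  \<comment> \<open>By maximality of \<open>J\<close>, no position outside \<open>J\<close> is
    confined to a finite set near \<sigma>: enough bits to separate its values would make it
    constant as well and thus extend \<open>J\<close>.\<close>
  have step: "\<exists>\<sigma>'\<in>A1. near k \<sigma> \<sigma>' N \<and> \<sigma>' i \<notin> F"
    if \<sigma>: "\<sigma> \<in> A1" "near k \<pi> \<sigma> n" and i: "i < k" "i \<notin> J" and F: "finite F" for \<sigma> i F N
  proof (rule ccontr)
    assume no: "\<not> (\<exists>\<sigma>'\<in>A1. near k \<sigma> \<sigma>' N \<and> \<sigma>' i \<notin> F)"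
    obtain N0 where N0: "\<forall>a\<in>insert (\<sigma> i) F. \<forall>b\<in>insert (\<sigma> i) F. (\<forall>m<N0. gen a m = gen b m) --> a = b"
      using gen_separate[of "insert (\<sigma> i) F"] F by auto
    define N1 where "N1 = max n (max N N0)"
    have "rigid \<sigma> N1 (insert i J)" unfolding rigid_def
    proof (intro conjI ballI impI)
      show "\<sigma> \<in> A1" "insert i J \<subseteq> {..<k}" using \<sigma> i J by auto
      fix \<sigma>' j assume \<sigma>': "\<sigma>' \<in> A1" and nr: "near k \<sigma> \<sigma>' N1" and j: "j \<in> insert i J"
      have nr3: "near k \<sigma> \<sigma>' n" "near k \<sigma> \<sigma>' N" "near k \<sigma> \<sigma>' N0" using near_mono[OF nr] by (auto simp: N1_def)
      show "\<sigma>' j = \<sigma> j"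
      proof (cases "j = i")
        case True
        have "\<sigma>' i \<in> F" using no \<sigma>' nr3(2) by blast
        moreover have "\<forall>m<N0. gen (\<sigma>' i) m = gen (\<sigma> i) m" using nr3(3) i(1) unfolding near_def by simp
        ultimately show ?thesis using N0 True by blast
      next
        case False
        then have "j \<in> J" using j by blast
        then show ?thesis using rJ[OF \<sigma>' near_trans[OF \<sigma>(2) nr3(1)]] rJ[OF \<sigma>] by simp
      qed
    qed
    from max[OF this] show False using i(2) finite_subset[OF J] by simp
  qed
  define F where "F = \<pi> ` {..<k}"
  have finF: "finite F" unfolding F_def by simp
  have "\<exists>\<sigma>\<in>A1. near k \<pi> \<sigma> n \<and> (\<forall>i\<in>I. \<sigma> i \<notin> F)" if "finite I" "I \<subseteq> {..<k} - J" for I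
    using that
  proof (induction I)
    case empty
    then show ?case using \<pi> by (auto simp: near_def)
  next
    case (insert i I)
    then obtain \<sigma> where \<sigma>: "\<sigma> \<in> A1" "near k \<pi> \<sigma> n" "\<forall>i\<in>I. \<sigma> i \<notin> F" by blast
    \<comment> \<open>Enough bits are kept to prevent the positions already moved off
      \<open>F\<close> from returning to it.\<close>
    obtain N0 where N0: "\<forall>a\<in>F \<union> \<sigma> ` {..<k}. \<forall>b\<in>F \<union> \<sigma> ` {..<k}. (\<forall>m<N0. gen a m = gen b m) --> a = b"
      using gen_separate[of "F \<union> \<sigma> ` {..<k}"] finF by auto
    have "\<exists>\<sigma>'\<in>A1. near k \<sigma> \<sigma>' (max n N0) \<and> \<sigma>' i \<notin> F" using step[OF \<sigma>(1,2) _ _ finF] insert.prems by blast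
    then obtain \<sigma>' where \<sigma>': "\<sigma>' \<in> A1" "near k \<sigma> \<sigma>' (max n N0)" "\<sigma>' i \<notin> F" by blast
    have nr: "near k \<sigma> \<sigma>' n" "near k \<sigma> \<sigma>' N0" using near_mono[OF \<sigma>'(2)] by auto
    have "\<sigma>' j \<notin> F" if j: "j \<in> I" for j
    proof
      assume "\<sigma>' j \<in> F"
      have "j < k" using j insert.prems by blast
      then have "\<forall>m<N0. gen (\<sigma>' j) m = gen (\<sigma> j) m" using nr(2) unfolding near_def by simp
      then have "\<sigma>' j = \<sigma> j" using N0 \<open>\<sigma>' j \<in> F\<close> \<open>j < k\<close> by blast
      then show False using \<sigma>(3) j \<open>\<sigma>' j \<in> F\<close> by simp
    qed
    then show ?case using \<sigma>'(1,3) near_trans[OF \<sigma>(2) nr(1)] by blast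
  qed
  \<comment> \<open>The sequence of \<rho> denotes the same value as that of \<pi>; it agrees with
    it on \<open>J\<close> and avoids all its indices elsewhere.\<close>
  from this[of "{..<k} - J"] obtain \<rho> where \<rho>: "\<rho> \<in> A1" "near k \<pi> \<rho> n" "\<forall>i\<in>{..<k} - J. \<rho> i \<notin> F" by auto
  have c\<pi>: "\<pi> \<in> perms" and c\<rho>: "\<rho> \<in> perms" using c1 \<pi> \<rho>(1) by auto
  note yn = HS_name[OF y(1)]
  have "interp G (act_name \<pi> y) = interp G (act_name \<rho> y)" using v1 \<pi> \<rho>(1) by simp
  then obtain q where q: "q \<in> G" "forces_eq q (act_name \<pi> y) (act_name \<rho> y)"
    using truth_eq[OF name_act[OF c\<pi> yn] name_act[OF c\<rho> yn]] by blast
  obtain K where K: "\<forall>c m i. entry c m i \<in> elts q --> c < K \<and> m < K" using P_bound[OF G_P[OF q(1)]] by blast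
  define E where "E = {..<K} \<union> F \<union> \<rho> ` {..<k}"
  have "finite E" using finF by (simp add: E_def)
  then obtain N0 where N0: "\<forall>a\<in>E. \<forall>b\<in>E. (\<forall>m<N0. gen a m = gen b m) --> a = b" using gen_separate by blast
  \<comment> \<open>\<open>N\<close> covers the bits mentioned by \<open>q\<close>, the
    neighbourhood in which \<open>J\<close> is rigid, and enough bits to tell all indices in
    \<open>E\<close> apart.\<close>
  define N where "N = max n (max K N0)"
  obtain \<pi>1 where \<pi>1: "\<pi>1 \<in> A2" "near k \<pi> \<pi>1 N" using d1 \<pi> by blast
  have c\<pi>1: "\<pi>1 \<in> perms" using c2 \<pi>1(1) by auto
  have close: "\<forall>m<N. gen (\<pi> i) m = gen (\<pi>1 i) m" if "i < k" for i using \<pi>1(2) that unfolding near_def by blast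
  have sep: "c = \<pi> i" if "c \<in> E" "i < k" "c = \<pi>1 i" for c i
  proof -
    have "\<forall>m<N0. gen c m = gen (\<pi> i) m" using close[OF that(2)] that(3) by (auto simp: N_def)
    moreover have "\<pi> i \<in> E" using that(2) by (auto simp: E_def F_def)
    ultimately show ?thesis using N0 that(1) by blast
  qed
  \<comment> \<open>\<pi>1 is a limit of points of \<open>A1\<close> near \<pi>, all of which have
    the same index as \<pi> at each position in \<open>J\<close>; a different index would show at
    some bit.\<close>
  have agree: "\<pi>1 j = \<pi> j" if j: "j \<in> J" for j
  proof (rule ccontr)
    assume "\<pi>1 j \<noteq> \<pi> j"
    then obtain m where m: "gen (\<pi>1 j) m \<noteq> gen (\<pi> j) m" using gen_distinct by blast
    have jk: "j < k" using j J by blast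
    obtain \<pi>2 where \<pi>2: "\<pi>2 \<in> A1" "near k \<pi>1 \<pi>2 (max n (Suc m))" using d2 \<pi>1(1) by blast
    have "near k \<pi> \<pi>1 n" using near_mono[OF \<pi>1(2)] by (simp add: N_def)
    then have "near k \<pi> \<pi>2 n" using near_trans near_mono[OF \<pi>2(2)] by (meson max.cobounded1)
    then have "\<pi>2 j = \<pi> j" using rJ[OF \<pi>2(1) _ j] by blast
    moreover have "gen (\<pi>1 j) m = gen (\<pi>2 j) m" using \<pi>2(2) jk unfolding near_def by simp
    ultimately show False using m by simp
  qed
  have "\<forall>i<k. \<forall>j<k. \<pi> i = \<pi>1 j --> i = j"
  proof (intro allI impI)
    fix i j assume ij: "i < k" "j < k" "\<pi> i = \<pi>1 j"
    then have "\<pi> i \<in> E" unfolding E_def F_def by blast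
    then have "\<pi> i = \<pi> j" using sep ij by blast
    then show "i = j" using bijA \<pi> by (auto dest: injD)
  qed
  moreover have "inj_on \<pi> {..<k}" "inj_on \<pi>1 {..<k}" using bijA \<pi> \<pi>1(1) inj_on_subset by blast+
  ultimately obtain \<tau> where \<tau>: "\<tau> \<in> perms" "\<forall>i<k. \<tau> (\<pi> i) = \<pi>1 i \<and> \<tau> (\<pi>1 i) = \<pi> i"
    "\<forall>c. c \<notin> \<pi> ` {..<k} --> c \<notin> \<pi>1 ` {..<k} --> \<tau> c = c" using finitary_swaps[of \<pi> k \<pi>1] by blast
  have fx: "\<tau> (\<rho> i) = \<rho> i" if i: "i < k" for i
  proof (cases "i \<in> J")
    case True
    then have "\<rho> i = \<pi> i" "\<pi>1 i = \<pi> i" using rJ[OF \<rho>(1,2)] agree by auto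
    then show ?thesis using \<tau>(2) i by simp
  next
    case False
    then have *: "\<rho> i \<notin> F" using \<rho>(3) i by blast
    have "\<rho> i \<notin> \<pi>1 ` {..<k}"
    proof
      assume "\<rho> i \<in> \<pi>1 ` {..<k}"
      then obtain l where l: "l < k" "\<rho> i = \<pi>1 l" by auto
      have "\<rho> i \<in> E" using i by (auto simp: E_def)
      then have "\<rho> i = \<pi> l" using sep l by blast
      then show False using * l(1) by (auto simp: F_def)
    qed
    then show ?thesis using \<tau>(3) * by (auto simp: F_def)
  qed
  \<comment> \<open>Thus \<tau> carries \<pi> to \<pi>1, fixes \<rho> and keeps \<open>q\<close>
    within \<open>G\<close>, so the equality forced for \<pi> and \<rho> is transported to \<pi>1
    and \<rho>.\<close>
  have "act_cond \<tau> q \<in> G"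
  proof (rule act_cond_G[OF \<tau>(1) q(1)], intro allI impI)
    fix c m i assume "entry c m i \<in> elts q"
    then have "c < K" "m < K" using K by blast+
    then have cm: "c \<in> E" "m < N" by (auto simp: E_def N_def)
    show "gen (\<tau> c) m = gen c m"
    proof (cases "c \<in> \<pi> ` {..<k}")
      case True
      then obtain i where "i < k" "c = \<pi> i" by auto
      then show ?thesis using \<tau>(2) close cm(2) by simp
    next
      case False
      then have "c \<notin> \<pi>1 ` {..<k}" using sep[OF cm(1)] by auto
      then show ?thesis using \<tau>(3) False by simp
    qed
  qed
  moreover have "forces_eq (act_cond \<tau> q) (act_name \<tau> (act_name \<pi> y)) (act_name \<tau> (act_name \<rho> y))"
    using forces_eq_act[OF \<tau>(1) name_act[OF c\<pi> yn] name_act[OF c\<rho> yn] q(2)] .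
  moreover have "act_name \<tau> (act_name \<pi> y) = act_name \<pi>1 y"
    unfolding act_name_comp using act_agree[OF y(2) yn finitary_comp[OF \<tau>(1) c\<pi>] c\<pi>1] \<tau>(2) by simp
  moreover have "act_name \<tau> (act_name \<rho> y) = act_name \<rho> y"
    unfolding act_name_comp using act_agree[OF y(2) yn finitary_comp[OF \<tau>(1) c\<rho>] c\<rho>] fx by simp
  ultimately have "interp G (act_name \<pi>1 y) = interp G (act_name \<rho> y)"
    using truth_eq[OF name_act[OF c\<pi>1 yn] name_act[OF c\<rho> yn]] by auto
  then show ?thesis using v1 v2 \<pi>1(1) \<rho>(1) by simp
qed

text \<open>A value whose index lies outside the support could be exchanged with a fresh real that
  agrees with it on all bits mentioned by the forcing condition; the function would then have two
  values at one argument.\<close>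

lemma breal_image_finite:
  assumes \<kappa>: "\<kappa> \<in> V" and F: "Gr \<kappa> F \<in> M" and val: "\<forall>\<alpha>\<in>elts \<kappa>. \<exists>\<pi>\<in>perms. F \<alpha> = breal \<pi> 1"
  shows "\<exists>k. \<forall>\<alpha>\<in>elts \<kappa>. \<exists>\<pi>\<in>perms. \<pi> 0 < k \<and> F \<alpha> = breal \<pi> 1"
proof -
  obtain f where f: "HS f" "Gr \<kappa> F = interp G f" using M_E[OF F] by blast
  obtain k where k: "supports k f" using HS_supports[OF f(1)] by blast
  have "\<pi> 0 < k" if \<alpha>: "\<alpha> \<in> elts \<kappa>" and \<pi>: "\<pi> \<in> perms" "F \<alpha> = breal \<pi> 1" for \<alpha> \<pi>
  proof (rule ccontr)
    assume "\<not> \<pi> 0 < k"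
    have hs: "HS (check \<alpha>)" "HS (act_name \<pi> (rnm (num 1)))" using HS_check[OF V_trans[OF \<alpha> \<kappa>]] HS_act[OF \<pi>(1) HS_rnm] by auto
    have "opair \<alpha> (breal \<pi> 1) \<in> elts (Gr \<kappa> F)" using \<alpha> \<pi>(2) by (simp add: opair_Gr)
    then have "opair (interp G (check \<alpha>)) (interp G (act_name \<pi> (rnm (num 1)))) \<in> elts (interp G f)"
      using f(2) interp_check[OF empty_G] by (simp only: breal_def)
    then obtain p where p: "p \<in> G" "forces_mem p (opn (check \<alpha>) (act_name \<pi> (rnm (num 1)))) f"
      using truth_pair[OF hs f(1)] by blast
    obtain K where K: "\<forall>c m i. entry c m i \<in> elts p --> c < K \<and> m < K" using P_bound[OF G_P[OF p(1)]] by blast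
    obtain c where c: "c \<ge> max (Suc (\<pi> 0)) (max k K)" "\<forall>m<K. gen c m = gen (\<pi> 0) m" using gen_copy by blast
    \<comment> \<open>For sequences of length one the swap lemma gives the transposition of
      \<open>\<pi> 0\<close> and \<open>c\<close>.\<close>
    have "inj_on (\<lambda>i::nat. \<pi> 0) {..<1}" "inj_on (\<lambda>i::nat. c) {..<1}" "\<forall>i<1. \<forall>j<1. \<pi> 0 = c --> i = (j::nat)" by (auto simp: inj_on_def)
    from finitary_swaps[OF this] obtain \<tau> where \<tau>: "\<tau> \<in> perms" "\<tau> (\<pi> 0) = c" "\<forall>x. x \<noteq> \<pi> 0 --> x \<noteq> c --> \<tau> x = x"
      by auto
    have "act_cond \<tau> p \<in> G"
    proof (rule act_cond_G[OF \<tau>(1) p(1)], intro allI impI)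
      fix a m i assume "entry a m i \<in> elts p"
      then have "a < K" "m < K" using K by auto
      then show "gen (\<tau> a) m = gen a m" using \<tau>(2,3) c by (cases "a = \<pi> 0") auto
    qed
    moreover have "forces_mem (act_cond \<tau> p) (act_name \<tau> (opn (check \<alpha>) (act_name \<pi> (rnm (num 1))))) (act_name \<tau> f)"
      using forces_mem_act[OF \<tau>(1) HS_name[OF HS_opn[OF hs]] HS_name[OF f(1)] p(2)] .
    moreover have "\<tau> \<in> fixer {..<k}" unfolding fixer_def using \<tau> c(1) \<open>\<not> \<pi> 0 < k\<close> by auto
    then have "act_name \<tau> f = f" using k by (simp add: supports_def)
    ultimately have "\<exists>q\<in>G. forces_mem q (opn (check \<alpha>) (act_name (\<tau> \<circ> \<pi>) (rnm (num 1)))) f"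
      by (auto simp only: act_name_opn act_name_check act_name_comp)
    then have "opair (interp G (check \<alpha>)) (interp G (act_name (\<tau> \<circ> \<pi>) (rnm (num 1)))) \<in> elts (interp G f)"
      using truth_pair[OF hs(1) HS_act[OF finitary_comp[OF \<tau>(1) \<pi>(1)] HS_rnm] f(1)] by blast
    then have "opair \<alpha> (breal (\<tau> \<circ> \<pi>) 1) \<in> elts (Gr \<kappa> F)" using f(2) interp_check[OF empty_G] by (simp only: breal_def)
    then have "breal (\<tau> \<circ> \<pi>) 1 = breal \<pi> 1" using \<pi>(2) by (simp add: opair_Gr)
    then have "\<tau> (\<pi> 0) = \<pi> 0" using breal_inject[of "\<tau> \<circ> \<pi>" 1 \<pi>] by simp
    then show False using \<tau>(2) c(1) by simp
  qed
  then show ?thesis using val by blast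
qed

end

context cohen
begin

section \<open>The cardinals attached to an infinite set of the model\<close>

lemma omega_M [simp]: "omega \<in> M"
  using V_subset_M[OF omega_mem] .

lemma subset_omega:
  fixes \<theta> :: 'u
  assumes "is_ord \<theta>" "infinite (elts \<theta>)" shows "omega = \<theta> \<or> omega \<in> elts \<theta>"
  using ord_subset_iff[OF ord_omega assms(1)] infinite_ord[OF assms] unfolding elts_omega by blast

text \<open>An infinite set of natural numbers collapses onto \<omega>, which turns a definable
  function with infinite range into one that is onto.\<close>

lemma psurj_omega:
  assumes T: "T \<in> M" and d: "d \<in> M" "elts d \<subseteq> elts T" and R: "definable M (\<lambda>s. R (s 0) (s 1))"
    and \<nu>: "\<forall>x\<in>elts d. \<forall>n. R x (num n) \<longleftrightarrow> n = \<nu> x" and inf: "infinite (\<nu> ` elts d)"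
  shows "psurj M T omega"
proof -
  have F: "Gr d (\<lambda>x. num (\<nu> x)) \<in> M"
    by (rule MM.Gr_mem_rel[OF d(1) omega_M _ R]) (use \<nu> in \<open>auto simp: elts_omega\<close>)
  define Q where "Q = mk {n \<in> elts omega. \<exists>x\<in>elts d. R x n}"
  have QM: "Q \<in> M" unfolding Q_def by (rule MM.separation[OF omega_M]) (intro dintro MM.definable_comp2[OF R] d(1))
  have elQ: "elts Q = num ` \<nu> ` elts d"
  proof (intro equalityI subsetI)
    fix z assume "z \<in> elts Q"
    then obtain n x where "z = num n" "x \<in> elts d" "R x (num n)" unfolding Q_def elts_mk_Collect unfolding elts_omega by auto
    then show "z \<in> num ` \<nu> ` elts d" using \<nu> by auto
  next
    fix z :: 'u assume "z \<in> num ` \<nu> ` elts d"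
    then obtain x where x: "x \<in> elts d" "z = num (\<nu> x)" by blast
    then have "R x (num (\<nu> x))" using \<nu> by blast
    then show "z \<in> elts Q" unfolding Q_def elts_mk_Collect using x by auto
  qed
  have sub: "elts Q \<subseteq> elts omega" unfolding elQ elts_omega by blast
  obtain \<theta> where \<theta>: "\<theta> \<in> M" "is_ord \<theta>" "elts \<theta> \<subseteq> elts omega" "Gr Q (coll Q) \<in> M" "bij_betw (coll Q) (elts Q) (elts \<theta>)"
    using MM.collapse[OF QM omega_M ord_omega sub] by blast
  have "infinite (elts Q)" unfolding elQ using inf by (subst finite_image_iff) (auto simp: inj_on_def)
  then have "infinite (elts \<theta>)" using bij_betw_finite[OF \<theta>(5)] by simp
  then have "\<theta> = omega" using subset_omega[OF \<theta>(2)] \<theta>(3) mem_irrefl by blast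
  then have im: "coll Q ` elts Q = elts omega" using \<theta>(5) bij_betw_imp_surj_on by blast
  show ?thesis
  proof (rule MM.psurjI[OF d])
    show "Gr d (\<lambda>x. coll Q (num (\<nu> x))) \<in> M"
      by (rule MM.Gr_comp[OF d(1) omega_M F \<theta>(4)]) (use im elQ in auto)
    show "coll Q (num (\<nu> x)) \<in> elts omega" if "x \<in> elts d" for x
      unfolding im[symmetric] elQ using that by blast
    show "\<exists>x\<in>elts d. coll Q (num (\<nu> x)) = z" if "z \<in> elts omega" for z
      using that unfolding im[symmetric] elQ by blast
  qed
qed

text \<open>Through \<open>Q\<close> the set \<open>T\<close> is an infinite subset of Cantor space.
  If some \<open>x0\<close> in \<open>T\<close> is a limit point, the first place of difference from
  \<open>x0\<close> takes infinitely many values. Otherwise so does the least number of bits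
  isolating a point, since a bound on it would leave room for finitely many points only.\<close>

lemma psurj_omega_separated:
  assumes T: "T \<in> M" "infinite (elts T)" and Q: "definable M (\<lambda>s. Q (s 0) (s 1))"
    and sep: "\<forall>x\<in>elts T. \<forall>x'\<in>elts T. (\<forall>n. Q x (num n) \<longleftrightarrow> Q x' (num n)) --> x = x'"
  shows "psurj M T omega"
proof -
  define agree where "agree x x' n \<longleftrightarrow> (\<forall>m\<in>elts n. Q x m \<longleftrightarrow> Q x' m)" for x x' n
  have agree: "definable M (\<lambda>s. agree (s 0) (s 1) (s 2))"
    unfolding agree_def by (intro dintro MM.definable_comp2[OF Q])
  have agn: "agree x x' (num n) \<longleftrightarrow> (\<forall>m<n. Q x (num m) \<longleftrightarrow> Q x' (num m))" for x x' n
    unfolding agree_def elts_num by auto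
  show ?thesis
  proof (cases "\<exists>x0\<in>elts T. \<forall>n. \<exists>x\<in>elts T. x \<noteq> x0 \<and> agree x x0 (num n)")
    case True
    then obtain x0 where x0: "x0 \<in> elts T" "\<forall>n. \<exists>x\<in>elts T. x \<noteq> x0 \<and> agree x x0 (num n)" by blast
    have x0M: "x0 \<in> M" using MM.mem_trans[OF x0(1) T(1)] .
    define d where "d = mk {x \<in> elts T. x \<noteq> x0}"
    have dM: "d \<in> M" unfolding d_def by (rule MM.separation[OF T(1)]) (intro dintro x0M)
    have eld: "elts d = {x \<in> elts T. x \<noteq> x0}" unfolding d_def elts_mk_Collect ..
    define R where "R x n \<longleftrightarrow> agree x x0 n \<and> \<not> (Q x n \<longleftrightarrow> Q x0 n)" for x n
    have R: "definable M (\<lambda>s. R (s 0) (s 1))"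
      unfolding R_def by (intro dintro MM.definable_comp3[OF agree] MM.definable_comp2[OF Q] x0M)
    define \<nu> where "\<nu> x = (LEAST n. Q x (num n) \<noteq> Q x0 (num n))" for x
    have \<nu>R: "R x (num n) \<longleftrightarrow> n = \<nu> x" if x: "x \<in> elts d" for x n
    proof -
      have ex: "\<exists>n. Q x (num n) \<noteq> Q x0 (num n)" using sep x x0(1) unfolding eld by blast
      have 1: "Q x (num (\<nu> x)) \<noteq> Q x0 (num (\<nu> x))" unfolding \<nu>_def by (rule LeastI_ex[OF ex])
      have 2: "m < \<nu> x ==> Q x (num m) = Q x0 (num m)" for m unfolding \<nu>_def using not_less_Least by blast
      show ?thesis unfolding R_def agn using 1 2 by (metis nat_neq_iff)
    qed
    have "\<exists>x\<in>elts d. n \<le> \<nu> x" for n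
    proof -
      obtain x where x: "x \<in> elts T" "x \<noteq> x0" "agree x x0 (num n)" using x0(2) by blast
      then have xd: "x \<in> elts d" unfolding eld by blast
      have "R x (num (\<nu> x))" using \<nu>R[OF xd] by blast
      then have "\<not> \<nu> x < n" using x(3) unfolding R_def agn by blast
      then show ?thesis using xd by (meson not_less)
    qed
    then have "infinite (\<nu> ` elts d)" unfolding infinite_nat_iff_unbounded_le by blast
    then show ?thesis using psurj_omega[OF T(1) dM _ R] \<nu>R unfolding eld by blast
  next
    case False
    define iso where "iso x n \<longleftrightarrow> (\<forall>x'\<in>elts T. agree x' x n --> x' = x)" for x n
    have iso: "definable M (\<lambda>s. iso (s 0) (s 1))"
      unfolding iso_def by (intro dintro MM.definable_comp3[OF agree] T(1))
    define R where "R x n \<longleftrightarrow> iso x n \<and> (\<forall>m\<in>elts n. \<not> iso x m)" for x n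
    have R: "definable M (\<lambda>s. R (s 0) (s 1))" unfolding R_def by (intro dintro MM.definable_comp2[OF iso])
    define \<nu> where "\<nu> x = (LEAST n. iso x (num n))" for x
    have iso\<nu>: "iso x (num (\<nu> x))" if "x \<in> elts T" for x
    proof -
      have "\<exists>n. iso x (num n)" using False that unfolding iso_def by blast
      then show ?thesis unfolding \<nu>_def by (rule LeastI_ex)
    qed
    have \<nu>R: "R x (num n) \<longleftrightarrow> n = \<nu> x" if x: "x \<in> elts T" for x n
    proof -
      have 2: "m < \<nu> x ==> \<not> iso x (num m)" for m unfolding \<nu>_def using not_less_Least by blast
      have "R x (num n) \<longleftrightarrow> iso x (num n) \<and> (\<forall>m<n. \<not> iso x (num m))" unfolding R_def elts_num by auto
      then show ?thesis using 2 iso\<nu>[OF x] by (metis nat_neq_iff)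
    qed
    have "infinite (\<nu> ` elts T)"
    proof
      assume "finite (\<nu> ` elts T)"
      then obtain N where N: "\<nu> ` elts T \<subseteq> {..<N}" using finite_nat_iff_bounded by blast
      have "inj_on (\<lambda>x. {m. m < N \<and> Q x (num m)}) (elts T)"
      proof (rule inj_onI)
        fix x x' assume x: "x \<in> elts T" "x' \<in> elts T" and eq: "{m. m < N \<and> Q x (num m)} = {m. m < N \<and> Q x' (num m)}"
        have "\<nu> x' < N" using N x(2) by blast
        then have "agree x x' (num (\<nu> x'))" unfolding agn using eq by (metis (mono_tags, lifting) less_trans mem_Collect_eq)
        then show "x = x'" using iso\<nu>[OF x(2)] x(1) unfolding iso_def by blast
      qed
      moreover have "finite ((\<lambda>x. {m. m < N \<and> Q x (num m)}) ` elts T)"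
        by (rule finite_subset[of _ "Pow {..<N}"]) auto
      ultimately show False using finite_imageD T(2) by blast
    qed
    then show ?thesis using psurj_omega[OF T(1) T(1) order_refl R] \<nu>R by blast
  qed
qed

text \<open>Conditions serve as codes of basic open sets of sequences and are enumerated by natural
  numbers. \<open>Q x m\<close> says that the set of sequences naming \<open>x\<close> meets the
  open set with number \<open>m\<close>; elements with the same \<open>Q\<close> are thus named by
  sets with the same closure and are equal.\<close>

lemma fibre_psurj_omega:
  assumes d: "d \<in> M" and h: "Gr d h \<in> M" and i: "i \<in> M" and T: "T \<in> M" "infinite (elts T)"
    and onto: "\<forall>x\<in>elts T. \<exists>b\<in>elts BM. opair i b \<in> elts d \<and> h (opair i b) = x"
    and y: "HS y" "supports k y"
    and form: "\<forall>b. opair i b \<in> elts d --> (\<exists>\<pi>\<in>perms. b = breal \<pi> k)"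
    and val: "\<forall>\<pi>\<in>perms. opair i (breal \<pi> k) \<in> elts d --> h (opair i (breal \<pi> k)) = interp G (act_name \<pi> y)"
  shows "psurj M T omega"
proof -
  obtain de E where e: "de \<in> M" "elts de \<subseteq> elts omega" "Gr de E \<in> M" "\<forall>x\<in>elts de. E x \<in> elts PP" "\<forall>p\<in>elts PP. \<exists>x\<in>elts de. E x = p"
    by (rule MM.psurjE[OF psurj_V_M[OF countable_PP]])
  define Q where "Q x m \<longleftrightarrow> m \<in> elts de \<and> (\<exists>b\<in>elts BM. opair i b \<in> elts d \<and> ap (Gr d h) (opair i b) = x \<and>
      (\<forall>z\<in>elts (ap (Gr de E) m). usnd z = num 1 \<longleftrightarrow> ufst z \<in> elts b))" for x m
  have Q: "definable M (\<lambda>s. Q (s 0) (s 1))"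
    unfolding Q_def by (intro dintro e(1,3) d h i BM_mem MM.num_mem)
  define A where "A x = {\<pi> \<in> perms. opair i (breal \<pi> k) \<in> elts d \<and> h (opair i (breal \<pi> k)) = x}" for x
  have close: "\<exists>\<sigma>\<in>A x'. near k \<pi> \<sigma> n" if imp: "\<forall>n. Q x (num n) --> Q x' (num n)" and \<pi>: "\<pi> \<in> A x" for x x' \<pi> n
  proof -
    \<comment> \<open>The condition recording the first \<open>n\<close> bits of each component of
      the sequence given by \<pi>.\<close>
    define S where "S = (\<lambda>(j, m). (j, m, if gen (\<pi> j) m then 1 else 0 :: nat)) ` ({..<k} \<times> {..<n})"
    have S1: "finite S" unfolding S_def by simp
    have S2: "\<And>a b i j. (a, b, i) \<in> S ==> (a, b, j) \<in> S ==> i = j" and S3: "\<And>a b i. (a, b, i) \<in> S ==> i \<in> {0, 1}"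
      by (auto simp: S_def)
    have "\<exists>p\<in>P. elts p = {entry n m (num i) | n m i. (n, m, i) \<in> S}"
      by (rule P_finite_set[OF S1]) (use S2 S3 in blast)+
    then obtain p where p: "p \<in> P" "elts p = {entry n m (num i) | n m i. (n, m, i) \<in> S}" by blast
    then obtain c where c: "c \<in> elts de" "E c = p" using e(5) elts_PP by blast
    then obtain l where l: "c = num l" using e(2) unfolding elts_omega by blast
    have brl: "opair (num j) (num m) \<in> elts (breal \<sigma> k) \<longleftrightarrow> gen (\<sigma> j) m" if "j < k" for j m \<sigma>
      unfolding elts_breal using that by auto
    have iff: "(\<forall>z\<in>elts p. usnd z = num 1 \<longleftrightarrow> ufst z \<in> elts (breal \<sigma> k)) \<longleftrightarrow> near k \<pi> \<sigma> n" for \<sigma>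
    proof -
      have "(\<forall>z\<in>elts p. usnd z = num 1 \<longleftrightarrow> ufst z \<in> elts (breal \<sigma> k)) \<longleftrightarrow>
          (\<forall>j m. j < k --> m < n --> (num (if gen (\<pi> j) m then 1 else 0) = (num 1 :: 'u) \<longleftrightarrow> opair (num j) (num m) \<in> elts (breal \<sigma> k)))"
        (is "?l \<longleftrightarrow> ?r")
      proof (rule iffI; intro allI impI ballI)
        fix j m assume *: ?l "j < k" "m < n"
        then have "(j, m, if gen (\<pi> j) m then 1 else 0) \<in> S" unfolding S_def by (intro image_eqI[of _ _ "(j, m)"]) auto
        then have "entry j m (num (if gen (\<pi> j) m then 1 else 0)) \<in> elts p" unfolding p(2) by blast
        from bspec[OF *(1) this] show "num (if gen (\<pi> j) m then 1 else 0) = (num 1 :: 'u) \<longleftrightarrow> opair (num j) (num m) \<in> elts (breal \<sigma> k)"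
          by (simp only: ufst_opair usnd_opair)
      next
        fix z assume *: ?r "z \<in> elts p"
        then obtain j m l where l: "(j, m, l) \<in> S" "z = entry j m (num l)" unfolding p(2) by blast
        then have "j < k" "m < n" "l = (if gen (\<pi> j) m then 1 else 0)" unfolding S_def by auto
        then show "usnd z = num 1 \<longleftrightarrow> ufst z \<in> elts (breal \<sigma> k)" using * l(2) by (simp only: ufst_opair usnd_opair)
      qed
      also have "\<dots> \<longleftrightarrow> near k \<pi> \<sigma> n" unfolding near_def using brl by auto
      finally show ?thesis .
    qed
    have "breal \<pi> k \<in> elts BM" using \<pi> unfolding elts_BM_breal A_def by blast
    moreover have "\<forall>z\<in>elts p. usnd z = num 1 \<longleftrightarrow> ufst z \<in> elts (breal \<pi> k)" unfolding iff by (simp add: near_def)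
    ultimately have "Q x (num l)"
      unfolding Q_def using \<pi> c l by (auto simp: A_def)
    then have "Q x' (num l)" using imp by blast
    then obtain b where b: "opair i b \<in> elts d" "h (opair i b) = x'" "\<forall>z\<in>elts p. usnd z = num 1 \<longleftrightarrow> ufst z \<in> elts b"
      unfolding Q_def using c l by auto
    then obtain \<sigma> where "\<sigma> \<in> perms" "b = breal \<sigma> k" using form by blast
    then have "\<sigma> \<in> A x'" "near k \<pi> \<sigma> n" using b iff by (auto simp: A_def)
    then show ?thesis by blast
  qed
  show ?thesis
  proof (rule psurj_omega_separated[OF T Q], intro ballI impI)
    fix x x' assume x: "x \<in> elts T" "x' \<in> elts T" and eq: "\<forall>n. Q x (num n) \<longleftrightarrow> Q x' (num n)"
    have "A x \<noteq> {}" using onto x(1) form unfolding A_def by blast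
    moreover have "\<forall>\<pi>\<in>A x. interp G (act_name \<pi> y) = x" "\<forall>\<pi>\<in>A x'. interp G (act_name \<pi> y) = x'"
      using val unfolding A_def by auto
    moreover have "A x \<subseteq> perms" "A x' \<subseteq> perms" unfolding A_def by auto
    moreover have "\<forall>\<pi>\<in>A x. \<forall>n. \<exists>\<sigma>\<in>A x'. near k \<pi> \<sigma> n" "\<forall>\<pi>\<in>A x'. \<forall>n. \<exists>\<sigma>\<in>A x. near k \<pi> \<sigma> n" using close eq by blast+
    ultimately show "x = x'" using closure_determines_value[OF y] by blast
  qed
qed

text \<open>The indices are well-ordered in \<open>V\<close>, so each element of \<open>X\<close>
  has a least one; the indices that occur are collapsed and carried to a cardinal of
  \<open>V\<close>. Restricting the pairs to those naming an element under its own least index makes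
  \<open>j\<close> recover the index.\<close>

lemma indexing:
  assumes X: "X \<in> M"
  obtains \<kappa> d h j where "cardinal_in V \<kappa>" "d \<in> M" "elts d \<subseteq> elts (cprod \<kappa> BM)" "Gr d h \<in> M" "h ` elts d = elts X"
    "Gr X j \<in> M" "j ` elts X = elts \<kappa>" "\<forall>i b. opair i b \<in> elts d --> j (h (opair i b)) = i"
    "\<forall>i\<in>elts \<kappa>. \<exists>k y. HS y \<and> supports k y \<and>
      (\<forall>b. opair i b \<in> elts d --> (\<exists>\<pi>\<in>perms. b = breal \<pi> k)) \<and>
      (\<forall>\<pi>\<in>perms. opair i (breal \<pi> k) \<in> elts d --> h (opair i (breal \<pi> k)) = interp G (act_name \<pi> y))"
proof -
  obtain D d h where D: "D \<in> V" "d \<in> M" "elts d \<subseteq> elts (cprod D BM)" "Gr d h \<in> M" "h ` elts d = elts X"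
    and form: "\<forall>x\<in>elts D. \<exists>k y. HS y \<and> supports k y \<and>
      (\<forall>b. opair x b \<in> elts d --> (\<exists>\<pi>\<in>perms. b = breal \<pi> k)) \<and>
      (\<forall>\<pi>\<in>perms. opair x (breal \<pi> k) \<in> elts d --> h (opair x (breal \<pi> k)) = interp G (act_name \<pi> y))"
    by (rule decomposition[OF X])
  have DM: "D \<in> M" using V_subset_M[OF D(1)] .
  obtain \<eta> where \<eta>: "\<eta> \<in> V" "is_ord \<eta>" "psurj V \<eta> D" using wellorder[OF D(1)] by blast
  obtain de E where e: "de \<in> M" "elts de \<subseteq> elts \<eta>" "Gr de E \<in> M" "\<forall>x\<in>elts de. E x \<in> elts D" "\<forall>x\<in>elts D. \<exists>z\<in>elts de. E z = x"
    by (rule MM.psurjE[OF psurj_V_M[OF \<eta>(3)]])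
  have \<eta>M: "\<eta> \<in> M" using V_subset_M[OF \<eta>(1)] .
  \<comment> \<open>An element may be named under several indices. \<open>In\<close> relates it to
    all ordinals whose index names it, and \<open>L\<close> below takes the least.\<close>
  define In where "In x \<zeta> \<longleftrightarrow> \<zeta> \<in> elts de \<and> (\<exists>b\<in>elts BM. opair (ap (Gr de E) \<zeta>) b \<in> elts d \<and> ap (Gr d h) (opair (ap (Gr de E) \<zeta>) b) = x)" for x \<zeta>
  have In: "definable M (\<lambda>s. In (s 0) (s 1))"
    unfolding In_def by (intro dintro e(1,3) D(2,4) BM_mem)
  have ex: "\<exists>\<zeta>\<in>elts \<eta>. In x \<zeta>" if x: "x \<in> elts X" for x
  proof -
    obtain z where z: "z \<in> elts d" "h z = x" using x unfolding D(5)[symmetric] by blast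
    then obtain v b where "z = opair v b" "v \<in> elts D" "b \<in> elts BM" using D(3) unfolding MM.elts_cprod[OF DM BM_mem] by blast
    moreover from this obtain \<zeta> where "\<zeta> \<in> elts de" "E \<zeta> = v" using e(5) by blast
    ultimately have "In x \<zeta>" "\<zeta> \<in> elts \<eta>" using z e(2) unfolding In_def by auto
    then show ?thesis by blast
  qed
  define L where "L x \<zeta> \<longleftrightarrow> In x \<zeta> \<and> (\<forall>\<xi>\<in>elts \<zeta>. \<not> In x \<xi>)" for x \<zeta>
  have L: "definable M (\<lambda>s. L (s 0) (s 1))" unfolding L_def by (intro dintro MM.definable_comp2[OF In])
  have Lex: "\<exists>!\<zeta>. \<zeta> \<in> elts \<eta> \<and> L x \<zeta>" if x: "x \<in> elts X" for x
  proof -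
    have ne: "{\<zeta> \<in> elts \<eta>. In x \<zeta>} \<noteq> {}" using ex[OF x] by blast
    obtain \<zeta> where \<zeta>: "\<zeta> \<in> {\<zeta> \<in> elts \<eta>. In x \<zeta>}" "\<And>\<xi>. \<xi> \<in> {\<zeta> \<in> elts \<eta>. In x \<zeta>} ==> \<zeta> = \<xi> \<or> \<zeta> \<in> elts \<xi>"
      by (rule ord_least[OF ne]) (use ord_mem[OF \<eta>(2)] in auto)
    have "L x \<zeta>" unfolding L_def using \<zeta> ord_trans[OF \<eta>(2)] mem_irrefl mem_asym by blast
    moreover have "\<xi> = \<zeta>" if "\<xi> \<in> elts \<eta>" "L x \<xi>" for \<xi> using that \<zeta> unfolding L_def by blast
    ultimately show ?thesis using \<zeta>(1) by blast
  qed
  define f where "f x = (THE \<zeta>. \<zeta> \<in> elts \<eta> \<and> L x \<zeta>)" for x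
  have f: "f x \<in> elts \<eta> \<and> L x (f x)" if "x \<in> elts X" for x unfolding f_def by (rule theI'[OF Lex[OF that]])
  have f_iff: "L x \<zeta> \<longleftrightarrow> \<zeta> = f x" if "x \<in> elts X" "\<zeta> \<in> elts \<eta>" for x \<zeta> using Lex[OF that(1)] f[OF that(1)] that(2) by blast
  have fM: "Gr X f \<in> M" by (rule MM.Gr_mem_rel[OF X \<eta>M _ L]) (use f f_iff in auto)
  define R where "R = mk {\<zeta> \<in> elts \<eta>. \<exists>x\<in>elts X. L x \<zeta>}"
  have RM: "R \<in> M" unfolding R_def by (rule MM.separation[OF \<eta>M]) (intro dintro MM.definable_comp2[OF L] X)
  have elR: "elts R = f ` elts X" unfolding R_def elts_mk_Collect using f f_iff by blast
  have Rsub: "elts R \<subseteq> elts \<eta>" unfolding elR using f by blast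
  obtain \<theta> where \<theta>: "\<theta> \<in> M" "is_ord \<theta>" "Gr R (coll R) \<in> M" "bij_betw (coll R) (elts R) (elts \<theta>)"
    using MM.collapse[OF RM \<eta>M \<eta>(2) Rsub] by blast
  obtain \<kappa> F where \<kappa>: "\<kappa> \<in> V" "cardinal_in V \<kappa>" "Gr \<kappa> F \<in> V" "bij_betw F (elts \<kappa>) (elts \<theta>)"
    using cardinal_bij[OF M_ord_V[OF \<theta>(1,2)] \<theta>(2)] by blast
  have \<kappa>M: "\<kappa> \<in> M" "Gr \<kappa> F \<in> M" using V_subset_M \<kappa>(1,3) by auto
  define c' where "c' = inv_into (elts R) (coll R)"
  have c'M: "Gr \<theta> c' \<in> M" unfolding c'_def
    by (rule MM.Gr_inverse[OF RM \<theta>(1,3)]) (use \<theta>(4) in \<open>auto simp: bij_betw_def\<close>)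
  have c'b: "bij_betw c' (elts \<theta>) (elts R)" unfolding c'_def by (rule bij_betw_inv_into[OF \<theta>(4)])
  define w where "w i = c' (F i)" for i
  have wM: "Gr \<kappa> w \<in> M" unfolding w_def
    by (rule MM.Gr_comp[OF \<kappa>M(1) RM \<kappa>M(2) c'M]) (use \<kappa>(4) c'b in \<open>auto simp: bij_betw_def\<close>)
  have wb: "bij_betw w (elts \<kappa>) (elts R)" 
  proof -
    have "w = c' \<circ> F" by (rule ext) (simp add: w_def)
    then show ?thesis using bij_betw_trans[OF \<kappa>(4) c'b] by simp
  qed
  define u where "u = inv_into (elts \<kappa>) w"
  have uM: "Gr R u \<in> M" unfolding u_def
    by (rule MM.Gr_inverse[OF \<kappa>M(1) RM wM]) (use wb in \<open>auto simp: bij_betw_def\<close>)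
  have ub: "bij_betw u (elts R) (elts \<kappa>)" unfolding u_def by (rule bij_betw_inv_into[OF wb])
  have wu: "w (u z) = z" if "z \<in> elts R" for z unfolding u_def using bij_betw_inv_into_right[OF wb that] .
  define j where "j x = u (f x)" for x
  have jM: "Gr X j \<in> M" unfolding j_def
    by (rule MM.Gr_comp[OF X \<kappa>M(1) fM uM]) (use elR ub in \<open>auto simp: bij_betw_def\<close>)
  have jim: "j ` elts X = elts \<kappa>" using ub unfolding j_def bij_betw_def elR image_image by blast
  have wde: "w i \<in> elts de" if "i \<in> elts \<kappa>" for i
  proof -
    have "w i \<in> f ` elts X" using wb that elR unfolding bij_betw_def by blast
    then obtain x where x: "x \<in> elts X" "w i = f x" by blast
    then have "In x (f x)" using f[OF x(1)] unfolding L_def by blast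
    then show ?thesis unfolding x(2) In_def by (rule conjunct1)
  qed
  define \<Xi> where "\<Xi> i = E (w i)" for i
  have \<Xi>: "\<Xi> i \<in> elts D" "\<Xi> i = ap (Gr de E) (ap (Gr \<kappa> w) i)" if "i \<in> elts \<kappa>" for i
    using wde[OF that] that e(4) by (auto simp: \<Xi>_def)
  have \<Xi>M: "Gr \<kappa> \<Xi> \<in> M" unfolding \<Xi>_def
    by (rule MM.Gr_comp[OF \<kappa>M(1) DM wM e(3)]) (use wde e(4) in auto)
  \<comment> \<open>Only the pairs that name an element under its own index are kept.\<close>
  define d' where "d' = mk {z \<in> elts (cprod \<kappa> BM). opair (ap (Gr \<kappa> \<Xi>) (ufst z)) (usnd z) \<in> elts d \<and>
    ap (Gr X j) (ap (Gr d h) (opair (ap (Gr \<kappa> \<Xi>) (ufst z)) (usnd z))) = ufst z}"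
  have d'M: "d' \<in> M" unfolding d'_def
    by (rule MM.separation[OF MM.cprod_mem[OF \<kappa>M(1) BM_mem]]) (intro dintro \<Xi>M D(2,4) jM)
  have hX: "h z \<in> elts X" if "z \<in> elts d" for z using D(5) that by blast
  have mem: "opair i b \<in> elts d' \<longleftrightarrow> i \<in> elts \<kappa> \<and> b \<in> elts BM \<and> opair (\<Xi> i) b \<in> elts d \<and> j (h (opair (\<Xi> i) b)) = i" for i b
    unfolding d'_def elts_mk_Collect using \<kappa>M(1) hX by auto
  have d'sub: "elts d' \<subseteq> elts (cprod \<kappa> BM)" unfolding d'_def by auto
  define h' where "h' z = h (opair (\<Xi> (ufst z)) (usnd z))" for z
  have shape: "\<exists>i b. z = opair i b \<and> i \<in> elts \<kappa>" if "z \<in> elts d'" for z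
    using that d'sub unfolding MM.elts_cprod[OF \<kappa>M(1) BM_mem] by blast
  have h'M: "Gr d' h' \<in> M"
  proof (rule MM.Gr_mem_rel[OF d'M X])
    show "h' ` elts d' \<subseteq> elts X" using shape mem hX by (fastforce simp: h'_def)
    show "definable M (\<lambda>s. s 1 = ap (Gr d h) (opair (ap (Gr \<kappa> \<Xi>) (ufst (s 0))) (usnd (s 0))))"
      by (intro dintro \<Xi>M D(4))
    show "y = ap (Gr d h) (opair (ap (Gr \<kappa> \<Xi>) (ufst x)) (usnd x)) \<longleftrightarrow> y = h' x" if x: "x \<in> elts d'" for x y
    proof -
      obtain i b where ib: "x = opair i b" "i \<in> elts \<kappa>" using shape[OF x] by blast
      then have "opair (\<Xi> i) b \<in> elts d" using mem x by blast
      then show ?thesis using ib by (simp add: h'_def)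
    qed
  qed
  have onto: "h' ` elts d' = elts X"
  proof (intro equalityI subsetI)
    fix x assume "x \<in> h' ` elts d'"
    then show "x \<in> elts X" using shape mem hX by (fastforce simp: h'_def)
  next
    fix x assume x: "x \<in> elts X"
    have "w (j x) = f x" unfolding j_def using wu x elR by blast
    moreover have "In x (f x)" using f[OF x] unfolding L_def by blast
    ultimately obtain b where b: "b \<in> elts BM" "opair (\<Xi> (j x)) b \<in> elts d" "h (opair (\<Xi> (j x)) b) = x"
      unfolding In_def \<Xi>_def by auto
    moreover have "j x \<in> elts \<kappa>" using jim x by blast
    ultimately have "opair (j x) b \<in> elts d'" unfolding mem by simp
    moreover have "h' (opair (j x) b) = x" using b(3) by (simp add: h'_def)
    ultimately show "x \<in> h' ` elts d'" by (metis image_eqI)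
  qed
  have sec: "\<forall>i b. opair i b \<in> elts d' --> j (h' (opair i b)) = i" unfolding mem h'_def by simp
  have "\<forall>i\<in>elts \<kappa>. \<exists>k y. HS y \<and> supports k y \<and>
      (\<forall>b. opair i b \<in> elts d' --> (\<exists>\<pi>\<in>perms. b = breal \<pi> k)) \<and>
      (\<forall>\<pi>\<in>perms. opair i (breal \<pi> k) \<in> elts d' --> h' (opair i (breal \<pi> k)) = interp G (act_name \<pi> y))"
  proof
    fix i assume "i \<in> elts \<kappa>"
    then obtain k y where "HS y" "supports k y" "\<forall>b. opair (\<Xi> i) b \<in> elts d --> (\<exists>\<pi>\<in>perms. b = breal \<pi> k)"
      "\<forall>\<pi>\<in>perms. opair (\<Xi> i) (breal \<pi> k) \<in> elts d --> h (opair (\<Xi> i) (breal \<pi> k)) = interp G (act_name \<pi> y)"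
      using form \<Xi>(1) by blast
    then show "\<exists>k y. HS y \<and> supports k y \<and>
      (\<forall>b. opair i b \<in> elts d' --> (\<exists>\<pi>\<in>perms. b = breal \<pi> k)) \<and>
      (\<forall>\<pi>\<in>perms. opair i (breal \<pi> k) \<in> elts d' --> h' (opair i (breal \<pi> k)) = interp G (act_name \<pi> y))"
      unfolding mem h'_def ufst_opair usnd_opair by blast
  qed
  from that[OF \<kappa>(2) d'M d'sub h'M onto jM jim sec this] show ?thesis .
qed

lemma psurj_fst: "a \<in> M ==> b \<in> M ==> elts b \<noteq> {} ==> psurj M (cprod a b) a"
proof (rule MM.psurjI[OF MM.cprod_mem order_refl])
  assume ab: "a \<in> M" "b \<in> M" "elts b \<noteq> {}"
  note el = MM.elts_cprod[OF ab(1,2)]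
  show "Gr (cprod a b) ufst \<in> M"
    by (rule MM.Gr_mem_dterm[OF MM.cprod_mem[OF ab(1,2)] ab(1)]) (auto simp: el intro: dintro)
  show "ufst z \<in> elts a" if "z \<in> elts (cprod a b)" for z using that unfolding el by auto
  show "\<exists>z\<in>elts (cprod a b). ufst z = x" if "x \<in> elts a" for x
  proof -
    obtain y where "y \<in> elts b" using ab(3) by blast
    then have "opair x y \<in> elts (cprod a b)" using that unfolding el by blast
    then show ?thesis using ufst_opair by blast
  qed
qed

lemma BM_nonempty: "elts BM \<noteq> {}"
  unfolding elts_BM_breal using finitary_id by blast

text \<open>The covering bound, with \<open>BM\<close> entering only as a factor that is projected
  away.\<close>

lemma psurj_M_V:
  assumes "\<kappa> \<in> V" "is_ord \<kappa>" "infinite (elts \<kappa>)" "E \<in> V" "psurj M \<kappa> E"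
  shows "psurj V \<kappa> E"
proof (rule covering_bound[OF assms(1-4)])
  have "psurj M (cprod \<kappa> BM) \<kappa>" using psurj_fst[OF V_subset_M[OF assms(1)] BM_mem BM_nonempty] .
  then show "psurj M (cprod \<kappa> BM) E"
    using MM.psurj_trans[OF _ assms(5) MM.cprod_mem] V_subset_M assms(1,4) BM_mem by blast
qed

text \<open>Surjections between infinite ordinals are the same in both models because
  \<open>QQ\<close> is countable in \<open>V\<close>; finite ordinals are settled by
  counting.\<close>

lemma cardinal_M_iff: "cardinal_in M \<kappa> \<longleftrightarrow> cardinal_in V \<kappa>"
proof
  assume "cardinal_in M \<kappa>"
  then show "cardinal_in V \<kappa>" unfolding cardinal_in_def using M_ord_V V_subset_M by blast
next
  assume \<kappa>: "cardinal_in V \<kappa>"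
  then have \<kappa>V: "\<kappa> \<in> V" "is_ord \<kappa>" unfolding cardinal_in_def by auto
  show "cardinal_in M \<kappa>"
  proof (rule MM.cardinalI[OF V_subset_M[OF \<kappa>V(1)] \<kappa>V(2)])
    fix \<beta> assume \<beta>: "\<beta> \<in> elts \<kappa>"
    have \<beta>V: "\<beta> \<in> V" "is_ord \<beta>" using V_trans[OF \<beta> \<kappa>V(1)] ord_mem[OF \<kappa>V(2) \<beta>] by auto
    show "\<not> psurj M \<beta> \<kappa>"
    proof
      assume s: "psurj M \<beta> \<kappa>"
      show False
      proof (cases "finite (elts \<beta>)")
        case True
        have "elts \<beta> \<subset> elts \<kappa>" using \<beta> ord_trans[OF \<kappa>V(2) \<beta>] mem_irrefl[of \<beta>] by blast
        moreover have "finite (elts \<kappa>)" "card (elts \<kappa>) \<le> card (elts \<beta>)" using MM.psurj_finite[OF s True] by auto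
        ultimately show False using psubset_card_mono[of "elts \<kappa>" "elts \<beta>"] by simp
      next
        case False
        then show False using psurj_M_V[OF \<beta>V False \<kappa>V(1) s] cardinal_no_psurj[OF \<kappa> \<beta>] by blast
      qed
    qed
  qed
qed

lemma cardinal_omega: "cardinal_in V omega"
proof (rule cardinalI[OF omega_mem ord_omega])
  fix \<beta> :: 'u assume "\<beta> \<in> elts omega"
  then have "finite (elts \<beta>)" unfolding elts_omega by (auto simp: finite_num)
  then show "\<not> psurj V \<beta> omega" using psurj_finite infinite_omega by blast
qed

lemma cofinal_omega: "\<exists>f\<in>V. is_cofinal_map f omega omega"
proof
  show "Gr omega (\<lambda>x. x) \<in> V" by (rule Gr_mem_dterm[OF omega_mem omega_mem]) (auto intro: dintro)
  show "is_cofinal_map (Gr omega (\<lambda>x. x)) omega omega"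
    unfolding is_cofinal_map_def by (auto simp: opair_Gr)
qed

lemma injects_below_omega:
  fixes X :: 'u
  assumes "X \<in> M" "infinite (elts X)" "\<delta> \<in> elts omega" shows "injects M \<delta> X"
  using MM.finite_injects[of \<delta> X] assms MM.mem_trans[OF assms(3) omega_M] unfolding elts_omega by (auto simp: finite_num)

text \<open>Three cases for the number of indices. If it is finite, \<kappa> is replaced by \<omega>
  and the map onto \<omega> comes from an infinite fibre. If it is \<omega>, the lower bound only
  asks for finite sets. If it is uncountable, one sequence serves many indices, and the elements
  that it names under them are distinct.\<close>

lemma spectrum_data:
  assumes X: "X \<in> M" "infinite (elts X)"
  shows "\<exists>\<kappa>. cardinal_in V \<kappa> \<and> infinite (elts \<kappa>) \<and> psurj M X \<kappa> \<and> (\<forall>\<alpha>\<in>V. psurj M X \<alpha> --> psurj V \<kappa> \<alpha>) \<and>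
    (\<forall>\<delta>\<in>elts \<kappa>. injects M \<delta> X) \<and> (injects M \<kappa> X \<or> (\<exists>f\<in>V. is_cofinal_map f omega \<kappa>))"
proof -
  obtain \<kappa> d h j where \<kappa>: "cardinal_in V \<kappa>" and d: "d \<in> M" "elts d \<subseteq> elts (cprod \<kappa> BM)" "Gr d h \<in> M" "h ` elts d = elts X"
    and j: "Gr X j \<in> M" "j ` elts X = elts \<kappa>" "\<forall>i b. opair i b \<in> elts d --> j (h (opair i b)) = i"
    and form: "\<forall>i\<in>elts \<kappa>. \<exists>k y. HS y \<and> supports k y \<and>
      (\<forall>b. opair i b \<in> elts d --> (\<exists>\<pi>\<in>perms. b = breal \<pi> k)) \<and>
      (\<forall>\<pi>\<in>perms. opair i (breal \<pi> k) \<in> elts d --> h (opair i (breal \<pi> k)) = interp G (act_name \<pi> y))"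
    by (rule indexing[OF X(1)])
  have \<kappa>V: "\<kappa> \<in> V" "is_ord \<kappa>" using \<kappa> unfolding cardinal_in_def by auto
  have \<kappa>M: "\<kappa> \<in> M" using V_subset_M[OF \<kappa>V(1)] .
  have PX: "psurj M (cprod \<kappa> BM) X" unfolding psurj_def using d by blast
  have el: "elts d \<subseteq> {opair i b | i b. i \<in> elts \<kappa> \<and> b \<in> elts BM}" using d(2) unfolding MM.elts_cprod[OF \<kappa>M BM_mem] .
  \<comment> \<open>Stated for every infinite ordinal \<rho> containing \<kappa>, since a finite
    \<kappa> will be replaced by \<omega>.\<close>
  have upper: "psurj V \<rho> \<alpha>" if \<alpha>: "\<alpha> \<in> V" "psurj M X \<alpha>" and l: "\<rho> \<in> V" "is_ord \<rho>" "infinite (elts \<rho>)" "elts \<kappa> \<subseteq> elts \<rho>" for \<alpha> \<rho>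
  proof (rule covering_bound[OF l(1-3) \<alpha>(1)])
    have lM: "\<rho> \<in> M" using V_subset_M[OF l(1)] .
    have "psurj M (cprod \<rho> BM) (cprod \<kappa> BM)"
      using MM.psurj_subset[OF MM.cprod_mem[OF lM BM_mem] MM.cprod_mem[OF \<kappa>M BM_mem]] l(4)
      unfolding MM.elts_cprod[OF lM BM_mem] MM.elts_cprod[OF \<kappa>M BM_mem] by blast
    from MM.psurj_trans[OF this PX] have "psurj M (cprod \<rho> BM) X" using MM.cprod_mem lM \<kappa>M BM_mem X(1) by blast
    from MM.psurj_trans[OF this \<alpha>(2)] show "psurj M (cprod \<rho> BM) \<alpha>" using MM.cprod_mem lM BM_mem X(1) V_subset_M[OF \<alpha>(1)] by blast
  qed
  show ?thesis
  proof (cases "finite (elts \<kappa>)")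
    case True
    have "\<exists>i\<in>elts \<kappa>. infinite {x \<in> elts X. j x = i}"
    proof (rule ccontr)
      assume "\<not> ?thesis"
      then have "finite (\<Union>i\<in>elts \<kappa>. {x \<in> elts X. j x = i})" using True by auto
      moreover have "elts X \<subseteq> (\<Union>i\<in>elts \<kappa>. {x \<in> elts X. j x = i})" using j(2) by blast
      ultimately show False using X(2) finite_subset by blast
    qed
    then obtain i where i: "i \<in> elts \<kappa>" "infinite {x \<in> elts X. j x = i}" by blast
    have iM: "i \<in> M" using MM.mem_trans[OF i(1) \<kappa>M] .
    define T where "T = mk {x \<in> elts X. ap (Gr X j) x = i}"
    have TM: "T \<in> M" unfolding T_def by (rule MM.separation[OF X(1)]) (intro dintro j(1) iM)
    have elT: "elts T = {x \<in> elts X. j x = i}" unfolding T_def elts_mk_Collect by auto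
    obtain k y where "HS y" "supports k y" "\<forall>b. opair i b \<in> elts d --> (\<exists>\<pi>\<in>perms. b = breal \<pi> k)"
      "\<forall>\<pi>\<in>perms. opair i (breal \<pi> k) \<in> elts d --> h (opair i (breal \<pi> k)) = interp G (act_name \<pi> y)"
      using form i(1) by blast
    moreover have "\<forall>x\<in>elts T. \<exists>b\<in>elts BM. opair i b \<in> elts d \<and> h (opair i b) = x"
    proof
      fix x assume x: "x \<in> elts T"
      then have "x \<in> h ` elts d" unfolding d(4) elT by blast
      then obtain z where z: "z \<in> elts d" "h z = x" by blast
      then obtain i' b where ib: "z = opair i' b" "b \<in> elts BM" using el by blast
      then have "i' = i" using j(3) z x unfolding elT by auto
      then show "\<exists>b\<in>elts BM. opair i b \<in> elts d \<and> h (opair i b) = x" using ib z by blast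
    qed
    moreover have "infinite (elts T)" unfolding elT using i(2) .
    ultimately have "psurj M T omega" using fibre_psurj_omega[OF d(1,3) iM TM] by blast
    moreover have "psurj M X T" using MM.psurj_subset[OF X(1) TM] unfolding elT by blast
    ultimately have "psurj M X omega" using MM.psurj_trans[OF _ _ X(1) TM omega_M] by blast
    moreover have "elts \<kappa> \<subseteq> elts omega" using finite_ord[OF \<kappa>V(2) True] by (auto simp: elts_num)
    then have "\<forall>\<alpha>\<in>V. psurj M X \<alpha> --> psurj V omega \<alpha>" using upper[OF _ _ omega_mem ord_omega infinite_omega] by blast
    ultimately show ?thesis using cardinal_omega infinite_omega injects_below_omega[OF X] cofinal_omega by blast
  next
    case False
    have "psurj M X \<kappa>" unfolding psurj_def using X(1) j by blast
    moreover have "\<forall>\<alpha>\<in>V. psurj M X \<alpha> --> psurj V \<kappa> \<alpha>" using upper[OF _ _ \<kappa>V False] by blast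
    moreover have "(\<forall>\<delta>\<in>elts \<kappa>. injects M \<delta> X) \<and> (injects M \<kappa> X \<or> (\<exists>f\<in>V. is_cofinal_map f omega \<kappa>))"
    proof (cases "\<kappa> = omega")
      case True
      then show ?thesis using injects_below_omega[OF X] cofinal_omega by blast
    next
      case False
      then have om: "omega \<in> elts \<kappa>" using subset_omega[OF \<kappa>V(2) \<open>infinite (elts \<kappa>)\<close>] by blast
      define Rel where "Rel = mk {z \<in> elts (cprod BM \<kappa>). opair (usnd z) (ufst z) \<in> elts d}"
      have RM: "Rel \<in> M" unfolding Rel_def by (rule MM.separation[OF MM.cprod_mem[OF BM_mem \<kappa>M]]) (intro dintro d(1))
      have memRel: "opair b i \<in> elts Rel \<longleftrightarrow> opair i b \<in> elts d" for b i
        unfolding Rel_def elts_mk_Collect using el \<kappa>M by auto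
      have cover: "\<exists>b\<in>elts BM. opair b i \<in> elts Rel" if i: "i \<in> elts \<kappa>" for i
      proof -
        have "i \<in> j ` h ` elts d" unfolding d(4) j(2) by (rule i)
        then obtain z where z: "z \<in> elts d" "j (h z) = i" by blast
        then obtain i' b where "z = opair i' b" "b \<in> elts BM" using el by blast
        moreover from this have "i' = i" using z j(3) by auto
        ultimately show ?thesis using z(1) memRel by blast
      qed
      have inj: "injects M \<delta> X" if \<delta>: "\<delta> \<in> V" and hyp: "\<And>S. S \<in> V ==> (\<And>i. i \<in> elts \<kappa> ==> \<exists>w\<in>elts QQ. opair w i \<in> elts S) ==>
          \<exists>w\<in>elts QQ. injects V \<delta> (mk {i \<in> elts \<kappa>. opair w i \<in> elts S})" for \<delta>
      proof -
        obtain b S where b: "b \<in> elts BM" "S \<in> V" "injects V \<delta> S" "\<forall>i\<in>elts S. i \<in> elts \<kappa> \<and> opair b i \<in> elts Rel"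
          using generic_section[OF \<kappa>V(1) \<delta> RM cover hyp] by blast
        have bM: "b \<in> M" using MM.mem_trans[OF b(1) BM_mem] .
        have SM: "S \<in> M" using V_subset_M[OF b(2)] .
        have ind: "opair i b \<in> elts d" if "i \<in> elts S" for i using b(4) that memRel by blast
        \<comment> \<open>Along the fixed sequence \<open>b\<close>, different indices give
          different elements because \<open>j\<close> recovers the index.\<close>
        have "injects M S X" unfolding injects_def
        proof (intro exI conjI)
          show "Gr S (\<lambda>i. h (opair i b)) \<in> M"
          proof (rule MM.Gr_mem_rel[OF SM X(1)])
            show "(\<lambda>i. h (opair i b)) ` elts S \<subseteq> elts X" using ind d(4) by blast
            show "definable M (\<lambda>s. s 1 = ap (Gr d h) (opair (s 0) b))" by (intro dintro d(3) bM)
            show "y = ap (Gr d h) (opair x b) \<longleftrightarrow> y = h (opair x b)" if "x \<in> elts S" for x y using ind[OF that] by simp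
          qed
          show "inj_on (\<lambda>i. h (opair i b)) (elts S)" by (rule inj_onI) (metis ind j(3))
          show "(\<lambda>i. h (opair i b)) ` elts S \<subseteq> elts X" using ind d(4) by blast
        qed
        then show ?thesis using MM.injects_trans[OF injects_V_M[OF b(3)] _ V_subset_M[OF \<delta>] X(1)] by blast
      qed
      have np: "\<And>\<beta>. \<beta> \<in> elts \<kappa> ==> \<not> psurj V \<beta> \<kappa>" using cardinal_no_psurj[OF \<kappa>] .
      have "injects M \<delta> X" if d: "\<delta> \<in> elts \<kappa>" for \<delta>
      proof (rule inj[OF V_trans[OF d \<kappa>V(1)]])
        fix S assume S: "S \<in> V" "\<And>i. i \<in> elts \<kappa> ==> \<exists>w\<in>elts QQ. opair w i \<in> elts S"
        show "\<exists>w\<in>elts QQ. injects V \<delta> (mk {i \<in> elts \<kappa>. opair w i \<in> elts S})"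
          by (rule countable_union(1)[OF \<kappa>V om np QQ_mem countable_QQ S(1) S(2) d])
      qed
      moreover have "injects M \<kappa> X" if no: "\<not> (\<exists>f\<in>V. is_cofinal_map f omega \<kappa>)"
      proof (rule inj[OF \<kappa>V(1)])
        fix S assume S: "S \<in> V" "\<And>i. i \<in> elts \<kappa> ==> \<exists>w\<in>elts QQ. opair w i \<in> elts S"
        have "(\<exists>w\<in>elts QQ. injects V \<kappa> (mk {i \<in> elts \<kappa>. opair w i \<in> elts S})) \<or> (\<exists>f\<in>V. is_cofinal_map f omega \<kappa>)"
          by (rule countable_union(2)[OF \<kappa>V om np QQ_mem countable_QQ S(1) S(2)])
        then show "\<exists>w\<in>elts QQ. injects V \<kappa> (mk {i \<in> elts \<kappa>. opair w i \<in> elts S})" using no by blast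
      qed
      ultimately show ?thesis by blast
    qed
    ultimately show ?thesis using \<kappa> False by blast
  qed
qed

end

context cohen
begin

section \<open>Computation of the spectrum\<close>

text \<open>Otherwise the cardinal would be the successor of an infinite ordinal, which maps onto
  its successor.\<close>

lemma infinite_cardinal_suc:
  assumes "cardinal_in V \<kappa>" "infinite (elts \<kappa>)" "\<delta> \<in> elts \<kappa>"
  shows "suc \<delta> \<in> elts \<kappa>"
proof (rule ccontr)
  have \<kappa>: "\<kappa> \<in> V" "is_ord \<kappa>" using assms(1) unfolding cardinal_in_def by auto
  have \<delta>: "\<delta> \<in> V" "is_ord \<delta>" using V_trans[OF assms(3) \<kappa>(1)] ord_mem[OF \<kappa>(2) assms(3)] by auto
  assume "suc \<delta> \<notin> elts \<kappa>"
  moreover have "elts (suc \<delta>) \<subseteq> elts \<kappa>" using assms(3) ord_trans[OF \<kappa>(2) assms(3)] by auto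
  ultimately have eq: "suc \<delta> = \<kappa>" using ord_subset_iff[OF ord_suc[OF \<delta>(2)] \<kappa>(2)] by blast
  then have "infinite (elts \<delta>)" using assms(2) by auto
  then have "psurj V \<delta> \<kappa>" using psurj_suc[OF \<delta>] eq by simp
  then show False using cardinal_no_psurj[OF assms(1,3)] by blast
qed

lemma infinite_cardinal_bound:
  assumes \<kappa>: "cardinal_in V \<kappa>" "infinite (elts \<kappa>)" and A: "finite A" "A \<subseteq> elts \<kappa>"
  shows "\<exists>\<delta>\<in>elts \<kappa>. \<forall>a\<in>A. a \<in> elts \<delta>"
  using A
proof (induction A)
  case empty
  have "elts \<kappa> \<noteq> {}" using \<kappa>(2) by auto
  then show ?case by blast
next
  case (insert a A)
  then obtain \<delta> where \<delta>: "\<delta> \<in> elts \<kappa>" "\<forall>a\<in>A. a \<in> elts \<delta>" by blast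
  have o: "is_ord \<kappa>" using \<kappa>(1) unfolding cardinal_in_def by auto
  have a: "a \<in> elts \<kappa>" using insert.prems by blast
  have ord: "is_ord a" "is_ord \<delta>" using ord_mem[OF o] a \<delta>(1) by auto
  have sa: "suc a \<in> elts \<kappa>" using infinite_cardinal_suc[OF \<kappa> a] .
  consider "a \<in> elts \<delta>" | "a = \<delta>" | "\<delta> \<in> elts a" using ord_linear[OF ord] by blast
  then show ?case
  proof cases
    case 1
    then show ?thesis using \<delta> by blast
  next
    case 2
    then have "\<forall>b\<in>insert a A. b \<in> elts (suc a)" using \<delta>(2) by auto
    then show ?thesis using sa by blast
  next
    case 3
    then have "\<forall>b\<in>insert a A. b \<in> elts (suc a)" using \<delta>(2) ord_trans[OF ord(1) 3] by auto
    then show ?thesis using sa by blast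
  qed
qed

text \<open>Finitely many values are bounded strictly below \<kappa>. Hence a cofinal map from
  \<omega> already shows that the cofinality is exactly \<omega>.\<close>

lemma finite_not_cofinal:
  assumes \<kappa>: "cardinal_in V \<kappa>" "infinite (elts \<kappa>)" and \<beta>: "finite (elts \<beta>)"
  shows "\<not> is_cofinal_map f \<beta> \<kappa>"
proof
  assume f: "is_cofinal_map f \<beta> \<kappa>"
  then have fn: "f = Gr \<beta> (ap f)" "is_fun f \<beta> \<kappa>" using is_fun_eq_Gr unfolding is_cofinal_map_def by blast+
  then have "ap f ` elts \<beta> \<subseteq> elts \<kappa>" by (metis is_fun_Gr)
  then obtain \<delta> where \<delta>: "\<delta> \<in> elts \<kappa>" "\<forall>a\<in>ap f ` elts \<beta>. a \<in> elts \<delta>"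
    using infinite_cardinal_bound[OF \<kappa> finite_imageI[OF \<beta>]] by blast
  obtain \<xi> \<epsilon> where \<epsilon>: "\<xi> \<in> elts \<beta>" "opair \<xi> \<epsilon> \<in> elts f" "\<delta> = \<epsilon> \<or> \<delta> \<in> elts \<epsilon>" using f \<delta>(1) unfolding is_cofinal_map_def by blast
  have "\<epsilon> = ap f \<xi>" using \<epsilon>(2) fn(1) opair_Gr by metis
  then have "\<epsilon> \<in> elts \<delta>" using \<delta>(2) \<epsilon>(1) by blast
  then show False using \<epsilon>(3) mem_irrefl mem_asym by blast
qed

lemma spec_infinite:
  assumes X: "X \<in> M" "infinite (elts X)" and h: "hartogs_in M X \<nu>" and l: "lindenbaum_in M X \<mu>"
  shows "\<exists>\<kappa>. cardinal_in M \<kappa> \<and> succ_cardinal_in M \<kappa> \<mu> \<and> (\<nu> = \<mu> \<or> \<nu> = \<kappa> \<and> cofinality_in M \<kappa> omega)"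
proof -
  obtain \<kappa> where \<kappa>: "cardinal_in V \<kappa>" "infinite (elts \<kappa>)" "psurj M X \<kappa>" and up: "\<forall>\<alpha>\<in>V. psurj M X \<alpha> --> psurj V \<kappa> \<alpha>"
    and lo: "\<forall>\<delta>\<in>elts \<kappa>. injects M \<delta> X" and top: "injects M \<kappa> X \<or> (\<exists>f\<in>V. is_cofinal_map f omega \<kappa>)"
    using spectrum_data[OF X] by blast
  have \<kappa>V: "\<kappa> \<in> V" "is_ord \<kappa>" using \<kappa>(1) unfolding cardinal_in_def by auto
  note \<kappa>M = V_subset_M[OF \<kappa>V(1)]
  have \<mu>: "\<mu> \<in> M" "is_ord \<mu>" "elts \<mu> \<noteq> {}" "\<not> (\<exists>f\<in>M. is_surj f X \<mu>)" "\<forall>\<beta>\<in>elts \<mu>. elts \<beta> \<noteq> {} --> (\<exists>f\<in>M. is_surj f X \<beta>)"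
    using l unfolding lindenbaum_in_def by auto
  have \<nu>: "\<nu> \<in> M" "is_ord \<nu>" "\<not> injects M \<nu> X" "\<forall>\<beta>\<in>elts \<nu>. injects M \<beta> X"
    using h unfolding hartogs_in_def MM.injects_iff by auto
  have n\<mu>: "\<not> psurj M X \<mu>" using MM.psurj_is_surj[OF _ X(1) \<mu>(1,3)] \<mu>(4) by blast
  have via: "psurj M X \<alpha>" if "\<alpha> \<in> M" "psurj M \<kappa> \<alpha>" for \<alpha> using MM.psurj_trans[OF \<kappa>(3) that(2) X(1) \<kappa>M that(1)] .
  have "\<not> elts \<mu> \<subseteq> elts \<kappa>" using via[OF \<mu>(1)] n\<mu> MM.psurj_subset[OF \<kappa>M \<mu>(1)] by blast
  then have \<kappa>\<mu>: "\<kappa> \<in> elts \<mu>" using ord_linear[OF \<kappa>V(2) \<mu>(2)] ord_trans[OF \<kappa>V(2)] by blast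
  have small: "psurj V \<kappa> \<beta>" if \<beta>: "\<beta> \<in> elts \<mu>" for \<beta>
  proof -
    have bM: "\<beta> \<in> M" using MM.mem_trans[OF \<beta> \<mu>(1)] .
    then have bV: "\<beta> \<in> V" using M_ord_V ord_mem[OF \<mu>(2) \<beta>] by blast
    show ?thesis
    proof (cases "elts \<beta> = {}")
      case True
      then show ?thesis using psurj_subset[OF \<kappa>V(1) bV] by simp
    next
      case False
      then have "psurj M X \<beta>" using \<mu>(5) \<beta> MM.is_surj_psurj[OF X(1)] by blast
      then show ?thesis using up bV by blast
    qed
  qed
  have nV: "\<not> psurj V \<kappa> \<mu>" using via[OF \<mu>(1)] psurj_V_M n\<mu> by blast
  have \<mu>V: "\<mu> \<in> V" using M_ord_V[OF \<mu>(1,2)] .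
  have "cardinal_in V \<mu>"
  proof (rule cardinalI[OF \<mu>V \<mu>(2)])
    fix \<beta> assume \<beta>: "\<beta> \<in> elts \<mu>"
    show "\<not> psurj V \<beta> \<mu>" using psurj_trans[OF small[OF \<beta>] _ \<kappa>V(1) V_trans[OF \<beta> \<mu>V] \<mu>V] nV by blast
  qed
  then have succ: "succ_cardinal_in M \<kappa> \<mu>"
    unfolding succ_cardinal_in_def cardinal_M_iff using \<kappa>\<mu> small cardinal_no_psurj by blast
  have "\<nu> \<notin> elts \<kappa>" using lo \<nu>(3) by blast
  then consider "\<nu> = \<kappa>" | "\<kappa> \<in> elts \<nu>" using ord_linear[OF \<nu>(2) \<kappa>V(2)] by blast
  then have "\<nu> = \<mu> \<or> \<nu> = \<kappa> \<and> cofinality_in M \<kappa> omega"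
  proof cases
    case 1
    then obtain f where "f \<in> V" "is_cofinal_map f omega \<kappa>" using top \<nu>(3) by blast
    moreover have "finite (elts \<beta>)" if "\<beta> \<in> elts (omega :: 'u)" for \<beta> :: 'u using that unfolding elts_omega by (auto simp: finite_num)
    ultimately have "cofinality_in M \<kappa> omega"
      unfolding cofinality_in_def using V_subset_M omega_M ord_omega finite_not_cofinal[OF \<kappa>(1,2)] by blast
    then show ?thesis using 1 by blast
  next
    case 2
    have inj: "injects M \<kappa> X" using \<nu>(4) 2 by blast
    \<comment> \<open>An ordinal below \<mu> is an image of \<kappa>, hence embeds in \<kappa> by
      least preimages, and so in \<open>X\<close>.\<close>
    have "\<nu> \<notin> elts \<mu>"
    proof
      assume n: "\<nu> \<in> elts \<mu>"
      have "injects M \<nu> \<kappa>"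
        using MM.psurj_injects[OF psurj_V_M[OF small[OF n]] \<kappa>M \<nu>(1)] ord_mem[OF \<kappa>V(2)] by blast
      then show False using MM.injects_trans[OF _ inj \<nu>(1) X(1)] \<nu>(3) by blast
    qed
    moreover have "\<mu> \<notin> elts \<nu>"
      using \<nu>(4) MM.injects_psurj[OF _ \<mu>(1) X(1)] n\<mu> by blast
    ultimately show ?thesis using ord_linear[OF \<nu>(2) \<mu>(2)] by blast
  qed
  then show ?thesis using \<kappa>(1) succ cardinal_M_iff by blast
qed

text \<open>For a set with \<open>n\<close> elements both numbers are \<open>n + 1\<close>, the
  successor cardinal of the finite cardinal \<open>n\<close>.\<close>

lemma spec_finite:
  assumes X: "X \<in> M" "finite (elts X)" and h: "hartogs_in M X \<nu>" and l: "lindenbaum_in M X \<mu>"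
  shows "\<exists>\<kappa>. cardinal_in M \<kappa> \<and> succ_cardinal_in M \<kappa> \<mu> \<and> \<nu> = \<mu>"
proof -
  define n where "n = card (elts X)"
  have numM: "num m \<in> M" for m by (rule MM.num_mem)
  have card: "cardinal_in M (num m)" for m
  proof (rule MM.cardinalI[OF numM ord_num])
    fix \<beta> :: 'u assume "\<beta> \<in> elts (num m)"
    then obtain k where k: "k < m" "\<beta> = num k" by (auto simp: elts_num)
    show "\<not> psurj M \<beta> (num m)" using MM.psurj_finite[of "num k" "num m"] k by (auto simp: finite_num card_num)
  qed
  have inj: "injects M (num m) X" if "m \<le> n" for m
    using MM.finite_injects[OF _ _ numM X(1)] that by (simp add: finite_num card_num n_def)
  have ninj: "\<not> injects M (num (Suc n)) X"
  proof
    assume "injects M (num (Suc n)) X"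
    then have "psurj M X (num (Suc n))" using MM.injects_psurj[OF _ numM X(1)] by blast
    then show False using MM.psurj_finite[OF _ X(2)] by (fastforce simp: card_num n_def simp del: num.simps)
  qed
  have nsurj: "\<not> psurj M X (num (Suc n))"
    using MM.psurj_finite[OF _ X(2), of "num (Suc n)"] by (auto simp: card_num n_def simp del: num.simps)
  have \<mu>: "\<mu> \<in> M" "is_ord \<mu>" "elts \<mu> \<noteq> {}" "\<not> (\<exists>f\<in>M. is_surj f X \<mu>)" "\<forall>\<beta>\<in>elts \<mu>. elts \<beta> \<noteq> {} --> (\<exists>f\<in>M. is_surj f X \<beta>)"
    using l unfolding lindenbaum_in_def by auto
  have \<nu>: "\<nu> \<in> M" "is_ord \<nu>" "\<not> injects M \<nu> X" "\<forall>\<beta>\<in>elts \<nu>. injects M \<beta> X"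
    using h unfolding hartogs_in_def MM.injects_iff by auto
  have small: "\<exists>m\<le>n. \<beta> = num m" if "\<beta> \<in> elts (num (Suc n))" for \<beta> :: 'u using that unfolding elts_num by auto
  have "\<nu> \<notin> elts (num (Suc n))" using small[of \<nu>] inj \<nu>(3) by blast
  moreover have "num (Suc n) \<notin> elts \<nu>" using \<nu>(4) ninj by blast
  ultimately have \<nu>': "\<nu> = num (Suc n)" using ord_linear[OF \<nu>(2) ord_num[of "Suc n"]] by blast
  have "\<mu> \<notin> elts (num (Suc n))"
  proof
    assume "\<mu> \<in> elts (num (Suc n))"
    then obtain m where m: "m \<le> n" "\<mu> = num m" using small by blast
    then have "psurj M X \<mu>" using MM.injects_psurj[OF inj[OF m(1)] numM X(1)] by simp
    then show False using MM.psurj_is_surj[OF _ X(1) \<mu>(1,3)] \<mu>(4) by blast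
  qed
  moreover have "num (Suc n) \<notin> elts \<mu>"
  proof
    assume "num (Suc n) \<in> elts \<mu>"
    moreover have "elts (num (Suc n) :: 'u) \<noteq> {}" by (auto simp: elts_num simp del: num.simps)
    ultimately have "\<exists>f\<in>M. is_surj f X (num (Suc n))" using \<mu>(5) by blast
    then show False using MM.is_surj_psurj[OF X(1)] nsurj by blast
  qed
  ultimately have \<mu>': "\<mu> = num (Suc n)" using ord_linear[OF \<mu>(2) ord_num[of "Suc n"]] by blast
  have "succ_cardinal_in M (num n) (num (Suc n))"
    unfolding succ_cardinal_in_def using card[of "Suc n"] by (auto simp: elts_num simp del: num.simps)
  then show ?thesis using card[of n] \<nu>' \<mu>' by blast
qed

text \<open>The cardinality of \<beta> in \<open>V\<close> is a cardinal below the successor of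
  \<kappa>, hence at most \<kappa>.\<close>

lemma succ_cardinal_psurj:
  assumes \<kappa>: "cardinal_in M \<kappa>" and s: "succ_cardinal_in M \<kappa> \<mu>" and \<beta>: "\<beta> \<in> elts \<mu>"
  shows "psurj M \<kappa> \<beta>"
proof -
  have \<kappa>V: "\<kappa> \<in> V" "is_ord \<kappa>" using \<kappa> unfolding cardinal_M_iff unfolding cardinal_in_def by auto
  have \<mu>: "\<mu> \<in> V" "is_ord \<mu>" using s unfolding succ_cardinal_in_def cardinal_M_iff unfolding cardinal_in_def by auto
  have \<beta>V: "\<beta> \<in> V" "is_ord \<beta>" using V_trans[OF \<beta> \<mu>(1)] ord_mem[OF \<mu>(2) \<beta>] by auto
  obtain \<theta> F where \<theta>: "\<theta> \<in> V" "cardinal_in V \<theta>" "elts \<theta> \<subseteq> elts \<beta>" "Gr \<theta> F \<in> V" "bij_betw F (elts \<theta>) (elts \<beta>)"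
    using cardinal_bij[OF \<beta>V] by blast
  have \<theta>o: "is_ord \<theta>" using \<theta>(2) unfolding cardinal_in_def by blast
  have "\<theta> \<in> elts \<mu>" using ord_subset_iff[OF \<theta>o \<beta>V(2)] \<theta>(3) \<beta> ord_trans[OF \<mu>(2) \<beta>] by blast
  then have "\<kappa> \<notin> elts \<theta>" using s \<theta>(2) unfolding succ_cardinal_in_def cardinal_M_iff by blast
  then have "elts \<theta> \<subseteq> elts \<kappa>" using ord_linear[OF \<kappa>V(2) \<theta>o] ord_subset_iff[OF \<theta>o \<kappa>V(2)] by blast
  then have "psurj V \<kappa> \<theta>" using psurj_subset[OF \<kappa>V(1) \<theta>(1)] by blast
  moreover have "psurj V \<theta> \<beta>" unfolding psurj_def using \<theta>(1,4,5) bij_betw_imp_surj_on by blast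
  ultimately show ?thesis using psurj_V_M psurj_trans[OF _ _ \<kappa>V(1) \<theta>(1) \<beta>V(1)] by blast
qed

lemma lindenbaum_succ:
  assumes \<kappa>: "cardinal_in M \<kappa>" and s: "succ_cardinal_in M \<kappa> \<mu>" and X: "X \<in> M" "psurj M X \<kappa>" "\<not> psurj M X \<mu>"
  shows "lindenbaum_in M X \<mu>"
proof -
  have \<kappa>M: "\<kappa> \<in> M" using \<kappa> unfolding cardinal_in_def by auto
  have \<mu>: "\<mu> \<in> M" "is_ord \<mu>" "\<kappa> \<in> elts \<mu>" using s unfolding succ_cardinal_in_def cardinal_in_def by auto
  have "\<exists>f\<in>M. is_surj f X \<beta>" if \<beta>: "\<beta> \<in> elts \<mu>" "elts \<beta> \<noteq> {}" for \<beta>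
  proof -
    have bM: "\<beta> \<in> M" using MM.mem_trans[OF \<beta>(1) \<mu>(1)] .
    have "psurj M X \<beta>" using MM.psurj_trans[OF X(2) succ_cardinal_psurj[OF \<kappa> s \<beta>(1)] X(1) \<kappa>M bM] .
    then show ?thesis using MM.psurj_is_surj[OF _ X(1) bM \<beta>(2)] by blast
  qed
  moreover have "\<not> (\<exists>f\<in>M. is_surj f X \<mu>)" using MM.is_surj_psurj[OF X(1)] X(3) by blast
  ultimately show ?thesis unfolding lindenbaum_in_def using \<mu> by blast
qed

lemma spec_cardinal:
  assumes \<kappa>: "cardinal_in M \<kappa>" and s: "succ_cardinal_in M \<kappa> \<mu>"
  shows "hartogs_in M \<kappa> \<mu> \<and> lindenbaum_in M \<kappa> \<mu>"
proof -
  have \<kappa>M: "\<kappa> \<in> M" "is_ord \<kappa>" using \<kappa> unfolding cardinal_in_def by auto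
  have \<mu>: "cardinal_in M \<mu>" "\<mu> \<in> M" "is_ord \<mu>" "\<kappa> \<in> elts \<mu>" using s unfolding succ_cardinal_in_def cardinal_in_def by auto
  have no: "\<not> psurj M \<kappa> \<mu>" using MM.cardinal_no_psurj[OF \<mu>(1,4)] .
  have "\<not> injects M \<mu> \<kappa>" using MM.injects_psurj[OF _ \<mu>(2) \<kappa>M(1)] no by blast
  moreover have "injects M \<beta> \<kappa>" if "\<beta> \<in> elts \<mu>" for \<beta>
    using MM.psurj_injects[OF succ_cardinal_psurj[OF \<kappa> s that] \<kappa>M(1) MM.mem_trans[OF that \<mu>(2)]] ord_mem[OF \<kappa>M(2)] by blast
  ultimately have "hartogs_in M \<kappa> \<mu>" unfolding hartogs_in_def MM.injects_iff[symmetric] using \<mu> by blast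
  moreover have "lindenbaum_in M \<kappa> \<mu>" using lindenbaum_succ[OF \<kappa> s \<kappa>M(1) MM.psurj_subset[OF \<kappa>M(1) \<kappa>M(1) order_refl] no] .
  ultimately show ?thesis by blast
qed

text \<open>A finite ordinal has cofinality 0 or 1: the empty map serves for zero, and otherwise the
  map whose only value is the largest member.\<close>

lemma cofinality_omega_infinite:
  assumes "is_ord \<kappa>" "cofinality_in M \<kappa> omega"
  shows "infinite (elts \<kappa>)"
proof
  assume "finite (elts \<kappa>)"
  then obtain n where n: "\<kappa> = num n" using finite_ord[OF assms(1)] by blast
  have no: "\<not> is_cofinal_map f (num m) \<kappa>" if "f \<in> M" for f m
    using assms(2) that num_omega unfolding cofinality_in_def by blast
  show False
  proof (cases n)
    case 0
    have "is_cofinal_map (mk {}) (num 0) \<kappa>" unfolding is_cofinal_map_def is_fun_def n 0 by simp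
    then show False using no MM.empty_mem by blast
  next
    case (Suc m)
    have el: "elts (num 1 :: 'u) = {num 0}" by (simp only: elts_num) auto
    have "Gr (num 1) (\<lambda>_. num m) \<in> M" by (rule MM.finite_Gr) (auto simp: finite_num simp del: num.simps)
    moreover have "is_cofinal_map (Gr (num 1) (\<lambda>_. num m)) (num 1) \<kappa>"
      unfolding is_cofinal_map_def is_fun_Gr opair_Gr el n Suc
      by (auto simp: elts_num less_Suc_eq simp del: num.simps)
    ultimately show False using no by blast
  qed
qed

text \<open>The witness for \<open>cf \<kappa> = \<omega>\<close>: to a cofinal sequence \<open>c\<close> belongs the disjoint union, over all
  Cohen reals \<open>a\<close>, of the ordinals \<open>c (min a)\<close>.\<close>

lemma spec_cofinality_omega:
  assumes \<kappa>: "cardinal_in M \<kappa>" and cf: "cofinality_in M \<kappa> omega" and s: "succ_cardinal_in M \<kappa> \<mu>"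
  shows "\<exists>X\<in>M. hartogs_in M X \<kappa> \<and> lindenbaum_in M X \<mu>"
proof -
  have \<kappa>c: "cardinal_in V \<kappa>" using \<kappa> cardinal_M_iff by blast
  have \<kappa>V: "\<kappa> \<in> V" "is_ord \<kappa>" using \<kappa>c unfolding cardinal_in_def by auto
  note \<kappa>M = V_subset_M[OF \<kappa>V(1)]
  have inf: "infinite (elts \<kappa>)" using cofinality_omega_infinite[OF \<kappa>V(2) cf] .
  have \<mu>: "cardinal_in V \<mu>" "\<kappa> \<in> elts \<mu>" using s unfolding succ_cardinal_in_def cardinal_M_iff by auto
  have \<mu>V: "\<mu> \<in> V" using \<mu>(1) unfolding cardinal_in_def by auto
  obtain c where c: "c \<in> M" "is_cofinal_map c omega \<kappa>" using cf unfolding cofinality_in_def by blast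
  define C where "C n = ap c (num n)" for n
  have cfun: "is_fun c omega \<kappa>" using c(2) unfolding is_cofinal_map_def by blast
  have C\<kappa>: "C n \<in> elts \<kappa>" for n
  proof -
    have "ap c ` elts omega \<subseteq> elts \<kappa>" using cfun by (metis is_fun_eq_Gr is_fun_Gr)
    then show ?thesis unfolding C_def using num_omega by blast
  qed
  have Ccof: "\<exists>n. \<gamma> = C n \<or> \<gamma> \<in> elts (C n)" if \<gamma>: "\<gamma> \<in> elts \<kappa>" for \<gamma>
  proof -
    obtain \<xi> \<delta> where x: "\<xi> \<in> elts omega" "opair \<xi> \<delta> \<in> elts c" "\<gamma> = \<delta> \<or> \<gamma> \<in> elts \<delta>" using c(2) \<gamma> unfolding is_cofinal_map_def by blast
    obtain n where "\<xi> = num n" using x(1) unfolding elts_omega by blast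
    moreover have "\<delta> = ap c \<xi>" using x(2) is_fun_eq_Gr[OF cfun] opair_Gr by metis
    ultimately show ?thesis using x(3) unfolding C_def by blast
  qed
  \<comment> \<open>The internal form of membership in the disjoint union: the second component has
    only its row 0 inhabited, so it codes a single real, and the first component lies below
    \<open>c\<close> at the least element of that real.\<close>
  define W where "W z \<longleftrightarrow> (\<forall>w\<in>elts (usnd z). ufst w = num 0) \<and>
    (\<exists>m\<in>elts omega. opair (num 0) m \<in> elts (usnd z) \<and> (\<forall>l\<in>elts m. opair (num 0) l \<notin> elts (usnd z)) \<and> ufst z \<in> elts (ap c m))" for z
  define X where "X = mk {z \<in> elts (cprod \<kappa> BM). W z}"
  have XM: "X \<in> M" unfolding X_def
    by (rule MM.separation[OF MM.cprod_mem[OF \<kappa>M BM_mem]]) (unfold W_def, intro dintro MM.num_mem omega_M c(1))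
  have Xsub: "elts X \<subseteq> elts (cprod \<kappa> BM)" unfolding X_def by auto
  have fst: "n < 1 \<longleftrightarrow> n = 0" for n :: nat by auto
  have memX1: "\<exists>\<beta> \<pi> n. z = opair \<beta> (breal \<pi> 1) \<and> \<beta> \<in> elts \<kappa> \<and> \<pi> \<in> perms \<and> gen (\<pi> 0) n \<and> (\<forall>m<n. \<not> gen (\<pi> 0) m) \<and> \<beta> \<in> elts (C n)"
    if z: "z \<in> elts X" for z
  proof -
    obtain \<beta> b where zb: "z = opair \<beta> b" "\<beta> \<in> elts \<kappa>" "b \<in> elts BM" using z Xsub unfolding MM.elts_cprod[OF \<kappa>M BM_mem] by blast
    obtain \<pi> k where b: "b = breal \<pi> k" "\<pi> \<in> perms" using zb(3) unfolding elts_BM_breal by blast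
    have Wz: "W z" using z unfolding X_def by auto
    then obtain n where n: "opair (num 0) (num n) \<in> elts b" "\<forall>l\<in>elts (num n). opair (num 0) l \<notin> elts b" "\<beta> \<in> elts (C n)"
      unfolding W_def elts_omega zb(1) C_def by auto
    have k: "0 < k" "gen (\<pi> 0) n" using n(1) unfolding b(1) elts_breal by (auto simp del: num.simps)
    have nl: "\<not> gen (\<pi> 0) m" if "m < n" for m
    proof -
      have "opair (num 0) (num m) \<notin> elts b" using n(2) that by (auto simp: elts_num simp del: num.simps)
      then show ?thesis using k(1) unfolding b(1) elts_breal by blast
    qed
    \<comment> \<open>Only row 0 of \<open>b\<close> is inhabited, so \<open>b\<close> is also the
      sequence of length one, whatever \<open>k\<close> is.\<close>
    have "elts b = elts (breal \<pi> 1)"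
    proof (intro equalityI subsetI)
      fix w assume w: "w \<in> elts b"
      then obtain i m where im: "w = opair (num i) (num m)" "i < k" "gen (\<pi> i) m" unfolding b(1) elts_breal by blast
      have "i = 0" using Wz w im(1) unfolding W_def zb(1) by (auto simp del: num.simps)
      then show "w \<in> elts (breal \<pi> 1)" using im unfolding elts_breal by blast
    next
      fix w assume "w \<in> elts (breal \<pi> 1)"
      then show "w \<in> elts b" using k(1) unfolding b(1) elts_breal fst by blast
    qed
    then have "b = breal \<pi> 1" by (rule elts_inject)
    then show ?thesis using zb b(2) k(2) nl n(3) by blast
  qed
  have memX2: "opair \<beta> (breal \<pi> 1) \<in> elts X"
    if "\<beta> \<in> elts \<kappa>" "\<pi> \<in> perms" "gen (\<pi> 0) n" "\<forall>m<n. \<not> gen (\<pi> 0) m" "\<beta> \<in> elts (C n)" for \<beta> \<pi> n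
  proof -
    have br: "w \<in> elts (breal \<pi> 1) \<longleftrightarrow> (\<exists>m. w = opair (num 0) (num m) \<and> gen (\<pi> 0) m)" for w
      unfolding elts_breal fst by blast
    have "breal \<pi> 1 \<in> elts BM" unfolding elts_BM_breal using that(2) by blast
    moreover have "W (opair \<beta> (breal \<pi> 1))" unfolding W_def ufst_opair usnd_opair
    proof (intro conjI)
      show "\<forall>w\<in>elts (breal \<pi> 1). ufst w = num 0" using br ufst_opair by metis
      have "opair (num 0) (num n) \<in> elts (breal \<pi> 1)" unfolding br using that(3) by blast
      moreover have "\<forall>l\<in>elts (num n). opair (num 0) l \<notin> elts (breal \<pi> 1)" unfolding br elts_num using that(4) by (auto simp del: num.simps)
      ultimately show "\<exists>m\<in>elts omega. opair (num 0) m \<in> elts (breal \<pi> 1) \<and> (\<forall>l\<in>elts m. opair (num 0) l \<notin> elts (breal \<pi> 1)) \<and> \<beta> \<in> elts (ap c m)"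
        using that(5) num_omega[of n] unfolding C_def by blast
    qed
    ultimately show ?thesis unfolding X_def elts_mk_Collect using that(1) \<kappa>M by simp
  qed
  have real: "\<exists>\<pi>\<in>perms. gen (\<pi> 0) n \<and> (\<forall>m<n. \<not> gen (\<pi> 0) m)" for n
  proof -
    obtain a where a: "gen a n" "\<forall>m<n. \<not> gen a m" using gen_prescribed by blast
    show ?thesis
    proof (cases "a = 0")
      case True
      then show ?thesis using a by (intro bexI[of _ id]) auto
    next
      case False
      then have "inj_on (\<lambda>i::nat. 0::nat) {..<1}" "inj_on (\<lambda>i::nat. a) {..<1}" "\<forall>i<1. \<forall>j<1. 0 = a --> i = (j::nat)" by (auto simp: inj_on_def)
      from finitary_swaps[OF this] obtain \<tau> where "\<tau> \<in> perms" "\<tau> 0 = a" by auto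
      then show ?thesis using a by auto
    qed
  qed
  have pX: "psurj M X \<kappa>"
  proof (rule MM.psurjI[OF XM order_refl])
    show fstX: "ufst z \<in> elts \<kappa>" if "z \<in> elts X" for z using memX1[OF that] by auto
    show "Gr X ufst \<in> M" by (rule MM.Gr_mem_dterm[OF XM \<kappa>M]) (use fstX in \<open>auto intro: dintro\<close>)
    show "\<exists>z\<in>elts X. ufst z = \<beta>" if \<beta>: "\<beta> \<in> elts \<kappa>" for \<beta>
    proof -
      \<comment> \<open>A cofinal map reaches or exceeds each member; applied to the successor of
        \<beta> this puts \<beta> strictly below some \<open>C n\<close>.\<close>
      obtain n where "suc \<beta> = C n \<or> suc \<beta> \<in> elts (C n)" using Ccof[OF infinite_cardinal_suc[OF \<kappa>c inf \<beta>]] by blast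
      then have "\<beta> \<in> elts (C n)" using ord_trans[OF ord_mem[OF \<kappa>V(2) C\<kappa>]] elts_suc by (metis insertI1)
      moreover obtain \<pi> where "\<pi> \<in> perms" "gen (\<pi> 0) n" "\<forall>m<n. \<not> gen (\<pi> 0) m" using real by blast
      ultimately have "opair \<beta> (breal \<pi> 1) \<in> elts X" using memX2[OF \<beta>] by blast
      then show ?thesis using ufst_opair by blast
    qed
  qed
  have up: "psurj V \<kappa> \<alpha>" if "\<alpha> \<in> V" "psurj M X \<alpha>" for \<alpha>
  proof (rule covering_bound[OF \<kappa>V inf that(1)])
    have "psurj M (cprod \<kappa> BM) X" using MM.psurj_subset[OF MM.cprod_mem[OF \<kappa>M BM_mem] XM Xsub] .
    then show "psurj M (cprod \<kappa> BM) \<alpha>"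
      using MM.psurj_trans[OF _ that(2) MM.cprod_mem[OF \<kappa>M BM_mem] XM V_subset_M[OF that(1)]] by blast
  qed
  have lin: "lindenbaum_in M X \<mu>"
    using lindenbaum_succ[OF \<kappa> s XM pX] up[OF \<mu>V] cardinal_no_psurj[OF \<mu>] by blast
  have inj: "injects M \<delta> X" if \<delta>: "\<delta> \<in> elts \<kappa>" for \<delta>
  proof -
    obtain n where n: "\<delta> = C n \<or> \<delta> \<in> elts (C n)" using Ccof[OF \<delta>] by blast
    obtain \<pi> where \<pi>: "\<pi> \<in> perms" "gen (\<pi> 0) n" "\<forall>m<n. \<not> gen (\<pi> 0) m" using real by blast
    have bM: "breal \<pi> 1 \<in> M" using MM.mem_trans[OF _ BM_mem] \<pi>(1) unfolding elts_BM_breal by blast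
    have "\<beta> \<in> elts (C n)" if "\<beta> \<in> elts \<delta>" for \<beta> using n that ord_trans[OF ord_mem[OF \<kappa>V(2) C\<kappa>]] by blast
    then have val: "opair \<beta> (breal \<pi> 1) \<in> elts X" if "\<beta> \<in> elts \<delta>" for \<beta>
      using memX2[OF ord_trans[OF \<kappa>V(2) \<delta> that] \<pi>] that by blast
    show ?thesis unfolding injects_def
    proof (intro exI conjI)
      show "Gr \<delta> (\<lambda>\<beta>. opair \<beta> (breal \<pi> 1)) \<in> M"
      proof (rule MM.Gr_mem_dterm[OF MM.mem_trans[OF \<delta> \<kappa>M] XM])
        show "(\<lambda>\<beta>. opair \<beta> (breal \<pi> 1)) ` elts \<delta> \<subseteq> elts X" using val by blast
        show "dterm M (\<lambda>s. opair (s 0) (breal \<pi> 1))" by (intro dintro bM)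
      qed
      show "inj_on (\<lambda>\<beta>. opair \<beta> (breal \<pi> 1)) (elts \<delta>)" by (rule inj_onI) simp
      show "(\<lambda>\<beta>. opair \<beta> (breal \<pi> 1)) ` elts \<delta> \<subseteq> elts X" using val by blast
    qed
  qed
  have "\<not> injects M \<kappa> X"
  proof
    assume "injects M \<kappa> X"
    then obtain F where F: "Gr \<kappa> F \<in> M" "inj_on F (elts \<kappa>)" "\<forall>x\<in>elts \<kappa>. F x \<in> elts X" by (rule MM.injectsE)
    have F2: "Gr \<kappa> (\<lambda>\<alpha>. usnd (F \<alpha>)) \<in> M"
    proof (rule MM.Gr_mem_rel[OF \<kappa>M BM_mem])
      show "(\<lambda>\<alpha>. usnd (F \<alpha>)) ` elts \<kappa> \<subseteq> elts BM"
        using F(3) Xsub unfolding MM.elts_cprod[OF \<kappa>M BM_mem] by fastforce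
      show "definable M (\<lambda>s. s 1 = usnd (ap (Gr \<kappa> F) (s 0)))" by (intro dintro F(1))
      show "y = usnd (ap (Gr \<kappa> F) x) \<longleftrightarrow> y = usnd (F x)" if "x \<in> elts \<kappa>" for x y using that by simp
    qed
    have "\<forall>\<alpha>\<in>elts \<kappa>. \<exists>\<pi>\<in>perms. usnd (F \<alpha>) = breal \<pi> 1"
    proof
      fix \<alpha> assume "\<alpha> \<in> elts \<kappa>"
      then obtain \<beta> \<pi> n where "F \<alpha> = opair \<beta> (breal \<pi> 1)" "\<pi> \<in> perms" using memX1 F(3) by blast
      then show "\<exists>\<pi>\<in>perms. usnd (F \<alpha>) = breal \<pi> 1" by (metis usnd_opair)
    qed
    then obtain k where k: "\<forall>\<alpha>\<in>elts \<kappa>. \<exists>\<pi>\<in>perms. \<pi> 0 < k \<and> usnd (F \<alpha>) = breal \<pi> 1"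
      using breal_image_finite[OF \<kappa>V(1) F2] by blast
    \<comment> \<open>Only reals with index below \<open>k\<close> occur. Their finitely many least
      elements give finitely many bounds, so all first components stay below one \<delta> <
      \<kappa>.\<close>
    define A where "A = (\<lambda>i. C (LEAST m. gen i m)) ` {..<k}"
    have fA: "finite A" "A \<subseteq> elts \<kappa>" using C\<kappa> by (auto simp: A_def)
    have "\<exists>\<delta>\<in>elts \<kappa>. (\<forall>a\<in>A. a \<in> elts \<delta>) \<and> (omega \<in> elts \<kappa> --> omega \<in> elts \<delta>)"
    proof (cases "omega \<in> elts \<kappa>")
      case True
      then show ?thesis using infinite_cardinal_bound[OF \<kappa>c inf, of "insert omega A"] fA by auto
    next
      case False
      then show ?thesis using infinite_cardinal_bound[OF \<kappa>c inf fA] by blast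
    qed
    then obtain \<delta> where \<delta>: "\<delta> \<in> elts \<kappa>" "\<forall>a\<in>A. a \<in> elts \<delta>" "omega \<in> elts \<kappa> --> omega \<in> elts \<delta>" by blast
    have \<delta>o: "\<delta> \<in> V" "is_ord \<delta>" using V_trans[OF \<delta>(1) \<kappa>V(1)] ord_mem[OF \<kappa>V(2) \<delta>(1)] by auto
    note \<delta>M = V_subset_M[OF \<delta>o(1)]
    have val: "\<exists>\<beta> \<pi>. F \<alpha> = opair \<beta> (breal \<pi> 1) \<and> \<beta> \<in> elts \<delta> \<and> \<pi> \<in> perms \<and> \<pi> 0 < k" if \<alpha>: "\<alpha> \<in> elts \<kappa>" for \<alpha>
    proof -
      obtain \<beta> \<pi> n where 1: "F \<alpha> = opair \<beta> (breal \<pi> 1)" "\<pi> \<in> perms" "gen (\<pi> 0) n" "\<forall>m<n. \<not> gen (\<pi> 0) m" "\<beta> \<in> elts (C n)"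
        using memX1 F(3) \<alpha> by blast
      obtain \<sigma> where "\<sigma> 0 < k" "usnd (F \<alpha>) = breal \<sigma> 1" using k \<alpha> by blast
      then have lt: "\<pi> 0 < k" using 1(1) breal_inject[of \<pi> 1 \<sigma>] by simp
      have "(LEAST m. gen (\<pi> 0) m) = n" using 1(3,4) by (intro Least_equality) (auto simp: not_less[symmetric])
      then have "C n \<in> A" unfolding A_def using lt by blast
      then have "\<beta> \<in> elts \<delta>" using \<delta>(2) 1(5) ord_trans[OF \<delta>o(2)] by blast
      then show ?thesis using 1 lt by blast
    qed
    \<comment> \<open>If \<kappa> > \<omega>, then \<delta> contains \<omega>, and \<kappa> would be
      an image of \<delta> \<times> \<open>BM\<close>, hence of \<delta> in \<open>V\<close>. If
      \<kappa> = \<omega>, then \<delta> is finite and an injection into a finite set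
      results.\<close>
    show False
    proof (cases "omega \<in> elts \<kappa>")
      case True
      have infd: "infinite (elts \<delta>)"
      proof
        assume "finite (elts \<delta>)"
        then have "finite (elts (omega :: 'u))" using finite_subset ord_trans[OF \<delta>o(2)] \<delta>(3) True by (meson subsetI)
        then show False using infinite_omega by blast
      qed
      have "injects M \<kappa> (cprod \<delta> BM)" unfolding injects_def
      proof (intro exI conjI)
        show "F ` elts \<kappa> \<subseteq> elts (cprod \<delta> BM)"
          using val \<delta>M unfolding MM.elts_cprod[OF \<delta>M BM_mem] elts_BM_breal by blast
      qed (use F in auto)
      then have "psurj M (cprod \<delta> BM) \<kappa>" using MM.injects_psurj[OF _ \<kappa>M MM.cprod_mem[OF \<delta>M BM_mem]] by blast
      then have "psurj V \<delta> \<kappa>" using covering_bound[OF \<delta>o infd \<kappa>V(1)] by blast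
      then show False using cardinal_no_psurj[OF \<kappa>c \<delta>(1)] by blast
    next
      case False
      then have "\<kappa> = omega" using subset_omega[OF \<kappa>V(2) inf] by blast
      then have "\<delta> \<in> range num" using \<delta>(1) elts_omega by metis
      then have "finite (elts \<delta>)" by (auto simp: finite_num)
      define Y where "Y = (\<lambda>(\<beta>, i). opair \<beta> (mk {opair (num 0) (num m) | m. gen i m})) ` (elts \<delta> \<times> {..<k})"
      have "finite Y" unfolding Y_def using \<open>finite (elts \<delta>)\<close> by simp
      moreover have "F ` elts \<kappa> \<subseteq> Y"
      proof
        fix z assume "z \<in> F ` elts \<kappa>"
        then obtain \<beta> \<pi> where 1: "z = opair \<beta> (breal \<pi> 1)" "\<beta> \<in> elts \<delta>" "\<pi> 0 < k" using val by blast
        have "elts (breal \<pi> 1) = {opair (num 0) (num m) | m. gen (\<pi> 0) m}" unfolding elts_breal fst by blast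
        then have "breal \<pi> 1 = mk {opair (num 0) (num m) | m. gen (\<pi> 0) m}" using mk_elts[of "breal \<pi> 1"] by simp
        then show "z \<in> Y" unfolding Y_def using 1 by (intro image_eqI[of _ _ "(\<beta>, \<pi> 0)"]) auto
      qed
      ultimately have "finite (elts \<kappa>)" using finite_imageD[OF _ F(2)] finite_subset by blast
      then show False using inf by blast
    qed
  qed
  then have "hartogs_in M X \<kappa>" unfolding hartogs_in_def MM.injects_iff[symmetric] using \<kappa>M \<kappa>V(2) inj by blast
  then show ?thesis using lin XM by blast
qed

end

theorem theorem4p4:
  fixes V G M :: "'u::set_universe set"
  assumes "transitive_class V" and "models_ZFC V"
    and "generic V G"
    and "M = Cohen_first_model V G"
  shows "Spec_aleph M =
    {(\<mu>, \<mu>) | \<kappa> \<mu>. cardinal_in M \<kappa> \<and> succ_cardinal_in M \<kappa> \<mu>} \<union>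
    {(\<kappa>, \<mu>) | \<kappa> \<mu>. cardinal_in M \<kappa> \<and> cofinality_in M \<kappa> omega \<and> succ_cardinal_in M \<kappa> \<mu>}"
proof -
  interpret cohen V G
    by unfold_locales (use assms in auto)
  show ?thesis
  proof (intro equalityI subsetI)
    fix z assume "z \<in> Spec_aleph M"
    then obtain \<nu> \<mu> X where z: "z = (\<nu>, \<mu>)" "X \<in> Cohen_first_model V G" "hartogs_in (Cohen_first_model V G) X \<nu>" "lindenbaum_in (Cohen_first_model V G) X \<mu>"
      unfolding Spec_aleph_def assms(4) by blast
    then show "z \<in> {(\<mu>, \<mu>) | \<kappa> \<mu>. cardinal_in M \<kappa> \<and> succ_cardinal_in M \<kappa> \<mu>} \<union>
      {(\<kappa>, \<mu>) | \<kappa> \<mu>. cardinal_in M \<kappa> \<and> cofinality_in M \<kappa> omega \<and> succ_cardinal_in M \<kappa> \<mu>}"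
      unfolding assms(4) using spec_finite[OF z(2) _ z(3,4)] spec_infinite[OF z(2) _ z(3,4)] by blast
  next
    fix z assume "z \<in> {(\<mu>, \<mu>) | \<kappa> \<mu>. cardinal_in M \<kappa> \<and> succ_cardinal_in M \<kappa> \<mu>} \<union>
      {(\<kappa>, \<mu>) | \<kappa> \<mu>. cardinal_in M \<kappa> \<and> cofinality_in M \<kappa> omega \<and> succ_cardinal_in M \<kappa> \<mu>}"
    then consider \<kappa> \<mu> where "z = (\<mu>, \<mu>)" "cardinal_in M \<kappa>" "succ_cardinal_in M \<kappa> \<mu>"
      | \<kappa> \<mu> where "z = (\<kappa>, \<mu>)" "cardinal_in M \<kappa>" "cofinality_in M \<kappa> omega" "succ_cardinal_in M \<kappa> \<mu>" by blast
    then show "z \<in> Spec_aleph M"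
    proof cases
      case (1 \<kappa> \<mu>)
      have "\<kappa> \<in> M" using 1(2) unfolding cardinal_in_def by blast
      then show ?thesis using spec_cardinal 1 unfolding Spec_aleph_def assms(4) by blast
    next
      case (2 \<kappa> \<mu>)
      then show ?thesis using spec_cofinality_omega unfolding Spec_aleph_def assms(4) by blast
    qed
  qed
qed

end
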